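(* For a function $f=f(\tau)$ on $G(n,j)$, $$P_k^{\alpha*}R_{p,q}^k f=c\,P_j^{(\alpha+l)*}f,\qquad c=\frac{2^l\pi^{l/2}\,\Gamma((n-j)/2)}{\Gamma((n-j-l)/2)},$$ provided that either side of this equality exists in the Lebesgue sense.
   Context: Standing assumptions: $n,p,q,l$ are integers with $p>0$, $q>0$, $l>0$, $p+q+l<n$; set $j=p+q$ and $k=p+l$. For a linear subspace $X\subset\mathbb{R}^n$, $G_m(X)$ is the set of $m$-dimensional linear subspaces of $X$ with its rotation-invariant probability measure; $G_{n,m}=G_m(\mathbb{R}^n)$. $G(n,m)$ is the set of all affine $m$-planes in $\mathbb{R}^n$; each element is written $(\xi,u)=\xi+u$ with $\xi\in G_{n,m}$, $u\in\xi^\perp$, and $G(n,m)$ carries the measure $d\xi\,du$ ($d\xi$ the $O(n)$-invariant probability measure, $du$ Lebesgue measure on $\xi^\perp$). For mutually orthogonal subspaces $P,Q$, $[P,Q]=P\oplus Q$. The Strichartz transform of a function $f$ on $G(n,j)$ is the function on $G(n,k)$ $$(R_{p,q}^k f)(\eta,v)=\int_{G_q(\eta^\perp)}dQ\int_{G_p(\eta)}dP\int_{P^\perp\cap\eta} f([P,Q]+u+v)\,du,$$ with $dQ,dP$ the invariant probability measures. The dual Semyanistyi integral of a function $\varphi$ on $G(n,m)$ is the function on $\mathbb{R}^n$ $$(P_m^{\alpha*}\varphi)(x)=\frac{1}{\gamma_{n-m}(\alpha)}\int_{G(n,m)}\varphi(\zeta)\,|x-\zeta|^{\alpha+m-n}\,d\zeta,\qquad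 \gamma_{n-m}(\alpha)=\frac{2^\alpha\pi^{(n-m)/2}\Gamma(\alpha/2)}{\Gamma((n-m-\alpha)/2)},$$ where $|x-\zeta|$ is the Euclidean distance from the point $x$ to the plane $\zeta$, and $\mathrm{Re}\,\alpha>0$, $\alpha+m-n\ne 0,2,4,\dots$. "Exists in the Lebesgue sense" means that the integral converges absolutely, i.e. it is finite with the function replaced by its absolute value.
   Formalization: Existence of the right side is taken as sufficient only when Re α + j + l < n; otherwise the left side diverges unless f = 0 a.e., even where the right side exists (e.g. n=4, p=q=l=1, α=3/2). Existence of the left side suffices without restriction. *)

theory Defs
  imports "HOL-Analysis.Analysis" "HOL-Probability.Probability_Measure"
begin

section \<open>Linear and affine Grassmannians\<close>

definition grassmannian :: "'a::euclidean_space set \<Rightarrow> nat \<Rightarrow> 'a set set" where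
  "grassmannian X m = {\<xi>. subspace \<xi> \<and> \<xi> \<subseteq> X \<and> dim \<xi> = m}"

definition affine_grassmannian :: "nat \<Rightarrow> 'a::euclidean_space set set" where
  "affine_grassmannian m = {\<zeta>. affine \<zeta> \<and> aff_dim \<zeta> = int m}"

text \<open>
  The sigma-algebra generated by the distance functions \<open>\<zeta> \<mapsto> |x - \<zeta>|\<close>. On a linear or affine
  Grassmannian these functions are continuous and countably many of them separate points, so
  this is the Borel sigma-algebra of the usual (manifold) topology.
\<close>

definition plane_algebra :: "'a::euclidean_space set set \<Rightarrow> 'a set measure" where
  "plane_algebra S = sigma S {{\<zeta> \<in> S. infdist x \<zeta> < r} | x r. True}"

section \<open>Measures\<close>

text \<open>
  Every orthogonal transformation of \<open>X\<close> extends to one of the whole space, so the maps \<open>T\<close> below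
  induce on \<open>X\<close> exactly the orthogonal group of \<open>X\<close>.
\<close>

definition invariant_grassmannian_measure ::
    "'a::euclidean_space set \<Rightarrow> nat \<Rightarrow> 'a set measure \<Rightarrow> bool" where
  "invariant_grassmannian_measure X m M \<longleftrightarrow>
     prob_space M \<and> sets M = sets (plane_algebra (grassmannian X m)) \<and>
     (\<forall>T. orthogonal_transformation T \<and> T ` X = X \<longrightarrow> distr M M (\<lambda>\<xi>. T ` \<xi>) = M)"

text \<open>
  All measures used for integration are completed, so that functions that are merely
  Lebesgue measurable are covered.
\<close>

definition grassmannian_measure :: "'a::euclidean_space set \<Rightarrow> nat \<Rightarrow> 'a set measure" where
  "grassmannian_measure X m = completion (THE M. invariant_grassmannian_measure X m M)"

text \<open>
  Lebesgue measure on a linear subspace \<open>W\<close>, as a measure on the ambient space that is concentrated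
  on \<open>W\<close>: the image of product Lebesgue measure under the coordinate map of an orthonormal basis
  of \<open>W\<close>. The result does not depend on the basis; for \<open>W = {0}\<close> it is the unit mass at \<open>0\<close>.
\<close>

definition lebesgue_subspace :: "'a::euclidean_space set \<Rightarrow> 'a measure" where
  "lebesgue_subspace W =
     (let B = (SOME B. pairwise orthogonal B \<and> (\<forall>b\<in>B. norm b = 1) \<and> span B = W)
      in completion (distr (Pi\<^sub>M B (\<lambda>_. lborel)) borel (\<lambda>w. \<Sum>b\<in>B. w b *\<^sub>R b)))"

text \<open>The measure \<open>d\<xi> du\<close>, where the plane \<open>(\<xi>, u)\<close> is \<open>\<xi> + u\<close> with \<open>u\<close> orthogonal to \<open>\<xi>\<close>.\<close>

definition affine_grassmannian_measure :: "nat \<Rightarrow> 'a::euclidean_space set measure" where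
  "affine_grassmannian_measure m = completion
     (measure_of (affine_grassmannian m) (sets (plane_algebra (affine_grassmannian m)))
       (\<lambda>A. \<integral>\<^sup>+ \<xi>. (\<integral>\<^sup>+ u. indicator A ((+) u ` \<xi>) \<partial>lebesgue_subspace (\<xi>\<^sup>\<bottom>))
              \<partial>grassmannian_measure UNIV m))"

section \<open>The Strichartz transform\<close>

text \<open>An affine plane \<open>\<zeta> = \<eta> + v\<close>, with \<open>v\<close> orthogonal to \<open>\<eta>\<close>, determines \<open>v\<close> and \<open>\<eta>\<close>:\<close>

definition plane_foot :: "'a::euclidean_space set \<Rightarrow> 'a" where
  "plane_foot \<zeta> = closest_point \<zeta> 0"

definition plane_direction :: "'a::euclidean_space set \<Rightarrow> 'a set" where
  "plane_direction \<zeta> = (\<lambda>y. y - plane_foot \<zeta>) ` \<zeta>"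

text \<open>\<open>join_plane P Q w = [P, Q] + w\<close>\<close>

definition join_plane :: "'a::euclidean_space set \<Rightarrow> 'a set \<Rightarrow> 'a \<Rightarrow> 'a set" where
  "join_plane P Q w = {a + b + w | a b. a \<in> P \<and> b \<in> Q}"

text \<open>
  The dimension \<open>k\<close> of the planes on which the transform lives is that of the argument \<open>\<zeta>\<close>.
\<close>

definition strichartz ::
    "nat \<Rightarrow> nat \<Rightarrow> ('a::euclidean_space set \<Rightarrow> complex) \<Rightarrow> 'a set \<Rightarrow> complex" where
  "strichartz p q f \<zeta> =
     (let \<eta> = plane_direction \<zeta>; v = plane_foot \<zeta> in
      LINT Q | grassmannian_measure (\<eta>\<^sup>\<bottom>) q. LINT P | grassmannian_measure \<eta> p.
        LINT u | lebesgue_subspace (P\<^sup>\<bottom> \<inter> \<eta>). f (join_plane P Q (u + v)))"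

text \<open>
  The same for functions with values in \<open>[0, \<infinity>]\<close>, which is used to express absolute convergence.
\<close>

definition strichartz_nn ::
    "nat \<Rightarrow> nat \<Rightarrow> ('a::euclidean_space set \<Rightarrow> ennreal) \<Rightarrow> 'a set \<Rightarrow> ennreal" where
  "strichartz_nn p q g \<zeta> =
     (let \<eta> = plane_direction \<zeta>; v = plane_foot \<zeta> in
      \<integral>\<^sup>+ Q. \<integral>\<^sup>+ P. \<integral>\<^sup>+ u. g (join_plane P Q (u + v))
        \<partial>lebesgue_subspace (P\<^sup>\<bottom> \<inter> \<eta>) \<partial>grassmannian_measure \<eta> p \<partial>grassmannian_measure (\<eta>\<^sup>\<bottom>) q)"

section \<open>The dual Semyanistyi integral\<close>

definition semyanistyi_gamma :: "nat \<Rightarrow> complex \<Rightarrow> complex" where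
  "semyanistyi_gamma d \<alpha> =
     2 powr \<alpha> * complex_of_real pi powr (of_nat d / 2) * Gamma (\<alpha> / 2) / Gamma ((of_nat d - \<alpha>) / 2)"

text \<open>
  For \<open>m < n\<close> the planes through \<open>x\<close> form a null set, hence the value of the kernel at distance
  \<open>0\<close> is irrelevant.
\<close>

definition semyanistyi_kernel ::
    "nat \<Rightarrow> complex \<Rightarrow> 'a::euclidean_space \<Rightarrow> 'a set \<Rightarrow> complex" where
  "semyanistyi_kernel m \<alpha> x \<zeta> =
     complex_of_real (infdist x \<zeta>) powr (\<alpha> + of_nat m - of_nat DIM('a))"

definition dual_semyanistyi ::
    "nat \<Rightarrow> complex \<Rightarrow> ('a::euclidean_space set \<Rightarrow> complex) \<Rightarrow> 'a \<Rightarrow> complex" where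
  "dual_semyanistyi m \<alpha> \<phi> x =
     1 / semyanistyi_gamma (DIM('a) - m) \<alpha> *
     (LINT \<zeta> | affine_grassmannian_measure m. \<phi> \<zeta> * semyanistyi_kernel m \<alpha> x \<zeta>)"

text \<open>
  The integral with the kernel replaced by its absolute value and without the normalizing
  factor, for functions with values in \<open>[0, \<infinity>]\<close>.
\<close>

definition dual_semyanistyi_nn ::
    "nat \<Rightarrow> complex \<Rightarrow> ('a::euclidean_space set \<Rightarrow> ennreal) \<Rightarrow> 'a \<Rightarrow> ennreal" where
  "dual_semyanistyi_nn m \<alpha> g x =
     (\<integral>\<^sup>+ \<zeta>. g \<zeta> * ennreal (norm (semyanistyi_kernel m \<alpha> x \<zeta>)) \<partial>affine_grassmannian_measure m)"

text \<open>The admissible parameters: \<open>Re \<alpha> > 0\<close> and \<open>\<alpha> + m - n \<noteq> 0, 2, 4, \<dots>\<close>\<close>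

definition semyanistyi_admissible :: "nat \<Rightarrow> nat \<Rightarrow> complex \<Rightarrow> bool" where
  "semyanistyi_admissible n m \<alpha> \<longleftrightarrow>
     Re \<alpha> > 0 \<and> (\<forall>i::nat. \<alpha> + of_nat m - of_nat n \<noteq> of_nat (2 * i))"

text \<open>
  Existence in the Lebesgue sense, at the point \<open>x\<close>, of the dual Semyanistyi integral of \<open>f\<close> and of
  its composition with the Strichartz transform: finiteness with \<open>f\<close> replaced by \<open>|f|\<close>.
\<close>

definition dual_semyanistyi_exists ::
    "nat \<Rightarrow> complex \<Rightarrow> ('a::euclidean_space set \<Rightarrow> complex) \<Rightarrow> 'a \<Rightarrow> bool" where
  "dual_semyanistyi_exists m \<alpha> f x \<longleftrightarrow>
     dual_semyanistyi_nn m \<alpha> (\<lambda>\<tau>. ennreal (norm (f \<tau>))) x < \<infinity>"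

definition dual_semyanistyi_strichartz_exists ::
    "nat \<Rightarrow> complex \<Rightarrow> nat \<Rightarrow> nat \<Rightarrow> ('a::euclidean_space set \<Rightarrow> complex) \<Rightarrow> 'a \<Rightarrow> bool" where
  "dual_semyanistyi_strichartz_exists k \<alpha> p q f x \<longleftrightarrow>
     dual_semyanistyi_nn k \<alpha> (strichartz_nn p q (\<lambda>\<tau>. ennreal (norm (f \<tau>)))) x < \<infinity>"

end

theory Submission
  imports Defs "HOL-Probability.Probability"
begin

text \<open>
  Both sides integrate \<open>f\<close> over the \<open>j\<close>-planes \<open>\<tau>\<close> against some weight, and the theorem says that the two
  weights agree. Fix mutually orthogonal subspaces \<open>P0\<close>, \<open>Q0\<close>, \<open>W0\<close>, \<open>V0\<close> of dimensions \<open>p\<close>, \<open>q\<close>, \<open>l\<close>,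
  \<open>n - j - l\<close> that span \<open>\<real>^n\<close>, and put \<open>E = P0 + W0\<close> and \<open>X = P0 + Q0\<close> (locale \<open>orthogonal_frame\<close>). Every
  \<open>k\<close>-plane is \<open>T(z + E)\<close> and every \<open>j\<close>-plane is \<open>T(w + X)\<close> with \<open>T\<close> orthogonal, \<open>z\<close> in \<open>E\<^sup>\<bottom>\<close>, \<open>w\<close> in \<open>X\<^sup>\<bottom>\<close>, and the
  measures on the affine Grassmannians are images of Haar measure times Lebesgue measure
  (\<open>affine_grassmannian_measure_eq\<close>). This rests on a construction of Haar measure on the orthogonal group
  of a subspace and on the uniqueness of the invariant measure on a Grassmannian (\<open>grassmannian_measure_eq\<close>).

  At the plane \<open>T(z + E)\<close> the inner planes of the Strichartz transform are \<open>P = TA P0\<close> and \<open>Q = TB Q0\<close> with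
  \<open>A\<close>, \<open>B\<close> random orthogonal maps of \<open>E\<close> and \<open>E\<^sup>\<bottom>\<close>, and \<open>[P,Q] + u + v\<close> is \<open>TAB(u + B\<^sup>-\<^sup>1z + X)\<close>
  (\<open>strichartz_placed\<close>). Since \<open>T(z + E) = TAB(B\<^sup>-\<^sup>1z + E)\<close>, invariance of the measures in \<open>T\<close> and \<open>z\<close> absorbs \<open>A\<close>
  and \<open>B\<close>: the pair (large plane, small plane) may be taken to be \<open>T(z + E)\<close>, \<open>T(u + z + X)\<close> with \<open>u\<close> in \<open>W0\<close>.
  Split \<open>z = a + b\<close> along \<open>E\<^sup>\<bottom> = Q0 + V0\<close>. The vector \<open>a\<close> lies in \<open>X\<close> and does not move the small plane, and
  \<open>w = u + b\<close> runs through \<open>X\<^sup>\<bottom> = W0 + V0\<close>. So the small plane \<open>\<tau> = T(w + X)\<close> has the invariant distribution, and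
  given it the squared distance from \<open>x\<close> to the large plane is the sum of \<open>|y|\<^sup>2\<close>, with \<open>y\<close> running through
  \<open>Q0\<close>, and of the squared length of the \<open>V0\<close>-component of \<open>T\<^sup>-\<^sup>1x - w\<close>. Replacing \<open>T\<close> by \<open>TC\<close> with \<open>C\<close> in the
  orthogonal group of \<open>X\<^sup>\<bottom>\<close> keeps \<open>\<tau>\<close> and averages that component over all directions
  (\<open>nn_integral_reduction\<close>, \<open>large_law_eq_small_law\<close>).

  The theorem is thereby reduced to one integral over \<open>C\<close> and \<open>y\<close>. With \<open>\<beta> = (n - k - \<alpha>)/2\<close>, integrating
  \<open>(|y|\<^sup>2 + s\<^sup>2)\<close> to the power \<open>-\<beta>\<close> over \<open>Q0\<close> gives a multiple of \<open>s\<close> to the power \<open>-2(\<beta> - q/2)\<close>, and averaging over \<open>C\<close>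
  turns the \<open>V0\<close>-component into a multiple of the same power of \<open>|x - \<tau>|\<close>, which is the kernel on the
  right-hand side (\<open>integral_kernel_average\<close>). Both factors come from Gaussian integrals, since a negative
  power is a Gamma average of exponentials; together with the normalizing factors they
  multiply to \<open>c\<close> (\<open>normalized_const_eq\<close>).

  For nonnegative functions the computation shows that the two absolute integrals are positive
  multiples of each other when \<open>Re \<alpha> + j + l < n\<close> (\<open>dual_nn_finite\<close>). Otherwise the kernel average is infinite, so
  that the left-hand side converges only if \<open>f\<close> vanishes almost everywhere (\<open>dual_nn_infinite\<close>), and then both sides are \<open>0\<close>.
  A Lebesgue measurable \<open>f\<close> is replaced by a Borel function: applied to the indicator of a null set of
  \<open>j\<close>-planes, the reduction shows that for almost every \<open>k\<close>-plane the inner integrals do not see that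
  null set (\<open>AE_strichartz_null\<close>, \<open>dual_integrals_cong_AE\<close>).
\<close>

section \<open>Orthogonal projections and orthogonal matrices\<close>

text \<open>
  Random rotations enter both as \<open>T\<close> and as \<open>transpose T\<close>, and composition
  with \<open>matrix_vector_mul_assoc\<close> needs all of them as matrices acting from the left.
\<close>

declare transpose_matrix_vector [simp del]

definition proj :: "'a::euclidean_space set \<Rightarrow> 'a \<Rightarrow> 'a" where
  "proj X x = (THE y. y \<in> X \<and> x - y \<in> X\<^sup>\<bottom>)"

lemma proj_eqI:
  assumes "subspace X" "y \<in> X" "x - y \<in> X\<^sup>\<bottom>"
  shows "proj X x = y"
  unfolding proj_def
proof (rule the_equality)
  fix z assume z: "z \<in> X \<and> x - z \<in> X\<^sup>\<bottom>"
  have "(x - y) - (x - z) \<in> X\<^sup>\<bottom>"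
    using z assms subspace_diff[OF subspace_orthogonal_comp] by blast
  moreover have "z - y \<in> X" using z assms by (intro subspace_diff) auto
  ultimately have "z - y \<in> X \<inter> X\<^sup>\<bottom>" by (simp add: algebra_simps)
  then show "z = y" using orthogonal_Int_0[OF assms(1)] by auto
qed (use assms in auto)

lemma proj_props:
  assumes "subspace X"
  shows proj_in: "proj X x \<in> X" and proj_comp: "x - proj X x \<in> X\<^sup>\<bottom>"
proof -
  have "x \<in> X + X\<^sup>\<bottom>" using subspace_sum_orthogonal_comp[OF assms] by simp
  then obtain y z where "x = y + z" "y \<in> X" "z \<in> X\<^sup>\<bottom>" by (rule set_plus_elim)
  then have "proj X x = y" by (intro proj_eqI assms) auto
  then show "proj X x \<in> X" "x - proj X x \<in> X\<^sup>\<bottom>"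
    using \<open>x = y + z\<close> \<open>y \<in> X\<close> \<open>z \<in> X\<^sup>\<bottom>\<close> by auto
qed

lemma orthogonal_comp_inner: "y \<in> X\<^sup>\<bottom> \<Longrightarrow> x \<in> X \<Longrightarrow> x \<bullet> y = 0"
  "y \<in> X\<^sup>\<bottom> \<Longrightarrow> x \<in> X \<Longrightarrow> y \<bullet> x = 0"
  by (auto simp: orthogonal_comp_def orthogonal_def inner_commute)

lemma orthogonal_compI: "(\<And>x. x \<in> X \<Longrightarrow> x \<bullet> y = 0) \<Longrightarrow> y \<in> X\<^sup>\<bottom>"
  by (auto simp: orthogonal_comp_def orthogonal_def)

lemma proj_id [simp]: "subspace X \<Longrightarrow> x \<in> X \<Longrightarrow> proj X x = x"
  by (rule proj_eqI) (auto simp: subspace_0 subspace_orthogonal_comp)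

lemma proj_zero: "subspace X \<Longrightarrow> x \<in> X\<^sup>\<bottom> \<Longrightarrow> proj X x = 0"
  by (rule proj_eqI) (auto simp: subspace_0)

lemma proj_add: "subspace X \<Longrightarrow> proj X (x + y) = proj X x + proj X y"
  by (rule proj_eqI)
     (auto intro!: subspace_add proj_in simp: add_diff_add subspace_orthogonal_comp proj_comp)

lemma proj_scaleR: "subspace X \<Longrightarrow> proj X (c *\<^sub>R x) = c *\<^sub>R proj X x"
  by (rule proj_eqI)
     (auto intro!: subspace_scale proj_in proj_comp subspace_orthogonal_comp
        simp flip: scaleR_diff_right)

lemma linear_proj: "subspace X \<Longrightarrow> linear (proj X)"
  by (intro linearI proj_add proj_scaleR)

lemma proj_diff: "subspace X \<Longrightarrow> proj X (x - y) = proj X x - proj X y"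
  using linear_proj by (rule linear_diff)

lemma proj_0 [simp]: "subspace X \<Longrightarrow> proj X 0 = 0"
  by (simp add: subspace_0)

lemma continuous_on_proj: "subspace X \<Longrightarrow> continuous_on S (proj X)"
  using linear_proj by (rule linear_continuous_on_compose[OF continuous_on_id, simplified id_def])

lemma borel_measurable_proj: "subspace X \<Longrightarrow> proj X \<in> borel_measurable borel"
  by (intro borel_measurable_continuous_onI continuous_on_proj)

lemma borel_measurable_proj' [measurable (raw)]:
  "subspace X \<Longrightarrow> f \<in> borel_measurable M \<Longrightarrow> (\<lambda>x. proj X (f x)) \<in> borel_measurable M"
  using borel_measurable_proj by (rule measurable_compose_rev)

lemma proj_orthogonal_comp: "subspace X \<Longrightarrow> proj (X\<^sup>\<bottom>) x = x - proj X x"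
  by (rule proj_eqI) (auto simp: subspace_orthogonal_comp orthogonal_comp_self proj_in proj_comp)

lemma norm_proj_Pythagoras:
  "subspace X \<Longrightarrow> (norm x)\<^sup>2 = (norm (proj X x))\<^sup>2 + (norm (x - proj X x))\<^sup>2"
  using norm_add_Pythagorean[of "proj X x" "x - proj X x"] proj_in[of X x] proj_comp[of X x]
  by (auto simp: orthogonal_comp_def)

lemma inner_proj_right: "subspace X \<Longrightarrow> x \<in> X \<Longrightarrow> x \<bullet> proj X y = x \<bullet> y"
  using orthogonal_comp_inner(1)[OF proj_comp[of X y]] by (simp add: inner_diff_right)

lemma proj_subset: 
  assumes "subspace X" "subspace Y" "X \<subseteq> Y" shows "proj X (proj Y x) = proj X x"
proof (rule proj_eqI[symmetric])
  have "proj Y x - proj X (proj Y x) \<in> X\<^sup>\<bottom>" using assms by (simp add: proj_comp)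
  moreover have "x - proj Y x \<in> X\<^sup>\<bottom>" using assms proj_comp[of Y x] orthogonal_comp_anti_mono by blast
  ultimately have "(proj Y x - proj X (proj Y x)) + (x - proj Y x) \<in> X\<^sup>\<bottom>"
    by (rule subspace_add[OF subspace_orthogonal_comp])
  then show "x - proj X (proj Y x) \<in> X\<^sup>\<bottom>" by simp
qed (use assms in \<open>auto simp: proj_in\<close>)

lemma set_plus_eq: "X + Y = {x + y | x y. x \<in> X \<and> y \<in> Y}"
  by (auto simp: set_plus_def)

lemma subspace_orth_sum: "subspace X \<Longrightarrow> subspace Y \<Longrightarrow> subspace (X + Y)"
  by (simp add: set_plus_eq subspace_sums)

lemma proj_sum:
  assumes "subspace X" "subspace Y" "X \<subseteq> Y\<^sup>\<bottom>"
  shows "proj (X + Y) x = proj X x + proj Y x"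
proof (rule proj_eqI)
  show "subspace (X + Y)" using assms by (simp add: subspace_orth_sum)
  show "proj X x + proj Y x \<in> X + Y" using assms by (simp add: proj_in set_plus_intro)
  have X: "u \<bullet> proj Y x = 0" if "u \<in> X" for u
    using that assms proj_in[of Y x] by (auto intro: orthogonal_comp_inner)
  have Y: "u \<bullet> proj X x = 0" if "u \<in> Y" for u
    using that assms proj_in[of X x] by (auto intro: orthogonal_comp_inner)
  show "x - (proj X x + proj Y x) \<in> (X + Y)\<^sup>\<bottom>"
  proof (rule orthogonal_compI)
    fix z assume "z \<in> X + Y"
    then obtain u v where z: "z = u + v" "u \<in> X" "v \<in> Y" by (rule set_plus_elim)
    then show "z \<bullet> (x - (proj X x + proj Y x)) = 0"
      using assms by (simp add: inner_simps inner_proj_right X Y)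
  qed
qed

text \<open>
  All distances to planes are turned into norms of orthogonal projections by this formula.
\<close>

lemma infdist_subspace:
  assumes "subspace X"
  shows "infdist x ((+) v ` X) = norm (x - v - proj X (x - v))"
proof (rule antisym)
  have "infdist x ((+) v ` X) \<le> dist x (v + proj X (x - v))"
    by (rule infdist_le) (use assms in \<open>auto simp: proj_in\<close>)
  then show "infdist x ((+) v ` X) \<le> norm (x - v - proj X (x - v))"
    by (simp add: dist_norm algebra_simps)
  have ne: "(+) v ` X \<noteq> {}" using assms subspace_0 by auto
  show "norm (x - v - proj X (x - v)) \<le> infdist x ((+) v ` X)"
    unfolding infdist_notempty[OF ne]
  proof (rule cINF_greatest[OF ne])
    fix z assume "z \<in> (+) v ` X"
    then obtain y where "y \<in> X" and z: "z = v + y" by auto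
    have "(norm (x - v - proj X (x - v)))\<^sup>2 \<le> (norm (x - v - y))\<^sup>2"
      using norm_proj_Pythagoras[OF assms, of "x - v - y"] \<open>y \<in> X\<close> assms by (simp add: proj_diff)
    then show "norm (x - v - proj X (x - v)) \<le> dist x z"
      by (simp add: dist_norm z algebra_simps flip: abs_le_square_iff)
  qed
qed

lemma infdist_subspace0:
  "subspace X \<Longrightarrow> infdist x X = norm (x - proj X x)"
  using infdist_subspace[of X x 0] by simp

lemma dim_orthogonal_comp: 
  fixes X :: "'a::euclidean_space set"
  assumes "subspace X" shows "dim X + dim (X\<^sup>\<bottom>) = DIM('a)"
  using dim_subspace_orthogonal_to_vectors[OF assms subspace_UNIV, simplified]
  by (simp add: orthogonal_comp_def orthogonal_commute)

lemma dim_orth_sum: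
  fixes X :: "'a::euclidean_space set"
  assumes "subspace X" "subspace Y" "X \<subseteq> Y\<^sup>\<bottom>"
  shows "dim (X + Y) = dim X + dim Y"
proof -
  have "X \<inter> Y = {0}" using assms orthogonal_Int_0[of Y] subspace_0 by blast
  then have "dim (X \<inter> Y) = 0" by simp
  then show ?thesis using dim_sums_Int[OF assms(1,2)] unfolding set_plus_eq by linarith
qed

lemma orthogonal_matrix_inner:
  fixes A :: "real^'n^'n"
  assumes "orthogonal_matrix A"
  shows "(A *v x) \<bullet> (A *v y) = x \<bullet> y"
  using assms by (metis dot_lmul_matrix matrix_vector_mul_assoc matrix_vector_mul_lid orthogonal_matrix_def vector_transpose_matrix transpose_matrix_vector)

lemma orthogonal_matrix_norm:
  fixes A :: "real^'n^'n"
  shows "orthogonal_matrix A \<Longrightarrow> norm (A *v x) = norm x"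
  by (simp add: norm_eq_sqrt_inner orthogonal_matrix_inner)

lemma orthogonal_matrix_cancel:
  fixes A :: "real^'n^'n"
  assumes "orthogonal_matrix A"
  shows "transpose A *v (A *v x) = x" "A *v (transpose A *v x) = x"
  using assms by (auto simp: orthogonal_matrix_def matrix_vector_mul_assoc)

lemma orthogonal_matrix_transformation:
  fixes A :: "real^'n^'n"
  shows "orthogonal_matrix A \<Longrightarrow> orthogonal_transformation ((*v) A)"
  by (simp add: orthogonal_transformation_def orthogonal_matrix_inner)

lemma inner_transpose: 
  fixes A :: "real^'n^'n"
  shows "(transpose A *v x) \<bullet> y = x \<bullet> (A *v y)"
  by (metis dot_lmul_matrix transpose_matrix_vector)

lemma orthogonal_matrix_image_comp:
  fixes A :: "real^'n^'n"
  assumes "orthogonal_matrix A"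
  shows "((*v) A ` X)\<^sup>\<bottom> = (*v) A ` (X\<^sup>\<bottom>)"
proof (intro equalityI subsetI)
  fix y assume y: "y \<in> ((*v) A ` X)\<^sup>\<bottom>"
  have "x \<bullet> (transpose A *v y) = (A *v x) \<bullet> y" for x
    by (metis inner_commute inner_transpose)
  then have "transpose A *v y \<in> X\<^sup>\<bottom>"
    using y by (auto intro!: orthogonal_compI simp: orthogonal_comp_inner)
  then show "y \<in> (*v) A ` (X\<^sup>\<bottom>)"
    using orthogonal_matrix_cancel[OF assms, of y] by (metis imageI)
qed (auto intro!: orthogonal_compI simp: orthogonal_matrix_inner[OF assms] orthogonal_comp_inner)

lemma subspace_matrix_image:
  fixes A :: "real^'n^'n"
  shows "subspace X \<Longrightarrow> subspace ((*v) A ` X)"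
  by (intro linear_subspace_image matrix_vector_mul_linear)

lemma dim_orthogonal_matrix_image:
  fixes A :: "real^'n^'n"
  assumes "orthogonal_matrix A" shows "dim ((*v) A ` X) = dim X"
  by (rule dim_image_eq)
     (use assms in \<open>auto intro!: inj_on_inverseI[where g="(*v) (transpose A)"] simp: orthogonal_matrix_cancel\<close>)

lemma proj_orthogonal_matrix_image:
  fixes A :: "real^'n^'n"
  assumes "orthogonal_matrix A" "subspace X"
  shows "proj ((*v) A ` X) (A *v x) = A *v proj X x"
proof (rule proj_eqI)
  show "A *v x - A *v proj X x \<in> ((*v) A ` X)\<^sup>\<bottom>"
    by (auto simp: orthogonal_matrix_image_comp assms proj_comp simp flip: matrix_vector_mult_diff_distrib)
qed (use assms in \<open>auto simp: subspace_matrix_image proj_in\<close>)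

text \<open>
  The orthogonal group of \<open>X\<close>, realized by matrices of the ambient space: acting as the identity on the
  complement makes the groups of all subspaces subgroups of one matrix group, and those of
  orthogonal subspaces commute.
\<close>
definition rot :: "(real^'n) set \<Rightarrow> (real^'n^'n) set" where
  "rot X = {A. orthogonal_matrix A \<and> (\<forall>x\<in>X\<^sup>\<bottom>. A *v x = x)}"

lemma rot_orthogonal: "A \<in> rot X \<Longrightarrow> orthogonal_matrix A"
  by (simp add: rot_def)

lemma rot_fix: "A \<in> rot X \<Longrightarrow> x \<in> X\<^sup>\<bottom> \<Longrightarrow> A *v x = x"
  by (simp add: rot_def)

lemma rot_mono: "X \<subseteq> Y \<Longrightarrow> rot X \<subseteq> rot Y"
  using orthogonal_comp_anti_mono[of X Y] by (auto simp: rot_def)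

lemma rot_id: "mat 1 \<in> rot X"
  by (simp add: rot_def orthogonal_matrix_id)

lemma rot_mult: "A \<in> rot X \<Longrightarrow> B \<in> rot X \<Longrightarrow> A ** B \<in> rot X"
  by (simp add: rot_def orthogonal_matrix_mul flip: matrix_vector_mul_assoc)

lemma rot_transpose: "A \<in> rot X \<Longrightarrow> transpose A \<in> rot X"
  unfolding rot_def by (simp, metis orthogonal_matrix_cancel(1))

lemma rot_UNIV: "rot UNIV = {A. orthogonal_matrix A}"
  by (auto simp: rot_def)

lemma rot_maps:
  assumes "subspace X" "A \<in> rot X" "x \<in> X"
  shows "A *v x \<in> X"
proof -
  have "A *v x \<in> X\<^sup>\<bottom>\<^sup>\<bottom>"
  proof (rule orthogonal_compI)
    fix y assume "y \<in> X\<^sup>\<bottom>"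
    then have "y \<bullet> (A *v x) = (A *v y) \<bullet> (A *v x)" using assms by (simp add: rot_fix)
    also have "\<dots> = 0" using assms \<open>y \<in> X\<^sup>\<bottom>\<close>
      by (simp add: orthogonal_matrix_inner[OF rot_orthogonal] orthogonal_comp_inner)
    finally show "y \<bullet> (A *v x) = 0" .
  qed
  then show ?thesis using assms by (simp add: orthogonal_comp_self)
qed

lemma rot_image:
  assumes "subspace X" "A \<in> rot X" shows "(*v) A ` X = X"
proof
  show "X \<subseteq> (*v) A ` X"
    using rot_maps[OF assms(1) rot_transpose[OF assms(2)]]
      orthogonal_matrix_cancel(2)[OF rot_orthogonal[OF assms(2)]]
    by (metis image_iff subsetI)
qed (use rot_maps assms in auto)

lemma rot_image_comp:
  assumes "A \<in> rot X" "Y \<subseteq> X\<^sup>\<bottom>" shows "(*v) A ` Y = Y"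
  using assms rot_fix by (force simp: image_iff subset_iff)

lemma proj_rot:
  assumes "subspace X" "A \<in> rot X" shows "proj X (A *v x) = A *v proj X x"
  using proj_orthogonal_matrix_image[OF rot_orthogonal[OF assms(2)] assms(1), of x]
  by (simp add: rot_image assms)

lemma grassmannian_rot_image:
  assumes "P \<in> grassmannian X m" "subspace X" "A \<in> rot X"
  shows "(*v) A ` P \<in> grassmannian X m"
  using assms dim_orthogonal_matrix_image[OF rot_orthogonal[OF assms(3)]]
    rot_image[OF assms(2,3)] by (auto simp: grassmannian_def subspace_matrix_image)

section \<open>Haar measure on the orthogonal group of a subspace\<close>

lemma nn_integral_lborel_translate:
  fixes f :: "'a::euclidean_space \<Rightarrow> ennreal"
  assumes [measurable]: "f \<in> borel_measurable borel"
  shows "(\<integral>\<^sup>+x. f (c + x) \<partial>lborel) = (\<integral>\<^sup>+x. f x \<partial>lborel)"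
proof -
  have "(\<integral>\<^sup>+x. f x \<partial>lborel) = (\<integral>\<^sup>+x. f x \<partial>distr lborel borel ((+) c))"
    by (simp add: lborel_distr_plus)
  also have "\<dots> = (\<integral>\<^sup>+x. f (c + x) \<partial>lborel)" by (subst nn_integral_distr) auto
  finally show ?thesis by simp
qed

text \<open>
  The image measure is translation invariant and gives the unit ball the same finite nonzero
  mass as Lebesgue measure. Two translation invariant measures are proportional, by Fubini applied to the product of
  \<open>E\<close> with the ball.
\<close>

lemma lborel_distr_orthogonal:
  fixes T :: "'a::euclidean_space \<Rightarrow> 'a"
  assumes T: "orthogonal_transformation T"
  shows "distr lborel borel T = lborel"
proof (rule measure_eqI)
  let ?B = "cball 0 1 :: 'a set"
  have lin: "linear T" using T by (rule orthogonal_transformation_linear)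
  have [measurable]: "T \<in> borel_measurable borel"
    by (intro borel_measurable_continuous_onI linear_continuous_on linear_conv_bounded_linear[THEN iffD1] lin)
  define \<nu> where "\<nu> = distr lborel borel T"
  have sf: "sigma_finite_measure \<nu>" unfolding \<nu>_def
  proof -
    show "sigma_finite_measure (distr lborel borel T)"
    proof (intro sigma_finite_measure.intro exI conjI ballI)
      show "countable (range (\<lambda>i. cball (0::'a) (real i)))" by simp
      show "(\<Union>(range (\<lambda>i. cball (0::'a) (real i)))) = space (distr lborel borel T)"
        by (auto simp: real_arch_simple)
      fix a assume "a \<in> range (\<lambda>i. cball (0::'a) (real i))"
      then obtain i where a: "a = cball 0 (real i)" by auto
      have "T -` cball 0 (real i) = cball 0 (real i)"
        using orthogonal_transformation_norm[OF T] by auto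
      then show "emeasure (distr lborel borel T) a \<noteq> \<infinity>"
        using emeasure_bounded_finite[OF bounded_cball] by (simp add: a emeasure_distr less_top[symmetric])
    qed auto
  qed
  interpret \<nu>: sigma_finite_measure \<nu> by (rule sf)
  interpret pair_sigma_finite lborel \<nu> ..
  have [measurable_cong]: "sets \<nu> = sets borel" by (simp add: \<nu>_def)
  have inv: "(\<integral>\<^sup>+y. h (x + y) \<partial>\<nu>) = (\<integral>\<^sup>+y. h y \<partial>\<nu>)" if [measurable]: "h \<in> borel_measurable borel" for h x
  proof -
    obtain z where z: "x = T z" using orthogonal_transformation_surj[OF T] by (metis surjD)
    have "(\<integral>\<^sup>+y. h (x + y) \<partial>\<nu>) = (\<integral>\<^sup>+y. h (T (z + y)) \<partial>lborel)"
      unfolding \<nu>_def by (subst nn_integral_distr) (simp_all add: z linear_add[OF lin])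
    also have "\<dots> = (\<integral>\<^sup>+y. h (T y) \<partial>lborel)"
      by (rule nn_integral_lborel_translate[where f="\<lambda>y. h (T y)"]) measurable
    also have "\<dots> = (\<integral>\<^sup>+y. h y \<partial>\<nu>)" unfolding \<nu>_def by (subst nn_integral_distr) simp_all
    finally show ?thesis .
  qed
  have \<nu>B: "emeasure \<nu> ?B = emeasure lborel ?B"
  proof -
    have "T -` ?B = ?B" using orthogonal_transformation_norm[OF T] by auto
    then show ?thesis unfolding \<nu>_def by (subst emeasure_distr) auto
  qed
  have B0: "emeasure lborel ?B \<noteq> 0" "emeasure lborel ?B \<noteq> \<infinity>"
  proof -
    have "emeasure lborel (ball (0::'a) 1) \<noteq> 0"
      using open_not_negligible[of "ball (0::'a) 1"]
      by (auto simp: negligible_iff_null_sets null_sets_def)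
    moreover have "emeasure lborel (ball (0::'a) 1) \<le> emeasure lborel ?B"
      by (intro emeasure_mono) auto
    ultimately show "emeasure lborel ?B \<noteq> 0" by auto
    show "emeasure lborel ?B \<noteq> \<infinity>" using emeasure_bounded_finite[OF bounded_cball, of 0 1] by (metis infinity_ennreal_def less_irrefl)
  qed
  show "emeasure (distr lborel borel T) E = emeasure lborel E" if "E \<in> sets (distr lborel borel T)" for E
  proof -
    have [measurable]: "E \<in> sets borel" using that by simp
    have [measurable]: "?B \<in> sets borel" by simp
    \<comment> \<open>The product of the masses of \<open>E\<close> and of the ball is computed twice, shifting once in \<open>x\<close> and once in \<open>y\<close>.\<close>
    have tr: "(\<integral>\<^sup>+x. indicator ?B (- y + x) \<partial>lborel) = emeasure lborel ?B" for y
      by (subst nn_integral_lborel_translate) auto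
    have "emeasure \<nu> E * emeasure lborel ?B = (\<integral>\<^sup>+y. indicator E y * (\<integral>\<^sup>+x. indicator ?B x \<partial>lborel) \<partial>\<nu>)"
      by (subst nn_integral_multc) (auto simp: \<nu>_def)
    also have "\<dots> = (\<integral>\<^sup>+y. \<integral>\<^sup>+x. indicator E y * indicator ?B (- y + x) \<partial>lborel \<partial>\<nu>)"
      by (intro nn_integral_cong, subst nn_integral_cmult) (simp_all only: tr, simp_all)
    also have "\<dots> = (\<integral>\<^sup>+x. \<integral>\<^sup>+y. indicator E y * indicator ?B (- y + x) \<partial>\<nu> \<partial>lborel)"
      by (rule Fubini') measurable
    also have "\<dots> = (\<integral>\<^sup>+x. \<integral>\<^sup>+y. indicator E (x + y) * indicator ?B (- y) \<partial>\<nu> \<partial>lborel)"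
    proof (rule nn_integral_cong)
      fix x
      show "(\<integral>\<^sup>+y. indicator E y * indicator ?B (- y + x) \<partial>\<nu>)
          = (\<integral>\<^sup>+y. indicator E (x + y) * indicator ?B (- y) \<partial>\<nu>)"
        using inv[of "\<lambda>y. indicator E y * indicator ?B (- y + x)" x] by simp
    qed
    also have "\<dots> = (\<integral>\<^sup>+y. \<integral>\<^sup>+x. indicator E (x + y) * indicator ?B (- y) \<partial>lborel \<partial>\<nu>)"
      by (rule Fubini'[symmetric]) measurable
    also have "\<dots> = (\<integral>\<^sup>+y. \<integral>\<^sup>+x. indicator E (y + x) * indicator ?B y \<partial>lborel \<partial>\<nu>)"
      by (simp add: indicator_def add.commute)
    also have "\<dots> = (\<integral>\<^sup>+y. (\<integral>\<^sup>+x. indicator E x \<partial>lborel) * indicator ?B y \<partial>\<nu>)"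
      by (intro nn_integral_cong, subst nn_integral_multc)
         (auto simp: nn_integral_lborel_translate[where f="indicator E"])
    also have "\<dots> = emeasure lborel E * emeasure lborel ?B"
      by (subst nn_integral_cmult) (auto simp: \<nu>_def \<nu>B[unfolded \<nu>_def])
    finally show ?thesis
      using B0 by (auto simp: mult.commute[of _ "emeasure lborel ?B"] ennreal_mult_cancel_left \<nu>_def)
  qed
qed simp

lemma borel_measurable_vec_lambda [measurable (raw)]:
  fixes f :: "'n::finite \<Rightarrow> 'a \<Rightarrow> 'b::euclidean_space"
  assumes [measurable]: "\<And>i. f i \<in> borel_measurable M"
  shows "(\<lambda>x. \<chi> i. f i x) \<in> borel_measurable M"
  by (subst borel_measurable_euclidean_space) (auto simp: Basis_vec_def inner_axis)

lemma borel_measurable_vec_nth' [measurable (raw)]: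
  fixes f :: "'a \<Rightarrow> ('b::euclidean_space)^'n"
  assumes f: "f \<in> borel_measurable M"
  shows "(\<lambda>x. f x $ i) \<in> borel_measurable M"
  using measurable_compose[OF f borel_measurable_continuous_onI[of "\<lambda>x. x $ i"]]
  by (simp add: continuous_on_component)

lemma borel_measurable_matrix_mult [measurable (raw)]:
  fixes f g :: "'a \<Rightarrow> real^'n^'n"
  assumes [measurable]: "f \<in> borel_measurable M" "g \<in> borel_measurable M"
  shows "(\<lambda>x. f x ** g x) \<in> borel_measurable M"
  unfolding matrix_matrix_mult_def by measurable

lemma borel_measurable_matrix_vector_mult [measurable (raw)]:
  fixes f :: "'a \<Rightarrow> real^'n^'n"
  assumes [measurable]: "f \<in> borel_measurable M" "g \<in> borel_measurable M"
  shows "(\<lambda>x. f x *v g x) \<in> borel_measurable M"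
  unfolding matrix_vector_mult_def by measurable

lemma borel_measurable_transpose [measurable (raw)]:
  fixes f :: "'a \<Rightarrow> real^'n^'n"
  assumes [measurable]: "f \<in> borel_measurable M"
  shows "(\<lambda>x. transpose (f x)) \<in> borel_measurable M"
  unfolding transpose_def by measurable

definition rot_borel :: "(real^'n) set \<Rightarrow> (real^'n^'n) measure" where
  "rot_borel X = restrict_space borel (rot X)"

lemma space_rot_borel [simp]: "space (rot_borel X) = rot X"
  by (simp add: rot_borel_def space_restrict_space)

lemma rot_borel_iff:
  "f \<in> M \<rightarrow>\<^sub>M rot_borel X \<longleftrightarrow> f \<in> borel_measurable M \<and> (\<forall>x\<in>space M. f x \<in> rot X)"
  unfolding rot_borel_def measurable_restrict_space2_iff by auto

lemma rot_borel_borel [measurable (raw)]: "f \<in> M \<rightarrow>\<^sub>M rot_borel X \<Longrightarrow> f \<in> borel_measurable M"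
  by (simp add: rot_borel_iff)

lemma rot_borel_space: "f \<in> M \<rightarrow>\<^sub>M rot_borel X \<Longrightarrow> x \<in> space M \<Longrightarrow> f x \<in> rot X"
  by (simp add: rot_borel_iff)

lemma rot_borel_mult [measurable (raw)]:
  "f \<in> M \<rightarrow>\<^sub>M rot_borel X \<Longrightarrow> g \<in> M \<rightarrow>\<^sub>M rot_borel X \<Longrightarrow> (\<lambda>x. f x ** g x) \<in> M \<rightarrow>\<^sub>M rot_borel X"
  by (auto simp: rot_borel_iff rot_mult intro!: borel_measurable_matrix_mult)

lemma rot_borel_transpose [measurable (raw)]:
  "f \<in> M \<rightarrow>\<^sub>M rot_borel X \<Longrightarrow> (\<lambda>x. transpose (f x)) \<in> M \<rightarrow>\<^sub>M rot_borel X"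
  by (auto simp: rot_borel_iff rot_transpose intro!: borel_measurable_transpose)

lemma rot_borel_mono: "f \<in> M \<rightarrow>\<^sub>M rot_borel X \<Longrightarrow> X \<subseteq> Y \<Longrightarrow> f \<in> M \<rightarrow>\<^sub>M rot_borel Y"
  using rot_mono[of X Y] by (auto simp: rot_borel_iff)

subsection \<open>Householder reflections\<close>

definition refl :: "real^'n \<Rightarrow> real^'n^'n" where
  "refl v = (\<chi> i j. (if i = j then 1 else 0) - 2 * (v $ i) * (v $ j) / (v \<bullet> v))"

lemma refl_apply: "refl v *v x = x - (2 * (v \<bullet> x) / (v \<bullet> v)) *\<^sub>R v"
proof -
  have "(\<Sum>j\<in>UNIV. ((if i = j then 1 else 0) - 2 * (v $ i) * (v $ j) / (v \<bullet> v)) * x $ j)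
      = x $ i - (2 * (v \<bullet> x) / (v \<bullet> v)) * v $ i" for i
  proof -
    have "(\<Sum>j\<in>UNIV. ((if i = j then 1 else 0) - 2 * (v $ i) * (v $ j) / (v \<bullet> v)) * x $ j)
      = (\<Sum>j\<in>UNIV. (if i = j then x $ j else 0)) - (\<Sum>j\<in>UNIV. (2 * (v $ i) / (v \<bullet> v)) * (v $ j * x $ j))"
      unfolding sum_subtractf[symmetric] by (rule sum.cong) (auto simp: left_diff_distrib)
    also have "\<dots> = x $ i - (2 * (v $ i) / (v \<bullet> v)) * (v \<bullet> x)"
      by (simp add: sum_distrib_left[symmetric] sum_divide_distrib[symmetric] inner_vec_def[of v x])
    finally show ?thesis by simp
  qed
  then show ?thesis by (simp add: vec_eq_iff refl_def matrix_vector_mult_def)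
qed

lemma refl_orthogonal: "orthogonal_matrix (refl v)"
proof -
  have "orthogonal_transformation ((*v) (refl v))"
    by (cases "v = 0") (auto simp: orthogonal_transformation_def refl_apply inner_simps field_simps inner_commute)
  then show ?thesis by (simp add: orthogonal_transformation_matrix)
qed

lemma refl_in_rot: "v \<in> X \<Longrightarrow> refl v \<in> rot X"
  by (auto simp: rot_def refl_orthogonal refl_apply orthogonal_comp_inner)

text \<open>
  Reflecting in the hyperplane halfway between two vectors of the same length exchanges them. This
  provides, measurably in \<open>s\<close>, an orthogonal map with prescribed value on one unit vector. For \<open>s = e\<close> the
  definition of \<open>refl 0\<close> by division by zero gives the identity.
\<close>

lemma refl_swap:
  assumes "norm s = norm e"
  shows "refl (s - e) *v e = s" "refl (s - e) *v s = e"
proof -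
  have ss: "s \<bullet> s = e \<bullet> e" using assms by (simp add: norm_eq)
  show "refl (s - e) *v e = s"
  proof (cases "s = e")
    case False
    then have "(s - e) \<bullet> (s - e) \<noteq> 0" by simp
    moreover have "2 * ((s - e) \<bullet> e) = - ((s - e) \<bullet> (s - e))"
      using ss by (simp add: inner_simps inner_commute)
    ultimately have "2 * ((s - e) \<bullet> e) / ((s - e) \<bullet> (s - e)) = - 1" by simp
    then show ?thesis by (simp add: refl_apply)
  qed (simp add: refl_apply)
  show "refl (s - e) *v s = e"
  proof (cases "s = e")
    case False
    then have "(s - e) \<bullet> (s - e) \<noteq> 0" by simp
    moreover have "2 * ((s - e) \<bullet> s) = ((s - e) \<bullet> (s - e))"
      using ss by (simp add: inner_simps inner_commute)
    ultimately have "2 * ((s - e) \<bullet> s) / ((s - e) \<bullet> (s - e)) = 1" by (metis divide_self)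
    then show ?thesis by (simp only: refl_apply scaleR_one) simp
  qed (simp add: refl_apply)
qed

lemma borel_measurable_refl [measurable (raw)]:
  assumes [measurable]: "f \<in> borel_measurable M"
  shows "(\<lambda>x. refl (f x)) \<in> borel_measurable M"
  unfolding refl_def by measurable

definition perp_in :: "'a::euclidean_space set \<Rightarrow> 'a \<Rightarrow> 'a set" where
  "perp_in X e = {x \<in> X. e \<bullet> x = 0}"

lemma subspace_perp_in: "subspace X \<Longrightarrow> subspace (perp_in X e)"
  by (auto simp: perp_in_def subspace_def inner_simps)

lemma perp_in_sum:
  assumes "subspace X" "e \<in> X" "norm e = 1"
  shows "span {e} + perp_in X e = X" "span {e} \<subseteq> (perp_in X e)\<^sup>\<bottom>"
proof -
  show "span {e} \<subseteq> (perp_in X e)\<^sup>\<bottom>"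
    by (auto simp: span_singleton perp_in_def inner_commute intro!: orthogonal_compI)
  show "span {e} + perp_in X e = X"
  proof (intro equalityI subsetI)
    fix x assume "x \<in> X"
    have "x = (e \<bullet> x) *\<^sub>R e + (x - (e \<bullet> x) *\<^sub>R e)" by simp
    moreover have "x - (e \<bullet> x) *\<^sub>R e \<in> perp_in X e"
      using assms \<open>x \<in> X\<close> 
      by (auto simp: perp_in_def inner_simps norm_eq_1 intro!: subspace_diff subspace_scale)
    ultimately show "x \<in> span {e} + perp_in X e"
      using set_plus_intro[of "(e \<bullet> x) *\<^sub>R e" "span {e}"] by (metis rangeI span_singleton)
  next
    fix x assume "x \<in> span {e} + perp_in X e"
    then show "x \<in> X"
      using assms by (auto simp: set_plus_def span_singleton perp_in_def intro!: subspace_add subspace_scale)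
  qed
qed

lemma dim_perp_in:
  assumes "subspace X" "e \<in> X" "norm e = 1"
  shows "dim X = Suc (dim (perp_in X e))"
proof -
  have "e \<noteq> 0" using assms by auto
  then have "dim (span {e}) = 1" by (simp add: dim_singleton)
  then show ?thesis
    using dim_orth_sum[OF subspace_span subspace_perp_in[OF assms(1)] perp_in_sum(2)[OF assms]]
      perp_in_sum(1)[OF assms] by simp
qed

text \<open>
  The stabilizer of a unit vector is the orthogonal group of a space of one dimension less. This is
  the step by which orthogonal groups are handled by induction on the dimension.
\<close>

lemma rot_perp_in:
  assumes "subspace X" "e \<in> X" "norm e = 1"
  shows "rot (perp_in X e) = {A \<in> rot X. A *v e = e}"
proof (intro equalityI subsetI)
  fix A assume A: "A \<in> rot (perp_in X e)"
  then have "A *v e = e"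
    using perp_in_sum(2)[OF assms] by (auto intro!: rot_fix simp: span_base)
  then show "A \<in> {A \<in> rot X. A *v e = e}"
    using A rot_mono[of "perp_in X e" X] by (auto simp: perp_in_def)
next
  fix A assume A: "A \<in> {A \<in> rot X. A *v e = e}"
  have "A *v y = y" if y: "y \<in> (perp_in X e)\<^sup>\<bottom>" for y
  proof -
    have "y - (e \<bullet> y) *\<^sub>R e \<in> X\<^sup>\<bottom>"
    proof (rule orthogonal_compI)
      fix x assume "x \<in> X"
      then have "x \<in> span {e} + perp_in X e" using perp_in_sum(1)[OF assms] by simp
      then obtain c z where "x = c *\<^sub>R e + z" "z \<in> perp_in X e"
        by (auto simp: set_plus_def span_singleton)
      then show "x \<bullet> (y - (e \<bullet> y) *\<^sub>R e) = 0"
        using y assms(3) by (auto simp: inner_simps orthogonal_comp_inner norm_eq_1 perp_in_def inner_commute)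
    qed
    then have "A *v (y - (e \<bullet> y) *\<^sub>R e) = y - (e \<bullet> y) *\<^sub>R e" using A rot_fix by blast
    then show ?thesis using A by (simp add: matrix_vector_mult_diff_distrib matrix_vector_mult_scaleR)
  qed
  then show "A \<in> rot (perp_in X e)" using A by (auto simp: rot_def)
qed

definition is_haar :: "(real^'n) set \<Rightarrow> (real^'n^'n) measure \<Rightarrow> bool" where
  "is_haar X H \<longleftrightarrow> prob_space H \<and> sets H = sets (rot_borel X) \<and>
     (\<forall>S\<in>rot X. distr H (rot_borel X) (\<lambda>A. S ** A) = H)"

lemma is_haar_nn_integral:
  assumes "is_haar X H" "S \<in> rot X" "F \<in> borel_measurable (rot_borel X)"
  shows "(\<integral>\<^sup>+A. F (S ** A) \<partial>H) = (\<integral>\<^sup>+A. F A \<partial>H)"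
proof -
  have [measurable_cong]: "sets H = sets (rot_borel X)" using assms by (simp add: is_haar_def)
  have [measurable]: "(\<lambda>A. S ** A) \<in> rot_borel X \<rightarrow>\<^sub>M rot_borel X"
    by (rule rot_borel_mult) (auto simp: assms)
  note assms(3)[measurable]
  have "(\<integral>\<^sup>+A. F A \<partial>H) = (\<integral>\<^sup>+A. F A \<partial>distr H (rot_borel X) (\<lambda>A. S ** A))"
    using assms by (simp add: is_haar_def)
  also have "\<dots> = (\<integral>\<^sup>+A. F (S ** A) \<partial>H)" by (subst nn_integral_distr) auto
  finally show ?thesis by simp
qed

lemma is_haarI:
  assumes "prob_space H" and sets: "sets H = sets (rot_borel X)"
    and inv: "\<And>S (F :: _ \<Rightarrow> ennreal). S \<in> rot X \<Longrightarrow> F \<in> borel_measurable (rot_borel X) \<Longrightarrow> (\<integral>\<^sup>+A. F (S ** A) \<partial>H) = (\<integral>\<^sup>+A. F A \<partial>H)"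
  shows "is_haar X H"
  unfolding is_haar_def
proof (intro conjI ballI assms measure_eqI)
  note sets[measurable_cong]
  fix S assume S: "S \<in> rot X"
  have [measurable]: "(\<lambda>A. S ** A) \<in> rot_borel X \<rightarrow>\<^sub>M rot_borel X"
    by (rule rot_borel_mult) (auto simp: S)
  fix E assume "E \<in> sets (distr H (rot_borel X) (\<lambda>A. S ** A))"
  then have [measurable]: "E \<in> sets (rot_borel X)" by simp
  have "emeasure (distr H (rot_borel X) (\<lambda>A. S ** A)) E = (\<integral>\<^sup>+A. indicator E A \<partial>distr H (rot_borel X) (\<lambda>A. S ** A))"
    by simp
  also have "\<dots> = (\<integral>\<^sup>+A. indicator E (S ** A) \<partial>H)" by (subst nn_integral_distr) auto
  also have "\<dots> = (\<integral>\<^sup>+A. indicator E A \<partial>H)" by (rule inv[OF S]) measurable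
  also have "\<dots> = emeasure H E" by (simp add: sets)
  finally show "emeasure (distr H (rot_borel X) (\<lambda>A. S ** A)) E = emeasure H E" .
qed (simp add: sets)

text \<open>
  An auxiliary probability measure that is invariant under all orthogonal maps; its direction in a subspace
  is a uniformly distributed unit vector.
\<close>
definition unif_ball :: "'a::euclidean_space measure" where
  "unif_ball = uniform_measure lborel (cball 0 1)"

lemma sets_unif_ball [simp, measurable_cong]: "sets unif_ball = sets borel"
  by (simp add: unif_ball_def)

lemma lborel_cball_1:
  "emeasure lborel (cball (0::'a::euclidean_space) 1) \<noteq> 0" "emeasure lborel (cball (0::'a) 1) \<noteq> \<infinity>"
proof -
  have "emeasure lborel (ball (0::'a) 1) \<noteq> 0"
    using open_not_negligible[of "ball (0::'a) 1"]
    by (auto simp: negligible_iff_null_sets null_sets_def)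
  moreover have "emeasure lborel (ball (0::'a) 1) \<le> emeasure lborel (cball (0::'a) 1)"
    by (intro emeasure_mono) auto
  ultimately show "emeasure lborel (cball (0::'a) 1) \<noteq> 0" by auto
  show "emeasure lborel (cball (0::'a) 1) \<noteq> \<infinity>" using emeasure_bounded_finite[OF bounded_cball, of 0 1] by (metis infinity_ennreal_def less_irrefl)
qed

lemma prob_unif_ball: "prob_space (unif_ball :: 'a::euclidean_space measure)"
  unfolding unif_ball_def by (intro prob_space_uniform_measure lborel_cball_1)

lemma unif_ball_invariant:
  fixes S :: "real^'n^'n" and F :: "real^'n \<Rightarrow> ennreal"
  assumes S: "orthogonal_matrix S" and [measurable]: "F \<in> borel_measurable borel"
  shows "(\<integral>\<^sup>+y. F (S *v y) \<partial>unif_ball) = (\<integral>\<^sup>+y. F y \<partial>unif_ball)"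
proof -
  have [measurable]: "cball 0 1 \<in> sets (borel :: (real^'n) measure)" by simp
  have "(\<integral>\<^sup>+y. F y * indicator (cball 0 1) y \<partial>lborel)
     = (\<integral>\<^sup>+y. F y * indicator (cball 0 1) y \<partial>distr lborel borel ((*v) S))"
    by (simp add: lborel_distr_orthogonal orthogonal_matrix_transformation[OF S])
  also have "\<dots> = (\<integral>\<^sup>+y. F (S *v y) * indicator (cball 0 1) (S *v y) \<partial>lborel)"
    by (subst nn_integral_distr) auto
  also have "\<dots> = (\<integral>\<^sup>+y. F (S *v y) * indicator (cball 0 1) y \<partial>lborel)"
    by (simp add: indicator_def orthogonal_matrix_norm[OF S])
  finally show ?thesis unfolding unif_ball_def by (simp add: nn_integral_uniform_measure)
qed

lemma unif_ball_AE_proj: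
  assumes "subspace X" "X \<noteq> {0}"
  shows "AE y in unif_ball. proj X y \<noteq> (0::'a::euclidean_space)"
proof -
  have "0 < dim X" using assms dim_eq_0[of X] subspace_0 by auto
  then have "dim (X\<^sup>\<bottom>) < DIM('a)" using dim_orthogonal_comp[OF assms(1)] by simp
  then have "negligible (X\<^sup>\<bottom>)" by (rule negligible_lowdim)
  moreover have "closed (X\<^sup>\<bottom>)" by (rule closed_subspace[OF subspace_orthogonal_comp])
  ultimately have "X\<^sup>\<bottom> \<in> null_sets lborel"
    by (auto simp: negligible_iff_null_sets null_sets_def)
  then have "AE y in lborel. y \<notin> X\<^sup>\<bottom>" by (rule AE_not_in)
  then have *: "AE y in lborel. proj X y \<noteq> 0"
    by eventually_elim (metis assms(1) diff_zero proj_comp)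
  show ?thesis unfolding unif_ball_def
    by (rule AE_uniform_measureI) (use * in auto)
qed

text \<open>
  By induction on the dimension. Fix a unit vector \<open>e\<close> in \<open>X\<close>. A random rotation of \<open>X\<close> is obtained by choosing
  the image \<open>s y\<close> of \<open>e\<close> uniformly on the unit sphere of \<open>X\<close>, reflecting \<open>e\<close> to it, and composing with a random
  element of the stabilizer of \<open>e\<close>. Left multiplication by \<open>S\<close> moves \<open>s y\<close> to \<open>S (s y)\<close>, which has the same
  distribution, and changes the second factor by a left multiplication in the stabilizer.
\<close>

lemma is_haar_exists:
  fixes X :: "(real^'n) set"
  shows "subspace X \<Longrightarrow> \<exists>H. is_haar X H"
proof (induction "dim X" arbitrary: X)
  case 0
  then have X: "X = {0}" using dim_eq_0[of X] subspace_0 by auto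
  have rX: "rot X = {mat 1}"
    by (auto simp: X rot_def orthogonal_matrix_id matrix_eq)
  have "is_haar X (return (rot_borel X) (mat 1))"
    by (rule is_haarI) (auto simp: rX nn_integral_return intro!: prob_space_return)
  then show ?case ..
next
  case (Suc d)
  then have "X \<noteq> {0}" by auto
  then obtain x where "x \<in> X" "x \<noteq> 0" using Suc.prems subspace_0 by blast
  define e where "e = x /\<^sub>R norm x"
  have e: "e \<in> X" "norm e = 1"
    using \<open>x \<in> X\<close> \<open>x \<noteq> 0\<close> Suc.prems by (auto simp: e_def subspace_scale)
  define X' where "X' = perp_in X e"
  have X': "subspace X'" "dim X' = d" "X' \<subseteq> X"
    using Suc.prems Suc.hyps dim_perp_in[OF Suc.prems e] by (auto simp: X'_def subspace_perp_in) (auto simp: perp_in_def)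
  then obtain H' where H': "is_haar X' H'" using Suc.hyps(1)[of X'] by auto
  interpret H': prob_space H' using H' by (simp add: is_haar_def)
  interpret U: prob_space "unif_ball :: (real^'n) measure" by (rule prob_unif_ball)
  interpret pair_prob_space "unif_ball :: (real^'n) measure" H' ..
  have setsH'[measurable_cong]: "sets H' = sets (rot_borel X')" using H' by (simp add: is_haar_def)
  define s where "s y = sgn (proj X y)" for y
  define h where "h y = refl (s y - e)" for y
  have sX: "s y \<in> X" for y
    using Suc.prems by (simp add: s_def sgn_div_norm subspace_scale proj_in)
  have hX: "h y \<in> rot X" for y
    unfolding h_def by (intro refl_in_rot subspace_diff Suc.prems sX e)
  have ms[measurable]: "s \<in> borel_measurable borel"
    unfolding s_def sgn_div_norm using Suc.prems by measurable
  have [measurable]: "h \<in> borel \<rightarrow>\<^sub>M rot_borel X"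
    unfolding rot_borel_iff using hX by (auto simp: h_def[abs_def])
  have idm[measurable]: "(\<lambda>A. A) \<in> rot_borel X' \<rightarrow>\<^sub>M rot_borel X"
    by (rule rot_borel_mono[OF _ X'(3)]) simp
  have [measurable]: "(\<lambda>p. h (fst p) ** snd p) \<in> borel \<Otimes>\<^sub>M rot_borel X' \<rightarrow>\<^sub>M rot_borel X"
    by (rule rot_borel_mult) (use measurable_compose[OF measurable_snd idm] in auto)
  define H where "H = distr (unif_ball \<Otimes>\<^sub>M H') (rot_borel X) (\<lambda>p. h (fst p) ** snd p)"
  have H_eq: "(\<integral>\<^sup>+A. F A \<partial>H) = (\<integral>\<^sup>+y. \<integral>\<^sup>+A. F (h y ** A) \<partial>H' \<partial>unif_ball)"
    if [measurable]: "F \<in> borel_measurable (rot_borel X)" for F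
    unfolding H_def by (subst nn_integral_distr) (simp_all add: H'.nn_integral_fst[symmetric])
  have "is_haar X H"
  proof (rule is_haarI)
    show "prob_space H" unfolding H_def by (rule prob_space_distr) measurable
    show "sets H = sets (rot_borel X)" by (simp add: H_def)
    fix S :: "real^'n^'n" and F :: "_ \<Rightarrow> ennreal" assume S: "S \<in> rot X" and F[measurable]: "F \<in> borel_measurable (rot_borel X)"
    have [measurable]: "(\<lambda>A. S ** A) \<in> rot_borel X \<rightarrow>\<^sub>M rot_borel X"
      by (rule rot_borel_mult) (auto simp: S)
    have "(\<integral>\<^sup>+A. F (S ** A) \<partial>H) = (\<integral>\<^sup>+y. \<integral>\<^sup>+A. F (S ** (h y ** A)) \<partial>H' \<partial>unif_ball)"
      by (rule H_eq) measurable
    also have "\<dots> = (\<integral>\<^sup>+y. \<integral>\<^sup>+A. F (h (S *v y) ** A) \<partial>H' \<partial>unif_ball)"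
    proof (rule nn_integral_cong_AE)
      show "AE y in unif_ball. (\<integral>\<^sup>+A. F (S ** (h y ** A)) \<partial>H') = (\<integral>\<^sup>+A. F (h (S *v y) ** A) \<partial>H')"
        using unif_ball_AE_proj[OF Suc.prems \<open>X \<noteq> {0}\<close>]
      proof eventually_elim
        fix y assume y: "proj X y \<noteq> 0"
        have Ss: "s (S *v y) = S *v s y"
          using S Suc.prems by (simp add: s_def sgn_div_norm proj_rot orthogonal_matrix_norm[OF rot_orthogonal[OF S]]
              matrix_vector_mult_scaleR)
        have ns: "norm (s y) = norm e" "norm (s (S *v y)) = norm e"
          using y e by (auto simp: Ss orthogonal_matrix_norm[OF rot_orthogonal[OF S]]) (auto simp: s_def norm_sgn)
        \<comment> \<open>\<open>S\<close> times the reflection for \<open>s y\<close> is the reflection for \<open>S (s y)\<close> up to an element \<open>B\<close> of the stabilizer of \<open>e\<close>.\<close>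
        define B where "B = transpose (h (S *v y)) ** (S ** h y)"
        have hB: "h (S *v y) ** B = S ** h y"
          unfolding B_def using rot_orthogonal[OF hX[of "S *v y"]]
          by (metis matrix_mul_assoc matrix_mul_lid orthogonal_matrix_def)
        have hinv: "transpose (h (S *v y)) *v (s (S *v y)) = e"
          using orthogonal_matrix_cancel(1)[OF rot_orthogonal[OF hX[of "S *v y"]], of e]
          by (simp add: h_def refl_swap(1)[OF ns(2)])
        have "B *v e = e"
          using hinv unfolding B_def
          by (simp add: matrix_vector_mul_assoc[symmetric] Ss) (simp add: h_def refl_swap(1)[OF ns(1)])
        then have B: "B \<in> rot X'"
          unfolding X'_def rot_perp_in[OF Suc.prems e]
          using S hX by (auto simp: B_def intro!: rot_mult rot_transpose)
        have [measurable]: "(\<lambda>A. F (h (S *v y) ** A)) \<in> borel_measurable (rot_borel X')"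
        proof (rule measurable_compose[OF _ F])
          show "(**) (h (S *v y)) \<in> rot_borel X' \<rightarrow>\<^sub>M rot_borel X"
            by (rule rot_borel_mult[OF _ idm]) (auto simp: hX)
        qed
        have "(\<integral>\<^sup>+A. F (S ** (h y ** A)) \<partial>H') = (\<integral>\<^sup>+A. F (h (S *v y) ** (B ** A)) \<partial>H')"
          by (simp add: matrix_mul_assoc hB)
        also have "\<dots> = (\<integral>\<^sup>+A. F (h (S *v y) ** A) \<partial>H')"
          by (rule is_haar_nn_integral[OF H' B, where F="\<lambda>A. F (h (S *v y) ** A)"]) measurable
        finally show "(\<integral>\<^sup>+A. F (S ** (h y ** A)) \<partial>H') = (\<integral>\<^sup>+A. F (h (S *v y) ** A) \<partial>H')" .
      qed
    qed
    also have "\<dots> = (\<integral>\<^sup>+y. \<integral>\<^sup>+A. F (h y ** A) \<partial>H' \<partial>unif_ball)"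
      by (rule unif_ball_invariant[OF rot_orthogonal[OF S], where F="\<lambda>y. \<integral>\<^sup>+A. F (h y ** A) \<partial>H'"]) measurable
    also have "\<dots> = (\<integral>\<^sup>+A. F A \<partial>H)" by (rule H_eq[symmetric]) measurable
    finally show "(\<integral>\<^sup>+A. F (S ** A) \<partial>H) = (\<integral>\<^sup>+A. F A \<partial>H)" .
  qed
  then show ?case ..
qed

definition haar :: "(real^'n) set \<Rightarrow> (real^'n^'n) measure" where
  "haar X = (SOME H. is_haar X H)"

lemma is_haar_haar: "subspace X \<Longrightarrow> is_haar X (haar X)"
  unfolding haar_def by (rule someI_ex[OF is_haar_exists])

lemma sets_haar: "subspace X \<Longrightarrow> sets (haar X) = sets (rot_borel X)"
  using is_haar_haar by (auto simp: is_haar_def)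

lemma space_haar: "subspace X \<Longrightarrow> space (haar X) = rot X"
  using sets_eq_imp_space_eq[OF sets_haar] by simp

lemma prob_haar: "subspace X \<Longrightarrow> prob_space (haar X)"
  using is_haar_haar by (auto simp: is_haar_def)

lemma haar_left:
  "subspace X \<Longrightarrow> S \<in> rot X \<Longrightarrow> F \<in> borel_measurable (rot_borel X) \<Longrightarrow>
    (\<integral>\<^sup>+A. F (S ** A) \<partial>haar X) = (\<integral>\<^sup>+A. F A \<partial>haar X)"
  by (rule is_haar_nn_integral[OF is_haar_haar])

text \<open>
  A left invariant probability measure on a group is invariant under inversion: average \<open>F (A\<^sup>-\<^sup>1B)\<close> over
  independent \<open>A\<close> and \<open>B\<close>, integrating first over \<open>B\<close> or first over \<open>A\<close>.
\<close>

lemma haar_transpose: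
  assumes X: "subspace X" and F[measurable]: "F \<in> borel_measurable (rot_borel X)"
  shows "(\<integral>\<^sup>+A. F (transpose A) \<partial>haar X) = (\<integral>\<^sup>+A. F A \<partial>haar X)"
proof -
  interpret H: prob_space "haar X" by (rule prob_haar[OF X])
  interpret pair_prob_space "haar X" "haar X" ..
  note sets_haar[OF X, measurable_cong]
  have "(\<integral>\<^sup>+A. F A \<partial>haar X) = (\<integral>\<^sup>+A. \<integral>\<^sup>+B. F (transpose A ** B) \<partial>haar X \<partial>haar X)"
  proof -
    have "(\<integral>\<^sup>+B. F (transpose A ** B) \<partial>haar X) = (\<integral>\<^sup>+B. F B \<partial>haar X)" if "A \<in> space (haar X)" for A
      by (rule haar_left[OF X _ F]) (use that in \<open>simp add: space_haar X rot_transpose\<close>)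
    then have "(\<integral>\<^sup>+A. \<integral>\<^sup>+B. F (transpose A ** B) \<partial>haar X \<partial>haar X) = (\<integral>\<^sup>+A. \<integral>\<^sup>+B. F B \<partial>haar X \<partial>haar X)"
      by (rule nn_integral_cong)
    then show ?thesis by (simp add: H.emeasure_space_1)
  qed
  also have "\<dots> = (\<integral>\<^sup>+B. \<integral>\<^sup>+A. F (transpose (transpose B ** A)) \<partial>haar X \<partial>haar X)"
    by (subst Fubini') (simp_all add: matrix_transpose_mul)
  also have "\<dots> = (\<integral>\<^sup>+B. \<integral>\<^sup>+A. F (transpose A) \<partial>haar X \<partial>haar X)"
  proof (rule nn_integral_cong)
    fix B assume B: "B \<in> space (haar X)"
    show "(\<integral>\<^sup>+A. F (transpose (transpose B ** A)) \<partial>haar X) = (\<integral>\<^sup>+A. F (transpose A) \<partial>haar X)"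
      by (rule haar_left[OF X, where F="\<lambda>A. F (transpose A)"]) (use B in \<open>auto simp: space_haar X rot_transpose\<close>)
  qed
  also have "\<dots> = (\<integral>\<^sup>+A. F (transpose A) \<partial>haar X)" by (simp add: H.emeasure_space_1)
  finally show ?thesis by simp
qed

text \<open>
  Inversion exchanges left and right multiplication.
\<close>

lemma haar_right:
  assumes X: "subspace X" and S: "S \<in> rot X" and F[measurable]: "F \<in> borel_measurable (rot_borel X)"
  shows "(\<integral>\<^sup>+A. F (A ** S) \<partial>haar X) = (\<integral>\<^sup>+A. F A \<partial>haar X)"
proof -
  have [measurable]: "(\<lambda>A. A ** S) \<in> rot_borel X \<rightarrow>\<^sub>M rot_borel X"
    by (rule rot_borel_mult) (auto simp: S)
  have "(\<integral>\<^sup>+A. F (A ** S) \<partial>haar X) = (\<integral>\<^sup>+A. F (transpose A ** S) \<partial>haar X)"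
    by (rule haar_transpose[OF X, symmetric]) measurable
  also have "\<dots> = (\<integral>\<^sup>+A. F (transpose (transpose S ** A)) \<partial>haar X)"
    by (simp add: matrix_transpose_mul)
  also have "\<dots> = (\<integral>\<^sup>+A. F (transpose A) \<partial>haar X)"
    by (rule haar_left[OF X rot_transpose[OF S], where F="\<lambda>A. F (transpose A)"]) measurable
  also have "\<dots> = (\<integral>\<^sup>+A. F A \<partial>haar X)" by (rule haar_transpose[OF X F])
  finally show ?thesis .
qed

section \<open>Measurability on Grassmannians\<close>

lemma space_plane_algebra [simp]: "space (plane_algebra S) = S"
  by (simp add: plane_algebra_def space_measure_of_conv)

text \<open>
  The sigma-algebra is generated by the distance functions, so that measurability of a plane-valued
  map is measurability of real functions.
\<close>

lemma measurable_plane_algebraI: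
  assumes "\<And>z. z \<in> space M \<Longrightarrow> f z \<in> S" and [measurable]: "\<And>x. (\<lambda>z. infdist x (f z)) \<in> borel_measurable M"
  shows "f \<in> M \<rightarrow>\<^sub>M plane_algebra S"
  unfolding plane_algebra_def
proof (rule measurable_measure_of)
  fix y assume "y \<in> {{\<zeta> \<in> S. infdist x \<zeta> < r} | x r. True}"
  then obtain x r where y: "y = {\<zeta> \<in> S. infdist x \<zeta> < r}" by auto
  have "f -` y \<inter> space M = {z \<in> space M. infdist x (f z) < r}"
    using assms(1) by (auto simp: y)
  then show "f -` y \<inter> space M \<in> sets M" by simp
qed (use assms in auto)

lemma borel_measurable_infdist_plane:
  "(\<lambda>\<zeta>. infdist x \<zeta>) \<in> borel_measurable (plane_algebra S)"
proof (subst borel_measurable_iff_less, intro allI)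
  fix r
  have "{\<zeta> \<in> S. infdist x \<zeta> < r} \<in> sets (plane_algebra S)"
    unfolding plane_algebra_def by (subst sets_measure_of) auto
  then show "{\<zeta> \<in> space (plane_algebra S). infdist x \<zeta> < r} \<in> sets (plane_algebra S)" by simp
qed

lemma grassmannianD:
  "\<xi> \<in> grassmannian X m \<Longrightarrow> subspace \<xi>" "\<xi> \<in> grassmannian X m \<Longrightarrow> \<xi> \<subseteq> X" "\<xi> \<in> grassmannian X m \<Longrightarrow> dim \<xi> = m"
  by (auto simp: grassmannian_def)

text \<open>
  The squared distance determines the quadratic form \<open>|proj \<xi> x|\<^sup>2\<close>, and hence, by polarization, the
  projection. Consequently projections onto a plane depend measurably on the plane.
\<close>

lemma inner_proj_polarization:
  assumes "subspace \<xi>"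
  shows "proj \<xi> x \<bullet> y = (((norm (x + y))\<^sup>2 - (infdist (x + y) \<xi>)\<^sup>2) - ((norm x)\<^sup>2 - (infdist x \<xi>)\<^sup>2) - ((norm y)\<^sup>2 - (infdist y \<xi>)\<^sup>2)) / 2"
proof -
  have *: "(norm x)\<^sup>2 - (infdist x \<xi>)\<^sup>2 = (norm (proj \<xi> x))\<^sup>2" for x
    using norm_proj_Pythagoras[OF assms, of x] by (simp add: infdist_subspace0 assms)
  have "proj \<xi> x \<bullet> y = proj \<xi> x \<bullet> proj \<xi> y"
    using inner_proj_right[OF assms proj_in[OF assms]] by simp
  also have "2 * \<dots> = (norm (proj \<xi> (x + y)))\<^sup>2 - (norm (proj \<xi> x))\<^sup>2 - (norm (proj \<xi> y))\<^sup>2"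
    by (simp add: proj_add assms power2_norm_eq_inner inner_simps inner_commute)
  finally show ?thesis unfolding * by simp
qed

lemma borel_measurable_proj_plane [measurable (raw)]:
  fixes g :: "'b \<Rightarrow> 'a::euclidean_space"
  assumes f: "f \<in> M \<rightarrow>\<^sub>M plane_algebra (grassmannian X m)" and [measurable]: "g \<in> borel_measurable M"
  shows "(\<lambda>z. proj (f z) (g z)) \<in> borel_measurable M"
proof -
  have [measurable]: "(\<lambda>z. infdist x (f z)) \<in> borel_measurable M" for x
    by (rule measurable_compose[OF f borel_measurable_infdist_plane])
  have sub: "subspace (f z)" if "z \<in> space M" for z
    using measurable_space[OF f that] by (auto simp: grassmannian_def)
  have *: "(\<lambda>z. proj (f z) b) \<in> borel_measurable M" for b
  proof (subst borel_measurable_euclidean_space, intro ballI)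
    fix c :: 'a
    have "(\<lambda>z. (((norm (b + c))\<^sup>2 - (infdist (b + c) (f z))\<^sup>2) - ((norm b)\<^sup>2 - (infdist b (f z))\<^sup>2)
       - ((norm c)\<^sup>2 - (infdist c (f z))\<^sup>2)) / 2) \<in> borel_measurable M" by measurable
    then show "(\<lambda>z. proj (f z) b \<bullet> c) \<in> borel_measurable M"
      by (subst measurable_cong[OF inner_proj_polarization[OF sub]])
  qed
  have "(\<lambda>z. \<Sum>b\<in>Basis. (g z \<bullet> b) *\<^sub>R proj (f z) b) \<in> borel_measurable M"
    using * by measurable
  moreover have "proj (f z) (g z) = (\<Sum>b\<in>Basis. (g z \<bullet> b) *\<^sub>R proj (f z) b)" if "z \<in> space M" for z
  proof -
    have "proj (f z) (g z) = proj (f z) (\<Sum>b\<in>Basis. (g z \<bullet> b) *\<^sub>R b)" by (simp add: euclidean_representation)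
    then show ?thesis
      using linear_proj[OF sub[OF that]] by (simp add: linear_sum linear_scale)
  qed
  ultimately show ?thesis by (subst measurable_cong)
qed

lemma matrix_image_translation:
  fixes A :: "real^'n^'n" shows "(*v) A ` ((+) v ` X) = (+) (A *v v) ` ((*v) A ` X)"
  by (auto simp: image_image matrix_vector_right_distrib)

lemma matrix_image_sum:
  fixes A :: "real^'n^'n" shows "(*v) A ` (X + Y) = (*v) A ` X + (*v) A ` Y"
proof -
  have "(*v) A ` (X + Y) = {A *v x + A *v y |x y. x \<in> X \<and> y \<in> Y}"
    by (force simp: set_plus_def matrix_vector_right_distrib image_iff)
  then show ?thesis by (force simp: set_plus_eq)
qed

lemma infdist_matrix_image:
  fixes A :: "real^'n^'n"
  assumes "orthogonal_matrix A" "subspace P"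
  shows "infdist x ((+) v ` ((*v) A ` P)) = norm (x - v - A *v proj P (transpose A *v (x - v)))"
  using proj_orthogonal_matrix_image[OF assms, of "transpose A *v (x - v)"]
  by (simp add: infdist_subspace subspace_matrix_image assms orthogonal_matrix_cancel)

lemma measurable_moved_plane:
  fixes A :: "'b \<Rightarrow> real^'n^'n"
  assumes P[measurable]: "P \<in> M \<rightarrow>\<^sub>M plane_algebra (grassmannian X m)"
    and [measurable]: "A \<in> borel_measurable M" "v \<in> borel_measurable M"
    and "\<And>z. z \<in> space M \<Longrightarrow> orthogonal_matrix (A z)"
    and "\<And>z. z \<in> space M \<Longrightarrow> (+) (v z) ` ((*v) (A z) ` P z) \<in> S"
  shows "(\<lambda>z. (+) (v z) ` ((*v) (A z) ` P z)) \<in> M \<rightarrow>\<^sub>M plane_algebra S"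
proof (rule measurable_plane_algebraI)
  fix x
  have "(\<lambda>z. norm (x - v z - A z *v proj (P z) (transpose (A z) *v (x - v z)))) \<in> borel_measurable M"
    by measurable
  moreover have "infdist x ((+) (v z) ` ((*v) (A z) ` P z))
      = norm (x - v z - A z *v proj (P z) (transpose (A z) *v (x - v z)))" if "z \<in> space M" for z
    using measurable_space[OF P that] assms(4)[OF that]
    by (intro infdist_matrix_image) (auto simp: grassmannian_def)
  ultimately show "(\<lambda>z. infdist x ((+) (v z) ` ((*v) (A z) ` P z))) \<in> borel_measurable M"
    by (subst measurable_cong)
qed (use assms in auto)

lemma measurable_rotated_plane:
  fixes A :: "'b \<Rightarrow> real^'n^'n"
  assumes "P \<in> M \<rightarrow>\<^sub>M plane_algebra (grassmannian X m)" "A \<in> borel_measurable M"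
    and "\<And>z. z \<in> space M \<Longrightarrow> orthogonal_matrix (A z)"
    and "\<And>z. z \<in> space M \<Longrightarrow> (*v) (A z) ` P z \<in> S"
  shows "(\<lambda>z. (*v) (A z) ` P z) \<in> M \<rightarrow>\<^sub>M plane_algebra S"
  using measurable_moved_plane[of P M X m A "\<lambda>_. 0" S] assms by simp

subsection \<open>A Borel section of the orbit map\<close>

text \<open>
  Projecting the standard basis to \<open>\<xi>\<close> and normalizing the first nonzero result is a measurable
  choice of a unit vector.
\<close>

lemma borel_unit_vector:
  fixes X :: "'a::euclidean_space set"
  shows "\<exists>s \<in> borel_measurable (plane_algebra (grassmannian X (Suc m))).
    \<forall>\<xi>\<in>grassmannian X (Suc m). s \<xi> \<in> \<xi> \<and> norm (s \<xi>) = 1"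
proof -
  let ?G = "plane_algebra (grassmannian X (Suc m))"
  have "\<exists>g \<in> borel_measurable ?G. \<forall>\<xi>\<in>grassmannian X (Suc m). g \<xi> \<in> \<xi> \<and> (g \<xi> = 0 \<longrightarrow> (\<forall>b\<in>set bs. proj \<xi> b = 0))"
    for bs :: "'a list"
  proof (induction bs)
    case Nil
    then show ?case by (intro bexI[of _ "\<lambda>_. 0"]) (auto simp: grassmannian_def subspace_0)
  next
    case (Cons b bs)
    then obtain g where [measurable]: "g \<in> borel_measurable ?G"
      and g: "\<forall>\<xi>\<in>grassmannian X (Suc m). g \<xi> \<in> \<xi> \<and> (g \<xi> = 0 \<longrightarrow> (\<forall>b\<in>set bs. proj \<xi> b = 0))" by auto
    show ?case
    proof (intro bexI[of _ "\<lambda>\<xi>. if proj \<xi> b = 0 then g \<xi> else proj \<xi> b"])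
      have [measurable]: "(\<lambda>\<xi>. proj \<xi> b) \<in> borel_measurable ?G"
        by (rule borel_measurable_proj_plane[where f="\<lambda>x. x" and X=X and m="Suc m"]) auto
      show "(\<lambda>\<xi>. if proj \<xi> b = 0 then g \<xi> else proj \<xi> b) \<in> borel_measurable ?G" by measurable
    qed (use g in \<open>auto intro: proj_in grassmannianD(1)\<close>)
  qed
  moreover obtain bs :: "'a list" where "set bs = Basis" using finite_list[OF finite_Basis] by auto
  ultimately obtain g where [measurable]: "g \<in> borel_measurable ?G"
    and g: "\<forall>\<xi>\<in>grassmannian X (Suc m). g \<xi> \<in> \<xi> \<and> (g \<xi> = 0 \<longrightarrow> (\<forall>b\<in>Basis. proj \<xi> b = 0))" by metis
  show ?thesis
  proof (intro bexI[of _ "\<lambda>\<xi>. sgn (g \<xi>)"] ballI)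
    show "(\<lambda>\<xi>. sgn (g \<xi>)) \<in> borel_measurable ?G" unfolding sgn_div_norm by measurable
    fix \<xi> assume \<xi>: "\<xi> \<in> grassmannian X (Suc m)"
    have "g \<xi> \<noteq> 0"
    proof
      assume "g \<xi> = 0"
      then have *: "proj \<xi> b = 0" if "b \<in> Basis" for b using g \<xi> that by auto
      have sub: "subspace \<xi>" using \<xi> by (rule grassmannianD)
      have "x = 0" if "x \<in> \<xi>" for x
      proof -
        have "x \<bullet> b = 0" if "b \<in> Basis" for b
          using inner_proj_right[OF sub \<open>x \<in> \<xi>\<close>, of b] *[OF that] by simp
        then show ?thesis using euclidean_all_zero_iff by blast
      qed
      then have "\<xi> \<subseteq> {0}" by auto
      then have "dim \<xi> = 0" using dim_eq_0[of \<xi>] by blast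
      then show False using \<xi> by (simp add: grassmannian_def del: dim_eq_0)
    qed
    then show "sgn (g \<xi>) \<in> \<xi> \<and> norm (sgn (g \<xi>)) = 1"
      using g \<xi> by (auto simp: norm_sgn sgn_div_norm intro!: subspace_scale grassmannianD)
  qed
qed

text \<open>
  By induction on \<open>m\<close>. Reflect the chosen unit vector of \<open>\<xi>\<close> to the one of \<open>P\<close>, called \<open>e\<close>. The reflected plane
  and \<open>P\<close> then share \<open>e\<close>, and the induction hypothesis, applied to their parts orthogonal to \<open>e\<close>, gives a rotation
  that fixes \<open>e\<close> and maps one to the other. All choices are measurable in \<open>\<xi>\<close>.
\<close>

lemma borel_section:
  fixes X P :: "(real^'n) set"
  assumes "subspace X" "P \<in> grassmannian X m"
  shows "\<exists>s \<in> plane_algebra (grassmannian X m) \<rightarrow>\<^sub>M rot_borel X.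
    \<forall>\<xi>\<in>grassmannian X m. (*v) (s \<xi>) ` P = \<xi>"
  using assms
proof (induction m arbitrary: X P)
  case 0
  have *: "\<xi> = {0}" if "\<xi> \<in> grassmannian X 0" for \<xi>
  proof -
    have "\<xi> \<subseteq> {0}" "0 \<in> \<xi>"
      using that subspace_0[of \<xi>] dim_eq_0[of \<xi>] by (simp_all add: grassmannian_def)
    then show ?thesis by blast
  qed
  have "P = {0}" by (rule *[OF 0(2)])
  have "\<forall>\<xi>\<in>grassmannian X 0. (*v) (mat 1) ` P = \<xi>"
  proof
    fix \<xi> assume "\<xi> \<in> grassmannian X 0"
    then have "\<xi> = {0}" by (rule *)
    then show "(*v) (mat 1) ` P = \<xi>" using \<open>P = {0}\<close> by simp
  qed
  then show ?case by (intro bexI[of _ "\<lambda>_. mat 1"]) (simp_all add: rot_id)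
next
  case (Suc m)
  let ?G = "plane_algebra (grassmannian X (Suc m))"
  from borel_unit_vector[of X m] obtain s where sm[measurable]: "s \<in> borel_measurable ?G"
    and s0: "\<forall>\<xi>\<in>grassmannian X (Suc m). s \<xi> \<in> \<xi> \<and> norm (s \<xi>) = 1" by (rule bexE)
  have s: "s \<xi> \<in> \<xi>" "norm (s \<xi>) = 1" if "\<xi> \<in> grassmannian X (Suc m)" for \<xi>
    using s0 that by auto
  define e where "e = s P"
  have e: "e \<in> P" "norm e = 1" unfolding e_def using s[OF Suc.prems(2)] by auto
  have P: "subspace P" "P \<subseteq> X" "dim P = Suc m" using Suc.prems by (auto simp: grassmannian_def)
  have eX: "e \<in> X" using e P by auto
  define X' where "X' = perp_in X e"
  have X': "subspace X'" "X' \<subseteq> X" using Suc.prems by (auto simp: X'_def subspace_perp_in) (auto simp: perp_in_def)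
  have perp_gr: "perp_in \<xi> e \<in> grassmannian X' m" if "subspace \<xi>" "\<xi> \<subseteq> X" "dim \<xi> = Suc m" "e \<in> \<xi>" for \<xi>
    using that dim_perp_in[OF that(1,4) e(2)] by (auto simp: grassmannian_def X'_def subspace_perp_in) (auto simp: perp_in_def)
  then have P': "perp_in P e \<in> grassmannian X' m" using P e by auto
  from Suc.IH[OF X'(1) P'] obtain s' where s'm: "s' \<in> plane_algebra (grassmannian X' m) \<rightarrow>\<^sub>M rot_borel X'"
    and s'0: "\<forall>\<xi>\<in>grassmannian X' m. (*v) (s' \<xi>) ` perp_in P e = \<xi>" by (rule bexE)
  have s': "(*v) (s' \<xi>) ` perp_in P e = \<xi>" if "\<xi> \<in> grassmannian X' m" for \<xi>
    using s'0 that by blast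
  define h where "h \<xi> = refl (s \<xi> - e)" for \<xi>
  have [measurable]: "h \<in> borel_measurable ?G" unfolding h_def by measurable
  have hX: "h \<xi> \<in> rot X" if "\<xi> \<in> grassmannian X (Suc m)" for \<xi>
    unfolding h_def using s(1)[OF that] that Suc.prems eX
    by (intro refl_in_rot subspace_diff) (auto simp: grassmannian_def)
  \<comment> \<open>The reflected plane without the direction \<open>e\<close> is the argument for the induction hypothesis.\<close>
  define \<eta> where "\<eta> \<xi> = perp_in ((*v) (h \<xi>) ` \<xi>) e" for \<xi>
  have h\<xi>: "(*v) (h \<xi>) ` \<xi> \<in> grassmannian X (Suc m)" "e \<in> (*v) (h \<xi>) ` \<xi>" if "\<xi> \<in> grassmannian X (Suc m)" for \<xi>
  proof -
    show "(*v) (h \<xi>) ` \<xi> \<in> grassmannian X (Suc m)"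
      by (rule grassmannian_rot_image[OF that Suc.prems(1) hX[OF that]])
    have "h \<xi> *v s \<xi> = e" unfolding h_def by (rule refl_swap) (simp add: s(2)[OF that] e)
    then show "e \<in> (*v) (h \<xi>) ` \<xi>" using s(1)[OF that] by (metis imageI)
  qed
  have [measurable]: "(\<lambda>\<xi>. (*v) (h \<xi>) ` \<xi>) \<in> ?G \<rightarrow>\<^sub>M ?G"
    using hX h\<xi> by (intro measurable_rotated_plane[where X=X and m="Suc m"]) (auto simp: rot_def)
  have \<eta>m[measurable]: "\<eta> \<in> ?G \<rightarrow>\<^sub>M plane_algebra (grassmannian X' m)"
  proof (rule measurable_plane_algebraI)
    show "\<eta> \<xi> \<in> grassmannian X' m" if "\<xi> \<in> space ?G" for \<xi>
      unfolding \<eta>_def by (rule perp_gr) (use h\<xi>[of \<xi>] that in \<open>auto simp: grassmannian_def\<close>)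
    fix x
    have "(\<lambda>\<xi>. norm (x - (proj ((*v) (h \<xi>) ` \<xi>) x - (e \<bullet> x) *\<^sub>R e))) \<in> borel_measurable ?G"
      by measurable
    moreover have "infdist x (\<eta> \<xi>) = norm (x - (proj ((*v) (h \<xi>) ` \<xi>) x - (e \<bullet> x) *\<^sub>R e))" if "\<xi> \<in> space ?G" for \<xi>
    proof -
      let ?Y = "(*v) (h \<xi>) ` \<xi>"
      have Y: "subspace ?Y" "e \<in> ?Y" using h\<xi>[of \<xi>] that by (auto simp: grassmannian_def)
      have "proj ?Y x = proj (span {e}) x + proj (\<eta> \<xi>) x"
        unfolding \<eta>_def using perp_in_sum[OF Y e(2)]
        using proj_sum[OF subspace_span subspace_perp_in[OF Y(1)], of "{e}" e x] by simp
      moreover have "proj (span {e}) x = (e \<bullet> x) *\<^sub>R e"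
        using e(2) by (intro proj_eqI[OF subspace_span]) (auto simp: span_singleton inner_simps norm_eq_1 intro!: orthogonal_compI)
      ultimately show ?thesis
        by (simp add: infdist_subspace0 \<eta>_def subspace_perp_in Y)
    qed
    ultimately show "(\<lambda>\<xi>. infdist x (\<eta> \<xi>)) \<in> borel_measurable ?G" by (subst measurable_cong)
  qed
  have s\<eta>: "(\<lambda>\<xi>. s' (\<eta> \<xi>)) \<in> ?G \<rightarrow>\<^sub>M rot_borel X'"
    by (rule measurable_compose[OF \<eta>m s'm])
  show ?case
  proof (intro bexI[of _ "\<lambda>\<xi>. transpose (h \<xi>) ** s' (\<eta> \<xi>)"] ballI)
    show "(\<lambda>\<xi>. transpose (h \<xi>) ** s' (\<eta> \<xi>)) \<in> ?G \<rightarrow>\<^sub>M rot_borel X"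
      using hX by (intro rot_borel_mult rot_borel_transpose rot_borel_mono[OF s\<eta> X'(2)]) (auto simp: rot_borel_iff)
    fix \<xi> assume \<xi>: "\<xi> \<in> grassmannian X (Suc m)"
    let ?Y = "(*v) (h \<xi>) ` \<xi>"
    have Y: "subspace ?Y" "e \<in> ?Y" "?Y \<subseteq> X" "dim ?Y = Suc m"
      using h\<xi>[OF \<xi>] by (auto simp: grassmannian_def)
    have \<eta>: "\<eta> \<xi> \<in> grassmannian X' m" unfolding \<eta>_def by (rule perp_gr) (use Y in auto)
    have S: "s' (\<eta> \<xi>) \<in> rot X'" using rot_borel_space[OF s\<eta>, of \<xi>] \<xi> by simp
    have "(*v) (s' (\<eta> \<xi>)) ` P = (*v) (s' (\<eta> \<xi>)) ` span {e} + \<eta> \<xi>"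
      using perp_in_sum(1)[OF P(1) e] s'[OF \<eta>] by (metis matrix_image_sum)
    also have "(*v) (s' (\<eta> \<xi>)) ` span {e} = span {e}"
      using rot_image_comp[OF S] perp_in_sum(2)[OF Suc.prems(1) eX e(2)] by (simp add: X'_def)
    also have "span {e} + \<eta> \<xi> = ?Y"
      unfolding \<eta>_def by (rule perp_in_sum(1)[OF Y(1,2) e(2)])
    finally have 1: "(*v) (s' (\<eta> \<xi>)) ` P = ?Y" .
    have "(*v) (transpose (h \<xi>)) ` ?Y = \<xi>"
      by (simp add: image_image orthogonal_matrix_cancel[OF rot_orthogonal[OF hX[OF \<xi>]]])
    then show "(*v) (transpose (h \<xi>) ** s' (\<eta> \<xi>)) ` P = \<xi>"
      using 1 by (simp add: image_image flip: matrix_vector_mul_assoc) (metis image_image)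
  qed
qed

corollary rot_transitive:
  assumes "subspace X" "P \<in> grassmannian X m" "Q \<in> grassmannian X m"
  obtains A where "A \<in> rot X" "(*v) A ` P = Q"
  using borel_section[OF assms(1,2)] assms(3) by (metis rot_borel_space space_plane_algebra)

section \<open>The invariant measure on a Grassmannian\<close>

text \<open>
  Uniqueness of the invariant measure. By invariance, \<open>M D\<close> is the average over \<open>A\<close> of the \<open>M\<close>-measure of the planes
  that \<open>A\<^sup>-\<^sup>1\<close> moves into \<open>D\<close>. After exchanging the integrals, the inner average over \<open>A\<close> is the same for
  all planes, because the orthogonal group acts transitively and Haar measure is left invariant.
\<close>

lemma emeasure_invariant_grassmannian:
  fixes X :: "(real^'n) set"
  assumes X: "subspace X" and P: "P \<in> grassmannian X m" and M: "invariant_grassmannian_measure X m M"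
    and D[measurable]: "D \<in> sets (plane_algebra (grassmannian X m))"
  shows "emeasure M D = (\<integral>\<^sup>+A. indicator D ((*v) (transpose A) ` P) \<partial>haar X)"
proof -
  let ?G = "plane_algebra (grassmannian X m)"
  interpret M: prob_space M using M by (simp add: invariant_grassmannian_measure_def)
  interpret H: prob_space "haar X" by (rule prob_haar[OF X])
  interpret pair_prob_space M "haar X" ..
  note sets_haar[OF X, measurable_cong]
  have [measurable_cong]: "sets M = sets ?G" using M by (simp add: invariant_grassmannian_measure_def)
  then have spM: "space M = grassmannian X m" by (metis sets_eq_imp_space_eq space_plane_algebra)
  have [measurable]: "(\<lambda>z. (*v) (transpose (snd z)) ` fst z) \<in> ?G \<Otimes>\<^sub>M rot_borel X \<rightarrow>\<^sub>M ?G"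
    by (rule measurable_rotated_plane[where X=X and m=m])
      (auto simp: space_pair_measure rot_orthogonal intro!: grassmannian_rot_image X rot_transpose)
  have m2: "(\<lambda>\<xi>. (*v) (transpose A) ` \<xi>) \<in> ?G \<rightarrow>\<^sub>M ?G" if "A \<in> rot X" for A
    by (rule measurable_rotated_plane[where X=X and m=m])
      (use that in \<open>auto simp: rot_orthogonal intro!: grassmannian_rot_image X rot_transpose\<close>)
  have m3[measurable]: "(\<lambda>A. (*v) (transpose A) ` P) \<in> rot_borel X \<rightarrow>\<^sub>M ?G"
    by (rule measurable_rotated_plane[where X=X and m=m])
      (use P in \<open>auto simp: rot_orthogonal intro!: grassmannian_rot_image X rot_transpose\<close>)
  have 1: "emeasure M D = (\<integral>\<^sup>+\<xi>. indicator D ((*v) (transpose A) ` \<xi>) \<partial>M)" if A: "A \<in> rot X" for A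
  proof -
    note m2[OF A, measurable]
    have "orthogonal_transformation ((*v) (transpose A))" "(*v) (transpose A) ` X = X"
      using rot_image[OF X rot_transpose[OF A]] rot_orthogonal[OF rot_transpose[OF A]]
      by (auto intro: orthogonal_matrix_transformation)
    then have "distr M M (\<lambda>\<xi>. (*v) (transpose A) ` \<xi>) = M"
      using M by (auto simp: invariant_grassmannian_measure_def)
    then have "emeasure M D = (\<integral>\<^sup>+\<xi>. indicator D \<xi> \<partial>distr M M (\<lambda>\<xi>. (*v) (transpose A) ` \<xi>))"
      by simp
    also have "\<dots> = (\<integral>\<^sup>+\<xi>. indicator D ((*v) (transpose A) ` \<xi>) \<partial>M)"
      by (subst nn_integral_distr) auto
    finally show ?thesis .
  qed
  have "emeasure M D = (\<integral>\<^sup>+A. emeasure M D \<partial>haar X)" by (simp add: H.emeasure_space_1)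
  also have "\<dots> = (\<integral>\<^sup>+A. \<integral>\<^sup>+\<xi>. indicator D ((*v) (transpose A) ` \<xi>) \<partial>M \<partial>haar X)"
    by (rule nn_integral_cong) (simp add: 1 space_haar X)
  also have "\<dots> = (\<integral>\<^sup>+\<xi>. \<integral>\<^sup>+A. indicator D ((*v) (transpose A) ` \<xi>) \<partial>haar X \<partial>M)"
    by (rule Fubini') measurable
  also have "\<dots> = (\<integral>\<^sup>+\<xi>. \<integral>\<^sup>+A. indicator D ((*v) (transpose A) ` P) \<partial>haar X \<partial>M)"
  proof (rule nn_integral_cong)
    fix \<xi> assume "\<xi> \<in> space M"
    then obtain S where S: "S \<in> rot X" "(*v) S ` P = \<xi>"
      using rot_transitive[OF X P] by (metis spM)
    have "(\<integral>\<^sup>+A. indicator D ((*v) (transpose A) ` \<xi>) \<partial>haar X)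
        = (\<integral>\<^sup>+A. indicator D ((*v) (transpose (transpose S ** A)) ` P) \<partial>haar X)"
      by (simp add: matrix_transpose_mul image_image flip: S(2) matrix_vector_mul_assoc)
    also have "\<dots> = (\<integral>\<^sup>+A. indicator D ((*v) (transpose A) ` P) \<partial>haar X)"
      by (rule haar_left[OF X rot_transpose[OF S(1)], where F="\<lambda>A. indicator D ((*v) (transpose A) ` P)"]) measurable
    finally show "(\<integral>\<^sup>+A. indicator D ((*v) (transpose A) ` \<xi>) \<partial>haar X)
       = (\<integral>\<^sup>+A. indicator D ((*v) (transpose A) ` P) \<partial>haar X)" .
  qed
  also have "\<dots> = (\<integral>\<^sup>+A. indicator D ((*v) (transpose A) ` P) \<partial>haar X)"
    by (simp add: M.emeasure_space_1)
  finally show ?thesis .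
qed

text \<open>
  The image of a fixed plane under a random rotation. The outer matrix \<open>T\<close> transports the construction from
  \<open>X\<close> to the subspace \<open>TX\<close>, so that the Haar measure of the fixed group \<open>rot X\<close> serves all
  subspaces of the same dimension.
\<close>
definition random_plane :: "(real^'n) set \<Rightarrow> (real^'n) set \<Rightarrow> (real^'n^'n) \<Rightarrow> (real^'n) set measure" where
  "random_plane X P T = distr (haar X) (plane_algebra (grassmannian ((*v) T ` X) (dim P))) (\<lambda>A. (*v) T ` ((*v) A ` P))"

lemma measurable_random_plane:
  assumes X: "subspace X" and P: "P \<in> grassmannian X m" and T: "orthogonal_matrix T"
  shows "(\<lambda>A. (*v) T ` ((*v) A ` P)) \<in> rot_borel X \<rightarrow>\<^sub>M plane_algebra (grassmannian ((*v) T ` X) m)"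
proof -
  have "(*v) T ` ((*v) A ` P) \<in> grassmannian ((*v) T ` X) m" if "A \<in> rot X" for A
    using grassmannian_rot_image[OF P X that] 
    by (auto simp: grassmannian_def subspace_matrix_image dim_orthogonal_matrix_image[OF T])
  moreover have "(\<lambda>A. (*v) A ` P) \<in> rot_borel X \<rightarrow>\<^sub>M plane_algebra (grassmannian X m)"
    by (rule measurable_rotated_plane[where X=X and m=m])
      (use P in \<open>auto simp: rot_orthogonal intro!: grassmannian_rot_image X\<close>)
  ultimately show ?thesis
    by (intro measurable_rotated_plane[where A="\<lambda>_. T" and X=X and m=m]) (simp_all add: T)
qed

text \<open>
  An orthogonal map of \<open>TX\<close> is conjugated by \<open>T\<close> to an orthogonal map \<open>B\<close> of \<open>X\<close>. Outside \<open>X\<close> the map \<open>B\<close> need not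
  be the identity, so it is replaced by the element \<open>B'\<close> of \<open>rot X\<close> with the same action on \<open>X\<close>, which Haar
  measure absorbs.
\<close>

lemma random_plane_invariant:
  assumes X: "subspace X" and P: "P \<in> grassmannian X m" and T: "orthogonal_matrix T"
  shows "invariant_grassmannian_measure ((*v) T ` X) m (random_plane X P T)"
  unfolding invariant_grassmannian_measure_def
proof (intro conjI allI impI)
  let ?G = "plane_algebra (grassmannian ((*v) T ` X) m)"
  have dP: "dim P = m" using P by (simp add: grassmannian_def)
  note sets_haar[OF X, measurable_cong]
  note measurable_random_plane[OF assms, measurable]
  interpret H: prob_space "haar X" by (rule prob_haar[OF X])
  show "prob_space (random_plane X P T)"
    unfolding random_plane_def dP by (rule H.prob_space_distr) measurable
  show sets: "sets (random_plane X P T) = sets ?G" by (simp add: random_plane_def dP)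
  note sets[measurable_cong]
  fix R assume "orthogonal_transformation R \<and> R ` ((*v) T ` X) = (*v) T ` X"
  then have R: "orthogonal_transformation R" "R ` ((*v) T ` X) = (*v) T ` X" by auto
  define S where "S = matrix R"
  have S: "orthogonal_matrix S" "R = (*v) S"
    using R(1) by (auto simp: orthogonal_transformation_matrix S_def matrix_vector_mul)
  have SX: "(*v) S ` ((*v) T ` X) = (*v) T ` X" using R S by simp
  define B where "B = transpose T ** (S ** T)"
  have oB: "orthogonal_matrix B" by (simp add: B_def orthogonal_matrix_mul T S)
  have TB: "T *v (B *v x) = S *v (T *v x)" for x
    by (simp add: B_def orthogonal_matrix_cancel[OF T] flip: matrix_vector_mul_assoc)
  have BX: "(*v) B ` X = X"
  proof -
    have "(*v) T ` ((*v) B ` X) = (*v) T ` X"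
      using SX by (simp add: image_image TB)
    moreover have "inj ((*v) T)"
      by (rule inj_on_inverseI[where g="(*v) (transpose T)"]) (simp add: orthogonal_matrix_cancel[OF T])
    ultimately show ?thesis by (simp add: inj_image_eq_iff)
  qed
  define B' where "B' = matrix (\<lambda>x. B *v proj X x + (x - proj X x))"
  have B'app: "B' *v x = B *v proj X x + (x - proj X x)" for x
  proof -
    have "linear (\<lambda>x. B *v proj X x + (x - proj X x))"
      by (intro linearI) (simp_all add: proj_add proj_scaleR X matrix_vector_right_distrib
          matrix_vector_mult_scaleR algebra_simps)
    then show ?thesis unfolding B'_def by (simp add: matrix_vector_mul)
  qed
  have oB': "orthogonal_matrix B'"
  proof -
    have "norm (B' *v x) = norm x" for x
    proof -
      have 1: "B *v proj X x \<in> X" using BX proj_in[OF X, of x] by blast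
      have "(norm (B' *v x))\<^sup>2 = (norm (B *v proj X x))\<^sup>2 + (norm (x - proj X x))\<^sup>2"
        unfolding B'app by (rule norm_add_Pythagorean)
          (use orthogonal_comp_inner[OF proj_comp[OF X] 1] in \<open>auto simp: orthogonal_def\<close>)
      also have "\<dots> = (norm x)\<^sup>2"
        using norm_proj_Pythagoras[OF X, of x] by (simp add: orthogonal_matrix_norm[OF oB])
      finally show ?thesis by simp
    qed
    then have "orthogonal_transformation ((*v) B')" by (simp add: orthogonal_transformation)
    then show ?thesis by (simp add: orthogonal_transformation_matrix)
  qed
  have B': "B' \<in> rot X" using oB' by (auto simp: rot_def B'app proj_zero X)
  have eq: "(*v) S ` ((*v) T ` ((*v) A ` P)) = (*v) T ` ((*v) (B' ** A) ` P)" if A: "A \<in> rot X" for A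
  proof -
    have "B' *v (A *v x) = B *v (A *v x)" if "x \<in> P" for x
    proof -
      have "A *v x \<in> X" using rot_maps[OF X A] that P by (auto simp: grassmannian_def)
      then show ?thesis by (simp add: B'app X)
    qed
    then show ?thesis by (simp add: image_image TB[symmetric] flip: matrix_vector_mul_assoc)
  qed
  have mS[measurable]: "(\<lambda>\<xi>. (*v) S ` \<xi>) \<in> ?G \<rightarrow>\<^sub>M ?G"
  proof (rule measurable_rotated_plane[where X="(*v) T ` X" and m=m])
    fix \<xi> assume "\<xi> \<in> space ?G"
    then have \<xi>: "subspace \<xi>" "\<xi> \<subseteq> (*v) T ` X" "dim \<xi> = m" by (auto simp: grassmannian_def)
    have "(*v) S ` \<xi> \<subseteq> (*v) T ` X" using image_mono[OF \<xi>(2), of "(*v) S"] SX by simp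
    then show "(*v) S ` \<xi> \<in> grassmannian ((*v) T ` X) m"
      using \<xi> by (simp add: grassmannian_def subspace_matrix_image dim_orthogonal_matrix_image[OF S(1)])
  qed (auto simp: S)
  show "distr (random_plane X P T) (random_plane X P T) (\<lambda>\<xi>. R ` \<xi>) = random_plane X P T"
  proof (rule measure_eqI)
    fix D assume "D \<in> sets (distr (random_plane X P T) (random_plane X P T) (\<lambda>\<xi>. R ` \<xi>))"
    then have [measurable]: "D \<in> sets ?G" by (simp add: sets)
    have rp: "(\<integral>\<^sup>+\<xi>. F \<xi> \<partial>random_plane X P T) = (\<integral>\<^sup>+A. F ((*v) T ` ((*v) A ` P)) \<partial>haar X)"
      if [measurable]: "F \<in> borel_measurable ?G" for F
      unfolding random_plane_def dP by (subst nn_integral_distr) auto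
    have "emeasure (distr (random_plane X P T) (random_plane X P T) (\<lambda>\<xi>. R ` \<xi>)) D
       = (\<integral>\<^sup>+\<xi>. indicator D \<xi> \<partial>distr (random_plane X P T) (random_plane X P T) (\<lambda>\<xi>. (*v) S ` \<xi>))"
      unfolding S(2) by (subst nn_integral_indicator) (auto simp: sets)
    also have "\<dots> = (\<integral>\<^sup>+\<xi>. indicator D ((*v) S ` \<xi>) \<partial>random_plane X P T)"
      by (subst nn_integral_distr) auto
    also have "\<dots> = (\<integral>\<^sup>+A. indicator D ((*v) T ` ((*v) (B' ** A) ` P)) \<partial>haar X)"
      by (subst rp) (auto intro!: nn_integral_cong simp: eq space_haar X)
    also have "\<dots> = (\<integral>\<^sup>+A. indicator D ((*v) T ` ((*v) A ` P)) \<partial>haar X)"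
      by (rule haar_left[OF X B', where F="\<lambda>A. indicator D ((*v) T ` ((*v) A ` P))"]) measurable
    also have "\<dots> = (\<integral>\<^sup>+\<xi>. indicator D \<xi> \<partial>random_plane X P T)" by (rule rp[symmetric]) measurable
    also have "\<dots> = emeasure (random_plane X P T) D" by (simp add: sets)
    finally show "emeasure (distr (random_plane X P T) (random_plane X P T) (\<lambda>\<xi>. R ` \<xi>)) D
      = emeasure (random_plane X P T) D" .
  qed simp
qed

theorem grassmannian_measure_eq:
  assumes X: "subspace X" and P: "P \<in> grassmannian X m" and T: "orthogonal_matrix T"
  shows "grassmannian_measure ((*v) T ` X) m = completion (random_plane X P T)"
proof -
  let ?Y = "(*v) T ` X"
  have Y: "subspace ?Y" using X by (rule subspace_matrix_image)
  have Q: "(*v) T ` P \<in> grassmannian ?Y m"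
    using P by (auto simp: grassmannian_def subspace_matrix_image dim_orthogonal_matrix_image[OF T])
  have "(THE M. invariant_grassmannian_measure ?Y m M) = random_plane X P T"
  proof (rule the_equality)
    show inv: "invariant_grassmannian_measure ?Y m (random_plane X P T)"
      by (rule random_plane_invariant[OF assms])
    fix M assume M: "invariant_grassmannian_measure ?Y m M"
    show "M = random_plane X P T"
      by (rule measure_eqI)
        (use M inv emeasure_invariant_grassmannian[OF Y Q] in \<open>auto simp: invariant_grassmannian_measure_def\<close>)
  qed
  then show ?thesis by (simp add: grassmannian_measure_def)
qed

section \<open>Lebesgue measure on a linear subspace\<close>

text \<open>
  The normal density of variance \<open>1/(2t)\<close> has total mass one.
\<close>

lemma nn_integral_exp_square:
  assumes "t > 0"
  shows "(\<integral>\<^sup>+x. ennreal (exp (- t * x\<^sup>2)) \<partial>lborel) = ennreal (sqrt (pi / t))"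
proof -
  define s where "s = 1 / sqrt (2 * t)"
  have s: "s > 0" "s\<^sup>2 = 1 / (2 * t)" using assms by (auto simp: s_def power_divide)
  have "normal_density 0 s x = exp (- t * x\<^sup>2) / sqrt (pi / t)" for x
    using assms by (simp add: normal_density_def s(2) field_simps)
  then have "ennreal (exp (- t * x\<^sup>2)) = ennreal (sqrt (pi / t)) * ennreal (normal_density 0 s x)" for x
    using assms by (simp add: ennreal_mult[symmetric])
  then have "(\<integral>\<^sup>+x. ennreal (exp (- t * x\<^sup>2)) \<partial>lborel)
     = ennreal (sqrt (pi / t)) * (\<integral>\<^sup>+x. ennreal (normal_density 0 s x) \<partial>lborel)"
    by (simp add: nn_integral_cmult)
  also have "(\<integral>\<^sup>+x. ennreal (normal_density 0 s x) \<partial>lborel) = 1"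
    using s by (subst nn_integral_eq_integral) auto
  finally show ?thesis by simp
qed

definition onb :: "'a::euclidean_space set \<Rightarrow> 'a set \<Rightarrow> bool" where
  "onb B W \<longleftrightarrow> pairwise orthogonal B \<and> (\<forall>b\<in>B. norm b = 1) \<and> span B = W"

lemma onb_exists: "subspace W \<Longrightarrow> \<exists>B. onb B W"
  using orthonormal_basis_subspace unfolding onb_def by metis

lemma onb_props:
  assumes "onb B W"
  shows "finite B" "card B = dim W" "B \<subseteq> W" "subspace W"
    "\<And>b c. b \<in> B \<Longrightarrow> c \<in> B \<Longrightarrow> b \<bullet> c = (if b = c then 1 else 0)"
proof -
  have "independent B" using assms unfolding onb_def
    by (intro pairwise_orthogonal_independent) auto
  then show "finite B" "card B = dim W"
    using assms dim_eq_card_independent[of B] by (auto simp: onb_def finiteI_independent)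
  show "B \<subseteq> W" "subspace W" using assms by (auto simp: onb_def span_base)
  show "b \<bullet> c = (if b = c then 1 else 0)" if "b \<in> B" "c \<in> B" for b c
    using assms that by (auto simp: onb_def pairwise_def orthogonal_def norm_eq_1)
qed

lemma onb_union:
  assumes B: "onb B W" and C: "onb C V" and "W \<subseteq> V\<^sup>\<bottom>"
  shows "onb (B \<union> C) (W + V)" "B \<inter> C = {}"
proof -
  have bc: "b \<bullet> c = 0" if "b \<in> B" "c \<in> C" for b c
    using that assms onb_props(3)[OF B] onb_props(3)[OF C] by (intro orthogonal_comp_inner[of b V]) auto
  have cb: "c \<bullet> b = 0" if "b \<in> B" "c \<in> C" for b c using bc[OF that] by (simp add: inner_commute)
  show "B \<inter> C = {}"
    using onb_props(5)[OF B] bc by force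
  show "onb (B \<union> C) (W + V)"
    using B C bc cb by (auto simp: onb_def pairwise_def orthogonal_def set_plus_eq span_Un)
qed

lemma onb_sum_norm:
  assumes "onb B W"
  shows "(norm (\<Sum>b\<in>B. w b *\<^sub>R b))\<^sup>2 = (\<Sum>b\<in>B. (w b)\<^sup>2)"
proof -
  have "(norm (\<Sum>b\<in>B. w b *\<^sub>R b))\<^sup>2 = (\<Sum>b\<in>B. \<Sum>c\<in>B. w b * (w c * (c \<bullet> b)))"
    by (simp add: power2_norm_eq_inner inner_sum_left inner_sum_right sum_distrib_left)
  also have "\<dots> = (\<Sum>b\<in>B. \<Sum>c\<in>B. if c = b then w b * w c else 0)"
    by (intro sum.cong) (auto simp: onb_props(5)[OF assms])
  also have "\<dots> = (\<Sum>b\<in>B. (w b)\<^sup>2)"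
    using onb_props(1)[OF assms] by (simp add: power2_eq_square)
  finally show ?thesis .
qed

interpretation lborels: product_sigma_finite "\<lambda>_::'a. lborel :: real measure"
  by standard

definition onb_sum :: "'a::euclidean_space set \<Rightarrow> ('a \<Rightarrow> real) \<Rightarrow> 'a" where
  "onb_sum B w = (\<Sum>b\<in>B. w b *\<^sub>R b)"

lemma onb_sum_measurable [measurable]: "onb_sum B \<in> borel_measurable (Pi\<^sub>M B (\<lambda>_. lborel))"
  unfolding onb_sum_def[abs_def] by measurable

lemma onb_sum_in: "onb B W \<Longrightarrow> onb_sum B w \<in> W"
  unfolding onb_sum_def using onb_props(3,4)[of B W] by (auto intro!: subspace_sum subspace_scale)

text \<open>
  Reindex the coordinates by a bijection of the two bases; the linear map between the bases is
  orthogonal and therefore preserves Lebesgue measure.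
\<close>

lemma lborel_onb:
  fixes C :: "'a::euclidean_space set"
  assumes C: "onb C UNIV"
  shows "lborel = distr (Pi\<^sub>M C (\<lambda>_. lborel)) borel (onb_sum C)"
proof -
  have finC: "finite C" and "card C = card (Basis :: 'a set)"
    using onb_props[OF C] by auto
  then obtain \<phi> where \<phi>: "bij_betw \<phi> (Basis :: 'a set) C"
    by (metis finite_Basis finite_same_card_bij)
  define \<psi> where "\<psi> = inv_into Basis \<phi>"
  have \<psi>: "bij_betw \<psi> C Basis" unfolding \<psi>_def by (rule bij_betw_inv_into[OF \<phi>])
  have \<psi>\<phi>: "\<psi> (\<phi> b) = b" if "b \<in> Basis" for b
    unfolding \<psi>_def using \<phi> that by (rule bij_betw_inv_into_left)
  have \<phi>C: "\<phi> b \<in> C" if "b \<in> Basis" for b using \<phi> that by (auto simp: bij_betw_def)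
  define R where "R w = (\<lambda>c\<in>C. w (\<psi> c))" for w :: "'a \<Rightarrow> real"
  have [measurable]: "R \<in> Pi\<^sub>M Basis (\<lambda>_. lborel) \<rightarrow>\<^sub>M Pi\<^sub>M C (\<lambda>_. lborel)"
    unfolding R_def using \<psi> by (intro measurable_restrict measurable_component_singleton) (auto simp: bij_betw_def)
  have reindex: "distr (Pi\<^sub>M Basis (\<lambda>_. lborel)) (Pi\<^sub>M C (\<lambda>_. lborel)) R = Pi\<^sub>M C (\<lambda>_. lborel)"
  proof (rule lborels.PiM_eqI[OF finC])
    fix A :: "'a \<Rightarrow> real set" assume A: "\<And>i. i \<in> C \<Longrightarrow> A i \<in> sets lborel"
    have "R -` (Pi\<^sub>E C A) \<inter> space (Pi\<^sub>M Basis (\<lambda>_. lborel)) = Pi\<^sub>E Basis (\<lambda>b. A (\<phi> b))"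
    proof (intro equalityI subsetI)
      fix w assume "w \<in> R -` (Pi\<^sub>E C A) \<inter> space (Pi\<^sub>M Basis (\<lambda>_. lborel))"
      then have w: "R w \<in> Pi\<^sub>E C A" "w \<in> extensional Basis" by (auto simp: space_PiM PiE_def)
      have "w b \<in> A (\<phi> b)" if "b \<in> Basis" for b
        using PiE_mem[OF w(1) \<phi>C[OF that]] \<phi>C[OF that] \<psi>\<phi>[OF that] by (simp add: R_def)
      then show "w \<in> Pi\<^sub>E Basis (\<lambda>b. A (\<phi> b))" using w(2) by (auto simp: PiE_def)
    next
      fix w assume w: "w \<in> Pi\<^sub>E Basis (\<lambda>b. A (\<phi> b))"
      have "w (\<psi> c) \<in> A c" if "c \<in> C" for c
        using PiE_mem[OF w, of "\<psi> c"] that \<psi> bij_betw_inv_into_right[OF \<phi> that]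
        by (auto simp: bij_betw_def \<psi>_def)
      then show "w \<in> R -` (Pi\<^sub>E C A) \<inter> space (Pi\<^sub>M Basis (\<lambda>_. lborel))"
        using w by (auto simp: R_def space_PiM PiE_def)
    qed
    then have "emeasure (distr (Pi\<^sub>M Basis (\<lambda>_. lborel)) (Pi\<^sub>M C (\<lambda>_. lborel)) R) (Pi\<^sub>E C A)
        = (\<Prod>b\<in>Basis. emeasure lborel (A (\<phi> b)))"
      using A \<phi>C by (subst emeasure_distr) (auto intro!: sets_PiM_I_finite finC lborels.emeasure_PiM)
    also have "\<dots> = (\<Prod>c\<in>C. emeasure lborel (A c))"
      by (rule prod.reindex_bij_betw[OF \<phi>])
    finally show "emeasure (distr (Pi\<^sub>M Basis (\<lambda>_. lborel)) (Pi\<^sub>M C (\<lambda>_. lborel)) R) (Pi\<^sub>E C A)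
        = (\<Prod>c\<in>C. emeasure lborel (A c))" .
  qed simp
  define T where "T x = (\<Sum>b\<in>Basis. (x \<bullet> b) *\<^sub>R \<phi> b)" for x
  have sumC: "(\<Sum>b\<in>Basis. f b *\<^sub>R \<phi> b) = onb_sum C (\<lambda>c. f (\<psi> c))" for f
    unfolding onb_sum_def using sum.reindex_bij_betw[OF \<phi>, of "\<lambda>c. f (\<psi> c) *\<^sub>R c"]
    by (simp add: \<psi>\<phi> cong: sum.cong)
  have "linear T"
    by (rule linearI) (simp_all add: T_def inner_simps scaleR_add_left sum.distrib scaleR_sum_right)
  moreover have "norm (T x) = norm x" for x
  proof -
    have "(norm (T x))\<^sup>2 = (\<Sum>c\<in>C. (x \<bullet> \<psi> c)\<^sup>2)"
      unfolding T_def sumC onb_sum_def by (rule onb_sum_norm[OF C])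
    also have "\<dots> = (\<Sum>b\<in>Basis. (x \<bullet> b)\<^sup>2)" by (rule sum.reindex_bij_betw[OF \<psi>])
    also have "\<dots> = (norm x)\<^sup>2" unfolding power2_norm_eq_inner euclidean_inner[of x x] by (simp add: power2_eq_square)
    finally show ?thesis by simp
  qed
  ultimately have oT: "orthogonal_transformation T" by (simp add: orthogonal_transformation)
  have [measurable]: "T \<in> borel_measurable borel" unfolding T_def by measurable
  have "lborel = distr lborel borel T" by (simp add: lborel_distr_orthogonal oT)
  also have "\<dots> = distr (Pi\<^sub>M Basis (\<lambda>_. lborel)) borel (\<lambda>w. T (\<Sum>b\<in>Basis. w b *\<^sub>R b))"
    by (subst lborel_eq) (simp add: distr_distr o_def)
  also have "\<dots> = distr (Pi\<^sub>M Basis (\<lambda>_. lborel)) borel (\<lambda>w. onb_sum C (R w))"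
  proof (rule distr_cong)
    fix w
    have "T (\<Sum>b\<in>Basis. w b *\<^sub>R b) = (\<Sum>b\<in>Basis. w b *\<^sub>R \<phi> b)"
      unfolding T_def by (simp add: inner_sum_left_Basis)
    then show "T (\<Sum>b\<in>Basis. w b *\<^sub>R b) = onb_sum C (R w)"
      by (simp add: sumC) (simp add: onb_sum_def R_def)
  qed auto
  also have "\<dots> = distr (distr (Pi\<^sub>M Basis (\<lambda>_. lborel)) (Pi\<^sub>M C (\<lambda>_. lborel)) R) borel (onb_sum C)"
    by (simp add: distr_distr o_def)
  finally show ?thesis unfolding reindex .
qed

text \<open>
  A Gaussian density of total mass one in the directions orthogonal to \<open>W\<close>.
\<close>
definition gaussian_weight :: "'a::euclidean_space set \<Rightarrow> 'a \<Rightarrow> real" where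
  "gaussian_weight W y = (1 / sqrt pi) ^ (DIM('a) - dim W) * exp (- (norm (y - proj W y))\<^sup>2)"

text \<open>
  Lebesgue measure on \<open>W\<close>: the ambient Lebesgue measure, weighted by a probability density in the
  orthogonal directions, is projected to \<open>W\<close>. In contrast to the description by an orthonormal basis, this one
  contains no choice and depends measurably on \<open>W\<close>.
\<close>
definition lborel_on :: "'a::euclidean_space set \<Rightarrow> 'a measure" where
  "lborel_on W = distr (density lborel (\<lambda>y. ennreal (gaussian_weight W y))) borel (proj W)"

lemma gaussian_weight_nonneg [simp]: "gaussian_weight W y \<ge> 0"
  by (simp add: gaussian_weight_def)

lemma sets_lborel_on [simp, measurable_cong]: "sets (lborel_on W) = sets borel"
  by (simp add: lborel_on_def)

lemma space_lborel_on [simp]: "space (lborel_on W) = UNIV"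
  by (simp add: lborel_on_def)

lemma gaussian_weight_measurable [measurable (raw)]:
  fixes g :: "'b \<Rightarrow> 'a::euclidean_space"
  assumes "subspace W" and [measurable]: "g \<in> borel_measurable M"
  shows "(\<lambda>z. gaussian_weight W (g z)) \<in> borel_measurable M"
proof -
  note borel_measurable_proj[OF assms(1), measurable]
  show ?thesis unfolding gaussian_weight_def by measurable
qed

lemma nn_integral_lborel_on:
  assumes W: "subspace W" and [measurable]: "g \<in> borel_measurable borel"
  shows "(\<integral>\<^sup>+u. g u \<partial>lborel_on W) = (\<integral>\<^sup>+y. ennreal (gaussian_weight W y) * g (proj W y) \<partial>lborel)"
proof -
  have [measurable]: "proj W \<in> borel_measurable borel" by (rule borel_measurable_proj[OF W])
  have [measurable]: "gaussian_weight W \<in> borel_measurable borel"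
    using gaussian_weight_measurable[OF W, of "\<lambda>x. x"] by simp
  show ?thesis unfolding lborel_on_def
    by (subst nn_integral_distr) (auto simp: nn_integral_density)
qed

lemma integral_lborel_on:
  fixes g :: "'a::euclidean_space \<Rightarrow> 'b::{banach, second_countable_topology}"
  assumes W: "subspace W" and [measurable]: "g \<in> borel_measurable borel"
  shows "(LINT u|lborel_on W. g u) = (LINT y|lborel. gaussian_weight W y *\<^sub>R g (proj W y))"
proof -
  have [measurable]: "proj W \<in> borel_measurable borel" by (rule borel_measurable_proj[OF W])
  have [measurable]: "gaussian_weight W \<in> borel_measurable borel"
    using gaussian_weight_measurable[OF W, of "\<lambda>x. x"] by simp
  show ?thesis unfolding lborel_on_def
    by (subst integral_distr) (auto simp: integral_density)
qed

text \<open>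
  Complete the orthonormal basis of \<open>W\<close> to one of the whole space. The weight depends only on the
  coordinates orthogonal to \<open>W\<close>, where it integrates to one.
\<close>

lemma nn_integral_lborel_on_onb:
  fixes W :: "'a::euclidean_space set"
  assumes B: "onb B W" and g[measurable]: "g \<in> borel_measurable borel"
  shows "(\<integral>\<^sup>+u. g u \<partial>lborel_on W) = (\<integral>\<^sup>+w. g (onb_sum B w) \<partial>Pi\<^sub>M B (\<lambda>_. lborel))"
proof -
  have W: "subspace W" using onb_props(4)[OF B] .
  obtain B' where B': "onb B' (W\<^sup>\<bottom>)" using onb_exists[OF subspace_orthogonal_comp] by blast
  have WW: "W \<subseteq> W\<^sup>\<bottom>\<^sup>\<bottom>" by (rule orthogonal_comp_subset)
  define C where "C = B \<union> B'"
  have C: "onb C UNIV" and disj: "B \<inter> B' = {}"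
    using onb_union[OF B B' WW] subspace_sum_orthogonal_comp[OF W] by (auto simp: C_def)
  have fin: "finite B" "finite B'" using onb_props(1) B B' by auto
  have cardB': "card B' = DIM('a) - dim W"
    using onb_props(2)[OF B'] dim_orthogonal_comp[OF W] by simp
  have [measurable]: "proj W \<in> borel_measurable borel" by (rule borel_measurable_proj[OF W])
  have [measurable]: "gaussian_weight W \<in> borel_measurable borel"
    using gaussian_weight_measurable[OF W, of "\<lambda>x. x"] by simp
  let ?c = "ennreal ((1 / sqrt pi) ^ (DIM('a) - dim W))"
  have split: "onb_sum C (merge B B' (x, y)) = onb_sum B x + onb_sum B' y" for x y
  proof -
    have "onb_sum C (merge B B' (x, y)) = (\<Sum>b\<in>B. merge B B' (x, y) b *\<^sub>R b) + (\<Sum>b\<in>B'. merge B B' (x, y) b *\<^sub>R b)"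
      unfolding onb_sum_def C_def using fin disj by (rule sum.union_disjoint)
    also have "\<dots> = onb_sum B x + onb_sum B' y"
      unfolding onb_sum_def using disj by (intro arg_cong2[where f="(+)"] sum.cong) (auto simp: merge_def)
    finally show ?thesis .
  qed
  have pr: "proj W (onb_sum B x + onb_sum B' y) = onb_sum B x" for x y
    using onb_sum_in[OF B, of x] onb_sum_in[OF B', of y] W by (simp add: proj_add proj_zero)
  have weight: "ennreal (gaussian_weight W (onb_sum B x + onb_sum B' y)) = ?c * (\<Prod>b\<in>B'. ennreal (exp (- 1 * (y b)\<^sup>2)))" for x y
    unfolding gaussian_weight_def pr add_diff_cancel_left'
    unfolding onb_sum_def[of B' y]
    using fin by (simp add: onb_sum_norm[OF B'] sum_negf[symmetric] exp_sum ennreal_mult' prod_ennreal del: exp_minus)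
  have "(\<integral>\<^sup>+u. g u \<partial>lborel_on W) = (\<integral>\<^sup>+y. ennreal (gaussian_weight W y) * g (proj W y) \<partial>lborel)"
    by (rule nn_integral_lborel_on[OF W g])
  also have "\<dots> = (\<integral>\<^sup>+w. ennreal (gaussian_weight W (onb_sum C w)) * g (proj W (onb_sum C w)) \<partial>Pi\<^sub>M C (\<lambda>_. lborel))"
    by (subst lborel_onb[OF C], subst nn_integral_distr) auto
  also have "\<dots> = (\<integral>\<^sup>+x. \<integral>\<^sup>+y. ennreal (gaussian_weight W (onb_sum C (merge B B' (x, y)))) * g (proj W (onb_sum C (merge B B' (x, y)))) \<partial>Pi\<^sub>M B' (\<lambda>_. lborel) \<partial>Pi\<^sub>M B (\<lambda>_. lborel))"
    unfolding C_def by (rule lborels.product_nn_integral_fold[OF disj fin]) measurable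
  also have "\<dots> = (\<integral>\<^sup>+x. (\<integral>\<^sup>+y. (\<Prod>b\<in>B'. ennreal (exp (- 1 * (y b)\<^sup>2))) \<partial>Pi\<^sub>M B' (\<lambda>_. lborel)) * (?c * g (onb_sum B x)) \<partial>Pi\<^sub>M B (\<lambda>_. lborel))"
    unfolding split pr weight by (subst nn_integral_multc[symmetric]) (auto simp: ac_simps)
  also have "(\<integral>\<^sup>+y. (\<Prod>b\<in>B'. ennreal (exp (- 1 * (y b)\<^sup>2))) \<partial>Pi\<^sub>M B' (\<lambda>_. lborel)) = ennreal (sqrt pi ^ (DIM('a) - dim W))"
    by (subst lborels.product_nn_integral_prod[OF fin(2)])
       (auto simp: nn_integral_exp_square[of 1, simplified] cardB' ennreal_power)
  also have "(\<lambda>x. ennreal (sqrt pi ^ (DIM('a) - dim W)) * (?c * g (onb_sum B x))) = (\<lambda>x. g (onb_sum B x))"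
    by (simp add: mult.assoc[symmetric] ennreal_mult[symmetric] power_mult_distrib[symmetric])
  finally show ?thesis .
qed

lemma distr_onb_lborel_on:
  assumes B: "onb B W"
  shows "distr (Pi\<^sub>M B (\<lambda>_. lborel)) borel (\<lambda>w. \<Sum>b\<in>B. w b *\<^sub>R b) = lborel_on W"
proof (rule measure_eqI)
  fix E assume "E \<in> sets (distr (Pi\<^sub>M B (\<lambda>_. lborel)) borel (\<lambda>w. \<Sum>b\<in>B. w b *\<^sub>R b))"
  then have [measurable]: "E \<in> sets borel" by simp
  have "emeasure (distr (Pi\<^sub>M B (\<lambda>_. lborel)) borel (onb_sum B)) E = (\<integral>\<^sup>+u. indicator E u \<partial>distr (Pi\<^sub>M B (\<lambda>_. lborel)) borel (onb_sum B))"
    by simp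
  also have "\<dots> = (\<integral>\<^sup>+u. indicator E u \<partial>lborel_on W)"
    by (subst nn_integral_distr, simp, simp, subst nn_integral_lborel_on_onb[OF B]) auto
  finally show "emeasure (distr (Pi\<^sub>M B (\<lambda>_. lborel)) borel (\<lambda>w. \<Sum>b\<in>B. w b *\<^sub>R b)) E = emeasure (lborel_on W) E"
    by (simp add: onb_sum_def[abs_def])
qed simp

theorem lebesgue_subspace_eq:
  assumes "subspace W"
  shows "lebesgue_subspace W = completion (lborel_on W)"
proof -
  define B where "B = (SOME B. pairwise orthogonal B \<and> (\<forall>b\<in>B. norm b = 1) \<and> span B = W)"
  have "onb B W"
    using someI_ex[OF onb_exists[OF assms, unfolded onb_def]] by (simp add: B_def onb_def)
  then show ?thesis unfolding lebesgue_subspace_def by (simp add: Let_def B_def[symmetric] distr_onb_lborel_on)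
qed

lemma nn_integral_lborel_on_exp:
  assumes W: "subspace W" and t: "t > 0"
  shows "(\<integral>\<^sup>+u. ennreal (exp (- t * (norm u)\<^sup>2)) \<partial>lborel_on W) = ennreal ((pi / t) powr (dim W / 2))"
proof -
  obtain B where B: "onb B W" using onb_exists[OF W] by blast
  have "(\<integral>\<^sup>+u. ennreal (exp (- t * (norm u)\<^sup>2)) \<partial>lborel_on W)
      = (\<integral>\<^sup>+w. (\<Prod>b\<in>B. ennreal (exp (- t * (w b)\<^sup>2))) \<partial>Pi\<^sub>M B (\<lambda>_. lborel))"
    using onb_props(1)[OF B]
    by (subst nn_integral_lborel_on_onb[OF B])
       (auto simp: onb_sum_def onb_sum_norm[OF B] sum_distrib_left exp_sum prod_ennreal simp flip: sum_negf intro!: nn_integral_cong)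
  also have "\<dots> = (\<Prod>b\<in>B. ennreal (sqrt (pi / t)))"
    by (subst lborels.product_nn_integral_prod[OF onb_props(1)[OF B]])
       (auto simp: nn_integral_exp_square[OF t, simplified])
  also have "\<dots> = ennreal (sqrt (pi / t) ^ dim W)"
    using t by (simp add: ennreal_power onb_props(2)[OF B])
  also have "sqrt (pi / t) ^ dim W = (pi / t) powr (dim W / 2)"
    using t by (simp add: powr_half_sqrt[symmetric] powr_powr powr_realpow[symmetric])
  finally show ?thesis .
qed

text \<open>
  On a ball of radius \<open>i\<close> the indicator is at most \<open>exp (i\<^sup>2)\<close> times the Gaussian, whose integral is finite.
\<close>

lemma sigma_finite_lborel_on:
  assumes W: "subspace W" shows "sigma_finite_measure (lborel_on W)"
proof (intro sigma_finite_measure.intro exI conjI ballI)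
  show "countable (range (\<lambda>i. cball (0::'a) (real i)))" by simp
  show "(\<Union>(range (\<lambda>i. cball (0::'a) (real i)))) = space (lborel_on W)"
    by (auto simp: real_arch_simple)
  fix a assume "a \<in> range (\<lambda>i. cball (0::'a) (real i))"
  then obtain i where a: "a = cball 0 (real i)" by auto
  have [measurable]: "a \<in> sets borel" by (simp add: a)
  have "emeasure (lborel_on W) a = (\<integral>\<^sup>+u. indicator a u \<partial>lborel_on W)" by simp
  also have "\<dots> \<le> (\<integral>\<^sup>+u. ennreal (exp ((real i)\<^sup>2)) * ennreal (exp (- 1 * (norm u)\<^sup>2)) \<partial>lborel_on W)"
    by (intro nn_integral_mono)
       (auto simp: a indicator_def ennreal_mult[symmetric] exp_add[symmetric] ennreal_1[symmetric] ennreal_leI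
        simp del: ennreal_1 intro!: power_mono)
  also have "\<dots> = ennreal (exp ((real i)\<^sup>2)) * ennreal ((pi / 1) powr (dim W / 2))"
    by (subst nn_integral_cmult) (auto simp: nn_integral_lborel_on_exp[OF W, of 1, simplified])
  also have "\<dots> < \<infinity>" by (simp add: ennreal_mult[symmetric])
  finally show "emeasure (lborel_on W) a \<noteq> \<infinity>" by auto
qed auto

lemma nn_integral_lborel_on_sum:
  assumes W: "subspace W" and V: "subspace V" and orth: "W \<subseteq> V\<^sup>\<bottom>" and g[measurable]: "g \<in> borel_measurable borel"
  shows "(\<integral>\<^sup>+u. g u \<partial>lborel_on (W + V)) = (\<integral>\<^sup>+u. \<integral>\<^sup>+v. g (u + v) \<partial>lborel_on V \<partial>lborel_on W)"
proof -
  obtain B where B: "onb B W" using onb_exists[OF W] by blast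
  obtain C where C: "onb C V" using onb_exists[OF V] by blast
  note BC = onb_union[OF B C orth]
  have fin: "finite B" "finite C" using onb_props(1) B C by auto
  interpret V: sigma_finite_measure "lborel_on V" by (rule sigma_finite_lborel_on[OF V])
  have split: "onb_sum (B \<union> C) (merge B C (x, y)) = onb_sum B x + onb_sum C y" for x y
  proof -
    have "onb_sum (B \<union> C) (merge B C (x, y)) = (\<Sum>b\<in>B. merge B C (x, y) b *\<^sub>R b) + (\<Sum>b\<in>C. merge B C (x, y) b *\<^sub>R b)"
      unfolding onb_sum_def using fin BC(2) by (rule sum.union_disjoint)
    also have "\<dots> = onb_sum B x + onb_sum C y"
      unfolding onb_sum_def using BC(2) by (intro arg_cong2[where f="(+)"] sum.cong) (auto simp: merge_def)
    finally show ?thesis .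
  qed
  have "(\<integral>\<^sup>+u. g u \<partial>lborel_on (W + V)) = (\<integral>\<^sup>+w. g (onb_sum (B \<union> C) w) \<partial>Pi\<^sub>M (B \<union> C) (\<lambda>_. lborel))"
    by (rule nn_integral_lborel_on_onb[OF BC(1) g])
  also have "\<dots> = (\<integral>\<^sup>+x. \<integral>\<^sup>+y. g (onb_sum (B \<union> C) (merge B C (x, y))) \<partial>Pi\<^sub>M C (\<lambda>_. lborel) \<partial>Pi\<^sub>M B (\<lambda>_. lborel))"
    by (rule lborels.product_nn_integral_fold[OF BC(2) fin]) measurable
  also have "\<dots> = (\<integral>\<^sup>+x. \<integral>\<^sup>+v. g (onb_sum B x + v) \<partial>lborel_on V \<partial>Pi\<^sub>M B (\<lambda>_. lborel))"
    unfolding split by (intro nn_integral_cong nn_integral_lborel_on_onb[OF C, symmetric]) measurable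
  also have "\<dots> = (\<integral>\<^sup>+u. \<integral>\<^sup>+v. g (u + v) \<partial>lborel_on V \<partial>lborel_on W)"
    by (rule nn_integral_lborel_on_onb[OF B, symmetric]) measurable
  finally show ?thesis .
qed

lemma nn_integral_lborel_on_rotate:
  fixes A :: "real^'n^'n"
  assumes W: "subspace W" and A: "orthogonal_matrix A" and [measurable]: "g \<in> borel_measurable borel"
  shows "(\<integral>\<^sup>+u. g u \<partial>lborel_on ((*v) A ` W)) = (\<integral>\<^sup>+u. g (A *v u) \<partial>lborel_on W)"
proof -
  have AW: "subspace ((*v) A ` W)" by (rule subspace_matrix_image[OF W])
  have [measurable]: "proj W \<in> borel_measurable borel" "proj ((*v) A ` W) \<in> borel_measurable borel"
    by (intro borel_measurable_proj W AW)+
  have [measurable]: "gaussian_weight ((*v) A ` W) \<in> borel_measurable borel"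
    using gaussian_weight_measurable[OF AW, of "\<lambda>x. x"] by simp
  have wt: "gaussian_weight ((*v) A ` W) (A *v y) = gaussian_weight W y" for y
    by (simp add: gaussian_weight_def proj_orthogonal_matrix_image[OF A W] dim_orthogonal_matrix_image[OF A]
        orthogonal_matrix_norm[OF A] flip: matrix_vector_mult_diff_distrib)
  have "(\<integral>\<^sup>+u. g u \<partial>lborel_on ((*v) A ` W))
    = (\<integral>\<^sup>+y. ennreal (gaussian_weight ((*v) A ` W) y) * g (proj ((*v) A ` W) y) \<partial>distr lborel borel ((*v) A))"
    by (simp add: nn_integral_lborel_on[OF AW] lborel_distr_orthogonal orthogonal_matrix_transformation[OF A])
  also have "\<dots> = (\<integral>\<^sup>+y. ennreal (gaussian_weight W y) * g (A *v proj W y) \<partial>lborel)"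
    by (subst nn_integral_distr) (auto simp: wt proj_orthogonal_matrix_image[OF A W])
  also have "\<dots> = (\<integral>\<^sup>+u. g (A *v u) \<partial>lborel_on W)"
    by (rule nn_integral_lborel_on[OF W, symmetric]) measurable
  finally show ?thesis .
qed

lemma nn_integral_lborel_on_translate:
  assumes W: "subspace W" and c: "c \<in> W" and [measurable]: "g \<in> borel_measurable borel"
  shows "(\<integral>\<^sup>+u. g (c + u) \<partial>lborel_on W) = (\<integral>\<^sup>+u. g u \<partial>lborel_on W)"
proof -
  have [measurable]: "proj W \<in> borel_measurable borel" by (rule borel_measurable_proj[OF W])
  have [measurable]: "gaussian_weight W \<in> borel_measurable borel"
    using gaussian_weight_measurable[OF W, of "\<lambda>x. x"] by simp
  have "(\<integral>\<^sup>+u. g u \<partial>lborel_on W) = (\<integral>\<^sup>+y. ennreal (gaussian_weight W (c + y)) * g (proj W (c + y)) \<partial>lborel)"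
    by (subst nn_integral_lborel_on[OF W], simp,
        subst nn_integral_lborel_translate[where f="\<lambda>y. ennreal (gaussian_weight W y) * g (proj W y)"]) auto
  also have "\<dots> = (\<integral>\<^sup>+y. ennreal (gaussian_weight W y) * g (c + proj W y) \<partial>lborel)"
    using W c by (simp add: gaussian_weight_def proj_add)
  also have "\<dots> = (\<integral>\<^sup>+u. g (c + u) \<partial>lborel_on W)"
    by (rule nn_integral_lborel_on[OF W, symmetric]) measurable
  finally show ?thesis by simp
qed

lemma AE_lborel_on_in:
  assumes W: "subspace W" shows "AE u in lborel_on W. u \<in> W"
proof -
  have [measurable]: "proj W \<in> borel_measurable borel" by (rule borel_measurable_proj[OF W])
  have [measurable]: "W \<in> sets borel" using closed_subspace[OF W] by simp
  show ?thesis unfolding lborel_on_def by (subst AE_distr_iff) (auto simp: proj_in W)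
qed

text \<open>
  A single point has measure zero: by translation it is \<open>0\<close>, and the vectors projecting to \<open>0\<close> form a
  proper subspace of the ambient space.
\<close>

lemma AE_lborel_on_neq:
  assumes W: "subspace W" and "W \<noteq> {0}" and c: "c \<in> W" shows "AE u in lborel_on W. u \<noteq> c"
proof -
  have [measurable]: "proj W \<in> borel_measurable borel" by (rule borel_measurable_proj[OF W])
  have "0 < dim W" using assms dim_eq_0[of W] subspace_0 by auto
  then have "dim (W\<^sup>\<bottom>) < DIM('a)" using dim_orthogonal_comp[OF W] by simp
  then have "negligible (W\<^sup>\<bottom>)" by (rule negligible_lowdim)
  moreover have "closed (W\<^sup>\<bottom>)" by (rule closed_subspace[OF subspace_orthogonal_comp])
  ultimately have "W\<^sup>\<bottom> \<in> null_sets lborel"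
    by (auto simp: negligible_iff_null_sets null_sets_def)
  then have "AE y in lborel. y \<notin> W\<^sup>\<bottom>" by (rule AE_not_in)
  then have "AE y in lborel. proj W y \<noteq> 0"
    by eventually_elim (metis W diff_zero proj_comp)
  then have "(\<integral>\<^sup>+y. ennreal (gaussian_weight W y) * indicator {0} (proj W y) \<partial>lborel) = (\<integral>\<^sup>+y. 0 \<partial>(lborel :: 'a measure))"
    by (intro nn_integral_cong_AE) auto
  then have 0: "(\<integral>\<^sup>+u. indicator {0} u \<partial>lborel_on W) = 0"
    by (subst nn_integral_lborel_on[OF W]) auto
  have "emeasure (lborel_on W) {c} = (\<integral>\<^sup>+u. indicator {c} u \<partial>lborel_on W)" by simp
  also have "\<dots> = (\<integral>\<^sup>+u. indicator {c} (c + u) \<partial>lborel_on W)"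
    by (rule nn_integral_lborel_on_translate[OF W c, symmetric]) simp
  also have "\<dots> = (\<integral>\<^sup>+u. indicator {0} u \<partial>lborel_on W)" by (simp add: indicator_def)
  finally have "{c} \<in> null_sets (lborel_on W)" using 0 by (auto simp: null_sets_def)
  from AE_not_in[OF this] show ?thesis by simp
qed

text \<open>
  In the Gaussian description the subspace enters only through its projection, which is measurable;
  the measure with respect to which one integrates is fixed.
\<close>

lemma nn_integral_lborel_on_measurable:
  fixes g :: "'b \<Rightarrow> 'a::euclidean_space \<Rightarrow> ennreal"
  assumes W: "W \<in> M \<rightarrow>\<^sub>M plane_algebra (grassmannian X m)"
    and [measurable]: "(\<lambda>z. g (fst z) (snd z)) \<in> borel_measurable (M \<Otimes>\<^sub>M borel)"
  shows "(\<lambda>z. \<integral>\<^sup>+u. g z u \<partial>lborel_on (W z)) \<in> borel_measurable M"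
proof -
  have sub: "subspace (W z)" "dim (W z) = m" if "z \<in> space M" for z
    using measurable_space[OF W that] by (auto simp: grassmannian_def)
  have W'[measurable]: "(\<lambda>z. W (fst z)) \<in> M \<Otimes>\<^sub>M borel \<rightarrow>\<^sub>M plane_algebra (grassmannian X m)"
    by (rule measurable_compose[OF measurable_fst W])
  have [measurable]: "(\<lambda>z. proj (W (fst z)) (snd z)) \<in> borel_measurable (M \<Otimes>\<^sub>M (borel :: 'a measure))"
    by measurable
  have "(\<lambda>z. (fst z, proj (W (fst z)) (snd z))) \<in> M \<Otimes>\<^sub>M (borel :: 'a measure) \<rightarrow>\<^sub>M M \<Otimes>\<^sub>M (borel :: 'a measure)"
    by measurable
  from measurable_compose[OF this assms(2)]
  have [measurable]: "(\<lambda>z. g (fst z) (proj (W (fst z)) (snd z))) \<in> borel_measurable (M \<Otimes>\<^sub>M borel)" by simp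
  have "(\<lambda>z. ennreal ((1 / sqrt pi) ^ (DIM('a) - m) * exp (- (norm (snd z - proj (W (fst z)) (snd z)))\<^sup>2))
       * g (fst z) (proj (W (fst z)) (snd z))) \<in> borel_measurable (M \<Otimes>\<^sub>M lborel)"
    by measurable
  from lborel.borel_measurable_nn_integral_fst[OF this]
  have "(\<lambda>z. \<integral>\<^sup>+y. ennreal ((1 / sqrt pi) ^ (DIM('a) - m) * exp (- (norm (y - proj (W z) y))\<^sup>2))
       * g z (proj (W z) y) \<partial>lborel) \<in> borel_measurable M"
    by simp
  moreover have "(\<integral>\<^sup>+u. g z u \<partial>lborel_on (W z)) = (\<integral>\<^sup>+y. ennreal ((1 / sqrt pi) ^ (DIM('a) - m) * exp (- (norm (y - proj (W z) y))\<^sup>2))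
       * g z (proj (W z) y) \<partial>lborel)" if "z \<in> space M" for z
  proof -
    have "g z \<in> borel_measurable borel"
      using measurable_compose[OF measurable_Pair1'[OF that] assms(2)] by simp
    then show ?thesis
      by (subst nn_integral_lborel_on) (simp_all add: sub[OF that] gaussian_weight_def)
  qed
  ultimately show ?thesis by (subst measurable_cong)
qed

lemma integral_lborel_on_measurable:
  fixes g :: "'b \<Rightarrow> 'a::euclidean_space \<Rightarrow> 'c::{banach, second_countable_topology}"
  assumes W: "W \<in> M \<rightarrow>\<^sub>M plane_algebra (grassmannian X m)"
    and [measurable]: "(\<lambda>z. g (fst z) (snd z)) \<in> borel_measurable (M \<Otimes>\<^sub>M borel)"
  shows "(\<lambda>z. LINT u|lborel_on (W z). g z u) \<in> borel_measurable M"
proof -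
  have sub: "subspace (W z)" "dim (W z) = m" if "z \<in> space M" for z
    using measurable_space[OF W that] by (auto simp: grassmannian_def)
  have W'[measurable]: "(\<lambda>z. W (fst z)) \<in> M \<Otimes>\<^sub>M borel \<rightarrow>\<^sub>M plane_algebra (grassmannian X m)"
    by (rule measurable_compose[OF measurable_fst W])
  have [measurable]: "(\<lambda>z. proj (W (fst z)) (snd z)) \<in> borel_measurable (M \<Otimes>\<^sub>M (borel :: 'a measure))"
    by measurable
  have "(\<lambda>z. (fst z, proj (W (fst z)) (snd z))) \<in> M \<Otimes>\<^sub>M (borel :: 'a measure) \<rightarrow>\<^sub>M M \<Otimes>\<^sub>M (borel :: 'a measure)"
    by measurable
  from measurable_compose[OF this assms(2)]
  have [measurable]: "(\<lambda>z. g (fst z) (proj (W (fst z)) (snd z))) \<in> borel_measurable (M \<Otimes>\<^sub>M borel)" by simp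
  have "(\<lambda>(z, y). ((1 / sqrt pi) ^ (DIM('a) - m) * exp (- (norm (y - proj (W z) y))\<^sup>2))
       *\<^sub>R g z (proj (W z) y)) \<in> borel_measurable (M \<Otimes>\<^sub>M lborel)"
    unfolding split_beta' by measurable
  from lborel.borel_measurable_lebesgue_integral[OF this]
  have "(\<lambda>z. LINT y|lborel. ((1 / sqrt pi) ^ (DIM('a) - m) * exp (- (norm (y - proj (W z) y))\<^sup>2))
       *\<^sub>R g z (proj (W z) y)) \<in> borel_measurable M" .
  moreover have "(LINT u|lborel_on (W z). g z u) = (LINT y|lborel. ((1 / sqrt pi) ^ (DIM('a) - m) * exp (- (norm (y - proj (W z) y))\<^sup>2))
       *\<^sub>R g z (proj (W z) y))" if "z \<in> space M" for z
  proof -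
    have "g z \<in> borel_measurable borel"
      using measurable_compose[OF measurable_Pair1'[OF that] assms(2)] by simp
    then show ?thesis
      by (subst integral_lborel_on) (simp_all add: sub[OF that] gaussian_weight_def)
  qed
  ultimately show ?thesis by (subst measurable_cong)
qed

section \<open>The affine Grassmannian\<close>

lemma translate_in_affine_grassmannian:
  assumes "\<xi> \<in> grassmannian UNIV m" shows "(+) v ` \<xi> \<in> affine_grassmannian m"
  using assms by (auto simp: affine_grassmannian_def grassmannian_def aff_dim_translation_eq
      aff_dim_subspace affine_translation[symmetric] subspace_imp_affine)

lemma affine_grassmannianE:
  assumes "\<zeta> \<in> affine_grassmannian m"
  obtains \<xi> v where "\<xi> \<in> grassmannian UNIV m" "v \<in> \<xi>\<^sup>\<bottom>" "\<zeta> = (+) v ` \<xi>"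
proof -
  have aff: "affine \<zeta>" and d: "aff_dim \<zeta> = int m" using assms by (auto simp: affine_grassmannian_def)
  then have "\<zeta> \<noteq> {}" by auto
  then obtain a where a: "a \<in> \<zeta>" by auto
  define \<xi> where "\<xi> = (\<lambda>x. - a + x) ` \<zeta>"
  have \<xi>: "subspace \<xi>" unfolding \<xi>_def using aff a by (rule affine_diffs_subspace)
  have \<zeta>: "\<zeta> = (+) a ` \<xi>" by (auto simp: \<xi>_def image_image)
  have "dim \<xi> = m" using d \<xi> by (simp add: \<zeta> aff_dim_translation_eq aff_dim_subspace)
  then have G: "\<xi> \<in> grassmannian UNIV m" using \<xi> by (simp add: grassmannian_def)
  have "\<zeta> = (+) (a - proj \<xi> a) ` \<xi>"
  proof -
    have "(+) (proj \<xi> a) ` \<xi> = \<xi>"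
      using \<xi> proj_in[OF \<xi>, of a]
      by (auto simp: image_iff subspace_add intro!: bexI[of _ "_ - proj \<xi> a"] subspace_diff)
    then have "(+) (a - proj \<xi> a) ` ((+) (proj \<xi> a) ` \<xi>) = (+) (a - proj \<xi> a) ` \<xi>" by simp
    then show ?thesis by (simp add: \<zeta> image_image)
  qed
  then show thesis using that[OF G proj_comp[OF \<xi>]] by simp
qed

lemma plane_foot_eq:
  assumes "subspace \<xi>" "v \<in> \<xi>\<^sup>\<bottom>" shows "plane_foot ((+) v ` \<xi>) = v"
  unfolding plane_foot_def
proof (rule closest_point_unique[symmetric])
  show "convex ((+) v ` \<xi>)" using assms by (simp add: subspace_imp_convex convex_translation)
  show "closed ((+) v ` \<xi>)" using assms by (simp add: closed_subspace closed_translation)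
  show "v \<in> (+) v ` \<xi>" using assms subspace_0 by force
  show "\<forall>z\<in>(+) v ` \<xi>. dist 0 v \<le> dist 0 z"
  proof
    fix z assume "z \<in> (+) v ` \<xi>"
    then obtain y where y: "y \<in> \<xi>" "z = v + y" by auto
    have "(norm z)\<^sup>2 = (norm v)\<^sup>2 + (norm y)\<^sup>2"
      unfolding y by (rule norm_add_Pythagorean) (use assms y in \<open>auto simp: orthogonal_def orthogonal_comp_inner\<close>)
    then have "(norm v)\<^sup>2 \<le> (norm z)\<^sup>2" by simp
    then show "dist 0 v \<le> dist 0 z" by (simp flip: abs_le_square_iff)
  qed
qed

lemma plane_direction_eq:
  assumes "subspace \<xi>" "v \<in> \<xi>\<^sup>\<bottom>" shows "plane_direction ((+) v ` \<xi>) = \<xi>"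
  by (simp add: plane_direction_def plane_foot_eq[OF assms] image_image)

text \<open>
  The only term that is odd in \<open>x\<close> is \<open>x \<bullet> v\<close>. Comparing the distances of \<open>b\<close> and \<open>-b\<close> to the plane therefore
  isolates \<open>b \<bullet> v\<close>, which makes the foot and the direction of a plane measurable functions of the plane.
\<close>

lemma infdist_affine_square:
  fixes v :: "'a::euclidean_space"
  assumes \<xi>: "subspace \<xi>" and v: "v \<in> \<xi>\<^sup>\<bottom>"
  shows "(infdist x ((+) v ` \<xi>))\<^sup>2 = (infdist x \<xi>)\<^sup>2 - 2 * (x \<bullet> v) + (norm v)\<^sup>2"
proof -
  have 1: "infdist x ((+) v ` \<xi>) = norm (x - proj \<xi> x - v)"
    unfolding infdist_subspace[OF \<xi>] proj_diff[OF \<xi>] proj_zero[OF \<xi> v] by (simp add: algebra_simps)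
  have 2: "v \<bullet> proj \<xi> x = 0" by (rule orthogonal_comp_inner(2)[OF v proj_in[OF \<xi>]])
  show ?thesis
    by (simp add: 1 infdist_subspace0 \<xi> power2_norm_eq_inner inner_simps inner_commute 2)
qed

lemma measurable_plane_foot [measurable]:
  "plane_foot \<in> borel_measurable (plane_algebra (affine_grassmannian m :: 'a::euclidean_space set set))"
proof (subst borel_measurable_euclidean_space, intro ballI)
  fix b :: 'a
  let ?G = "plane_algebra (affine_grassmannian m :: 'a set set)"
  note borel_measurable_infdist_plane[measurable]
  have "(\<lambda>\<zeta>. ((infdist (- b) \<zeta>)\<^sup>2 - (infdist b \<zeta>)\<^sup>2) / 4) \<in> borel_measurable ?G" by measurable
  moreover have "plane_foot \<zeta> \<bullet> b = ((infdist (- b) \<zeta>)\<^sup>2 - (infdist b \<zeta>)\<^sup>2) / 4" if "\<zeta> \<in> space ?G" for \<zeta>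
  proof -
    from that obtain \<xi> v where \<xi>: "\<xi> \<in> grassmannian UNIV m" "v \<in> \<xi>\<^sup>\<bottom>" "\<zeta> = (+) v ` \<xi>"
      by (auto elim: affine_grassmannianE)
    have sub: "subspace \<xi>" using \<xi> by (simp add: grassmannian_def)
    have "infdist (- b) \<xi> = infdist b \<xi>"
      using proj_scaleR[OF sub, of "-1" b] norm_minus_cancel[of "b - proj \<xi> b"]
      by (simp add: infdist_subspace0 sub norm_minus_commute)
    then show ?thesis
      by (simp add: \<xi>(3) infdist_affine_square[OF sub \<xi>(2)] plane_foot_eq[OF sub \<xi>(2)] inner_commute)
  qed
  ultimately show "(\<lambda>\<zeta>. plane_foot \<zeta> \<bullet> b) \<in> borel_measurable ?G" by (subst measurable_cong)
qed

lemma measurable_plane_direction [measurable]: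
  "plane_direction \<in> plane_algebra (affine_grassmannian m) \<rightarrow>\<^sub>M plane_algebra (grassmannian UNIV m)"
proof (rule measurable_plane_algebraI)
  let ?G = "plane_algebra (affine_grassmannian m)"
  note borel_measurable_infdist_plane[measurable]
  fix \<zeta> assume "\<zeta> \<in> space ?G"
  then show "plane_direction \<zeta> \<in> grassmannian UNIV m"
    by (auto elim!: affine_grassmannianE simp: plane_direction_eq grassmannianD(1))
next
  let ?G = "plane_algebra (affine_grassmannian m)"
  note borel_measurable_infdist_plane[measurable]
  fix x
  have "(\<lambda>\<zeta>. sqrt ((infdist x \<zeta>)\<^sup>2 + 2 * (x \<bullet> plane_foot \<zeta>) - (norm (plane_foot \<zeta>))\<^sup>2)) \<in> borel_measurable ?G"
    by measurable
  moreover have "infdist x (plane_direction \<zeta>) = sqrt ((infdist x \<zeta>)\<^sup>2 + 2 * (x \<bullet> plane_foot \<zeta>) - (norm (plane_foot \<zeta>))\<^sup>2)"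
    if "\<zeta> \<in> space ?G" for \<zeta>
  proof -
    from that obtain \<xi> v where \<xi>: "\<xi> \<in> grassmannian UNIV m" "v \<in> \<xi>\<^sup>\<bottom>" "\<zeta> = (+) v ` \<xi>"
      by (auto elim: affine_grassmannianE)
    have sub: "subspace \<xi>" using \<xi> by (simp add: grassmannian_def)
    show ?thesis
      by (simp add: \<xi>(3) infdist_affine_square[OF sub \<xi>(2)] plane_foot_eq[OF sub \<xi>(2)]
          plane_direction_eq[OF sub \<xi>(2)] infdist_nonneg)
  qed
  ultimately show "(\<lambda>\<zeta>. infdist x (plane_direction \<zeta>)) \<in> borel_measurable ?G" by (subst measurable_cong)
qed

text \<open>
  The plane \<open>T(w + X)\<close>. The offset is added before rotating, so that it ranges over the fixed
  space \<open>X\<^sup>\<bottom>\<close>.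
\<close>
definition placed :: "(real^'n) set \<Rightarrow> real^'n^'n \<Rightarrow> real^'n \<Rightarrow> (real^'n) set" where
  "placed X T w = (*v) T ` ((+) w ` X)"

lemma placed_eq: "placed X T w = (+) (T *v w) ` ((*v) T ` X)"
  by (simp add: placed_def matrix_image_translation)

lemma placed_in:
  assumes "X \<in> grassmannian UNIV m" "orthogonal_matrix T"
  shows "placed X T w \<in> affine_grassmannian m"
  unfolding placed_eq by (rule translate_in_affine_grassmannian)
    (use assms in \<open>auto simp: grassmannian_def subspace_matrix_image dim_orthogonal_matrix_image\<close>)

lemma placed_measurable:
  fixes X :: "(real^'n) set"
  assumes X: "X \<in> grassmannian UNIV m" and f: "f \<in> M \<rightarrow>\<^sub>M rot_borel UNIV" and [measurable]: "g \<in> borel_measurable M"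
  shows "(\<lambda>z. placed X (f z) (g z)) \<in> M \<rightarrow>\<^sub>M plane_algebra (affine_grassmannian m)"
proof -
  have o: "orthogonal_matrix (f z)" if "z \<in> space M" for z
    using rot_borel_space[OF f that] by (rule rot_orthogonal)
  note rot_borel_borel[OF f, measurable]
  show ?thesis unfolding placed_eq
    by (rule measurable_moved_plane[where X=UNIV and m=m])
      (use X placed_in[OF X o] in \<open>auto simp: o placed_eq\<close>)
qed

lemma infdist_placed:
  assumes "subspace X" "orthogonal_matrix T"
  shows "infdist x (placed X T w) = norm (transpose T *v x - w - proj X (transpose T *v x - w))"
proof -
  have "norm (x - T *v w - T *v proj X (transpose T *v (x - T *v w)))
     = norm (T *v (transpose T *v x - w - proj X (transpose T *v x - w)))"
    by (simp add: matrix_vector_mult_diff_distrib orthogonal_matrix_cancel[OF assms(2)])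
  then show ?thesis
    by (simp add: placed_eq infdist_matrix_image assms orthogonal_matrix_norm)
qed

lemma measurable_orthogonal_comp:
  "(\<lambda>\<xi>. \<xi>\<^sup>\<bottom>) \<in> plane_algebra (grassmannian UNIV m) \<rightarrow>\<^sub>M plane_algebra (grassmannian (UNIV :: 'a::euclidean_space set) (DIM('a) - m))"
proof (rule measurable_plane_algebraI)
  fix \<xi> :: "'a set" assume "\<xi> \<in> space (plane_algebra (grassmannian UNIV m))"
  then show "\<xi>\<^sup>\<bottom> \<in> grassmannian UNIV (DIM('a) - m)"
    using dim_orthogonal_comp[of \<xi>] by (auto simp: grassmannian_def subspace_orthogonal_comp)
next
  fix x :: 'a
  have "(\<lambda>\<xi>. norm (proj \<xi> x)) \<in> borel_measurable (plane_algebra (grassmannian UNIV m))"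
    using borel_measurable_proj_plane[of "\<lambda>\<xi>. \<xi>" "plane_algebra (grassmannian UNIV m)" UNIV m "\<lambda>_. x"]
    by measurable
  then show "(\<lambda>\<xi>. infdist x (\<xi>\<^sup>\<bottom>)) \<in> borel_measurable (plane_algebra (grassmannian UNIV m))"
    by (subst measurable_cong)
       (auto simp: grassmannian_def infdist_subspace0 subspace_orthogonal_comp proj_orthogonal_comp)
qed

definition affine_law :: "(real^'n) set \<Rightarrow> (real^'n) set measure" where
  "affine_law E = distr (haar UNIV \<Otimes>\<^sub>M lborel_on (E\<^sup>\<bottom>)) (plane_algebra (affine_grassmannian (dim E)))
     (\<lambda>z. placed E (fst z) (snd z))"

lemma sets_affine_law: "E \<in> grassmannian UNIV m \<Longrightarrow> sets (affine_law E) = sets (plane_algebra (affine_grassmannian m))"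
  by (simp add: affine_law_def grassmannian_def)

lemma nn_integral_affine_law:
  fixes E :: "(real^'n) set"
  assumes E: "E \<in> grassmannian UNIV m" and F[measurable]: "F \<in> borel_measurable (plane_algebra (affine_grassmannian m))"
  shows "(\<integral>\<^sup>+\<zeta>. F \<zeta> \<partial>affine_law E) = (\<integral>\<^sup>+T. \<integral>\<^sup>+z. F (placed E T z) \<partial>lborel_on (E\<^sup>\<bottom>) \<partial>haar UNIV)"
proof -
  interpret K: sigma_finite_measure "lborel_on (E\<^sup>\<bottom>)" by (rule sigma_finite_lborel_on[OF subspace_orthogonal_comp])
  note sets_haar[OF subspace_UNIV, measurable_cong]
  have d: "dim E = m" using E by (simp add: grassmannian_def)
  have [measurable]: "(\<lambda>z. placed E (fst z) (snd z)) \<in> rot_borel UNIV \<Otimes>\<^sub>M borel \<rightarrow>\<^sub>M plane_algebra (affine_grassmannian m)"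
    by (rule placed_measurable[OF E]) measurable
  show ?thesis unfolding affine_law_def d
    by (subst nn_integral_distr) (auto simp: K.nn_integral_fst[symmetric])
qed

text \<open>
  The direction \<open>TE\<close> is distributed by the invariant measure, and Lebesgue measure on its complement
  is the image under \<open>T\<close> of Lebesgue measure on \<open>E\<^sup>\<bottom>\<close>.
\<close>

theorem affine_grassmannian_measure_eq:
  fixes E :: "(real^'n) set"
  assumes E: "E \<in> grassmannian UNIV m"
  shows "affine_grassmannian_measure m = completion (affine_law E)"
proof -
  let ?A = "plane_algebra (affine_grassmannian m :: (real^'n) set set)"
  let ?G = "plane_algebra (grassmannian (UNIV :: (real^'n) set) m)"
  have sub: "subspace E" and d: "dim E = m" using E by (auto simp: grassmannian_def)
  have gm: "grassmannian_measure (UNIV :: (real^'n) set) m = completion (random_plane UNIV E (mat 1))"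
    using grassmannian_measure_eq[OF subspace_UNIV E orthogonal_matrix_id] by simp
  note sets_haar[OF subspace_UNIV, measurable_cong]
  have mE[measurable]: "(\<lambda>T. (*v) T ` E) \<in> rot_borel UNIV \<rightarrow>\<^sub>M ?G"
    using measurable_random_plane[OF subspace_UNIV E orthogonal_matrix_id] by simp
  have eq: "(\<integral>\<^sup>+\<xi>. (\<integral>\<^sup>+u. indicator D ((+) u ` \<xi>) \<partial>lebesgue_subspace (\<xi>\<^sup>\<bottom>)) \<partial>grassmannian_measure UNIV m)
      = emeasure (affine_law E) D" if D: "D \<in> sets ?A" for D
  proof -
    note D[measurable]
    have m1: "(\<lambda>z. (+) (snd z) ` fst z) \<in> ?G \<Otimes>\<^sub>M borel \<rightarrow>\<^sub>M ?A"
      using measurable_moved_plane[of fst "?G \<Otimes>\<^sub>M borel" UNIV m "\<lambda>_. mat 1" snd "affine_grassmannian m"]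
      by (auto simp: space_pair_measure orthogonal_matrix_id translate_in_affine_grassmannian)
    have [measurable]: "(\<lambda>z. indicator D ((+) (snd z) ` fst z) :: ennreal) \<in> borel_measurable (?G \<Otimes>\<^sub>M borel)"
      by (rule measurable_compose[OF m1]) measurable
    have [measurable]: "(\<lambda>\<xi>. \<integral>\<^sup>+u. indicator D ((+) u ` \<xi>) \<partial>lborel_on (\<xi>\<^sup>\<bottom>)) \<in> borel_measurable ?G"
      by (rule nn_integral_lborel_on_measurable[OF measurable_orthogonal_comp]) measurable
    have "(\<integral>\<^sup>+\<xi>. (\<integral>\<^sup>+u. indicator D ((+) u ` \<xi>) \<partial>lebesgue_subspace (\<xi>\<^sup>\<bottom>)) \<partial>grassmannian_measure UNIV m)
       = (\<integral>\<^sup>+\<xi>. (\<integral>\<^sup>+u. indicator D ((+) u ` \<xi>) \<partial>lborel_on (\<xi>\<^sup>\<bottom>)) \<partial>random_plane UNIV E (mat 1))"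
      by (simp add: gm nn_integral_completion lebesgue_subspace_eq subspace_orthogonal_comp)
    also have "\<dots> = (\<integral>\<^sup>+T. (\<integral>\<^sup>+u. indicator D ((+) u ` ((*v) T ` E)) \<partial>lborel_on (((*v) T ` E)\<^sup>\<bottom>)) \<partial>haar UNIV)"
      unfolding random_plane_def d by (subst nn_integral_distr) simp_all
    also have "\<dots> = (\<integral>\<^sup>+T. \<integral>\<^sup>+z. indicator D (placed E T z) \<partial>lborel_on (E\<^sup>\<bottom>) \<partial>haar UNIV)"
    proof (rule nn_integral_cong)
      fix T :: "real^'n^'n" assume "T \<in> space (haar UNIV)"
      then have T: "orthogonal_matrix T" "T \<in> rot UNIV" by (auto simp: space_haar rot_UNIV)
      have "(*v) T ` E \<in> space ?G" using measurable_space[OF mE, of T] T by simp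
      from measurable_compose[OF measurable_Pair1'[OF this] m1]
      have "(\<lambda>u. (+) u ` ((*v) T ` E)) \<in> borel \<rightarrow>\<^sub>M ?A" by simp
      then have [measurable]: "(\<lambda>u. indicator D ((+) u ` ((*v) T ` E)) :: ennreal) \<in> borel_measurable borel"
        by measurable
      show "(\<integral>\<^sup>+u. indicator D ((+) u ` ((*v) T ` E)) \<partial>lborel_on (((*v) T ` E)\<^sup>\<bottom>))
        = (\<integral>\<^sup>+z. indicator D (placed E T z) \<partial>lborel_on (E\<^sup>\<bottom>))"
        unfolding orthogonal_matrix_image_comp[OF T(1)] placed_eq
        by (rule nn_integral_lborel_on_rotate[OF subspace_orthogonal_comp T(1)]) measurable
    qed
    also have "\<dots> = (\<integral>\<^sup>+\<zeta>. indicator D \<zeta> \<partial>affine_law E)"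
      by (rule nn_integral_affine_law[OF E, symmetric]) measurable
    also have "\<dots> = emeasure (affine_law E) D" using D by (simp add: sets_affine_law[OF E])
    finally show ?thesis .
  qed
  have sp: "space (affine_law E) = affine_grassmannian m"
    using sets_eq_imp_space_eq[OF sets_affine_law[OF E]] by simp
  have "measure_of (affine_grassmannian m) (sets ?A)
       (\<lambda>D. \<integral>\<^sup>+\<xi>. (\<integral>\<^sup>+u. indicator D ((+) u ` \<xi>) \<partial>lebesgue_subspace (\<xi>\<^sup>\<bottom>)) \<partial>grassmannian_measure UNIV m)
     = measure_of (affine_grassmannian m) (sets ?A) (emeasure (affine_law E))"
  proof (rule measure_of_eq)
    show "sets ?A \<subseteq> Pow (affine_grassmannian m)" using sets.sets_into_space[of _ ?A] by auto
    fix D assume "D \<in> sigma_sets (affine_grassmannian m) (sets ?A)"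
    then have "D \<in> sets ?A" using sets.sigma_sets_eq[of ?A] by simp
    then show "(\<integral>\<^sup>+\<xi>. (\<integral>\<^sup>+u. indicator D ((+) u ` \<xi>) \<partial>lebesgue_subspace (\<xi>\<^sup>\<bottom>)) \<partial>grassmannian_measure UNIV m)
      = emeasure (affine_law E) D" by (rule eq)
  qed
  also have "\<dots> = affine_law E"
    using measure_of_of_measure[of "affine_law E"] by (simp add: sp sets_affine_law[OF E])
  finally show ?thesis unfolding affine_grassmannian_measure_def by simp
qed

section \<open>The Strichartz transform in terms of random rotations\<close>

lemma orthogonal_comp_sym: "A \<subseteq> B\<^sup>\<bottom> \<longleftrightarrow> B \<subseteq> A\<^sup>\<bottom>"
  by (simp add: orthogonal_comp_def orthogonal_def subset_iff) (metis inner_commute)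

lemma sum_orthogonal: "A \<subseteq> C\<^sup>\<bottom> \<Longrightarrow> B \<subseteq> C\<^sup>\<bottom> \<Longrightarrow> A + B \<subseteq> C\<^sup>\<bottom>"
  by (auto simp: set_plus_def intro: subspace_add[OF subspace_orthogonal_comp])

lemma orthogonal_comp_eqI:
  assumes "subspace A" "A \<subseteq> B\<^sup>\<bottom>" "A + B = UNIV"
  shows "A\<^sup>\<bottom> = B"
proof
  show "B \<subseteq> A\<^sup>\<bottom>" using assms by (simp add: orthogonal_comp_sym)
  show "A\<^sup>\<bottom> \<subseteq> B"
  proof
    fix x assume x: "x \<in> A\<^sup>\<bottom>"
    have "x \<in> A + B" using assms by simp
    then obtain a b where ab: "x = a + b" "a \<in> A" "b \<in> B" by (rule set_plus_elim)
    have "x - b \<in> A\<^sup>\<bottom>" using subspace_diff[OF subspace_orthogonal_comp x] ab(3) \<open>B \<subseteq> A\<^sup>\<bottom>\<close> by blast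
    then have "a \<in> A \<inter> A\<^sup>\<bottom>" using ab by simp
    then have "a = 0" using orthogonal_Int_0[OF assms(1)] by simp
    then show "x \<in> B" using ab by simp
  qed
qed

lemma lborel_on_rotate:
  fixes A :: "real^'n^'n"
  assumes "subspace W" "orthogonal_matrix A"
  shows "lborel_on ((*v) A ` W) = distr (lborel_on W) borel ((*v) A)"
proof (rule measure_eqI)
  fix D assume "D \<in> sets (lborel_on ((*v) A ` W))"
  then have [measurable]: "D \<in> sets borel" by simp
  have "emeasure (lborel_on ((*v) A ` W)) D = (\<integral>\<^sup>+u. indicator D u \<partial>lborel_on ((*v) A ` W))" by simp
  also have "\<dots> = (\<integral>\<^sup>+u. indicator D (A *v u) \<partial>lborel_on W)"
    by (rule nn_integral_lborel_on_rotate[OF assms]) measurable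
  also have "\<dots> = (\<integral>\<^sup>+u. indicator D u \<partial>distr (lborel_on W) borel ((*v) A))"
    by (subst nn_integral_distr) auto
  also have "\<dots> = emeasure (distr (lborel_on W) borel ((*v) A)) D" by simp
  finally show "emeasure (lborel_on ((*v) A ` W)) D = emeasure (distr (lborel_on W) borel ((*v) A)) D" .
qed simp

lemma join_plane_eq: "join_plane P Q w = (+) w ` (P + Q)"
  by (force simp: join_plane_def set_plus_def)

lemma join_plane_measurable:
  assumes \<eta>: "subspace \<eta>"
  shows "(\<lambda>z. join_plane (fst (fst z)) (snd (fst z)) (snd z + v)) \<in>
     (plane_algebra (grassmannian \<eta> p) \<Otimes>\<^sub>M plane_algebra (grassmannian (\<eta>\<^sup>\<bottom>) q)) \<Otimes>\<^sub>M borel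
       \<rightarrow>\<^sub>M plane_algebra (affine_grassmannian (p + q))"
    (is "_ \<in> ?M \<rightarrow>\<^sub>M _")
proof -
  have pq: "subspace P \<and> subspace Q \<and> P \<subseteq> Q\<^sup>\<bottom> \<and> dim P = p \<and> dim Q = q"
    if "P \<in> grassmannian \<eta> p" "Q \<in> grassmannian (\<eta>\<^sup>\<bottom>) q" for P Q
  proof -
    have "P \<subseteq> \<eta>\<^sup>\<bottom>\<^sup>\<bottom>" using that \<eta> by (simp add: grassmannian_def orthogonal_comp_self)
    also have "\<dots> \<subseteq> Q\<^sup>\<bottom>" using that by (intro orthogonal_comp_anti_mono) (simp add: grassmannian_def)
    finally show ?thesis using that by (simp add: grassmannian_def)
  qed
  show ?thesis
  proof (rule measurable_plane_algebraI)
    fix z assume "z \<in> space ?M"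
    then have "subspace (fst (fst z)) \<and> subspace (snd (fst z)) \<and> fst (fst z) \<subseteq> (snd (fst z))\<^sup>\<bottom> \<and> dim (fst (fst z)) = p \<and> dim (snd (fst z)) = q"
      by (intro pq) (auto simp: space_pair_measure)
    then have "fst (fst z) + snd (fst z) \<in> grassmannian UNIV (p + q)"
      by (simp add: grassmannian_def subspace_orth_sum dim_orth_sum)
    then show "join_plane (fst (fst z)) (snd (fst z)) (snd z + v) \<in> affine_grassmannian (p + q)"
      unfolding join_plane_eq by (rule translate_in_affine_grassmannian)
  next
    fix x
    have [measurable]: "(\<lambda>z. fst (fst z)) \<in> ?M \<rightarrow>\<^sub>M plane_algebra (grassmannian \<eta> p)"
      "(\<lambda>z. snd (fst z)) \<in> ?M \<rightarrow>\<^sub>M plane_algebra (grassmannian (\<eta>\<^sup>\<bottom>) q)" by measurable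
    have "(\<lambda>z. norm (x - (snd z + v) - (proj (fst (fst z)) (x - (snd z + v)) + proj (snd (fst z)) (x - (snd z + v))))) \<in> borel_measurable ?M"
      by measurable
    moreover have "infdist x (join_plane (fst (fst z)) (snd (fst z)) (snd z + v))
      = norm (x - (snd z + v) - (proj (fst (fst z)) (x - (snd z + v)) + proj (snd (fst z)) (x - (snd z + v))))"
      if "z \<in> space ?M" for z
    proof -
      have "subspace (fst (fst z)) \<and> subspace (snd (fst z)) \<and> fst (fst z) \<subseteq> (snd (fst z))\<^sup>\<bottom> \<and> dim (fst (fst z)) = p \<and> dim (snd (fst z)) = q"
        using that by (intro pq) (auto simp: space_pair_measure)
      then show ?thesis
        unfolding join_plane_eq by (subst infdist_subspace) (simp_all add: subspace_orth_sum proj_sum)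
    qed
    ultimately show "(\<lambda>z. infdist x (join_plane (fst (fst z)) (snd (fst z)) (snd z + v))) \<in> borel_measurable ?M"
      by (subst measurable_cong)
  qed
qed

lemma relative_comp:
  assumes \<eta>: "subspace \<eta>" and P: "subspace P" "P \<subseteq> \<eta>"
  shows "P + (P\<^sup>\<bottom> \<inter> \<eta>) = \<eta>" "proj (P\<^sup>\<bottom> \<inter> \<eta>) x = proj \<eta> x - proj P x" "dim (P\<^sup>\<bottom> \<inter> \<eta>) = dim \<eta> - dim P"
    "subspace (P\<^sup>\<bottom> \<inter> \<eta>)"
proof -
  show sub: "subspace (P\<^sup>\<bottom> \<inter> \<eta>)" by (intro subspace_inter subspace_orthogonal_comp \<eta>)
  show s: "P + (P\<^sup>\<bottom> \<inter> \<eta>) = \<eta>"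
  proof (intro equalityI subsetI)
    fix x assume "x \<in> \<eta>"
    then have "x - proj P x \<in> P\<^sup>\<bottom> \<inter> \<eta>" using proj_comp[OF P(1), of x] proj_in[OF P(1), of x] P \<eta>
      by (auto intro: subspace_diff)
    then have "proj P x + (x - proj P x) \<in> P + (P\<^sup>\<bottom> \<inter> \<eta>)"
      by (intro set_plus_intro proj_in[OF P(1)])
    then show "x \<in> P + (P\<^sup>\<bottom> \<inter> \<eta>)" by simp
  qed (use P \<eta> in \<open>auto simp: set_plus_def intro: subspace_add\<close>)
  have orth: "P \<subseteq> (P\<^sup>\<bottom> \<inter> \<eta>)\<^sup>\<bottom>" by (subst orthogonal_comp_sym) auto
  show "proj (P\<^sup>\<bottom> \<inter> \<eta>) x = proj \<eta> x - proj P x"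
    using proj_sum[OF P(1) sub orth, of x] by (simp add: s)
  show "dim (P\<^sup>\<bottom> \<inter> \<eta>) = dim \<eta> - dim P"
    using dim_orth_sum[OF P(1) sub orth] by (simp add: s)
qed

lemma measurable_relative_comp:
  assumes \<eta>: "subspace \<eta>"
  shows "(\<lambda>P. P\<^sup>\<bottom> \<inter> \<eta>) \<in> plane_algebra (grassmannian \<eta> p) \<rightarrow>\<^sub>M plane_algebra (grassmannian UNIV (dim \<eta> - p))"
proof (rule measurable_plane_algebraI)
  fix P assume "P \<in> space (plane_algebra (grassmannian \<eta> p))"
  then show "P\<^sup>\<bottom> \<inter> \<eta> \<in> grassmannian UNIV (dim \<eta> - p)"
    using relative_comp[OF \<eta>, of P] by (auto simp: grassmannian_def)
next
  fix x
  have [measurable]: "(\<lambda>P. proj P x) \<in> borel_measurable (plane_algebra (grassmannian \<eta> p))"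
    by (rule borel_measurable_proj_plane[where f="\<lambda>P. P" and X=\<eta> and m=p]) auto
  have "(\<lambda>P. norm (x - (proj \<eta> x - proj P x))) \<in> borel_measurable (plane_algebra (grassmannian \<eta> p))"
    by measurable
  then show "(\<lambda>P. infdist x (P\<^sup>\<bottom> \<inter> \<eta>)) \<in> borel_measurable (plane_algebra (grassmannian \<eta> p))"
    by (subst measurable_cong) (auto simp: grassmannian_def infdist_subspace0 relative_comp \<eta>)
qed

text \<open>
  Reference planes. \<open>P0\<close> and \<open>Q0\<close> model the two summands of a \<open>j\<close>-plane, \<open>W0\<close> the directions of the \<open>k\<close>-plane that
  are orthogonal to \<open>P0\<close>, and \<open>V0\<close> the remaining directions.
\<close>
locale orthogonal_frame =
  fixes P0 Q0 W0 V0 :: "(real^'n) set" and p q l :: nat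
  assumes subs: "subspace P0" "subspace Q0" "subspace W0" "subspace V0"
    and dims: "dim P0 = p" "dim Q0 = q" "dim W0 = l"
    and orth: "P0 \<subseteq> Q0\<^sup>\<bottom>" "P0 \<subseteq> W0\<^sup>\<bottom>" "P0 \<subseteq> V0\<^sup>\<bottom>" "Q0 \<subseteq> W0\<^sup>\<bottom>" "Q0 \<subseteq> V0\<^sup>\<bottom>" "W0 \<subseteq> V0\<^sup>\<bottom>"
    and total: "P0 + Q0 + (W0 + V0) = UNIV"
begin

definition E :: "(real^'n) set" where "E = P0 + W0"
definition X :: "(real^'n) set" where "X = P0 + Q0"

lemma subE: "subspace E" and subX: "subspace X"
  using subs by (auto simp: E_def X_def subspace_orth_sum)

lemma orth_sym: "Q0 \<subseteq> P0\<^sup>\<bottom>" "W0 \<subseteq> P0\<^sup>\<bottom>" "V0 \<subseteq> P0\<^sup>\<bottom>" "W0 \<subseteq> Q0\<^sup>\<bottom>" "V0 \<subseteq> Q0\<^sup>\<bottom>" "V0 \<subseteq> W0\<^sup>\<bottom>"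
  using orth by (simp_all add: orthogonal_comp_sym[of Q0 P0] orthogonal_comp_sym[of W0 P0] orthogonal_comp_sym[of V0 P0]
      orthogonal_comp_sym[of W0 Q0] orthogonal_comp_sym[of V0 Q0] orthogonal_comp_sym[of V0 W0])

lemma E_comp: "E\<^sup>\<bottom> = Q0 + V0"
proof (rule orthogonal_comp_eqI[OF subE])
  have "Q0 + V0 \<subseteq> P0\<^sup>\<bottom>" "Q0 + V0 \<subseteq> W0\<^sup>\<bottom>"
    by (intro sum_orthogonal orth orth_sym)+
  then show "E \<subseteq> (Q0 + V0)\<^sup>\<bottom>" unfolding E_def
    by (intro sum_orthogonal) (simp_all add: orthogonal_comp_sym[of _ "Q0 + V0"])
  have "E + (Q0 + V0) = P0 + Q0 + (W0 + V0)" unfolding E_def by (simp add: ac_simps)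
  then show "E + (Q0 + V0) = UNIV" using total by simp
qed

lemma X_comp: "X\<^sup>\<bottom> = W0 + V0"
proof (rule orthogonal_comp_eqI[OF subX])
  have "W0 + V0 \<subseteq> P0\<^sup>\<bottom>" "W0 + V0 \<subseteq> Q0\<^sup>\<bottom>"
    by (intro sum_orthogonal orth orth_sym)+
  then show "X \<subseteq> (W0 + V0)\<^sup>\<bottom>" unfolding X_def
    by (intro sum_orthogonal) (simp_all add: orthogonal_comp_sym[of _ "W0 + V0"])
  show "X + (W0 + V0) = UNIV" using total by (simp add: X_def)
qed

lemma E_gr: "E \<in> grassmannian UNIV (p + l)" and X_gr: "X \<in> grassmannian UNIV (p + q)"
  using dim_orth_sum[OF subs(1,3) orth(2)] dim_orth_sum[OF subs(1,2) orth(1)]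
  by (simp_all add: grassmannian_def subE subX) (simp_all add: E_def X_def dims)

lemma sub0: "P0 \<subseteq> E" "W0 \<subseteq> E" "P0 \<subseteq> X" "Q0 \<subseteq> X" "Q0 \<subseteq> E\<^sup>\<bottom>" "V0 \<subseteq> E\<^sup>\<bottom>" "W0 \<subseteq> X\<^sup>\<bottom>" "V0 \<subseteq> X\<^sup>\<bottom>"
proof -
  have *: "A \<subseteq> A + B" "B \<subseteq> A + B" if "subspace A" "subspace B" for A B :: "(real^'n) set"
    using set_plus_intro[OF _ subspace_0[OF that(2)], of _ A] set_plus_intro[OF subspace_0[OF that(1)], of _ B] by auto
  show "P0 \<subseteq> E" "W0 \<subseteq> E" "P0 \<subseteq> X" "Q0 \<subseteq> X" "Q0 \<subseteq> E\<^sup>\<bottom>" "V0 \<subseteq> E\<^sup>\<bottom>" "W0 \<subseteq> X\<^sup>\<bottom>" "V0 \<subseteq> X\<^sup>\<bottom>"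
    unfolding E_comp X_comp unfolding E_def X_def by (simp_all add: * subs)
qed

lemma P0_gr: "P0 \<in> grassmannian E p" and Q0_gr: "Q0 \<in> grassmannian (E\<^sup>\<bottom>) q"
  by (simp_all add: grassmannian_def subs dims sub0)

lemma W0_eq: "P0\<^sup>\<bottom> \<inter> E = W0"
proof (rule equalityI)
  show "P0\<^sup>\<bottom> \<inter> E \<subseteq> W0"
  proof
    fix x assume x: "x \<in> P0\<^sup>\<bottom> \<inter> E"
    then have "x \<in> P0 + W0" by (simp add: E_def)
    then obtain a b where ab: "x = a + b" "a \<in> P0" "b \<in> W0" by (rule set_plus_elim)
    have "b \<in> P0\<^sup>\<bottom>" using ab(3) orth_sym(2) by blast
    then have "x - b \<in> P0\<^sup>\<bottom>" using x by (simp add: subspace_diff[OF subspace_orthogonal_comp])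
    then have "a \<in> P0 \<inter> P0\<^sup>\<bottom>" using ab by simp
    then have "a = 0" using orthogonal_Int_0[OF subs(1)] by simp
    then show "x \<in> W0" using ab by simp
  qed
  show "W0 \<subseteq> P0\<^sup>\<bottom> \<inter> E" using sub0(2) orth_sym(2) by simp
qed

text \<open>
  The rotation \<open>B\<close> fixes \<open>E\<close> and \<open>A\<close> fixes its complement, so that \<open>AB\<close> maps \<open>X = P0 + Q0\<close> to \<open>A P0 + B Q0\<close>; the offset \<open>z\<close> is
  pulled back by \<open>B\<close> alone.
\<close>

lemma join_plane_placed: 
  assumes "A \<in> rot E" "B \<in> rot (E\<^sup>\<bottom>)" "z \<in> E\<^sup>\<bottom>" "u \<in> W0"
  shows "join_plane ((*v) T ` ((*v) A ` P0)) ((*v) T ` ((*v) B ` Q0)) ((T ** A) *v u + T *v z)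
    = placed X (T ** A ** B) (u + transpose B *v z)"
proof -
  have EE: "E \<subseteq> E\<^sup>\<bottom>\<^sup>\<bottom>" by (rule orthogonal_comp_subset)
  have 1: "B *v a = a" if "a \<in> E" for a by (rule rot_fix[OF assms(2)]) (use that EE in blast)
  have 2: "A *v a = a" if "a \<in> E\<^sup>\<bottom>" for a using rot_fix[OF assms(1) that] .
  have 3: "A *v (B *v b) = B *v b" if "b \<in> Q0" for b
  proof (rule 2)
    have "b \<in> E\<^sup>\<bottom>" using that sub0(5) by blast
    then show "B *v b \<in> E\<^sup>\<bottom>" by (rule rot_maps[OF subspace_orthogonal_comp assms(2)])
  qed
  have 4: "B *v (transpose B *v z) = z" using orthogonal_matrix_cancel(2)[OF rot_orthogonal[OF assms(2)]] .
  have "(T ** A ** B) *v (u + transpose B *v z + (a + b))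
    = T *v (A *v a) + T *v (B *v b) + ((T ** A) *v u + T *v z)" if "a \<in> P0" "b \<in> Q0" for a b
  proof -
    have "(T ** A ** B) *v (u + transpose B *v z + (a + b))
      = T *v (A *v (B *v u)) + T *v (A *v (B *v (transpose B *v z))) + (T *v (A *v (B *v a)) + T *v (A *v (B *v b)))"
      by (simp add: matrix_vector_right_distrib flip: matrix_vector_mul_assoc)
    also have "\<dots> = T *v (A *v u) + T *v z + (T *v (A *v a) + T *v (B *v b))"
    proof -
      have "u \<in> E" "a \<in> E" using that assms(4) sub0(1,2) by auto
      then show ?thesis using that(2) assms(3) by (simp add: 1 2 3 4)
    qed
    finally show ?thesis by (simp add: matrix_vector_mul_assoc[symmetric])
  qed
  note eq = this
  have "join_plane ((*v) T ` ((*v) A ` P0)) ((*v) T ` ((*v) B ` Q0)) ((T ** A) *v u + T *v z)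
    = {T *v (A *v a) + T *v (B *v b) + ((T ** A) *v u + T *v z) |a b. a \<in> P0 \<and> b \<in> Q0}"
    unfolding join_plane_def by blast
  also have "\<dots> = {(T ** A ** B) *v (u + transpose B *v z + (a + b)) |a b. a \<in> P0 \<and> b \<in> Q0}"
  proof (rule Collect_cong)
    fix y
    show "(\<exists>a b. y = T *v (A *v a) + T *v (B *v b) + ((T ** A) *v u + T *v z) \<and> a \<in> P0 \<and> b \<in> Q0)
      = (\<exists>a b. y = (T ** A ** B) *v (u + transpose B *v z + (a + b)) \<and> a \<in> P0 \<and> b \<in> Q0)"
      by (intro ex_cong1) (auto simp: eq)
  qed
  also have "\<dots> = placed X (T ** A ** B) (u + transpose B *v z)"
    unfolding placed_def X_def set_plus_eq by blast
  finally show ?thesis .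
qed

text \<open>
  The domain of the innermost variable at the plane \<open>TE\<close> with \<open>P = TA P0\<close>.
\<close>

lemma rotated_W0:
  assumes T: "orthogonal_matrix T" and A: "A \<in> rot E"
  shows "((*v) T ` ((*v) A ` P0))\<^sup>\<bottom> \<inter> ((*v) T ` E) = (*v) (T ** A) ` W0"
proof -
  have TA: "orthogonal_matrix (T ** A)" using T A by (simp add: orthogonal_matrix_mul rot_orthogonal)
  have "(*v) T ` E = (*v) (T ** A) ` E"
  proof -
    have "(*v) (T ** A) ` E = (*v) T ` ((*v) A ` E)" by (simp add: image_image matrix_vector_mul_assoc)
    then show ?thesis by (simp add: rot_image[OF subE A])
  qed
  moreover have "(*v) T ` ((*v) A ` P0) = (*v) (T ** A) ` P0"
    by (simp add: image_image matrix_vector_mul_assoc)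
  moreover have "inj ((*v) (T ** A))"
    by (rule inj_on_inverseI[where g="(*v) (transpose (T ** A))"]) (simp add: orthogonal_matrix_cancel[OF TA])
  ultimately show ?thesis
    by (simp add: orthogonal_matrix_image_comp[OF TA] image_Int[symmetric] W0_eq)
qed

lemma placed_foot_direction:
  assumes T: "orthogonal_matrix T" and z: "z \<in> E\<^sup>\<bottom>"
  shows "plane_foot (placed E T z) = T *v z" "plane_direction (placed E T z) = (*v) T ` E"
proof -
  have Tz: "T *v z \<in> ((*v) T ` E)\<^sup>\<bottom>" using z by (simp add: orthogonal_matrix_image_comp[OF T])
  show "plane_foot (placed E T z) = T *v z" "plane_direction (placed E T z) = (*v) T ` E"
    unfolding placed_eq
    by (rule plane_foot_eq[OF subspace_matrix_image[OF subE] Tz], rule plane_direction_eq[OF subspace_matrix_image[OF subE] Tz])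
qed

lemma measurable_inner_integrand:
  fixes f :: "(real^'n) set \<Rightarrow> 'b::topological_space"
  assumes f: "f \<in> borel_measurable (plane_algebra (affine_grassmannian (p + q)))" and \<eta>: "subspace \<eta>"
  shows "(\<lambda>z. f (join_plane (fst (fst z)) (snd (fst z)) (snd z + v))) \<in> borel_measurable
     ((plane_algebra (grassmannian \<eta> p) \<Otimes>\<^sub>M plane_algebra (grassmannian (\<eta>\<^sup>\<bottom>) q)) \<Otimes>\<^sub>M borel)"
  by (rule measurable_compose[OF join_plane_measurable[OF \<eta>] f])

lemma measurable_rotated_W:
  assumes \<eta>: "subspace \<eta>"
  shows "(\<lambda>z. (fst z)\<^sup>\<bottom> \<inter> \<eta>) \<in> plane_algebra (grassmannian \<eta> p) \<Otimes>\<^sub>M M \<rightarrow>\<^sub>M plane_algebra (grassmannian UNIV (dim \<eta> - p))"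
  by (rule measurable_compose[OF measurable_fst measurable_relative_comp[OF \<eta>]])

text \<open>
  All integrals of the transform are transported to the fixed frame: the random planes are images of \<open>P0\<close>
  and \<open>Q0\<close>, and the innermost Lebesgue measure is the image under \<open>TA\<close> of the one on \<open>W0\<close>.
\<close>

lemma strichartz_nn_placed:
  assumes f: "f \<in> borel_measurable (plane_algebra (affine_grassmannian (p + q)))"
    and T: "orthogonal_matrix T" and z: "z \<in> E\<^sup>\<bottom>"
  shows "strichartz_nn p q f (placed E T z) =
    (\<integral>\<^sup>+B. \<integral>\<^sup>+A. \<integral>\<^sup>+u. f (placed X (T ** A ** B) (u + transpose B *v z)) \<partial>lborel_on W0 \<partial>haar E \<partial>haar (E\<^sup>\<bottom>))"
proof -
  define \<eta> where "\<eta> = (*v) T ` E"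
  define v where "v = T *v z"
  have \<eta>: "subspace \<eta>" unfolding \<eta>_def by (rule subspace_matrix_image[OF subE])
  have \<eta>c: "\<eta>\<^sup>\<bottom> = (*v) T ` (E\<^sup>\<bottom>)" unfolding \<eta>_def by (rule orthogonal_matrix_image_comp[OF T])
  let ?Gp = "plane_algebra (grassmannian \<eta> p)" and ?Gq = "plane_algebra (grassmannian (\<eta>\<^sup>\<bottom>) q)"
  let ?RP = "random_plane E P0 T" and ?RQ = "random_plane (E\<^sup>\<bottom>) Q0 T"
  define F where "F P Q = (\<integral>\<^sup>+u. f (join_plane P Q (u + v)) \<partial>lborel_on (P\<^sup>\<bottom> \<inter> \<eta>))" for P Q
  have gp: "grassmannian_measure \<eta> p = completion ?RP"
    unfolding \<eta>_def by (rule grassmannian_measure_eq[OF subE P0_gr T])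
  have gq: "grassmannian_measure (\<eta>\<^sup>\<bottom>) q = completion ?RQ"
    unfolding \<eta>c by (rule grassmannian_measure_eq[OF subspace_orthogonal_comp Q0_gr T])
  note sets_haar[OF subE, measurable_cong] sets_haar[OF subspace_orthogonal_comp[of E], measurable_cong]
  have sRP[measurable_cong]: "sets ?RP = sets ?Gp" by (simp add: random_plane_def dims \<eta>_def)
  have sRQ[measurable_cong]: "sets ?RQ = sets ?Gq" by (simp add: random_plane_def dims \<eta>c)
  interpret RP: prob_space ?RP
    using random_plane_invariant[OF subE P0_gr T] by (simp add: invariant_grassmannian_measure_def)
  have mP[measurable]: "(\<lambda>A. (*v) T ` ((*v) A ` P0)) \<in> rot_borel E \<rightarrow>\<^sub>M ?Gp"
    unfolding \<eta>_def by (rule measurable_random_plane[OF subE P0_gr T])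
  have mQ[measurable]: "(\<lambda>B. (*v) T ` ((*v) B ` Q0)) \<in> rot_borel (E\<^sup>\<bottom>) \<rightarrow>\<^sub>M ?Gq"
    unfolding \<eta>c by (rule measurable_random_plane[OF subspace_orthogonal_comp Q0_gr T])
  have mF: "(\<lambda>x. F (fst x) (snd x)) \<in> borel_measurable (?Gp \<Otimes>\<^sub>M ?Gq)"
    unfolding F_def
    by (rule nn_integral_lborel_on_measurable[OF measurable_rotated_W[OF \<eta>] measurable_inner_integrand[OF f \<eta>]])
  have mF': "(\<lambda>P. F P Q) \<in> borel_measurable ?Gp" if "Q \<in> space ?Gq" for Q
    using measurable_compose[OF measurable_Pair2'[OF that] mF] by simp
  have [measurable]: "(\<lambda>(Q, P). F P Q) \<in> borel_measurable (?Gq \<Otimes>\<^sub>M ?RP)"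
    using measurable_compose[OF measurable_pair_swap' mF] by (simp add: split_beta')
  have "strichartz_nn p q f (placed E T z) = (\<integral>\<^sup>+Q. \<integral>\<^sup>+P. F P Q \<partial>?RP \<partial>?RQ)"
    unfolding strichartz_nn_def placed_foot_direction[OF T z] Let_def \<eta>_def[symmetric] v_def[symmetric] gp gq F_def
    by (simp add: nn_integral_completion lebesgue_subspace_eq subspace_inter subspace_orthogonal_comp \<eta>)
  also have "\<dots> = (\<integral>\<^sup>+B. \<integral>\<^sup>+P. F P ((*v) T ` ((*v) B ` Q0)) \<partial>?RP \<partial>haar (E\<^sup>\<bottom>))"
  proof -
    have "(\<lambda>Q. \<integral>\<^sup>+P. F P Q \<partial>?RP) \<in> borel_measurable ?Gq"
      by (rule RP.borel_measurable_nn_integral) measurable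
    then show ?thesis
      unfolding random_plane_def[of "E\<^sup>\<bottom>"] dims \<eta>c[symmetric]
      by (subst nn_integral_distr) simp_all
  qed
  also have "\<dots> = (\<integral>\<^sup>+B. \<integral>\<^sup>+A. F ((*v) T ` ((*v) A ` P0)) ((*v) T ` ((*v) B ` Q0)) \<partial>haar E \<partial>haar (E\<^sup>\<bottom>))"
  proof (rule nn_integral_cong)
    fix B assume "B \<in> space (haar (E\<^sup>\<bottom>))"
    then have "B \<in> rot (E\<^sup>\<bottom>)" by (simp add: space_haar subspace_orthogonal_comp)
    then have "(*v) T ` ((*v) B ` Q0) \<in> space ?Gq" using measurable_space[OF mQ, of B] by simp
    from mF'[OF this] show "(\<integral>\<^sup>+P. F P ((*v) T ` ((*v) B ` Q0)) \<partial>?RP)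
       = (\<integral>\<^sup>+A. F ((*v) T ` ((*v) A ` P0)) ((*v) T ` ((*v) B ` Q0)) \<partial>haar E)"
      unfolding random_plane_def[of E] dims \<eta>_def[symmetric]
      by (subst nn_integral_distr) simp_all
  qed
  also have "\<dots> = (\<integral>\<^sup>+B. \<integral>\<^sup>+A. \<integral>\<^sup>+u. f (placed X (T ** A ** B) (u + transpose B *v z)) \<partial>lborel_on W0 \<partial>haar E \<partial>haar (E\<^sup>\<bottom>))"
  proof (intro nn_integral_cong)
    fix A B assume "A \<in> space (haar E)" "B \<in> space (haar (E\<^sup>\<bottom>))"
    then have AB: "A \<in> rot E" "B \<in> rot (E\<^sup>\<bottom>)" by (simp_all add: space_haar subspace_orthogonal_comp subE)
    have TA: "orthogonal_matrix (T ** A)" using T AB by (simp add: orthogonal_matrix_mul rot_orthogonal)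
    have PQ: "((*v) T ` ((*v) A ` P0), (*v) T ` ((*v) B ` Q0)) \<in> space (?Gp \<Otimes>\<^sub>M ?Gq)"
      using measurable_space[OF mQ, of B] measurable_space[OF mP, of A] AB by (simp add: space_pair_measure)
    have [measurable]: "(\<lambda>u. f (join_plane ((*v) T ` ((*v) A ` P0)) ((*v) T ` ((*v) B ` Q0)) (u + v))) \<in> borel_measurable borel"
      using measurable_compose[OF measurable_Pair1'[OF PQ] measurable_inner_integrand[OF f \<eta>, of v]] by simp
    have "F ((*v) T ` ((*v) A ` P0)) ((*v) T ` ((*v) B ` Q0))
      = (\<integral>\<^sup>+u. f (join_plane ((*v) T ` ((*v) A ` P0)) ((*v) T ` ((*v) B ` Q0)) ((T ** A) *v u + v)) \<partial>lborel_on W0)"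
      unfolding F_def \<eta>_def rotated_W0[OF T AB(1)]
      by (rule nn_integral_lborel_on_rotate[OF subs(3) TA]) measurable
    also have "\<dots> = (\<integral>\<^sup>+u. f (placed X (T ** A ** B) (u + transpose B *v z)) \<partial>lborel_on W0)"
      using AE_lborel_on_in[OF subs(3)]
      by (intro nn_integral_cong_AE, eventually_elim) (simp add: v_def join_plane_placed AB z)
    finally show "F ((*v) T ` ((*v) A ` P0)) ((*v) T ` ((*v) B ` Q0))
       = (\<integral>\<^sup>+u. f (placed X (T ** A ** B) (u + transpose B *v z)) \<partial>lborel_on W0)" .
  qed
  finally show ?thesis .
qed

lemma strichartz_placed:
  assumes f: "f \<in> borel_measurable (plane_algebra (affine_grassmannian (p + q)))"
    and T: "orthogonal_matrix T" and z: "z \<in> E\<^sup>\<bottom>"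
  shows "strichartz p q f (placed E T z) =
    (LINT B|haar (E\<^sup>\<bottom>). LINT A|haar E. LINT u|lborel_on W0. f (placed X (T ** A ** B) (u + transpose B *v z)))"
proof -
  define \<eta> where "\<eta> = (*v) T ` E"
  define v where "v = T *v z"
  have \<eta>: "subspace \<eta>" unfolding \<eta>_def by (rule subspace_matrix_image[OF subE])
  have \<eta>c: "\<eta>\<^sup>\<bottom> = (*v) T ` (E\<^sup>\<bottom>)" unfolding \<eta>_def by (rule orthogonal_matrix_image_comp[OF T])
  let ?Gp = "plane_algebra (grassmannian \<eta> p)" and ?Gq = "plane_algebra (grassmannian (\<eta>\<^sup>\<bottom>) q)"
  let ?RP = "random_plane E P0 T" and ?RQ = "random_plane (E\<^sup>\<bottom>) Q0 T"
  define F where "F P Q = (LINT u|lborel_on (P\<^sup>\<bottom> \<inter> \<eta>). f (join_plane P Q (u + v)))" for P Q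
  have gp: "grassmannian_measure \<eta> p = completion ?RP"
    unfolding \<eta>_def by (rule grassmannian_measure_eq[OF subE P0_gr T])
  have gq: "grassmannian_measure (\<eta>\<^sup>\<bottom>) q = completion ?RQ"
    unfolding \<eta>c by (rule grassmannian_measure_eq[OF subspace_orthogonal_comp Q0_gr T])
  note sets_haar[OF subE, measurable_cong] sets_haar[OF subspace_orthogonal_comp[of E], measurable_cong]
  have sRP[measurable_cong]: "sets ?RP = sets ?Gp" by (simp add: random_plane_def dims \<eta>_def)
  have sRQ[measurable_cong]: "sets ?RQ = sets ?Gq" by (simp add: random_plane_def dims \<eta>c)
  have spP: "space ?RP = space ?Gp" and spQ: "space ?RQ = space ?Gq"
    using sets_eq_imp_space_eq[OF sRP] sets_eq_imp_space_eq[OF sRQ] by auto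
  interpret RP: prob_space ?RP
    using random_plane_invariant[OF subE P0_gr T] by (simp add: invariant_grassmannian_measure_def)
  have mP[measurable]: "(\<lambda>A. (*v) T ` ((*v) A ` P0)) \<in> rot_borel E \<rightarrow>\<^sub>M ?Gp"
    unfolding \<eta>_def by (rule measurable_random_plane[OF subE P0_gr T])
  have mQ[measurable]: "(\<lambda>B. (*v) T ` ((*v) B ` Q0)) \<in> rot_borel (E\<^sup>\<bottom>) \<rightarrow>\<^sub>M ?Gq"
    unfolding \<eta>c by (rule measurable_random_plane[OF subspace_orthogonal_comp Q0_gr T])
  have mF: "(\<lambda>x. F (fst x) (snd x)) \<in> borel_measurable (?Gp \<Otimes>\<^sub>M ?Gq)"
    unfolding F_def
    by (rule integral_lborel_on_measurable[OF measurable_rotated_W[OF \<eta>] measurable_inner_integrand[OF f \<eta>]])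
  have mF': "(\<lambda>P. F P Q) \<in> borel_measurable ?Gp" if "Q \<in> space ?Gq" for Q
    using measurable_compose[OF measurable_Pair2'[OF that] mF] by simp
  have [measurable]: "(\<lambda>(Q, P). F P Q) \<in> borel_measurable (?Gq \<Otimes>\<^sub>M ?RP)"
    using measurable_compose[OF measurable_pair_swap' mF] by (simp add: split_beta')
  have mFQ[measurable]: "(\<lambda>Q. LINT P|?RP. F P Q) \<in> borel_measurable ?Gq"
    by (rule RP.borel_measurable_lebesgue_integral) measurable
  have mu: "(\<lambda>u. f (join_plane P Q (u + v))) \<in> borel_measurable borel" if "P \<in> space ?Gp" "Q \<in> space ?Gq" for P Q
    using measurable_compose[OF measurable_Pair1'[of "(P, Q)" "?Gp \<Otimes>\<^sub>M ?Gq" borel] measurable_inner_integrand[OF f \<eta>, of v]] that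
    by (simp add: space_pair_measure)
  have "strichartz p q f (placed E T z) = (LINT Q|completion ?RQ. LINT P|completion ?RP. LINT u|completion (lborel_on (P\<^sup>\<bottom> \<inter> \<eta>)). f (join_plane P Q (u + v)))"
    unfolding strichartz_def placed_foot_direction[OF T z] Let_def \<eta>_def[symmetric] v_def[symmetric] gp gq
    by (simp add: lebesgue_subspace_eq subspace_inter subspace_orthogonal_comp \<eta>)
  also have "\<dots> = (LINT Q|completion ?RQ. LINT P|completion ?RP. F P Q)"
    unfolding F_def by (intro Bochner_Integration.integral_cong refl integral_completion)
      (simp add: spP spQ mu measurable_cong_sets[OF sets_lborel_on refl])
  also have "\<dots> = (LINT Q|completion ?RQ. LINT P|?RP. F P Q)"
    by (intro Bochner_Integration.integral_cong refl integral_completion) (simp add: spQ mF' measurable_cong_sets[OF sRP refl])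
  also have "\<dots> = (LINT Q|?RQ. LINT P|?RP. F P Q)"
    by (rule integral_completion) measurable
  also have "\<dots> = (LINT B|haar (E\<^sup>\<bottom>). LINT P|?RP. F P ((*v) T ` ((*v) B ` Q0)))"
    unfolding random_plane_def[of "E\<^sup>\<bottom>"] dims \<eta>c[symmetric]
    by (subst integral_distr) simp_all
  also have "\<dots> = (LINT B|haar (E\<^sup>\<bottom>). LINT A|haar E. F ((*v) T ` ((*v) A ` P0)) ((*v) T ` ((*v) B ` Q0)))"
  proof (rule Bochner_Integration.integral_cong[OF refl])
    fix B assume "B \<in> space (haar (E\<^sup>\<bottom>))"
    then have "B \<in> rot (E\<^sup>\<bottom>)" by (simp add: space_haar subspace_orthogonal_comp)
    then have "(*v) T ` ((*v) B ` Q0) \<in> space ?Gq" using measurable_space[OF mQ, of B] by simp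
    from mF'[OF this] show "(LINT P|?RP. F P ((*v) T ` ((*v) B ` Q0)))
       = (LINT A|haar E. F ((*v) T ` ((*v) A ` P0)) ((*v) T ` ((*v) B ` Q0)))"
      unfolding random_plane_def[of E] dims \<eta>_def[symmetric]
      by (subst integral_distr) simp_all
  qed
  also have "\<dots> = (LINT B|haar (E\<^sup>\<bottom>). LINT A|haar E. LINT u|lborel_on W0. f (placed X (T ** A ** B) (u + transpose B *v z)))"
  proof (intro Bochner_Integration.integral_cong[OF refl])
    fix A B assume "A \<in> space (haar E)" "B \<in> space (haar (E\<^sup>\<bottom>))"
    then have AB: "A \<in> rot E" "B \<in> rot (E\<^sup>\<bottom>)" by (simp_all add: space_haar subspace_orthogonal_comp subE)
    have TA: "orthogonal_matrix (T ** A)" using T AB by (simp add: orthogonal_matrix_mul rot_orthogonal)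
    have [measurable]: "(\<lambda>u. f (join_plane ((*v) T ` ((*v) A ` P0)) ((*v) T ` ((*v) B ` Q0)) (u + v))) \<in> borel_measurable borel"
      by (rule mu) (use measurable_space[OF mQ, of B] measurable_space[OF mP, of A] AB in simp_all)
    have pm: "(\<lambda>u. placed X (T ** A ** B) (u + transpose B *v z)) \<in> borel \<rightarrow>\<^sub>M plane_algebra (affine_grassmannian (p + q))"
      by (rule placed_measurable[OF X_gr]) (use TA AB in \<open>auto simp: rot_UNIV rot_borel_iff rot_orthogonal orthogonal_matrix_mul\<close>)
    have "F ((*v) T ` ((*v) A ` P0)) ((*v) T ` ((*v) B ` Q0))
      = (LINT u|lborel_on W0. f (join_plane ((*v) T ` ((*v) A ` P0)) ((*v) T ` ((*v) B ` Q0)) ((T ** A) *v u + v)))"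
      unfolding F_def \<eta>_def rotated_W0[OF T AB(1)] lborel_on_rotate[OF subs(3) TA]
      by (subst integral_distr) simp_all
    also have "\<dots> = (LINT u|lborel_on W0. f (placed X (T ** A ** B) (u + transpose B *v z)))"
    proof (rule integral_cong_AE)
      show "AE u in lborel_on W0. f (join_plane ((*v) T ` ((*v) A ` P0)) ((*v) T ` ((*v) B ` Q0)) ((T ** A) *v u + v))
        = f (placed X (T ** A ** B) (u + transpose B *v z))"
        using AE_lborel_on_in[OF subs(3)] by eventually_elim (simp add: v_def join_plane_placed AB z)
      show "(\<lambda>u. f (placed X (T ** A ** B) (u + transpose B *v z))) \<in> borel_measurable (lborel_on W0)"
        using measurable_compose[OF pm f] by simp
      show "(\<lambda>u. f (join_plane ((*v) T ` ((*v) A ` P0)) ((*v) T ` ((*v) B ` Q0)) ((T ** A) *v u + v))) \<in> borel_measurable (lborel_on W0)"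
        by measurable
    qed
    finally show "F ((*v) T ` ((*v) A ` P0)) ((*v) T ` ((*v) B ` Q0))
       = (LINT u|lborel_on W0. f (placed X (T ** A ** B) (u + transpose B *v z)))" .
  qed
  finally show ?thesis .
qed

end

lemma measurable_nn_integral3:
  assumes "sigma_finite_measure N1" "sigma_finite_measure N2" "sigma_finite_measure N3"
    and h: "h \<in> borel_measurable (((M \<Otimes>\<^sub>M N1) \<Otimes>\<^sub>M N2) \<Otimes>\<^sub>M N3)"
  shows "(\<lambda>a. \<integral>\<^sup>+x. \<integral>\<^sup>+y. \<integral>\<^sup>+u. h (((a, x), y), u) \<partial>N3 \<partial>N2 \<partial>N1) \<in> borel_measurable M"
  by (rule sigma_finite_measure.borel_measurable_nn_integral_fst[OF assms(1)
      sigma_finite_measure.borel_measurable_nn_integral_fst[OF assms(2)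
      sigma_finite_measure.borel_measurable_nn_integral_fst[OF assms(3) h]]])

lemma measurable_integral3:
  fixes h :: "_ \<Rightarrow> 'b::{banach, second_countable_topology}"
  assumes "sigma_finite_measure N1" "sigma_finite_measure N2" "sigma_finite_measure N3"
    and h: "h \<in> borel_measurable (((M \<Otimes>\<^sub>M N1) \<Otimes>\<^sub>M N2) \<Otimes>\<^sub>M N3)"
  shows "(\<lambda>a. LINT x|N1. LINT y|N2. LINT u|N3. h (((a, x), y), u)) \<in> borel_measurable M"
proof -
  have 1: "(\<lambda>a. LINT x|N. g (a, x)) \<in> borel_measurable M'"
    if "sigma_finite_measure N" "g \<in> borel_measurable (M' \<Otimes>\<^sub>M N)" for N and g :: "_ \<Rightarrow> 'b" and M'
    using sigma_finite_measure.borel_measurable_lebesgue_integral[OF that(1), of "\<lambda>a x. g (a, x)" M'] that(2)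
    by (simp add: split_beta')
  show ?thesis by (rule 1[OF assms(1) 1[OF assms(2) 1[OF assms(3) h]]])
qed

lemma const_rot: "A \<in> rot Y \<Longrightarrow> (\<lambda>_. A) \<in> M \<rightarrow>\<^sub>M rot_borel Y"
  by simp

context orthogonal_frame
begin

lemma rot_borel_E_mult:
  assumes "f \<in> M \<rightarrow>\<^sub>M rot_borel UNIV" "g \<in> M \<rightarrow>\<^sub>M rot_borel E" "h \<in> M \<rightarrow>\<^sub>M rot_borel (E\<^sup>\<bottom>)"
  shows "(\<lambda>x. f x ** g x ** h x) \<in> M \<rightarrow>\<^sub>M rot_borel UNIV"
  by (intro rot_borel_mult assms(1) rot_borel_mono[OF assms(2)] rot_borel_mono[OF assms(3)]) auto

lemma placed_X_measurable:
  "f \<in> M \<rightarrow>\<^sub>M rot_borel UNIV \<Longrightarrow> g \<in> borel_measurable M \<Longrightarrow>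
    (\<lambda>z. placed X (f z) (g z)) \<in> M \<rightarrow>\<^sub>M plane_algebra (affine_grassmannian (p + q))"
  by (rule placed_measurable[OF X_gr])

lemma infdist_placed_E_measurable:
  assumes "f \<in> M \<rightarrow>\<^sub>M rot_borel UNIV" "g \<in> borel_measurable M"
  shows "(\<lambda>z. infdist x (placed E (f z) (g z))) \<in> borel_measurable M"
  by (rule measurable_compose[OF placed_measurable[OF E_gr assms] borel_measurable_infdist_plane])

text \<open>
  The rotation \<open>A\<close> preserves \<open>E\<close> and fixes \<open>E\<^sup>\<bottom>\<close>, while \<open>B\<close> fixes \<open>E\<close> and cancels its inverse on the offset.
\<close>

lemma placed_E_rot:
  assumes "A \<in> rot E" "B \<in> rot (E\<^sup>\<bottom>)" "z \<in> E\<^sup>\<bottom>"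
  shows "placed E (T ** A ** B) (transpose B *v z) = placed E T z"
proof -
  have "(*v) (T ** A ** B) ` ((+) (transpose B *v z) ` E) = (*v) T ` ((*v) A ` ((*v) B ` ((+) (transpose B *v z) ` E)))"
    by (simp add: image_image flip: matrix_vector_mul_assoc)
  also have "(*v) B ` ((+) (transpose B *v z) ` E) = (+) z ` E"
    using rot_image_comp[OF assms(2) orthogonal_comp_subset]
    by (simp only: matrix_image_translation orthogonal_matrix_cancel(2)[OF rot_orthogonal[OF assms(2)]])
  also have "(*v) A ` ((+) z ` E) = (+) z ` E"
    by (simp only: matrix_image_translation rot_image[OF subE assms(1)] rot_fix[OF assms(1,3)])
  finally show ?thesis by (simp only: placed_def)
qed

text \<open>
  Applying the Borel section to the direction of a plane writes every \<open>k\<close>-plane measurably as \<open>T(z + E)\<close>. Hence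
  a function of \<open>\<zeta>\<close> is measurable as soon as it is measurable in \<open>T\<close> and \<open>z\<close>.
\<close>

lemma frame_section:
  "\<exists>\<sigma> \<in> plane_algebra (affine_grassmannian (p + l)) \<rightarrow>\<^sub>M rot_borel UNIV \<Otimes>\<^sub>M borel.
     \<forall>\<zeta>\<in>affine_grassmannian (p + l). fst (\<sigma> \<zeta>) \<in> rot UNIV \<and> snd (\<sigma> \<zeta>) \<in> E\<^sup>\<bottom> \<and> placed E (fst (\<sigma> \<zeta>)) (snd (\<sigma> \<zeta>)) = \<zeta>"
proof -
  from borel_section[OF subspace_UNIV E_gr]
  obtain s where s[measurable]: "s \<in> plane_algebra (grassmannian UNIV (p + l)) \<rightarrow>\<^sub>M rot_borel UNIV"
    and sE: "\<forall>\<xi>\<in>grassmannian UNIV (p + l). (*v) (s \<xi>) ` E = \<xi>" by (rule bexE)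
  have sd[measurable]: "(\<lambda>\<zeta>. s (plane_direction \<zeta>)) \<in> plane_algebra (affine_grassmannian (p + l)) \<rightarrow>\<^sub>M rot_borel UNIV"
    by (rule measurable_compose[OF measurable_plane_direction s])
  show ?thesis
  proof (intro bexI[of _ "\<lambda>\<zeta>. (s (plane_direction \<zeta>), transpose (s (plane_direction \<zeta>)) *v plane_foot \<zeta>)"] ballI)
    show "(\<lambda>\<zeta>. (s (plane_direction \<zeta>), transpose (s (plane_direction \<zeta>)) *v plane_foot \<zeta>))
      \<in> plane_algebra (affine_grassmannian (p + l)) \<rightarrow>\<^sub>M rot_borel UNIV \<Otimes>\<^sub>M borel" by measurable
    fix \<zeta> :: "(real^'n) set" assume "\<zeta> \<in> affine_grassmannian (p + l)"
    then obtain \<xi> v where \<xi>: "\<xi> \<in> grassmannian UNIV (p + l)" "v \<in> \<xi>\<^sup>\<bottom>" "\<zeta> = (+) v ` \<xi>"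
      by (rule affine_grassmannianE)
    have sub: "subspace \<xi>" using \<xi>(1) by (rule grassmannianD)
    have fd: "plane_foot \<zeta> = v" "plane_direction \<zeta> = \<xi>"
      unfolding \<xi>(3) by (rule plane_foot_eq[OF sub \<xi>(2)], rule plane_direction_eq[OF sub \<xi>(2)])
    have S: "s \<xi> \<in> rot UNIV" using rot_borel_space[OF s, of \<xi>] \<xi>(1) by simp
    note o = rot_orthogonal[OF S]
    have sx: "(*v) (s \<xi>) ` E = \<xi>" using sE \<xi>(1) by blast
    have "\<xi>\<^sup>\<bottom> = (*v) (s \<xi>) ` (E\<^sup>\<bottom>)" using orthogonal_matrix_image_comp[OF o, of E] sx by simp
    then obtain w where w: "w \<in> E\<^sup>\<bottom>" "v = s \<xi> *v w" using \<xi>(2) by auto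
    have z: "transpose (s \<xi>) *v v = w" by (simp add: w(2) orthogonal_matrix_cancel[OF o])
    have "placed E (s \<xi>) w = \<zeta>" unfolding placed_eq sx \<xi>(3) w(2) ..
    then show "fst (s (plane_direction \<zeta>), transpose (s (plane_direction \<zeta>)) *v plane_foot \<zeta>) \<in> rot UNIV \<and>
       snd (s (plane_direction \<zeta>), transpose (s (plane_direction \<zeta>)) *v plane_foot \<zeta>) \<in> E\<^sup>\<bottom> \<and>
       placed E (fst (s (plane_direction \<zeta>), transpose (s (plane_direction \<zeta>)) *v plane_foot \<zeta>))
        (snd (s (plane_direction \<zeta>), transpose (s (plane_direction \<zeta>)) *v plane_foot \<zeta>)) = \<zeta>"
      unfolding fd by (simp add: S z w(1))
  qed
qed

text \<open>
  The variables \<open>((((T, z), B), A), u)\<close> of the composed integral, nested as in iterated integration.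
\<close>
abbreviation params :: "(((((real^'n^'n) \<times> (real^'n)) \<times> (real^'n^'n)) \<times> (real^'n^'n)) \<times> (real^'n)) measure" where
  "params \<equiv> (((rot_borel UNIV \<Otimes>\<^sub>M borel) \<Otimes>\<^sub>M rot_borel (E\<^sup>\<bottom>)) \<Otimes>\<^sub>M rot_borel E) \<Otimes>\<^sub>M borel"

lemma placed_params:
  "(\<lambda>((((T, z), B), A), u). placed X (T ** A ** B) (u + transpose B *v z))
     \<in> params \<rightarrow>\<^sub>M plane_algebra (affine_grassmannian (p + q))"
  unfolding split_beta'
  by (rule placed_X_measurable[OF rot_borel_E_mult]) measurable

lemma dist_params:
  "(\<lambda>((((T, z), B), A), u). infdist x (placed E T z)) \<in> borel_measurable params"
  unfolding split_beta'
  by (rule infdist_placed_E_measurable) measurable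

lemma strichartz_nn_measurable:
  fixes G :: "real \<times> (real^'n) set \<Rightarrow> ennreal"
  assumes G: "G \<in> borel_measurable (borel \<Otimes>\<^sub>M plane_algebra (affine_grassmannian (p + q)))"
  shows "(\<lambda>\<zeta>. strichartz_nn p q (\<lambda>\<tau>. G (infdist x \<zeta>, \<tau>)) \<zeta>) \<in> borel_measurable (plane_algebra (affine_grassmannian (p + l)))"
proof -
  note sets_haar[OF subE, measurable_cong] sets_haar[OF subspace_orthogonal_comp[of E], measurable_cong]
  interpret HE: prob_space "haar E" by (rule prob_haar[OF subE])
  interpret HF: prob_space "haar (E\<^sup>\<bottom>)" by (rule prob_haar[OF subspace_orthogonal_comp])
  interpret KW: sigma_finite_measure "lborel_on W0" by (rule sigma_finite_lborel_on[OF subs(3)])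
  have Gs: "(\<lambda>\<tau>. G (s, \<tau>)) \<in> borel_measurable (plane_algebra (affine_grassmannian (p + q)))" for s
    by (rule measurable_compose[OF measurable_Pair1' G]) simp
  from frame_section obtain \<sigma> where \<sigma>: "\<sigma> \<in> plane_algebra (affine_grassmannian (p + l)) \<rightarrow>\<^sub>M rot_borel UNIV \<Otimes>\<^sub>M borel"
    and \<sigma>E: "\<forall>\<zeta>\<in>affine_grassmannian (p + l). fst (\<sigma> \<zeta>) \<in> rot UNIV \<and> snd (\<sigma> \<zeta>) \<in> E\<^sup>\<bottom> \<and> placed E (fst (\<sigma> \<zeta>)) (snd (\<sigma> \<zeta>)) = \<zeta>"
    by (rule bexE)
  let ?h = "\<lambda>y. G (infdist x (placed E (fst (fst (fst (fst y)))) (snd (fst (fst (fst y))))),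
     placed X (fst (fst (fst (fst y))) ** snd (fst y) ** snd (fst (fst y))) (snd y + transpose (snd (fst (fst y))) *v snd (fst (fst (fst y)))))"
  have "?h \<in> borel_measurable params"
    by (rule measurable_compose[OF measurable_Pair[OF dist_params[unfolded split_beta'] placed_params[unfolded split_beta']] G])
  then have h: "?h \<in> borel_measurable ((((rot_borel UNIV \<Otimes>\<^sub>M borel) \<Otimes>\<^sub>M haar (E\<^sup>\<bottom>)) \<Otimes>\<^sub>M haar E) \<Otimes>\<^sub>M lborel_on W0)"
    by (simp cong: measurable_cong_sets sets_pair_measure_cong)
  have "(\<lambda>a. \<integral>\<^sup>+B. \<integral>\<^sup>+A. \<integral>\<^sup>+u. G (infdist x (placed E (fst a) (snd a)), placed X (fst a ** A ** B) (u + transpose B *v snd a))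
       \<partial>lborel_on W0 \<partial>haar E \<partial>haar (E\<^sup>\<bottom>)) \<in> borel_measurable (rot_borel UNIV \<Otimes>\<^sub>M borel)"
    using measurable_nn_integral3[OF HF.sigma_finite_measure_axioms HE.sigma_finite_measure_axioms KW.sigma_finite_measure_axioms h] by simp
  from measurable_compose[OF \<sigma> this] show ?thesis
  proof (subst measurable_cong)
    fix \<zeta> :: "(real^'n) set" assume "\<zeta> \<in> space (plane_algebra (affine_grassmannian (p + l)))"
    then have *: "fst (\<sigma> \<zeta>) \<in> rot UNIV" "snd (\<sigma> \<zeta>) \<in> E\<^sup>\<bottom>" "placed E (fst (\<sigma> \<zeta>)) (snd (\<sigma> \<zeta>)) = \<zeta>" using \<sigma>E by auto
    show "strichartz_nn p q (\<lambda>\<tau>. G (infdist x \<zeta>, \<tau>)) \<zeta> =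
      (\<integral>\<^sup>+B. \<integral>\<^sup>+A. \<integral>\<^sup>+u. G (infdist x (placed E (fst (\<sigma> \<zeta>)) (snd (\<sigma> \<zeta>))), placed X (fst (\<sigma> \<zeta>) ** A ** B) (u + transpose B *v snd (\<sigma> \<zeta>)))
       \<partial>lborel_on W0 \<partial>haar E \<partial>haar (E\<^sup>\<bottom>))"
      using strichartz_nn_placed[OF Gs[of "infdist x \<zeta>"] rot_orthogonal[OF *(1)] *(2)] by (simp only: *(3))
  qed
qed

lemma strichartz_measurable:
  fixes f :: "(real^'n) set \<Rightarrow> complex"
  assumes f: "f \<in> borel_measurable (plane_algebra (affine_grassmannian (p + q)))"
  shows "strichartz p q f \<in> borel_measurable (plane_algebra (affine_grassmannian (p + l)))"
proof -
  note sets_haar[OF subE, measurable_cong] sets_haar[OF subspace_orthogonal_comp[of E], measurable_cong]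
  interpret HE: prob_space "haar E" by (rule prob_haar[OF subE])
  interpret HF: prob_space "haar (E\<^sup>\<bottom>)" by (rule prob_haar[OF subspace_orthogonal_comp])
  interpret KW: sigma_finite_measure "lborel_on W0" by (rule sigma_finite_lborel_on[OF subs(3)])
  from frame_section obtain \<sigma> where \<sigma>: "\<sigma> \<in> plane_algebra (affine_grassmannian (p + l)) \<rightarrow>\<^sub>M rot_borel UNIV \<Otimes>\<^sub>M borel"
    and \<sigma>E: "\<forall>\<zeta>\<in>affine_grassmannian (p + l). fst (\<sigma> \<zeta>) \<in> rot UNIV \<and> snd (\<sigma> \<zeta>) \<in> E\<^sup>\<bottom> \<and> placed E (fst (\<sigma> \<zeta>)) (snd (\<sigma> \<zeta>)) = \<zeta>"
    by (rule bexE)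
  let ?h = "\<lambda>y. f (placed X (fst (fst (fst (fst y))) ** snd (fst y) ** snd (fst (fst y))) (snd y + transpose (snd (fst (fst y))) *v snd (fst (fst (fst y)))))"
  have "?h \<in> borel_measurable params"
    by (rule measurable_compose[OF placed_params[unfolded split_beta'] f])
  then have h: "?h \<in> borel_measurable ((((rot_borel UNIV \<Otimes>\<^sub>M borel) \<Otimes>\<^sub>M haar (E\<^sup>\<bottom>)) \<Otimes>\<^sub>M haar E) \<Otimes>\<^sub>M lborel_on W0)"
    by (simp cong: measurable_cong_sets sets_pair_measure_cong)
  have "(\<lambda>a. LINT B|haar (E\<^sup>\<bottom>). LINT A|haar E. LINT u|lborel_on W0. f (placed X (fst a ** A ** B) (u + transpose B *v snd a)))
      \<in> borel_measurable (rot_borel UNIV \<Otimes>\<^sub>M borel)"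
    using measurable_integral3[OF HF.sigma_finite_measure_axioms HE.sigma_finite_measure_axioms KW.sigma_finite_measure_axioms h] by simp
  from measurable_compose[OF \<sigma> this] show ?thesis
  proof (subst measurable_cong)
    fix \<zeta> :: "(real^'n) set" assume "\<zeta> \<in> space (plane_algebra (affine_grassmannian (p + l)))"
    then have *: "fst (\<sigma> \<zeta>) \<in> rot UNIV" "snd (\<sigma> \<zeta>) \<in> E\<^sup>\<bottom>" "placed E (fst (\<sigma> \<zeta>)) (snd (\<sigma> \<zeta>)) = \<zeta>" using \<sigma>E by auto
    show "strichartz p q f \<zeta> =
      (LINT B|haar (E\<^sup>\<bottom>). LINT A|haar E. LINT u|lborel_on W0. f (placed X (fst (\<sigma> \<zeta>) ** A ** B) (u + transpose B *v snd (\<sigma> \<zeta>))))"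
      using strichartz_placed[OF f rot_orthogonal[OF *(1)] *(2)] by (simp only: *(3))
  qed
qed

section \<open>Exchanging the order of the two planes\<close>

text \<open>
  For fixed \<open>A\<close> and \<open>B\<close>, the rotation \<open>B\<close> of \<open>E\<^sup>\<bottom>\<close> preserves Lebesgue measure in \<open>z\<close>, and right multiplication by \<open>AB\<close>
  preserves Haar measure in \<open>T\<close>. The averages over \<open>A\<close> and \<open>B\<close> are then averages of a constant.
\<close>

lemma nn_integral_absorb_rotations:
  fixes \<Phi> :: "real^'n^'n \<Rightarrow> real^'n \<Rightarrow> real^'n \<Rightarrow> ennreal"
  assumes \<Phi>: "(\<lambda>x. \<Phi> (fst (fst x)) (snd (fst x)) (snd x)) \<in> borel_measurable ((rot_borel UNIV \<Otimes>\<^sub>M borel) \<Otimes>\<^sub>M borel)"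
  shows "(\<integral>\<^sup>+T. \<integral>\<^sup>+z. \<integral>\<^sup>+B. \<integral>\<^sup>+A. \<integral>\<^sup>+u. \<Phi> (T ** A ** B) (transpose B *v z) u
       \<partial>lborel_on W0 \<partial>haar E \<partial>haar (E\<^sup>\<bottom>) \<partial>lborel_on (E\<^sup>\<bottom>) \<partial>haar UNIV)
    = (\<integral>\<^sup>+T. \<integral>\<^sup>+z. \<integral>\<^sup>+u. \<Phi> T z u \<partial>lborel_on W0 \<partial>lborel_on (E\<^sup>\<bottom>) \<partial>haar UNIV)"
proof -
  note sets_haar[OF subE, measurable_cong] sets_haar[OF subspace_orthogonal_comp[of E], measurable_cong]
    sets_haar[OF subspace_UNIV, measurable_cong]
  interpret HE: prob_space "haar E" by (rule prob_haar[OF subE])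
  interpret HF: prob_space "haar (E\<^sup>\<bottom>)" by (rule prob_haar[OF subspace_orthogonal_comp])
  interpret HU: prob_space "haar (UNIV :: (real^'n) set)" by (rule prob_haar[OF subspace_UNIV])
  interpret KW: sigma_finite_measure "lborel_on W0" by (rule sigma_finite_lborel_on[OF subs(3)])
  interpret KE: sigma_finite_measure "lborel_on (E\<^sup>\<bottom>)" by (rule sigma_finite_lborel_on[OF subspace_orthogonal_comp])
  interpret FK: pair_sigma_finite "haar (E\<^sup>\<bottom>)" "lborel_on (E\<^sup>\<bottom>)" ..
  interpret EK: pair_sigma_finite "haar E" "lborel_on (E\<^sup>\<bottom>)" ..
  interpret FU: pair_sigma_finite "haar (E\<^sup>\<bottom>)" "haar (UNIV :: (real^'n) set)" ..
  interpret EU: pair_sigma_finite "haar E" "haar (UNIV :: (real^'n) set)" ..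
  define \<Theta> where "\<Theta> T z = (\<integral>\<^sup>+u. \<Phi> T z u \<partial>lborel_on W0)" for T z
  have \<Theta>0: "(\<lambda>x. \<Theta> (fst x) (snd x)) \<in> borel_measurable (rot_borel UNIV \<Otimes>\<^sub>M borel)"
    unfolding \<Theta>_def by (rule KW.borel_measurable_nn_integral) (use \<Phi> in \<open>simp add: split_beta' cong: measurable_cong_sets sets_pair_measure_cong\<close>)
  have \<Theta>m: "(\<lambda>x. \<Theta> (f x ** g x ** h x) (k x)) \<in> borel_measurable M"
    if "f \<in> M \<rightarrow>\<^sub>M rot_borel UNIV" "g \<in> M \<rightarrow>\<^sub>M rot_borel E" "h \<in> M \<rightarrow>\<^sub>M rot_borel (E\<^sup>\<bottom>)" "k \<in> borel_measurable M" for M f g h k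
    using measurable_compose[OF measurable_Pair[OF rot_borel_E_mult[OF that(1-3)] that(4)] \<Theta>0] by simp
  define \<Omega> where "\<Omega> T = (\<integral>\<^sup>+z. \<Theta> T z \<partial>lborel_on (E\<^sup>\<bottom>))" for T
  have \<Omega>0: "\<Omega> \<in> borel_measurable (rot_borel UNIV)"
    unfolding \<Omega>_def[abs_def] by (rule KE.borel_measurable_nn_integral) (use \<Theta>0 in \<open>simp add: split_beta' cong: measurable_cong_sets sets_pair_measure_cong\<close>)
  have \<Omega>m: "(\<lambda>x. \<Omega> (f x ** g x ** h x)) \<in> borel_measurable M"
    if "f \<in> M \<rightarrow>\<^sub>M rot_borel UNIV" "g \<in> M \<rightarrow>\<^sub>M rot_borel E" "h \<in> M \<rightarrow>\<^sub>M rot_borel (E\<^sup>\<bottom>)" for M f g h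
    by (rule measurable_compose[OF rot_borel_E_mult[OF that] \<Omega>0])
  have inner: "(\<integral>\<^sup>+z. \<integral>\<^sup>+B. \<integral>\<^sup>+A. \<Theta> (T ** A ** B) (transpose B *v z) \<partial>haar E \<partial>haar (E\<^sup>\<bottom>) \<partial>lborel_on (E\<^sup>\<bottom>))
    = (\<integral>\<^sup>+B. \<integral>\<^sup>+A. \<Omega> (T ** A ** B) \<partial>haar E \<partial>haar (E\<^sup>\<bottom>))" if T: "T \<in> rot UNIV" for T :: "real^'n^'n"
  proof -
    have "(\<integral>\<^sup>+z. \<integral>\<^sup>+B. \<integral>\<^sup>+A. \<Theta> (T ** A ** B) (transpose B *v z) \<partial>haar E \<partial>haar (E\<^sup>\<bottom>) \<partial>lborel_on (E\<^sup>\<bottom>))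
       = (\<integral>\<^sup>+B. \<integral>\<^sup>+z. \<integral>\<^sup>+A. \<Theta> (T ** A ** B) (transpose B *v z) \<partial>haar E \<partial>lborel_on (E\<^sup>\<bottom>) \<partial>haar (E\<^sup>\<bottom>))"
    proof (rule FK.Fubini')
      have [measurable]: "(\<lambda>x. \<Theta> (T ** snd x ** fst (fst x)) (transpose (fst (fst x)) *v (snd (fst x))))
        \<in> borel_measurable ((haar (E\<^sup>\<bottom>) \<Otimes>\<^sub>M lborel_on (E\<^sup>\<bottom>)) \<Otimes>\<^sub>M haar E)"
        by (rule \<Theta>m[OF const_rot[OF T]]) measurable
      show "(\<lambda>(B, z). \<integral>\<^sup>+A. \<Theta> (T ** A ** B) (transpose B *v z) \<partial>haar E) \<in> borel_measurable (haar (E\<^sup>\<bottom>) \<Otimes>\<^sub>M lborel_on (E\<^sup>\<bottom>))"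
        unfolding split_beta' by (rule HE.borel_measurable_nn_integral) (simp add: split_beta')
    qed
    also have "\<dots> = (\<integral>\<^sup>+B. \<integral>\<^sup>+A. \<Omega> (T ** A ** B) \<partial>haar E \<partial>haar (E\<^sup>\<bottom>))"
    proof (rule nn_integral_cong)
      fix B assume "B \<in> space (haar (E\<^sup>\<bottom>))"
      then have B: "B \<in> rot (E\<^sup>\<bottom>)" by (simp add: space_haar subspace_orthogonal_comp)
      have 1: "(\<lambda>z. \<integral>\<^sup>+A. \<Theta> (T ** A ** B) (transpose B *v z) \<partial>haar E) \<in> borel_measurable borel"
        by (rule HE.borel_measurable_nn_integral, unfold split_beta', rule \<Theta>m[OF const_rot[OF T] _ const_rot[OF B]]) measurable
      have "(\<integral>\<^sup>+z. \<integral>\<^sup>+A. \<Theta> (T ** A ** B) (transpose B *v z) \<partial>haar E \<partial>lborel_on (E\<^sup>\<bottom>))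
         = (\<integral>\<^sup>+z. \<integral>\<^sup>+A. \<Theta> (T ** A ** B) z \<partial>haar E \<partial>lborel_on (E\<^sup>\<bottom>))"
        using nn_integral_lborel_on_rotate[OF subspace_orthogonal_comp[of E] rot_orthogonal[OF B] 1]
        by (simp add: rot_image[OF subspace_orthogonal_comp B] orthogonal_matrix_cancel[OF rot_orthogonal[OF B]])
      also have "\<dots> = (\<integral>\<^sup>+A. \<Omega> (T ** A ** B) \<partial>haar E)"
        unfolding \<Omega>_def
        by (rule EK.Fubini', unfold split_beta', rule \<Theta>m[OF const_rot[OF T] _ const_rot[OF B]]) measurable
      finally show "(\<integral>\<^sup>+z. \<integral>\<^sup>+A. \<Theta> (T ** A ** B) (transpose B *v z) \<partial>haar E \<partial>lborel_on (E\<^sup>\<bottom>))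
         = (\<integral>\<^sup>+A. \<Omega> (T ** A ** B) \<partial>haar E)" .
    qed
    finally show ?thesis .
  qed
  have "(\<integral>\<^sup>+T. \<integral>\<^sup>+z. \<integral>\<^sup>+B. \<integral>\<^sup>+A. \<integral>\<^sup>+u. \<Phi> (T ** A ** B) (transpose B *v z) u
       \<partial>lborel_on W0 \<partial>haar E \<partial>haar (E\<^sup>\<bottom>) \<partial>lborel_on (E\<^sup>\<bottom>) \<partial>haar UNIV)
     = (\<integral>\<^sup>+T. \<integral>\<^sup>+B. \<integral>\<^sup>+A. \<Omega> (T ** A ** B) \<partial>haar E \<partial>haar (E\<^sup>\<bottom>) \<partial>haar UNIV)"
    unfolding \<Theta>_def[symmetric] by (rule nn_integral_cong) (simp add: inner space_haar)
  also have "\<dots> = (\<integral>\<^sup>+B. \<integral>\<^sup>+T. \<integral>\<^sup>+A. \<Omega> (T ** A ** B) \<partial>haar E \<partial>haar UNIV \<partial>haar (E\<^sup>\<bottom>))"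
  proof (rule FU.Fubini')
    show "(\<lambda>(B, T). \<integral>\<^sup>+A. \<Omega> (T ** A ** B) \<partial>haar E) \<in> borel_measurable (haar (E\<^sup>\<bottom>) \<Otimes>\<^sub>M haar UNIV)"
      unfolding split_beta' by (rule HE.borel_measurable_nn_integral, unfold split_beta', rule \<Omega>m) measurable
  qed
  also have "\<dots> = (\<integral>\<^sup>+B. \<integral>\<^sup>+A. \<integral>\<^sup>+T. \<Omega> (T ** A ** B) \<partial>haar UNIV \<partial>haar E \<partial>haar (E\<^sup>\<bottom>))"
  proof (rule nn_integral_cong)
    fix B assume "B \<in> space (haar (E\<^sup>\<bottom>))"
    then have B: "B \<in> rot (E\<^sup>\<bottom>)" by (simp add: space_haar subspace_orthogonal_comp)
    show "(\<integral>\<^sup>+T. \<integral>\<^sup>+A. \<Omega> (T ** A ** B) \<partial>haar E \<partial>haar UNIV) = (\<integral>\<^sup>+A. \<integral>\<^sup>+T. \<Omega> (T ** A ** B) \<partial>haar UNIV \<partial>haar E)"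
      by (rule EU.Fubini', unfold split_beta', rule \<Omega>m[OF _ _ const_rot[OF B]]) measurable
  qed
  also have "\<dots> = (\<integral>\<^sup>+B. \<integral>\<^sup>+A. \<integral>\<^sup>+T. \<Omega> T \<partial>haar UNIV \<partial>haar E \<partial>haar (E\<^sup>\<bottom>))"
  proof (rule nn_integral_cong, rule nn_integral_cong)
    fix A B assume "B \<in> space (haar (E\<^sup>\<bottom>))" "A \<in> space (haar E)"
    then have "A ** B \<in> rot UNIV"
      using rot_mono[of E UNIV] rot_mono[of "E\<^sup>\<bottom>" UNIV]
      by (auto simp: space_haar subspace_orthogonal_comp subE intro!: rot_mult)
    from haar_right[OF subspace_UNIV this \<Omega>0]
    show "(\<integral>\<^sup>+T. \<Omega> (T ** A ** B) \<partial>haar UNIV) = (\<integral>\<^sup>+T. \<Omega> T \<partial>haar UNIV)"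
      by (simp add: matrix_mul_assoc)
  qed
  also have "\<dots> = (\<integral>\<^sup>+T. \<Omega> T \<partial>haar UNIV)" by (simp add: HE.emeasure_space_1 HF.emeasure_space_1)
  finally show ?thesis by (simp only: \<Omega>_def \<Theta>_def)
qed

end

context orthogonal_frame
begin

lemma translate_absorb:
  assumes "subspace Y" "a \<in> Y" shows "(+) (w + a) ` Y = (+) w ` Y"
proof -
  have "(+) a ` Y = Y"
  proof (rule equalityI)
    show "(+) a ` Y \<subseteq> Y" using assms by (auto intro: subspace_add)
    show "Y \<subseteq> (+) a ` Y"
    proof
      fix y assume "y \<in> Y"
      then have "y - a \<in> Y" using assms by (simp add: subspace_diff)
      then have "a + (y - a) \<in> (+) a ` Y" by (rule imageI)
      then show "y \<in> (+) a ` Y" by simp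
    qed
  qed
  then have "(+) w ` ((+) a ` Y) = (+) w ` Y" by simp
  then show ?thesis by (simp add: image_image add.assoc)
qed

lemma placed_X_absorb: "a \<in> X \<Longrightarrow> placed X T (w + a) = placed X T w"
  by (simp only: placed_def translate_absorb[OF subX])

text \<open>
  The distance is the length of the component of \<open>T\<^sup>-\<^sup>1x - (a + b)\<close> orthogonal to \<open>E\<close>, that is in \<open>Q0 + V0\<close>. Adding
  \<open>u\<close> does not change its \<open>V0\<close>-part, which makes that part a function of the offset \<open>u + b\<close> of the small plane.
\<close>

lemma infdist_placed_split:
  assumes T: "orthogonal_matrix T" and "a \<in> Q0" "b \<in> V0" "u \<in> W0"
  shows "infdist x (placed E T (a + b)) =
    sqrt ((norm (a - proj Q0 (transpose T *v x)))\<^sup>2 + (norm (proj V0 (transpose T *v x - (u + b))))\<^sup>2)"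
proof -
  define d where "d = transpose T *v x - (a + b)"
  have aV: "proj V0 a = 0" by (rule proj_zero[OF subs(4)]) (use orth(5) assms in blast)
  have bQ: "proj Q0 b = 0" by (rule proj_zero[OF subs(2)]) (use orth_sym(5) assms in blast)
  have uV: "proj V0 u = 0" by (rule proj_zero[OF subs(4)]) (use orth(6) assms in blast)
  have "d - proj E d = proj (E\<^sup>\<bottom>) d" by (simp add: proj_orthogonal_comp[OF subE])
  also have "\<dots> = proj Q0 d + proj V0 d" unfolding E_comp by (rule proj_sum[OF subs(2,4) orth(5)])
  finally have "infdist x (placed E T (a + b)) = norm (proj Q0 d + proj V0 d)"
    using infdist_placed[OF subE T, of x "a + b"] by (simp add: d_def)
  also have "\<dots> = sqrt ((norm (proj Q0 d))\<^sup>2 + (norm (proj V0 d))\<^sup>2)"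
  proof -
    have "orthogonal (proj Q0 d) (proj V0 d)"
      using orthogonal_comp_inner(1)[of "proj V0 d" Q0 "proj Q0 d"] proj_in[OF subs(2), of d] proj_in[OF subs(4), of d] orth_sym(5)
      by (auto simp: orthogonal_def)
    from norm_add_Pythagorean[OF this] show ?thesis by (metis norm_ge_zero real_sqrt_unique)
  qed
  also have "proj Q0 d = - (a - proj Q0 (transpose T *v x))"
    unfolding d_def using assms by (simp add: proj_diff proj_add subs bQ)
  also have "proj V0 d = proj V0 (transpose T *v x - (u + b))"
    unfolding d_def using assms by (simp add: proj_diff proj_add subs aV uV)
  finally show ?thesis by (simp only: norm_minus_cancel)
qed

text \<open>
  The offset \<open>a + b\<close> in \<open>E\<^sup>\<bottom>\<close> and the vector \<open>u\<close> in \<open>W0\<close> are regrouped as \<open>y\<close> in \<open>Q0\<close>, a translate of \<open>a\<close>, and \<open>w = u + b\<close> in \<open>X\<^sup>\<bottom>\<close>. The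
  small plane depends on \<open>w\<close> only.
\<close>

lemma nn_integral_split_offset:
  fixes G :: "real \<times> (real^'n) set \<Rightarrow> ennreal"
  assumes G: "G \<in> borel_measurable (borel \<Otimes>\<^sub>M plane_algebra (affine_grassmannian (p + q)))"
    and T: "T \<in> rot UNIV"
  shows "(\<integral>\<^sup>+z. \<integral>\<^sup>+u. G (infdist x (placed E T z), placed X T (u + z)) \<partial>lborel_on W0 \<partial>lborel_on (E\<^sup>\<bottom>))
    = (\<integral>\<^sup>+w. \<integral>\<^sup>+y. G (sqrt ((norm y)\<^sup>2 + (norm (proj V0 (transpose T *v x - w)))\<^sup>2), placed X T w) \<partial>lborel_on Q0 \<partial>lborel_on (X\<^sup>\<bottom>))"
proof -
  interpret KW: sigma_finite_measure "lborel_on W0" by (rule sigma_finite_lborel_on[OF subs(3)])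
  interpret KV: sigma_finite_measure "lborel_on V0" by (rule sigma_finite_lborel_on[OF subs(4)])
  interpret KQ: sigma_finite_measure "lborel_on Q0" by (rule sigma_finite_lborel_on[OF subs(2)])
  interpret KX: sigma_finite_measure "lborel_on (X\<^sup>\<bottom>)" by (rule sigma_finite_lborel_on[OF subspace_orthogonal_comp])
  interpret VW: pair_sigma_finite "lborel_on W0" "lborel_on V0" ..
  interpret XQ: pair_sigma_finite "lborel_on (X\<^sup>\<bottom>)" "lborel_on Q0" ..
  have oT: "orthogonal_matrix T" using T by (rule rot_orthogonal)
  \<comment> \<open>The distance contains \<open>a - c\<close>; the shift by \<open>c\<close> is removed at the end by translation invariance.\<close>
  define c where "c = proj Q0 (transpose T *v x)"
  have c: "- c \<in> Q0" unfolding c_def by (intro subspace_neg proj_in subs)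
  define H where "H y w = G (sqrt ((norm y)\<^sup>2 + (norm (proj V0 (transpose T *v x - w)))\<^sup>2), placed X T w)" for y w :: "real^'n"
  have Hm: "(\<lambda>z. H (f z) (g z)) \<in> borel_measurable M" if "f \<in> borel_measurable M" "g \<in> borel_measurable M" for M f g
  proof -
    note that[measurable] borel_measurable_proj[OF subs(4), measurable]
    have "(\<lambda>z. sqrt ((norm (f z))\<^sup>2 + (norm (proj V0 (transpose T *v x - g z)))\<^sup>2)) \<in> borel_measurable M" by measurable
    from measurable_compose[OF measurable_Pair[OF this placed_X_measurable[OF const_rot[OF T] that(2)]] G]
    show ?thesis by (simp add: H_def)
  qed
  let ?I = "\<lambda>z u. G (infdist x (placed E T z), placed X T (u + z))"
  have Im: "(\<lambda>y. ?I (f y) (g y)) \<in> borel_measurable M" if "f \<in> borel_measurable M" "g \<in> borel_measurable M" for M f g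
    using measurable_compose[OF measurable_Pair[OF infdist_placed_E_measurable[OF const_rot[OF T] that(1)]
      placed_X_measurable[OF const_rot[OF T] borel_measurable_add[OF that(2,1)]]] G] by simp
  have gm: "(\<lambda>z. \<integral>\<^sup>+u. ?I z u \<partial>lborel_on W0) \<in> borel_measurable borel"
    by (rule KW.borel_measurable_nn_integral, unfold split_beta', rule Im) measurable
  have "(\<integral>\<^sup>+z. \<integral>\<^sup>+u. ?I z u \<partial>lborel_on W0 \<partial>lborel_on (E\<^sup>\<bottom>))
     = (\<integral>\<^sup>+a. \<integral>\<^sup>+b. \<integral>\<^sup>+u. ?I (a + b) u \<partial>lborel_on W0 \<partial>lborel_on V0 \<partial>lborel_on Q0)"
    unfolding E_comp by (rule nn_integral_lborel_on_sum[OF subs(2,4) orth(5) gm])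
  also have "\<dots> = (\<integral>\<^sup>+a. \<integral>\<^sup>+b. \<integral>\<^sup>+u. H (- c + a) (u + b) \<partial>lborel_on W0 \<partial>lborel_on V0 \<partial>lborel_on Q0)"
  proof (rule nn_integral_cong_AE, use AE_lborel_on_in[OF subs(2)] in eventually_elim)
    fix a assume a: "a \<in> Q0"
    show "(\<integral>\<^sup>+b. \<integral>\<^sup>+u. ?I (a + b) u \<partial>lborel_on W0 \<partial>lborel_on V0) = (\<integral>\<^sup>+b. \<integral>\<^sup>+u. H (- c + a) (u + b) \<partial>lborel_on W0 \<partial>lborel_on V0)"
    proof (rule nn_integral_cong_AE, use AE_lborel_on_in[OF subs(4)] in eventually_elim)
      fix b assume b: "b \<in> V0"
      show "(\<integral>\<^sup>+u. ?I (a + b) u \<partial>lborel_on W0) = (\<integral>\<^sup>+u. H (- c + a) (u + b) \<partial>lborel_on W0)"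
      proof (rule nn_integral_cong_AE, use AE_lborel_on_in[OF subs(3)] in eventually_elim)
        fix u assume u: "u \<in> W0"
        have "placed X T (u + (a + b)) = placed X T (u + b)"
          using placed_X_absorb[of a T "u + b"] a sub0(4) by (simp add: ac_simps subset_iff)
        then show "?I (a + b) u = H (- c + a) (u + b)"
          unfolding H_def infdist_placed_split[OF oT a b u] c_def by simp
      qed
    qed
  qed
  also have "\<dots> = (\<integral>\<^sup>+a. \<integral>\<^sup>+w. H (- c + a) w \<partial>lborel_on (X\<^sup>\<bottom>) \<partial>lborel_on Q0)"
  proof (rule nn_integral_cong)
    fix a
    have "(\<integral>\<^sup>+b. \<integral>\<^sup>+u. H (- c + a) (u + b) \<partial>lborel_on W0 \<partial>lborel_on V0)
       = (\<integral>\<^sup>+u. \<integral>\<^sup>+b. H (- c + a) (u + b) \<partial>lborel_on V0 \<partial>lborel_on W0)"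
      by (rule VW.Fubini', unfold split_beta', rule Hm) measurable
    also have "\<dots> = (\<integral>\<^sup>+w. H (- c + a) w \<partial>lborel_on (X\<^sup>\<bottom>))"
      unfolding X_comp by (rule nn_integral_lborel_on_sum[OF subs(3,4) orth(6), symmetric]) (rule Hm; measurable)
    finally show "(\<integral>\<^sup>+b. \<integral>\<^sup>+u. H (- c + a) (u + b) \<partial>lborel_on W0 \<partial>lborel_on V0) = (\<integral>\<^sup>+w. H (- c + a) w \<partial>lborel_on (X\<^sup>\<bottom>))" .
  qed
  also have "\<dots> = (\<integral>\<^sup>+w. \<integral>\<^sup>+a. H (- c + a) w \<partial>lborel_on Q0 \<partial>lborel_on (X\<^sup>\<bottom>))"
    by (rule XQ.Fubini', unfold split_beta', rule Hm) measurable
  also have "\<dots> = (\<integral>\<^sup>+w. \<integral>\<^sup>+a. H a w \<partial>lborel_on Q0 \<partial>lborel_on (X\<^sup>\<bottom>))"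
    by (rule nn_integral_cong, rule nn_integral_lborel_on_translate[OF subs(2) c], rule Hm) measurable
  finally show ?thesis by (simp only: H_def)
qed

lemma placed_X_rot:
  assumes "C \<in> rot (X\<^sup>\<bottom>)"
  shows "placed X (T ** C) (transpose C *v w) = placed X T w"
proof -
  have "placed X (T ** C) (transpose C *v w) = (*v) T ` ((*v) C ` ((+) (transpose C *v w) ` X))"
    by (simp add: placed_def image_image flip: matrix_vector_mul_assoc)
  also have "(*v) C ` ((+) (transpose C *v w) ` X) = (+) w ` X"
    using rot_image_comp[OF assms orthogonal_comp_subset]
    by (simp only: matrix_image_translation orthogonal_matrix_cancel(2)[OF rot_orthogonal[OF assms]])
  finally show ?thesis by (simp only: placed_def)
qed

text \<open>
  Replacing \<open>T\<close> by \<open>TC\<close> and \<open>w\<close> by \<open>C\<^sup>-\<^sup>1w\<close>, for \<open>C\<close> in the orthogonal group of \<open>X\<^sup>\<bottom>\<close>, preserves the measures and the small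
  plane but rotates the vector whose \<open>V0\<close>-component enters the distance; then average over \<open>C\<close>.
\<close>

lemma nn_integral_average_rotations:
  fixes G :: "real \<times> (real^'n) set \<Rightarrow> ennreal"
  assumes G: "G \<in> borel_measurable (borel \<Otimes>\<^sub>M plane_algebra (affine_grassmannian (p + q)))"
  shows "(\<integral>\<^sup>+T. \<integral>\<^sup>+w. \<integral>\<^sup>+y. G (sqrt ((norm y)\<^sup>2 + (norm (proj V0 (transpose T *v x - w)))\<^sup>2), placed X T w) \<partial>lborel_on Q0 \<partial>lborel_on (X\<^sup>\<bottom>) \<partial>haar UNIV)
    = (\<integral>\<^sup>+T. \<integral>\<^sup>+w. \<integral>\<^sup>+C. \<integral>\<^sup>+y. G (sqrt ((norm y)\<^sup>2 + (norm (proj V0 (transpose C *v (transpose T *v x - w))))\<^sup>2), placed X T w)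
        \<partial>lborel_on Q0 \<partial>haar (X\<^sup>\<bottom>) \<partial>lborel_on (X\<^sup>\<bottom>) \<partial>haar UNIV)"
proof -
  note sets_haar[OF subspace_orthogonal_comp[of X], measurable_cong] sets_haar[OF subspace_UNIV, measurable_cong]
  interpret HX: prob_space "haar (X\<^sup>\<bottom>)" by (rule prob_haar[OF subspace_orthogonal_comp])
  interpret HU: prob_space "haar (UNIV :: (real^'n) set)" by (rule prob_haar[OF subspace_UNIV])
  interpret KQ: sigma_finite_measure "lborel_on Q0" by (rule sigma_finite_lborel_on[OF subs(2)])
  interpret KX: sigma_finite_measure "lborel_on (X\<^sup>\<bottom>)" by (rule sigma_finite_lborel_on[OF subspace_orthogonal_comp])
  interpret XU: pair_sigma_finite "haar (X\<^sup>\<bottom>)" "haar (UNIV :: (real^'n) set)" ..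
  interpret XK: pair_sigma_finite "haar (X\<^sup>\<bottom>)" "lborel_on (X\<^sup>\<bottom>)" ..
  define \<Lambda> where "\<Lambda> v T w = (\<integral>\<^sup>+y. G (sqrt ((norm y)\<^sup>2 + (norm (proj V0 v))\<^sup>2), placed X T w) \<partial>lborel_on Q0)" for v T w
  have \<Lambda>m: "(\<lambda>z. \<Lambda> (v z) (f z) (g z)) \<in> borel_measurable M"
    if "v \<in> borel_measurable M" "f \<in> M \<rightarrow>\<^sub>M rot_borel UNIV" "g \<in> borel_measurable M" for M v f g
    unfolding \<Lambda>_def
  proof (rule KQ.borel_measurable_nn_integral, unfold split_beta')
    note that[measurable] borel_measurable_proj[OF subs(4), measurable]
    have 1: "(\<lambda>z. sqrt ((norm (snd z))\<^sup>2 + (norm (proj V0 (v (fst z))))\<^sup>2)) \<in> borel_measurable (M \<Otimes>\<^sub>M lborel_on Q0)" by measurable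
    have 2: "(\<lambda>z. placed X (f (fst z)) (g (fst z))) \<in> M \<Otimes>\<^sub>M lborel_on Q0 \<rightarrow>\<^sub>M plane_algebra (affine_grassmannian (p + q))"
      by (rule placed_X_measurable) measurable
    show "(\<lambda>z. G (sqrt ((norm (snd z))\<^sup>2 + (norm (proj V0 (v (fst z))))\<^sup>2), placed X (f (fst z)) (g (fst z)))) \<in> borel_measurable (M \<Otimes>\<^sub>M lborel_on Q0)"
      by (rule measurable_compose[OF measurable_Pair[OF 1 2] G])
  qed
  define \<Omega> where "\<Omega> T = (\<integral>\<^sup>+w. \<Lambda> (transpose T *v x - w) T w \<partial>lborel_on (X\<^sup>\<bottom>))" for T
  have \<Omega>m: "\<Omega> \<in> borel_measurable (rot_borel UNIV)"
    unfolding \<Omega>_def[abs_def] by (rule KX.borel_measurable_nn_integral, unfold split_beta', rule \<Lambda>m) measurable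
  have "(\<integral>\<^sup>+T. \<Omega> T \<partial>haar UNIV) = (\<integral>\<^sup>+C. \<integral>\<^sup>+T. \<Omega> T \<partial>haar UNIV \<partial>haar (X\<^sup>\<bottom>))"
    by (simp add: HX.emeasure_space_1)
  also have "\<dots> = (\<integral>\<^sup>+C. \<integral>\<^sup>+T. \<integral>\<^sup>+w. \<Lambda> (transpose C *v (transpose T *v x - w)) T w \<partial>lborel_on (X\<^sup>\<bottom>) \<partial>haar UNIV \<partial>haar (X\<^sup>\<bottom>))"
  proof (rule nn_integral_cong)
    fix C assume "C \<in> space (haar (X\<^sup>\<bottom>))"
    then have C: "C \<in> rot (X\<^sup>\<bottom>)" by (simp add: space_haar subspace_orthogonal_comp)
    then have CU: "C \<in> rot UNIV" using rot_mono[of "X\<^sup>\<bottom>" UNIV] by auto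
    have "(\<integral>\<^sup>+T. \<Omega> T \<partial>haar UNIV) = (\<integral>\<^sup>+T. \<Omega> (T ** C) \<partial>haar UNIV)"
      by (rule haar_right[OF subspace_UNIV CU \<Omega>m, symmetric])
    also have "\<dots> = (\<integral>\<^sup>+T. \<integral>\<^sup>+w. \<Lambda> (transpose C *v (transpose T *v x - w)) T w \<partial>lborel_on (X\<^sup>\<bottom>) \<partial>haar UNIV)"
    proof (rule nn_integral_cong)
      fix T :: "real^'n^'n" assume "T \<in> space (haar UNIV)"
      then have T: "T \<in> rot UNIV" by (simp add: space_haar)
      have m: "(\<lambda>w. \<Lambda> (transpose (T ** C) *v x - w) (T ** C) w) \<in> borel_measurable borel"
        by (rule \<Lambda>m[OF _ const_rot[OF rot_mult[OF T CU]]]) measurable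
      have tC: "transpose C \<in> rot (X\<^sup>\<bottom>)" using C by (rule rot_transpose)
      have "\<Omega> (T ** C) = (\<integral>\<^sup>+w. \<Lambda> (transpose (T ** C) *v x - w) (T ** C) w \<partial>lborel_on ((*v) (transpose C) ` (X\<^sup>\<bottom>)))"
        by (simp only: \<Omega>_def rot_image[OF subspace_orthogonal_comp tC])
      also have "\<dots> = (\<integral>\<^sup>+w. \<Lambda> (transpose (T ** C) *v x - transpose C *v w) (T ** C) (transpose C *v w) \<partial>lborel_on (X\<^sup>\<bottom>))"
        by (rule nn_integral_lborel_on_rotate[OF subspace_orthogonal_comp rot_orthogonal[OF tC] m])
      also have "\<dots> = (\<integral>\<^sup>+w. \<Lambda> (transpose C *v (transpose T *v x - w)) T w \<partial>lborel_on (X\<^sup>\<bottom>))"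
        unfolding \<Lambda>_def
        by (simp add: placed_X_rot[OF C] matrix_transpose_mul matrix_vector_mult_diff_distrib flip: matrix_vector_mul_assoc)
      finally show "\<Omega> (T ** C) = (\<integral>\<^sup>+w. \<Lambda> (transpose C *v (transpose T *v x - w)) T w \<partial>lborel_on (X\<^sup>\<bottom>))" .
    qed
    finally show "(\<integral>\<^sup>+T. \<Omega> T \<partial>haar UNIV) = (\<integral>\<^sup>+T. \<integral>\<^sup>+w. \<Lambda> (transpose C *v (transpose T *v x - w)) T w \<partial>lborel_on (X\<^sup>\<bottom>) \<partial>haar UNIV)" .
  qed
  also have "\<dots> = (\<integral>\<^sup>+T. \<integral>\<^sup>+C. \<integral>\<^sup>+w. \<Lambda> (transpose C *v (transpose T *v x - w)) T w \<partial>lborel_on (X\<^sup>\<bottom>) \<partial>haar (X\<^sup>\<bottom>) \<partial>haar UNIV)"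
  proof (rule XU.Fubini'[symmetric], unfold split_beta')
    show "(\<lambda>z. \<integral>\<^sup>+w. \<Lambda> (transpose (fst z) *v (transpose (snd z) *v x - w)) (snd z) w \<partial>lborel_on (X\<^sup>\<bottom>)) \<in> borel_measurable (haar (X\<^sup>\<bottom>) \<Otimes>\<^sub>M haar UNIV)"
      by (rule KX.borel_measurable_nn_integral, unfold split_beta', rule \<Lambda>m) measurable
  qed
  also have "\<dots> = (\<integral>\<^sup>+T. \<integral>\<^sup>+w. \<integral>\<^sup>+C. \<Lambda> (transpose C *v (transpose T *v x - w)) T w \<partial>haar (X\<^sup>\<bottom>) \<partial>lborel_on (X\<^sup>\<bottom>) \<partial>haar UNIV)"
  proof (rule nn_integral_cong)
    fix T :: "real^'n^'n" assume "T \<in> space (haar UNIV)"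
    then have T: "T \<in> rot UNIV" by (simp add: space_haar)
    show "(\<integral>\<^sup>+C. \<integral>\<^sup>+w. \<Lambda> (transpose C *v (transpose T *v x - w)) T w \<partial>lborel_on (X\<^sup>\<bottom>) \<partial>haar (X\<^sup>\<bottom>))
       = (\<integral>\<^sup>+w. \<integral>\<^sup>+C. \<Lambda> (transpose C *v (transpose T *v x - w)) T w \<partial>haar (X\<^sup>\<bottom>) \<partial>lborel_on (X\<^sup>\<bottom>))"
      by (rule XK.Fubini'[symmetric], unfold split_beta', rule \<Lambda>m[OF _ const_rot[OF T]]) measurable
  qed
  finally show ?thesis by (simp only: \<Omega>_def \<Lambda>_def)
qed

text \<open>
  The distribution of the pair of the distance from \<open>x\<close> to the \<open>k\<close>-plane and the \<open>j\<close>-plane, in two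
  descriptions: choosing the \<open>k\<close>-plane first or the \<open>j\<close>-plane first.
\<close>

lemma nn_integral_reduction:
  fixes G :: "real \<times> (real^'n) set \<Rightarrow> ennreal"
  assumes G: "G \<in> borel_measurable (borel \<Otimes>\<^sub>M plane_algebra (affine_grassmannian (p + q)))"
  shows "(\<integral>\<^sup>+T. \<integral>\<^sup>+z. \<integral>\<^sup>+B. \<integral>\<^sup>+A. \<integral>\<^sup>+u. G (infdist x (placed E T z), placed X (T ** A ** B) (u + transpose B *v z))
       \<partial>lborel_on W0 \<partial>haar E \<partial>haar (E\<^sup>\<bottom>) \<partial>lborel_on (E\<^sup>\<bottom>) \<partial>haar UNIV)
    = (\<integral>\<^sup>+T. \<integral>\<^sup>+w. \<integral>\<^sup>+C. \<integral>\<^sup>+y. G (sqrt ((norm y)\<^sup>2 + (norm (proj V0 (transpose C *v (transpose T *v x - w))))\<^sup>2), placed X T w)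
        \<partial>lborel_on Q0 \<partial>haar (X\<^sup>\<bottom>) \<partial>lborel_on (X\<^sup>\<bottom>) \<partial>haar UNIV)"
proof -
  define \<Phi> where "\<Phi> T z u = G (infdist x (placed E T z), placed X T (u + z))" for T z u
  have \<Phi>m: "(\<lambda>y. \<Phi> (fst (fst y)) (snd (fst y)) (snd y)) \<in> borel_measurable ((rot_borel UNIV \<Otimes>\<^sub>M borel) \<Otimes>\<^sub>M borel)"
    unfolding \<Phi>_def
    by (rule measurable_compose[OF measurable_Pair[OF infdist_placed_E_measurable placed_X_measurable] G]) measurable
  have "(\<integral>\<^sup>+T. \<integral>\<^sup>+z. \<integral>\<^sup>+B. \<integral>\<^sup>+A. \<integral>\<^sup>+u. G (infdist x (placed E T z), placed X (T ** A ** B) (u + transpose B *v z))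
       \<partial>lborel_on W0 \<partial>haar E \<partial>haar (E\<^sup>\<bottom>) \<partial>lborel_on (E\<^sup>\<bottom>) \<partial>haar UNIV)
    = (\<integral>\<^sup>+T. \<integral>\<^sup>+z. \<integral>\<^sup>+B. \<integral>\<^sup>+A. \<integral>\<^sup>+u. \<Phi> (T ** A ** B) (transpose B *v z) u
       \<partial>lborel_on W0 \<partial>haar E \<partial>haar (E\<^sup>\<bottom>) \<partial>lborel_on (E\<^sup>\<bottom>) \<partial>haar UNIV)"
  proof (rule nn_integral_cong, rule nn_integral_cong_AE, use AE_lborel_on_in[OF subspace_orthogonal_comp] in eventually_elim)
    fix T :: "real^'n^'n" and z assume z: "z \<in> E\<^sup>\<bottom>"
    show "(\<integral>\<^sup>+B. \<integral>\<^sup>+A. \<integral>\<^sup>+u. G (infdist x (placed E T z), placed X (T ** A ** B) (u + transpose B *v z)) \<partial>lborel_on W0 \<partial>haar E \<partial>haar (E\<^sup>\<bottom>))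
      = (\<integral>\<^sup>+B. \<integral>\<^sup>+A. \<integral>\<^sup>+u. \<Phi> (T ** A ** B) (transpose B *v z) u \<partial>lborel_on W0 \<partial>haar E \<partial>haar (E\<^sup>\<bottom>))"
    proof (rule nn_integral_cong, rule nn_integral_cong)
      fix A B assume "B \<in> space (haar (E\<^sup>\<bottom>))" "A \<in> space (haar E)"
      then have AB: "A \<in> rot E" "B \<in> rot (E\<^sup>\<bottom>)" by (simp_all add: space_haar subspace_orthogonal_comp subE)
      show "(\<integral>\<^sup>+u. G (infdist x (placed E T z), placed X (T ** A ** B) (u + transpose B *v z)) \<partial>lborel_on W0)
        = (\<integral>\<^sup>+u. \<Phi> (T ** A ** B) (transpose B *v z) u \<partial>lborel_on W0)"
        unfolding \<Phi>_def by (simp only: placed_E_rot[OF AB z])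
    qed
  qed
  also have "\<dots> = (\<integral>\<^sup>+T. \<integral>\<^sup>+z. \<integral>\<^sup>+u. \<Phi> T z u \<partial>lborel_on W0 \<partial>lborel_on (E\<^sup>\<bottom>) \<partial>haar UNIV)"
    by (rule nn_integral_absorb_rotations[OF \<Phi>m])
  also have "\<dots> = (\<integral>\<^sup>+T. \<integral>\<^sup>+w. \<integral>\<^sup>+y. G (sqrt ((norm y)\<^sup>2 + (norm (proj V0 (transpose T *v x - w)))\<^sup>2), placed X T w) \<partial>lborel_on Q0 \<partial>lborel_on (X\<^sup>\<bottom>) \<partial>haar UNIV)"
    unfolding \<Phi>_def by (rule nn_integral_cong, rule nn_integral_split_offset[OF G]) (simp add: space_haar)
  also note nn_integral_average_rotations[OF G, of x]
  finally show ?thesis .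
qed

lemma strichartz_nn_reduction:
  fixes G :: "real \<times> (real^'n) set \<Rightarrow> ennreal"
  assumes G: "G \<in> borel_measurable (borel \<Otimes>\<^sub>M plane_algebra (affine_grassmannian (p + q)))"
  shows "(\<integral>\<^sup>+\<zeta>. strichartz_nn p q (\<lambda>\<tau>. G (infdist x \<zeta>, \<tau>)) \<zeta> \<partial>affine_law E)
    = (\<integral>\<^sup>+T. \<integral>\<^sup>+w. \<integral>\<^sup>+C. \<integral>\<^sup>+y. G (sqrt ((norm y)\<^sup>2 + (norm (proj V0 (transpose C *v (transpose T *v x - w))))\<^sup>2), placed X T w)
        \<partial>lborel_on Q0 \<partial>haar (X\<^sup>\<bottom>) \<partial>lborel_on (X\<^sup>\<bottom>) \<partial>haar UNIV)"
proof -
  have Gs: "(\<lambda>\<tau>. G (s, \<tau>)) \<in> borel_measurable (plane_algebra (affine_grassmannian (p + q)))" for s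
    by (rule measurable_compose[OF measurable_Pair1' G]) simp
  have "(\<integral>\<^sup>+\<zeta>. strichartz_nn p q (\<lambda>\<tau>. G (infdist x \<zeta>, \<tau>)) \<zeta> \<partial>affine_law E)
    = (\<integral>\<^sup>+T. \<integral>\<^sup>+z. strichartz_nn p q (\<lambda>\<tau>. G (infdist x (placed E T z), \<tau>)) (placed E T z) \<partial>lborel_on (E\<^sup>\<bottom>) \<partial>haar UNIV)"
    by (rule nn_integral_affine_law[OF E_gr strichartz_nn_measurable[OF G]])
  also have "\<dots> = (\<integral>\<^sup>+T. \<integral>\<^sup>+z. \<integral>\<^sup>+B. \<integral>\<^sup>+A. \<integral>\<^sup>+u. G (infdist x (placed E T z), placed X (T ** A ** B) (u + transpose B *v z))
       \<partial>lborel_on W0 \<partial>haar E \<partial>haar (E\<^sup>\<bottom>) \<partial>lborel_on (E\<^sup>\<bottom>) \<partial>haar UNIV)"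
  proof (rule nn_integral_cong, rule nn_integral_cong_AE, use AE_lborel_on_in[OF subspace_orthogonal_comp] in eventually_elim)
    fix T :: "real^'n^'n" and z assume "T \<in> space (haar UNIV)" "z \<in> E\<^sup>\<bottom>"
    then show "strichartz_nn p q (\<lambda>\<tau>. G (infdist x (placed E T z), \<tau>)) (placed E T z)
      = (\<integral>\<^sup>+B. \<integral>\<^sup>+A. \<integral>\<^sup>+u. G (infdist x (placed E T z), placed X (T ** A ** B) (u + transpose B *v z)) \<partial>lborel_on W0 \<partial>haar E \<partial>haar (E\<^sup>\<bottom>))"
      by (intro strichartz_nn_placed[OF Gs]) (simp_all add: space_haar rot_orthogonal)
  qed
  also note nn_integral_reduction[OF G, of x]
  finally show ?thesis .
qed

end

section \<open>Power functions and the Laplace transform\<close>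

text \<open>
  On the negative half-line the principal logarithm is \<open>ln |t| + i pi\<close>; both branches are measurable in \<open>t\<close>.
\<close>

lemma powr_of_real_measurable [measurable (raw)]:
  fixes z :: complex
  assumes [measurable]: "f \<in> borel_measurable M"
  shows "(\<lambda>x. complex_of_real (f x) powr z) \<in> borel_measurable M"
proof -
  have eq: "complex_of_real t powr z =
    (if t = 0 then 0 else exp (z * (complex_of_real (ln \<bar>t\<bar>) + (if t < 0 then \<i> * complex_of_real pi else 0))))" for t
  proof (cases "t < 0")
    case True
    have "Ln (complex_of_real t) = Ln (- complex_of_real (- t))" by simp
    also have "\<dots> = Ln (complex_of_real (- t)) + \<i> * complex_of_real pi"
      using True by (subst Ln_minus) auto
    also have "Ln (complex_of_real (- t)) = complex_of_real (ln (- t))" using True by (subst Ln_of_real) auto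
    finally show ?thesis using True by (simp add: powr_def)
  next
    case False
    then show ?thesis by (simp add: powr_def Ln_of_real)
  qed
  have "(\<lambda>x. complex_of_real (ln \<bar>f x\<bar>)) \<in> borel_measurable M" by measurable
  then show ?thesis unfolding eq by measurable
qed

lemma norm_of_real_powr: "0 \<le> s \<Longrightarrow> cmod (complex_of_real s powr z) = s powr Re z"
  by (subst norm_powr_real_powr) auto

lemma nn_integral_Gamma:
  assumes b: "b > 0" and \<phi>: "\<phi> > 0"
  shows "(\<integral>\<^sup>+t. ennreal (indicator {0<..} t * (t powr (b - 1) * exp (- (\<phi> * t)))) \<partial>lborel) = ennreal (Gamma b * \<phi> powr (- b))"
proof -
  let ?f = "\<lambda>t::real. ennreal (indicator {0<..} t * (t powr (b - 1) * exp (- t)))"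
  have "ennreal (Gamma b) = (\<integral>\<^sup>+t. ennreal (indicator {0..} t * t powr (b - 1) / exp t) \<partial>lborel)"
    by (rule Gamma_conv_nn_integral_real[OF b])
  also have "\<dots> = (\<integral>\<^sup>+t. ?f t \<partial>lborel)"
    by (rule nn_integral_cong) (auto simp: indicator_def exp_minus field_simps)
  also have "\<dots> = ennreal \<phi> * (\<integral>\<^sup>+t. ?f (0 + \<phi> * t) \<partial>lborel)"
    using \<phi> by (subst nn_integral_real_affine[where c=\<phi> and t=0]) auto
  also have "(\<integral>\<^sup>+t. ?f (0 + \<phi> * t) \<partial>lborel)
      = (\<integral>\<^sup>+t. ennreal (\<phi> powr (b - 1)) * ennreal (indicator {0<..} t * (t powr (b - 1) * exp (- (\<phi> * t)))) \<partial>lborel)"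
    using \<phi> by (intro nn_integral_cong) (auto simp: indicator_def powr_mult zero_less_mult_iff ennreal_mult[symmetric] mult_ac)
  also have "\<dots> = ennreal (\<phi> powr (b - 1)) * (\<integral>\<^sup>+t. ennreal (indicator {0<..} t * (t powr (b - 1) * exp (- (\<phi> * t)))) \<partial>lborel)"
    by (rule nn_integral_cmult) measurable
  finally have eq: "ennreal (Gamma b) = ennreal (\<phi> powr b) * (\<integral>\<^sup>+t. ennreal (indicator {0<..} t * (t powr (b - 1) * exp (- (\<phi> * t)))) \<partial>lborel)"
    using \<phi> by (simp add: mult.assoc[symmetric] ennreal_mult[symmetric] powr_mult_base)
  have "ennreal (Gamma b * \<phi> powr (- b)) = ennreal (\<phi> powr (- b)) * ennreal (Gamma b)"
    using b by (simp add: ennreal_mult[symmetric] mult.commute)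
  also have "\<dots> = (\<integral>\<^sup>+t. ennreal (indicator {0<..} t * (t powr (b - 1) * exp (- (\<phi> * t)))) \<partial>lborel)"
    unfolding eq using \<phi> by (simp add: mult.assoc[symmetric] ennreal_mult[symmetric] powr_add[symmetric])
  finally show ?thesis by simp
qed

lemma integral_Gamma_complex:
  assumes \<beta>: "Re \<beta> > 0" and \<phi>: "\<phi> > 0"
  shows "(LINT t|lborel. indicator {0<..} t *\<^sub>R (complex_of_real t powr (\<beta> - 1) * complex_of_real (exp (- (\<phi> * t)))))
      = Gamma \<beta> * complex_of_real \<phi> powr (- \<beta>)"
proof -
  let ?f = "\<lambda>t::real. indicator {0<..} t *\<^sub>R (complex_of_real t powr (\<beta> - 1) * complex_of_real (exp (- t)))"
  have [measurable]: "?f \<in> borel_measurable borel" by measurable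
  have "Gamma \<beta> = integral {0<..} (\<lambda>t. complex_of_real t powr (\<beta> - 1) / complex_of_real (exp t))"
    using Gamma_integral_complex'[OF \<beta>] by (simp add: integral_unique)
  also have "\<dots> = (LINT t:{0<..}|lebesgue. complex_of_real t powr (\<beta> - 1) / complex_of_real (exp t))"
    using absolutely_integrable_Gamma_integral'[OF \<beta>] by (rule set_lebesgue_integral_eq_integral(2)[symmetric])
  also have "\<dots> = (LINT t|lebesgue. ?f t)"
    unfolding set_lebesgue_integral_def
    by (intro Bochner_Integration.integral_cong) (auto simp: exp_minus field_simps)
  also have "\<dots> = (LINT t|lborel. ?f t)" by (rule integral_completion) measurable
  also have "\<dots> = \<phi> *\<^sub>R (LINT t|lborel. ?f (0 + \<phi> * t))"
    using \<phi> by (subst lborel_integral_real_affine[where c=\<phi> and t=0]) auto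
  also have "(LINT t|lborel. ?f (0 + \<phi> * t)) = (LINT t|lborel. complex_of_real \<phi> powr (\<beta> - 1) *
      (indicator {0<..} t *\<^sub>R (complex_of_real t powr (\<beta> - 1) * complex_of_real (exp (- (\<phi> * t))))))"
  proof (rule Bochner_Integration.integral_cong[OF refl])
    fix t :: real
    have "(complex_of_real \<phi> * complex_of_real t) powr (\<beta> - 1) = complex_of_real \<phi> powr (\<beta> - 1) * complex_of_real t powr (\<beta> - 1)"
      using \<phi> by (intro powr_times_real_left) auto
    then show "?f (0 + \<phi> * t) = complex_of_real \<phi> powr (\<beta> - 1) *
      (indicator {0<..} t *\<^sub>R (complex_of_real t powr (\<beta> - 1) * complex_of_real (exp (- (\<phi> * t)))))"
      using \<phi> by (auto simp: indicator_def zero_less_mult_iff)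
  qed
  also have "\<dots> = complex_of_real \<phi> powr (\<beta> - 1) *
      (LINT t|lborel. indicator {0<..} t *\<^sub>R (complex_of_real t powr (\<beta> - 1) * complex_of_real (exp (- (\<phi> * t)))))"
    by (rule Bochner_Integration.integral_mult_right_zero)
  finally have eq0: "Gamma \<beta> = \<phi> *\<^sub>R (complex_of_real \<phi> powr (\<beta> - 1) *
      (LINT t|lborel. indicator {0<..} t *\<^sub>R (complex_of_real t powr (\<beta> - 1) * complex_of_real (exp (- (\<phi> * t))))))" .
  have "complex_of_real \<phi> * complex_of_real \<phi> powr (\<beta> - 1) = complex_of_real \<phi> powr \<beta>"
    using \<phi> by (simp add: powr_diff)
  with eq0 have eq: "Gamma \<beta> = complex_of_real \<phi> powr \<beta> *
      (LINT t|lborel. indicator {0<..} t *\<^sub>R (complex_of_real t powr (\<beta> - 1) * complex_of_real (exp (- (\<phi> * t)))))"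
    by (simp only: scaleR_conv_of_real mult.assoc[symmetric])
  show ?thesis unfolding eq using \<phi> by (simp add: powr_minus)
qed

text \<open>
  Insert \<open>\<Gamma>(b) \<phi>\<^sup>-\<^sup>b = \<integral> t\<^sup>b\<^sup>-\<^sup>1 exp(-\<phi>t) dt\<close> and exchange the integrals. Thus the integral of a negative
  power of \<open>\<phi>\<close> depends only on the Laplace transform \<open>L\<close> of the distribution of \<open>\<phi>\<close>.
\<close>

lemma nn_integral_powr_Laplace:
  assumes "sigma_finite_measure M" and [measurable]: "\<phi> \<in> borel_measurable M" and pos: "AE x in M. \<phi> x > 0"
    and L: "\<And>t. t > 0 \<Longrightarrow> (\<integral>\<^sup>+x. ennreal (exp (- (\<phi> x * t))) \<partial>M) = ennreal (L t)"
    and b: "b > 0"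
  shows "ennreal (Gamma b) * (\<integral>\<^sup>+x. ennreal (\<phi> x powr (- b)) \<partial>M)
      = (\<integral>\<^sup>+t. ennreal (indicator {0<..} t * t powr (b - 1)) * ennreal (L t) \<partial>lborel)"
proof -
  interpret M: sigma_finite_measure M by fact
  interpret pair_sigma_finite lborel M ..
  have "ennreal (Gamma b) * (\<integral>\<^sup>+x. ennreal (\<phi> x powr (- b)) \<partial>M) = (\<integral>\<^sup>+x. ennreal (Gamma b * \<phi> x powr (- b)) \<partial>M)"
    using b by (simp add: nn_integral_cmult ennreal_mult)
  also have "\<dots> = (\<integral>\<^sup>+x. \<integral>\<^sup>+t. ennreal (indicator {0<..} t * (t powr (b - 1) * exp (- (\<phi> x * t)))) \<partial>lborel \<partial>M)"
    by (rule nn_integral_cong_AE, use pos in eventually_elim) (simp add: nn_integral_Gamma b)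
  also have "\<dots> = (\<integral>\<^sup>+t. \<integral>\<^sup>+x. ennreal (indicator {0<..} t * (t powr (b - 1) * exp (- (\<phi> x * t)))) \<partial>M \<partial>lborel)"
    by (rule Fubini') measurable
  also have "\<dots> = (\<integral>\<^sup>+t. ennreal (indicator {0<..} t * t powr (b - 1)) * ennreal (L t) \<partial>lborel)"
  proof (rule nn_integral_cong)
    fix t :: real
    have "(\<integral>\<^sup>+x. ennreal (indicator {0<..} t * (t powr (b - 1) * exp (- (\<phi> x * t)))) \<partial>M)
       = ennreal (indicator {0<..} t * t powr (b - 1)) * (\<integral>\<^sup>+x. ennreal (exp (- (\<phi> x * t))) \<partial>M)"
      by (subst nn_integral_cmult[symmetric]) (auto simp: ennreal_mult[symmetric] mult.assoc)
    then show "(\<integral>\<^sup>+x. ennreal (indicator {0<..} t * (t powr (b - 1) * exp (- (\<phi> x * t)))) \<partial>M)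
      = ennreal (indicator {0<..} t * t powr (b - 1)) * ennreal (L t)"
      using L[of t] by (cases "t > 0") auto
  qed
  finally show ?thesis .
qed

text \<open>
  For complex exponents the exchange of integrals is justified by the real case with exponent \<open>Re \<beta>\<close>.
\<close>

lemma integral_powr_Laplace:
  assumes "sigma_finite_measure M" and \<phi>[measurable]: "\<phi> \<in> borel_measurable M" and pos: "AE x in M. \<phi> x > 0"
    and L: "\<And>t. t > 0 \<Longrightarrow> (\<integral>\<^sup>+x. ennreal (exp (- (\<phi> x * t))) \<partial>M) = ennreal (L t)" and L0: "\<And>t. t > 0 \<Longrightarrow> L t \<ge> 0"
    and b: "Re \<beta> > 0" and fin: "(\<integral>\<^sup>+x. ennreal (\<phi> x powr (- Re \<beta>)) \<partial>M) < \<infinity>"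
  shows "Gamma \<beta> * (LINT x|M. complex_of_real (\<phi> x) powr (- \<beta>))
      = (LINT t|lborel. indicator {0<..} t *\<^sub>R (complex_of_real t powr (\<beta> - 1) * complex_of_real (L t)))"
proof -
  interpret M: sigma_finite_measure M by fact
  interpret pair_sigma_finite lborel M ..
  let ?F = "\<lambda>t x. indicator {0<..} t *\<^sub>R (complex_of_real t powr (\<beta> - 1) * complex_of_real (exp (- (\<phi> x * t))))"
  have nF: "ennreal (norm (?F t x)) = ennreal (indicator {0<..} t * (t powr (Re \<beta> - 1) * exp (- (\<phi> x * t))))" for t x
    by (auto simp: indicator_def norm_mult norm_of_real_powr)
  have int: "integrable (lborel \<Otimes>\<^sub>M M) (case_prod ?F)"
  proof (rule integrableI_bounded)
    show "case_prod ?F \<in> borel_measurable (lborel \<Otimes>\<^sub>M M)" unfolding split_beta' by measurable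
    have "(\<integral>\<^sup>+z. ennreal (norm (case_prod ?F z)) \<partial>(lborel \<Otimes>\<^sub>M M)) = (\<integral>\<^sup>+z. ennreal (indicator {0<..} (fst z) * (fst z powr (Re \<beta> - 1) * exp (- (\<phi> (snd z) * fst z)))) \<partial>(lborel \<Otimes>\<^sub>M M))"
      by (simp only: split_beta' nF)
    also have "\<dots> = (\<integral>\<^sup>+x. \<integral>\<^sup>+t. ennreal (indicator {0<..} t * (t powr (Re \<beta> - 1) * exp (- (\<phi> x * t)))) \<partial>lborel \<partial>M)"
      by (subst nn_integral_snd[symmetric]) (auto simp: split_beta')
    also have "\<dots> = (\<integral>\<^sup>+x. ennreal (Gamma (Re \<beta>) * \<phi> x powr (- Re \<beta>)) \<partial>M)"
      by (rule nn_integral_cong_AE, use pos in eventually_elim) (simp add: nn_integral_Gamma b)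
    also have "\<dots> = ennreal (Gamma (Re \<beta>)) * (\<integral>\<^sup>+x. ennreal (\<phi> x powr (- Re \<beta>)) \<partial>M)"
      using b by (simp add: nn_integral_cmult[symmetric] ennreal_mult)
    also have "\<dots> < \<infinity>" using fin by (simp add: ennreal_mult_less_top)
    finally show "(\<integral>\<^sup>+z. ennreal (norm (case_prod ?F z)) \<partial>(lborel \<Otimes>\<^sub>M M)) < \<infinity>" .
  qed
  have "Gamma \<beta> * (LINT x|M. complex_of_real (\<phi> x) powr (- \<beta>)) = (LINT x|M. Gamma \<beta> * complex_of_real (\<phi> x) powr (- \<beta>))"
    by simp
  also have "\<dots> = (LINT x|M. LINT t|lborel. ?F t x)"
  proof (rule integral_cong_AE)
    show "AE x in M. Gamma \<beta> * complex_of_real (\<phi> x) powr (- \<beta>) = (LINT t|lborel. ?F t x)"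
      using pos by eventually_elim (simp add: integral_Gamma_complex b)
    show "(\<lambda>x. LINT t|lborel. ?F t x) \<in> borel_measurable M"
      by (rule lborel.borel_measurable_lebesgue_integral) (simp add: split_beta')
  qed measurable
  also have "\<dots> = (LINT t|lborel. LINT x|M. ?F t x)" by (rule Fubini_integral[OF int])
  also have "\<dots> = (LINT t|lborel. indicator {0<..} t *\<^sub>R (complex_of_real t powr (\<beta> - 1) * complex_of_real (L t)))"
  proof (rule Bochner_Integration.integral_cong[OF refl])
    fix t :: real
    show "(LINT x|M. ?F t x) = indicator {0<..} t *\<^sub>R (complex_of_real t powr (\<beta> - 1) * complex_of_real (L t))"
    proof (cases "t > 0")
      case True
      have "(LINT x|M. exp (- (\<phi> x * t))) = L t"
        by (subst integral_eq_nn_integral) (auto simp: L[OF True] L0[OF True])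
      then have "(LINT x|M. complex_of_real (exp (- (\<phi> x * t)))) = complex_of_real (L t)"
        by (metis integral_complex_of_real)
      then show ?thesis using True by simp
    qed simp
  qed
  finally show ?thesis .
qed

text \<open>
  The Laplace transform of \<open>|y|\<^sup>2 + s\<^sup>2\<close> over \<open>W\<close> is a Gaussian integral.
\<close>

lemma nn_integral_powr_cylinder:
  assumes W: "subspace W" and s: "s > 0" and b: "b > 0"
  shows "ennreal (Gamma b) * (\<integral>\<^sup>+y. ennreal (((norm y)\<^sup>2 + s\<^sup>2) powr (- b)) \<partial>lborel_on W)
     = ennreal (pi powr (dim W / 2)) * (\<integral>\<^sup>+t. ennreal (indicator {0<..} t * (t powr (b - dim W / 2 - 1) * exp (- (s\<^sup>2 * t)))) \<partial>lborel)"
proof -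
  have "ennreal (Gamma b) * (\<integral>\<^sup>+y. ennreal (((norm y)\<^sup>2 + s\<^sup>2) powr (- b)) \<partial>lborel_on W)
    = (\<integral>\<^sup>+t. ennreal (indicator {0<..} t * t powr (b - 1)) * ennreal (exp (- (s\<^sup>2 * t)) * (pi / t) powr (dim W / 2)) \<partial>lborel)"
  proof (rule nn_integral_powr_Laplace[OF sigma_finite_lborel_on[OF W] _ _ _ b])
    show "AE y in lborel_on W. 0 < (norm y)\<^sup>2 + s\<^sup>2" using s by (auto intro!: AE_I2 add_nonneg_pos)
    fix t :: real assume t: "t > 0"
    have "(\<integral>\<^sup>+y. ennreal (exp (- (((norm y)\<^sup>2 + s\<^sup>2) * t))) \<partial>lborel_on W)
      = (\<integral>\<^sup>+y. ennreal (exp (- (s\<^sup>2 * t))) * ennreal (exp (- t * (norm y)\<^sup>2)) \<partial>lborel_on W)"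
      by (intro nn_integral_cong) (simp add: ennreal_mult[symmetric] exp_add[symmetric] algebra_simps)
    also have "\<dots> = ennreal (exp (- (s\<^sup>2 * t))) * ennreal ((pi / t) powr (dim W / 2))"
      using nn_integral_lborel_on_exp[OF W t] by (simp add: nn_integral_cmult)
    finally show "(\<integral>\<^sup>+y. ennreal (exp (- (((norm y)\<^sup>2 + s\<^sup>2) * t))) \<partial>lborel_on W) = ennreal (exp (- (s\<^sup>2 * t)) * (pi / t) powr (dim W / 2))"
      by (simp add: ennreal_mult)
  qed measurable
  also have "\<dots> = (\<integral>\<^sup>+t. ennreal (pi powr (dim W / 2)) * ennreal (indicator {0<..} t * (t powr (b - dim W / 2 - 1) * exp (- (s\<^sup>2 * t)))) \<partial>lborel)"
  proof (rule nn_integral_cong)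
    fix t :: real
    have "t powr (b - 1) * (pi / t) powr (dim W / 2) = pi powr (dim W / 2) * t powr (b - dim W / 2 - 1)" if "t > 0"
    proof -
      have "t powr (b - 1) = t powr (dim W / 2) * t powr (b - dim W / 2 - 1)" by (simp add: powr_add[symmetric])
      then show ?thesis using that by (simp add: powr_divide)
    qed
    then show "ennreal (indicator {0<..} t * t powr (b - 1)) * ennreal (exp (- (s\<^sup>2 * t)) * (pi / t) powr (dim W / 2))
      = ennreal (pi powr (dim W / 2)) * ennreal (indicator {0<..} t * (t powr (b - dim W / 2 - 1) * exp (- (s\<^sup>2 * t))))"
      by (cases "t > 0") (auto simp: ennreal_mult[symmetric] mult_ac)
  qed
  also have "\<dots> = ennreal (pi powr (dim W / 2)) * (\<integral>\<^sup>+t. ennreal (indicator {0<..} t * (t powr (b - dim W / 2 - 1) * exp (- (s\<^sup>2 * t)))) \<partial>lborel)"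
    by (rule nn_integral_cmult) measurable
  finally show ?thesis .
qed

lemma nn_integral_powr_cylinder_finite:
  assumes W: "subspace W" and s: "s > 0" and b: "b > dim W / 2"
  shows "(\<integral>\<^sup>+y. ennreal (((norm y)\<^sup>2 + s\<^sup>2) powr (- b)) \<partial>lborel_on W)
     = ennreal (pi powr (dim W / 2) * Gamma (b - dim W / 2) / Gamma b * (s\<^sup>2) powr (- (b - dim W / 2)))"
proof -
  have b0: "b > 0" using b by (meson less_trans of_nat_0_le_iff divide_nonneg_nonneg le_less_trans zero_le_numeral)
  have "ennreal (Gamma b) * (\<integral>\<^sup>+y. ennreal (((norm y)\<^sup>2 + s\<^sup>2) powr (- b)) \<partial>lborel_on W)
     = ennreal (pi powr (dim W / 2)) * ennreal (Gamma (b - dim W / 2) * (s\<^sup>2) powr (- (b - dim W / 2)))"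
    unfolding nn_integral_powr_cylinder[OF W s b0] using b s by (subst nn_integral_Gamma) auto
  also have "\<dots> = ennreal (Gamma b) * ennreal (pi powr (dim W / 2) * Gamma (b - dim W / 2) / Gamma b * (s\<^sup>2) powr (- (b - dim W / 2)))"
  proof -
    have "Gamma b \<noteq> 0" using Gamma_real_pos[OF b0] by simp
    then show ?thesis using b b0 by (simp add: ennreal_mult[symmetric])
  qed
  finally show ?thesis using Gamma_real_pos[OF b0] by (simp add: ennreal_mult_cancel_left)
qed

text \<open>
  At the critical exponent the Laplace side is the integral of \<open>exp(-s\<^sup>2t)/t\<close>, which diverges
  logarithmically at \<open>0\<close>: the part between \<open>exp(-N)\<close> and \<open>1\<close> is at least \<open>exp(-s\<^sup>2) N\<close>. A smaller
  exponent gives a larger integrand, up to a constant factor.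
\<close>

lemma nn_integral_powr_cylinder_infinite:
  assumes W: "subspace W" and d: "dim W > 0" and s: "s > 0" and b: "b \<le> dim W / 2"
  shows "(\<integral>\<^sup>+y. ennreal (((norm y)\<^sup>2 + s\<^sup>2) powr (- b)) \<partial>lborel_on W) = \<infinity>"
proof -
  let ?q = "dim W / 2"
  have q: "?q > 0" using d by simp
  have "(\<integral>\<^sup>+t. ennreal (indicator {0<..} t * (t powr (?q - ?q - 1) * exp (- (s\<^sup>2 * t)))) \<partial>lborel) \<ge> ennreal (exp (- (s\<^sup>2))) * of_nat N" for N :: nat
  proof (cases "N = 0")
    case False
    have "ennreal (exp (- (s\<^sup>2))) * of_nat N = ennreal (exp (- (s\<^sup>2))) * (\<integral>\<^sup>+t. ennreal (indicator {exp (- real N) .. 1} t * (1 / t)) \<partial>lborel)"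
    proof -
      have "(\<integral>\<^sup>+t. ennreal (1 / t) * indicator {exp (- real N) .. 1} t \<partial>lborel) = ennreal (ln 1 - ln (exp (- real N)))"
        by (rule nn_integral_FTC_Icc) (auto intro!: derivative_eq_intros elim: less_le_trans[OF exp_gt_zero] simp: order.trans[OF exp_ge_zero])
      moreover have "(\<integral>\<^sup>+t. ennreal (1 / t) * indicator {exp (- real N) .. 1} t \<partial>lborel) = (\<integral>\<^sup>+t. ennreal (indicator {exp (- real N) .. 1} t * (1 / t)) \<partial>lborel)"
        by (intro nn_integral_cong) (auto simp: indicator_def)
      ultimately show ?thesis by (simp add: ennreal_of_nat_eq_real_of_nat)
    qed
    also have "\<dots> = (\<integral>\<^sup>+t. ennreal (exp (- (s\<^sup>2)) * (indicator {exp (- real N) .. 1} t * (1 / t))) \<partial>lborel)"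
      by (subst nn_integral_cmult[symmetric])
         (auto intro!: nn_integral_cong simp: indicator_def ennreal_mult[symmetric] order.trans[OF exp_ge_zero])
    also have "\<dots> \<le> (\<integral>\<^sup>+t. ennreal (indicator {0<..} t * (t powr (?q - ?q - 1) * exp (- (s\<^sup>2 * t)))) \<partial>lborel)"
    proof (rule nn_integral_mono, rule ennreal_leI)
      fix t :: real
      show "exp (- (s\<^sup>2)) * (indicator {exp (- real N) .. 1} t * (1 / t)) \<le> indicator {0<..} t * (t powr (?q - ?q - 1) * exp (- (s\<^sup>2 * t)))"
      proof (cases "t \<in> {exp (- real N) .. 1}")
        case True
        then have t: "0 < t" "t \<le> 1" by (auto intro: less_le_trans[OF exp_gt_zero])
        have "s\<^sup>2 * t \<le> s\<^sup>2" using t by (simp add: mult_left_le)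
        then have "exp (- (s\<^sup>2)) \<le> exp (- (s\<^sup>2 * t))" by simp
        then show ?thesis using t True by (simp add: powr_minus_divide divide_right_mono)
      qed (auto simp: indicator_def)
    qed
    finally show ?thesis .
  qed simp
  then have "(\<integral>\<^sup>+t. ennreal (indicator {0<..} t * (t powr (?q - ?q - 1) * exp (- (s\<^sup>2 * t)))) \<partial>lborel) = \<infinity>" (is "?I = _")
  proof -
    assume le: "\<And>N. ennreal (exp (- (s\<^sup>2))) * of_nat N \<le> ?I"
    show "?I = \<infinity>"
    proof (rule ccontr)
      assume "?I \<noteq> \<infinity>"
      then obtain r where r: "r \<ge> 0" "?I = ennreal r" by (cases ?I) auto
      obtain N :: nat where N: "r / exp (- (s\<^sup>2)) < real N" using reals_Archimedean2 by blast
      then have "r < exp (- (s\<^sup>2)) * real N" by (simp add: field_simps)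
      moreover have "ennreal (exp (- (s\<^sup>2)) * real N) \<le> ennreal r"
        using le[of N] r by (simp add: ennreal_of_nat_eq_real_of_nat ennreal_mult)
      ultimately show False using r by (simp add: ennreal_le_iff)
    qed
  qed
  then have "ennreal (Gamma ?q) * (\<integral>\<^sup>+y. ennreal (((norm y)\<^sup>2 + s\<^sup>2) powr (- ?q)) \<partial>lborel_on W) = \<infinity>"
    unfolding nn_integral_powr_cylinder[OF W s q] by (simp add: ennreal_mult_top)
  then have inf: "(\<integral>\<^sup>+y. ennreal (((norm y)\<^sup>2 + s\<^sup>2) powr (- ?q)) \<partial>lborel_on W) = \<infinity>"
    by (metis ennreal_mult_eq_top_iff ennreal_neq_top infinity_ennreal_def)
  have "(\<integral>\<^sup>+y. ennreal ((s\<^sup>2) powr (?q - b)) * ennreal (((norm y)\<^sup>2 + s\<^sup>2) powr (- ?q)) \<partial>lborel_on W)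
     \<le> (\<integral>\<^sup>+y. ennreal (((norm y)\<^sup>2 + s\<^sup>2) powr (- b)) \<partial>lborel_on W)"
  proof (rule nn_integral_mono)
    fix y
    have p: "0 < (norm y)\<^sup>2 + s\<^sup>2" using s by (auto intro: add_nonneg_pos)
    have "(s\<^sup>2) powr (?q - b) \<le> ((norm y)\<^sup>2 + s\<^sup>2) powr (?q - b)" using b by (intro powr_mono2) auto
    then have "(s\<^sup>2) powr (?q - b) * ((norm y)\<^sup>2 + s\<^sup>2) powr (- ?q) \<le> ((norm y)\<^sup>2 + s\<^sup>2) powr (?q - b) * ((norm y)\<^sup>2 + s\<^sup>2) powr (- ?q)"
      by (rule mult_right_mono) simp
    also have "\<dots> = ((norm y)\<^sup>2 + s\<^sup>2) powr (- b)" by (simp add: powr_add[symmetric])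
    finally show "ennreal ((s\<^sup>2) powr (?q - b)) * ennreal (((norm y)\<^sup>2 + s\<^sup>2) powr (- ?q)) \<le> ennreal (((norm y)\<^sup>2 + s\<^sup>2) powr (- b))"
      by (simp add: ennreal_mult[symmetric] ennreal_leI)
  qed
  moreover have "(\<integral>\<^sup>+y. ennreal ((s\<^sup>2) powr (?q - b)) * ennreal (((norm y)\<^sup>2 + s\<^sup>2) powr (- ?q)) \<partial>lborel_on W) = \<infinity>"
    using s by (subst nn_integral_cmult) (auto simp: inf ennreal_mult_top)
  ultimately show ?thesis by (simp add: top_unique)
qed

lemma integral_powr_cylinder:
  fixes \<beta> :: complex
  assumes W: "subspace W" and s: "s > 0" and b: "Re \<beta> > dim W / 2"
  shows "(LINT y|lborel_on W. complex_of_real ((norm y)\<^sup>2 + s\<^sup>2) powr (- \<beta>))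
     = of_real (pi powr (dim W / 2)) * Gamma (\<beta> - dim W / 2) / Gamma \<beta> * complex_of_real (s\<^sup>2) powr (- (\<beta> - dim W / 2))"
proof -
  have b0: "Re \<beta> > 0" using b by (meson less_trans of_nat_0_le_iff divide_nonneg_nonneg le_less_trans zero_le_numeral)
  have "Gamma \<beta> * (LINT y|lborel_on W. complex_of_real ((norm y)\<^sup>2 + s\<^sup>2) powr (- \<beta>))
    = (LINT t|lborel. indicator {0<..} t *\<^sub>R (complex_of_real t powr (\<beta> - 1) * complex_of_real (exp (- (s\<^sup>2 * t)) * (pi / t) powr (dim W / 2))))"
  proof (rule integral_powr_Laplace[OF sigma_finite_lborel_on[OF W] _ _ _ _ b0])
    show "AE y in lborel_on W. 0 < (norm y)\<^sup>2 + s\<^sup>2" using s by (auto intro!: AE_I2 add_nonneg_pos)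
    show "(\<integral>\<^sup>+y. ennreal (((norm y)\<^sup>2 + s\<^sup>2) powr (- Re \<beta>)) \<partial>lborel_on W) < \<infinity>"
      using nn_integral_powr_cylinder_finite[OF W s b] by simp
    fix t :: real assume t: "t > 0"
    have "(\<integral>\<^sup>+y. ennreal (exp (- (((norm y)\<^sup>2 + s\<^sup>2) * t))) \<partial>lborel_on W)
      = (\<integral>\<^sup>+y. ennreal (exp (- (s\<^sup>2 * t))) * ennreal (exp (- t * (norm y)\<^sup>2)) \<partial>lborel_on W)"
      by (intro nn_integral_cong) (simp add: ennreal_mult[symmetric] exp_add[symmetric] algebra_simps)
    also have "\<dots> = ennreal (exp (- (s\<^sup>2 * t))) * ennreal ((pi / t) powr (dim W / 2))"
      using nn_integral_lborel_on_exp[OF W t] by (simp add: nn_integral_cmult)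
    finally show "(\<integral>\<^sup>+y. ennreal (exp (- (((norm y)\<^sup>2 + s\<^sup>2) * t))) \<partial>lborel_on W) = ennreal (exp (- (s\<^sup>2 * t)) * (pi / t) powr (dim W / 2))"
      by (simp add: ennreal_mult)
  qed auto
  also have "\<dots> = (LINT t|lborel. of_real (pi powr (dim W / 2)) * (indicator {0<..} t *\<^sub>R (complex_of_real t powr (\<beta> - dim W / 2 - 1) * complex_of_real (exp (- (s\<^sup>2 * t))))))"
  proof (rule Bochner_Integration.integral_cong[OF refl])
    fix t :: real
    have "complex_of_real t powr (\<beta> - 1) * complex_of_real ((pi / t) powr (dim W / 2)) = of_real (pi powr (dim W / 2)) * complex_of_real t powr (\<beta> - dim W / 2 - 1)" if "t > 0"
    proof -
      have "complex_of_real t powr (\<beta> - 1) = complex_of_real t powr complex_of_real (dim W / 2) * complex_of_real t powr (\<beta> - dim W / 2 - 1)"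
        by (simp add: powr_add[symmetric])
      moreover have "complex_of_real t powr complex_of_real (dim W / 2) = complex_of_real (t powr (dim W / 2))"
        using that by (subst powr_of_real) auto
      ultimately show ?thesis using that by (simp add: powr_divide)
    qed
    then show "indicator {0<..} t *\<^sub>R (complex_of_real t powr (\<beta> - 1) * complex_of_real (exp (- (s\<^sup>2 * t)) * (pi / t) powr (dim W / 2)))
      = of_real (pi powr (dim W / 2)) * (indicator {0<..} t *\<^sub>R (complex_of_real t powr (\<beta> - dim W / 2 - 1) * complex_of_real (exp (- (s\<^sup>2 * t)))))"
      by (cases "t > 0") (auto simp: mult_ac)
  qed
  also have "\<dots> = of_real (pi powr (dim W / 2)) * (Gamma (\<beta> - dim W / 2) * complex_of_real (s\<^sup>2) powr (- (\<beta> - dim W / 2)))"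
    using b s by (subst Bochner_Integration.integral_mult_right_zero, subst integral_Gamma_complex) auto
  finally have "Gamma \<beta> * (LINT y|lborel_on W. complex_of_real ((norm y)\<^sup>2 + s\<^sup>2) powr (- \<beta>))
    = of_real (pi powr (dim W / 2)) * (Gamma (\<beta> - dim W / 2) * complex_of_real (s\<^sup>2) powr (- (\<beta> - dim W / 2)))" .
  moreover have "Gamma \<beta> \<noteq> 0" using b0 by (auto simp: Gamma_eq_zero_iff elim!: nonpos_Ints_cases)
  ultimately show ?thesis by (simp add: field_simps)
qed

lemma Gamma_nonzero_Re: "Re z > 0 \<Longrightarrow> Gamma z \<noteq> 0"
  by (auto simp: Gamma_eq_zero_iff elim!: nonpos_Ints_cases)

section \<open>Gaussian moments\<close>

text \<open>
  The Gaussian of density \<open>exp(-|w|\<^sup>2)\<close> on \<open>W\<close>, of total mass \<open>pi\<close> to the power \<open>dim W / 2\<close>.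
\<close>
definition gauss :: "'a::euclidean_space set \<Rightarrow> 'a measure" where
  "gauss W = density (lborel_on W) (\<lambda>w. ennreal (exp (- (norm w)\<^sup>2)))"

lemma sets_gauss [simp, measurable_cong]: "sets (gauss W) = sets borel"
  by (simp add: gauss_def)

lemma space_gauss [simp]: "space (gauss W) = UNIV"
  by (simp add: gauss_def)

lemma nn_integral_gauss:
  "f \<in> borel_measurable borel \<Longrightarrow> (\<integral>\<^sup>+w. f w \<partial>gauss W) = (\<integral>\<^sup>+w. ennreal (exp (- (norm w)\<^sup>2)) * f w \<partial>lborel_on W)"
  unfolding gauss_def by (subst nn_integral_density) auto

lemma AE_gauss: "(AE w in lborel_on W. P w) \<Longrightarrow> (AE w in gauss W. P w)"
  unfolding gauss_def by (subst AE_density) auto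

lemma nn_integral_gauss_exp:
  assumes W: "subspace W" and t: "t > - 1"
  shows "(\<integral>\<^sup>+w. ennreal (exp (- ((norm w)\<^sup>2 * t))) \<partial>gauss W) = ennreal ((pi / (1 + t)) powr (dim W / 2))"
proof -
  have "(\<integral>\<^sup>+w. ennreal (exp (- ((norm w)\<^sup>2 * t))) \<partial>gauss W) = (\<integral>\<^sup>+w. ennreal (exp (- (1 + t) * (norm w)\<^sup>2)) \<partial>lborel_on W)"
    by (subst nn_integral_gauss)
       (auto intro!: nn_integral_cong simp: ennreal_mult[symmetric] exp_add[symmetric] algebra_simps)
  also have "\<dots> = ennreal ((pi / (1 + t)) powr (dim W / 2))" using t by (intro nn_integral_lborel_on_exp W) auto
  finally show ?thesis .
qed

lemma gauss_total: "subspace W \<Longrightarrow> emeasure (gauss W) UNIV = ennreal (pi powr (dim W / 2))"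
  using nn_integral_gauss_exp[of W 0] by (simp add: gauss_def)

lemma finite_gauss: "subspace W \<Longrightarrow> finite_measure (gauss W)"
  by (rule finite_measureI) (simp add: gauss_total)

lemma sigma_finite_gauss: "subspace W \<Longrightarrow> sigma_finite_measure (gauss W)"
  using finite_gauss by (rule finite_measure.axioms(1))

text \<open>
  The distribution of the squared length of a vector under \<open>gauss W\<close>, for \<open>a = dim W / 2\<close>.
\<close>
definition gamma_law :: "real \<Rightarrow> real measure" where
  "gamma_law a = density lborel (\<lambda>s. ennreal (pi powr a / Gamma a * (indicator {0<..} s * (s powr (a - 1) * exp (- s)))))"

lemma sets_gamma_law [simp, measurable_cong]: "sets (gamma_law a) = sets borel"
  by (simp add: gamma_law_def)

lemma nn_integral_gamma_law:
  assumes a: "a > 0" and [measurable]: "f \<in> borel_measurable borel"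
  shows "(\<integral>\<^sup>+s. f s \<partial>gamma_law a)
    = ennreal (pi powr a / Gamma a) * (\<integral>\<^sup>+s. ennreal (indicator {0<..} s * (s powr (a - 1) * exp (- s))) * f s \<partial>lborel)"
proof -
  have "(\<integral>\<^sup>+s. f s \<partial>gamma_law a) = (\<integral>\<^sup>+s. ennreal (pi powr a / Gamma a) * (ennreal (indicator {0<..} s * (s powr (a - 1) * exp (- s))) * f s) \<partial>lborel)"
  proof -
    have "ennreal (pi powr a / Gamma a * g) * f s = ennreal (pi powr a / Gamma a) * (ennreal g * f s)" for g s
      using Gamma_real_pos[OF a] by (subst ennreal_mult') (simp_all add: mult.assoc)
    then show ?thesis unfolding gamma_law_def by (subst nn_integral_density) simp_all
  qed
  then show ?thesis by (subst (asm) nn_integral_cmult) auto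
qed

lemma gamma_law_Laplace:
  assumes a: "a > 0" and t: "t > - 1"
  shows "(\<integral>\<^sup>+s. ennreal (exp (- (s * t))) \<partial>gamma_law a) = ennreal ((pi / (1 + t)) powr a)"
proof -
  have "(\<integral>\<^sup>+s. ennreal (exp (- (s * t))) \<partial>gamma_law a)
     = ennreal (pi powr a / Gamma a) * (\<integral>\<^sup>+s. ennreal (indicator {0<..} s * (s powr (a - 1) * exp (- ((1 + t) * s)))) \<partial>lborel)"
    by (subst nn_integral_gamma_law[OF a])
       (auto intro!: nn_integral_cong arg_cong2[where f="(*)"] simp: ennreal_mult[symmetric] exp_add[symmetric] algebra_simps mult_exp_exp)
  also have "\<dots> = ennreal (pi powr a / Gamma a) * ennreal (Gamma a * (1 + t) powr (- a))"
    using t by (subst nn_integral_Gamma) (auto simp: a)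
  also have "\<dots> = ennreal ((pi / (1 + t)) powr a)"
  proof -
    have "(pi / (1 + t)) powr a = pi powr a * (1 + t) powr (- a)"
      using t by (simp add: powr_divide powr_minus field_simps)
    then show ?thesis using Gamma_real_pos[OF a] by (simp add: ennreal_mult[symmetric])
  qed
  finally show ?thesis .
qed

lemma sigma_finite_gamma_law: "a > 0 \<Longrightarrow> sigma_finite_measure (gamma_law a)"
proof (rule finite_measure.axioms(1), rule finite_measureI)
  assume "a > 0"
  from gamma_law_Laplace[OF this, of 0] show "emeasure (gamma_law a) (space (gamma_law a)) \<noteq> \<infinity>"
    by (simp add: gamma_law_def)
qed

lemma gamma_law_pos: "AE s in gamma_law a. 0 < s"
  unfolding gamma_law_def by (subst AE_density) (auto simp: indicator_def)

lemma nn_integral_gamma_law_powr: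
  assumes a: "a > 0" and b: "b < a"
  shows "(\<integral>\<^sup>+s. ennreal (s powr (- b)) \<partial>gamma_law a) = ennreal (pi powr a / Gamma a * Gamma (a - b))"
proof -
  have "(\<integral>\<^sup>+s. ennreal (s powr (- b)) \<partial>gamma_law a)
     = ennreal (pi powr a / Gamma a) * (\<integral>\<^sup>+s. ennreal (indicator {0<..} s * (s powr (a - b - 1) * exp (- (1 * s)))) \<partial>lborel)"
  proof (subst nn_integral_gamma_law[OF a], simp, intro arg_cong2[where f="(*)"] refl nn_integral_cong)
    fix s :: real
    have "s powr (a - 1) * s powr (- b) = s powr (a - b - 1)" by (simp add: powr_add[symmetric] algebra_simps)
    then show "ennreal (indicator {0<..} s * (s powr (a - 1) * exp (- s))) * ennreal (s powr (- b))
      = ennreal (indicator {0<..} s * (s powr (a - b - 1) * exp (- (1 * s))))"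
      by (simp add: ennreal_mult[symmetric] mult_ac)
  qed
  also have "\<dots> = ennreal (pi powr a / Gamma a) * ennreal (Gamma (a - b))"
    using b by (subst nn_integral_Gamma) auto
  finally show ?thesis using Gamma_real_pos[OF a] b by (simp add: ennreal_mult[symmetric])
qed

lemma integral_gamma_law_powr:
  fixes \<beta> :: complex
  assumes a: "a > 0" and b: "Re \<beta> < a"
  shows "(LINT s|gamma_law a. complex_of_real s powr (- \<beta>)) = of_real (pi powr a / Gamma a) * Gamma (of_real a - \<beta>)"
proof -
  have "(LINT s|gamma_law a. complex_of_real s powr (- \<beta>))
     = (LINT s|lborel. (pi powr a / Gamma a * (indicator {0<..} s * (s powr (a - 1) * exp (- s)))) *\<^sub>R complex_of_real s powr (- \<beta>))"
    unfolding gamma_law_def using Gamma_real_pos[OF a] by (subst integral_density) auto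
  also have "\<dots> = (LINT s|lborel. complex_of_real (pi powr a / Gamma a) * (indicator {0<..} s *\<^sub>R (complex_of_real s powr (of_real a - \<beta> - 1) * complex_of_real (exp (- (1 * s))))))"
  proof (rule Bochner_Integration.integral_cong[OF refl])
    fix s :: real
    show "(pi powr a / Gamma a * (indicator {0<..} s * (s powr (a - 1) * exp (- s)))) *\<^sub>R complex_of_real s powr (- \<beta>)
      = complex_of_real (pi powr a / Gamma a) * (indicator {0<..} s *\<^sub>R (complex_of_real s powr (of_real a - \<beta> - 1) * complex_of_real (exp (- (1 * s)))))"
    proof (cases "s > 0")
      case True
      have 1: "complex_of_real (s powr (a - 1)) = complex_of_real s powr (of_real a - 1)"
        using True powr_of_real[of s "a - 1"] by simp
      have 2: "complex_of_real s powr (of_real a - \<beta> - 1) = complex_of_real s powr (of_real a - 1) * complex_of_real s powr (- \<beta>)"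
        by (simp add: powr_add[symmetric] algebra_simps)
      show ?thesis using True by (simp add: scaleR_conv_of_real 1 2)
    qed simp
  qed
  also have "\<dots> = complex_of_real (pi powr a / Gamma a) * (Gamma (of_real a - \<beta>) * complex_of_real 1 powr (- (of_real a - \<beta>)))"
    using b by (subst Bochner_Integration.integral_mult_right_zero, subst integral_Gamma_complex) auto
  finally show ?thesis by simp
qed

text \<open>
  The squared length under the Gaussian and the Gamma distribution have the same Laplace transform, and
  moments of negative order depend on nothing else.
\<close>

lemma nn_integral_gauss_powr:
  assumes W: "subspace W" "dim W > 0" and b: "0 < b" "b < dim W / 2"
  shows "(\<integral>\<^sup>+w. ennreal (((norm w)\<^sup>2) powr (- b)) \<partial>gauss W) = ennreal (pi powr (dim W / 2) / Gamma (dim W / 2) * Gamma (dim W / 2 - b))"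
proof -
  have a: "real (dim W) / 2 > 0" using W by simp
  have "W \<noteq> {0}" using W by auto
  then have pos: "AE w in gauss W. w \<noteq> 0"
    by (intro AE_gauss AE_lborel_on_neq W(1) subspace_0)
  have "ennreal (Gamma b) * (\<integral>\<^sup>+w. ennreal (((norm w)\<^sup>2) powr (- b)) \<partial>gauss W)
     = ennreal (Gamma b) * (\<integral>\<^sup>+s. ennreal (s powr (- b)) \<partial>gamma_law (dim W / 2))"
  proof (rule trans[OF nn_integral_powr_Laplace nn_integral_powr_Laplace[symmetric]])
    show "(\<integral>\<^sup>+w. ennreal (exp (- ((norm w)\<^sup>2 * t))) \<partial>gauss W) = ennreal ((pi / (1 + t)) powr (dim W / 2))" if "t > 0" for t
      using that by (intro nn_integral_gauss_exp W) auto
    show "(\<integral>\<^sup>+s. ennreal (exp (- (s * t))) \<partial>gamma_law (dim W / 2)) = ennreal ((pi / (1 + t)) powr (dim W / 2))" if "t > 0" for t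
      using that by (intro gamma_law_Laplace a) auto
  qed (auto simp: b pos gamma_law_pos intro!: sigma_finite_gauss W sigma_finite_gamma_law a)
  then have "(\<integral>\<^sup>+w. ennreal (((norm w)\<^sup>2) powr (- b)) \<partial>gauss W) = (\<integral>\<^sup>+s. ennreal (s powr (- b)) \<partial>gamma_law (dim W / 2))"
    using Gamma_real_pos[OF b(1)] by (simp add: ennreal_mult_cancel_left)
  then show ?thesis by (simp add: nn_integral_gamma_law_powr[OF a b(2)])
qed

lemma integral_gauss_powr:
  fixes \<beta> :: complex
  assumes W: "subspace W" "dim W > 0" and b: "0 < Re \<beta>" "Re \<beta> < dim W / 2"
  shows "(LINT w|gauss W. complex_of_real ((norm w)\<^sup>2) powr (- \<beta>)) = of_real (pi powr (dim W / 2) / Gamma (dim W / 2)) * Gamma (of_real (dim W / 2) - \<beta>)"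
proof -
  have a: "real (dim W) / 2 > 0" using W by simp
  have "W \<noteq> {0}" using W by auto
  then have pos: "AE w in gauss W. w \<noteq> 0"
    by (intro AE_gauss AE_lborel_on_neq W(1) subspace_0)
  have "Gamma \<beta> * (LINT w|gauss W. complex_of_real ((norm w)\<^sup>2) powr (- \<beta>))
     = Gamma \<beta> * (LINT s|gamma_law (dim W / 2). complex_of_real s powr (- \<beta>))"
  proof (rule trans[OF integral_powr_Laplace integral_powr_Laplace[symmetric]])
    show "(\<integral>\<^sup>+w. ennreal (exp (- ((norm w)\<^sup>2 * t))) \<partial>gauss W) = ennreal ((pi / (1 + t)) powr (dim W / 2))" if "t > 0" for t
      using that by (intro nn_integral_gauss_exp W) auto
    show "(\<integral>\<^sup>+s. ennreal (exp (- (s * t))) \<partial>gamma_law (dim W / 2)) = ennreal ((pi / (1 + t)) powr (dim W / 2))" if "t > 0" for t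
      using that by (intro gamma_law_Laplace a) auto
    show "(\<integral>\<^sup>+w. ennreal (((norm w)\<^sup>2) powr (- Re \<beta>)) \<partial>gauss W) < \<infinity>"
      by (simp add: nn_integral_gauss_powr[OF W b])
    show "(\<integral>\<^sup>+s. ennreal (s powr (- Re \<beta>)) \<partial>gamma_law (dim W / 2)) < \<infinity>"
      by (simp add: nn_integral_gamma_law_powr[OF a b(2)])
  qed (auto simp: b pos gamma_law_pos intro!: sigma_finite_gauss W sigma_finite_gamma_law a)
  moreover have "Gamma \<beta> \<noteq> 0" using b by (auto simp: Gamma_eq_zero_iff elim!: nonpos_Ints_cases)
  ultimately have "(LINT w|gauss W. complex_of_real ((norm w)\<^sup>2) powr (- \<beta>)) = (LINT s|gamma_law (dim W / 2). complex_of_real s powr (- \<beta>))"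
    by (rule mult_left_cancel[THEN iffD1, rotated])
  then show ?thesis by (simp only: integral_gamma_law_powr[OF a b(2)])
qed

section \<open>Averaging the kernel over rotations\<close>

context orthogonal_frame
begin

text \<open>
  Every vector of \<open>X\<^sup>\<bottom>\<close> is a multiple of a rotation of \<open>e\<close>, and the rotation is absorbed by Haar measure.
\<close>

lemma haar_isotropic:
  fixes h :: "real \<Rightarrow> ennreal"
  assumes e: "e \<in> X\<^sup>\<bottom>" "norm e = 1" and w: "w \<in> X\<^sup>\<bottom>" and h[measurable]: "h \<in> borel_measurable borel"
  shows "(\<integral>\<^sup>+C. h (norm (proj V0 (transpose C *v w))) \<partial>haar (X\<^sup>\<bottom>)) = (\<integral>\<^sup>+C. h (norm w * norm (proj V0 (transpose C *v e))) \<partial>haar (X\<^sup>\<bottom>))"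
proof -
  note borel_measurable_proj[OF subs(4), measurable]
  define s where "s = (if w = 0 then e else w /\<^sub>R norm w)"
  have s: "s \<in> X\<^sup>\<bottom>" "norm s = norm e" "w = norm w *\<^sub>R s"
    using e w by (auto simp: s_def intro: subspace_scale[OF subspace_orthogonal_comp])
  define S where "S = refl (s - e)"
  have S: "S \<in> rot (X\<^sup>\<bottom>)" unfolding S_def by (intro refl_in_rot subspace_diff subspace_orthogonal_comp s e)
  have Se: "S *v e = s" unfolding S_def by (rule refl_swap(1)[OF s(2)])
  have eq: "norm (proj V0 (transpose C *v w)) = norm w * norm (proj V0 (transpose (transpose S ** C) *v e))" for C
  proof -
    have "transpose (transpose S ** C) *v e = transpose C *v s"
      by (simp add: matrix_transpose_mul Se flip: matrix_vector_mul_assoc)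
    moreover have "proj V0 (transpose C *v w) = norm w *\<^sub>R proj V0 (transpose C *v s)"
      by (subst s(3)) (simp add: matrix_vector_mult_scaleR proj_scaleR subs)
    ultimately show ?thesis by simp
  qed
  show ?thesis unfolding eq
    by (rule haar_left[OF subspace_orthogonal_comp rot_transpose[OF S], where F="\<lambda>C. h (norm w * norm (proj V0 (transpose C *v e)))"]) measurable
qed

text \<open>
  A Gaussian vector in \<open>X\<^sup>\<bottom> = W0 + V0\<close> is its length times an independent uniform direction; its
  \<open>V0\<close>-component is Gaussian in \<open>V0\<close>. Comparing moments of both descriptions gives the moments of the
  \<open>V0\<close>-component of a uniform direction.
\<close>

lemma nn_integral_gauss_rotations:
  fixes h :: "real \<Rightarrow> ennreal"
  assumes e: "e \<in> X\<^sup>\<bottom>" "norm e = 1" and h[measurable]: "h \<in> borel_measurable borel"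
  shows "(\<integral>\<^sup>+w. \<integral>\<^sup>+C. h (norm w * norm (proj V0 (transpose C *v e))) \<partial>haar (X\<^sup>\<bottom>) \<partial>gauss (X\<^sup>\<bottom>))
    = ennreal (pi powr (l / 2)) * (\<integral>\<^sup>+v. h (norm v) \<partial>gauss V0)"
proof -
  note sets_haar[OF subspace_orthogonal_comp[of X], measurable_cong] borel_measurable_proj[OF subs(4), measurable]
  interpret HX: prob_space "haar (X\<^sup>\<bottom>)" by (rule prob_haar[OF subspace_orthogonal_comp])
  interpret GX: sigma_finite_measure "gauss (X\<^sup>\<bottom>)" by (rule sigma_finite_gauss[OF subspace_orthogonal_comp])
  interpret XG: pair_sigma_finite "haar (X\<^sup>\<bottom>)" "gauss (X\<^sup>\<bottom>)" ..
  interpret KV: sigma_finite_measure "lborel_on V0" by (rule sigma_finite_lborel_on[OF subs(4)])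
  have "(\<integral>\<^sup>+w. \<integral>\<^sup>+C. h (norm w * norm (proj V0 (transpose C *v e))) \<partial>haar (X\<^sup>\<bottom>) \<partial>gauss (X\<^sup>\<bottom>))
     = (\<integral>\<^sup>+w. \<integral>\<^sup>+C. h (norm (proj V0 (transpose C *v w))) \<partial>haar (X\<^sup>\<bottom>) \<partial>gauss (X\<^sup>\<bottom>))"
    by (rule nn_integral_cong_AE, use AE_gauss[OF AE_lborel_on_in[OF subspace_orthogonal_comp]] in eventually_elim)
       (rule haar_isotropic[OF e _ h, symmetric])
  also have "\<dots> = (\<integral>\<^sup>+C. \<integral>\<^sup>+w. h (norm (proj V0 (transpose C *v w))) \<partial>gauss (X\<^sup>\<bottom>) \<partial>haar (X\<^sup>\<bottom>))"
    by (rule XG.Fubini') measurable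
  also have "\<dots> = (\<integral>\<^sup>+C. \<integral>\<^sup>+w. h (norm (proj V0 w)) \<partial>gauss (X\<^sup>\<bottom>) \<partial>haar (X\<^sup>\<bottom>))"
  proof (rule nn_integral_cong)
    fix C assume "C \<in> space (haar (X\<^sup>\<bottom>))"
    then have C: "transpose C \<in> rot (X\<^sup>\<bottom>)" by (simp add: space_haar subspace_orthogonal_comp rot_transpose)
    note o = rot_orthogonal[OF C]
    have "(\<integral>\<^sup>+w. ennreal (exp (- (norm w)\<^sup>2)) * h (norm (proj V0 w)) \<partial>lborel_on ((*v) (transpose C) ` (X\<^sup>\<bottom>)))
      = (\<integral>\<^sup>+w. ennreal (exp (- (norm (transpose C *v w))\<^sup>2)) * h (norm (proj V0 (transpose C *v w))) \<partial>lborel_on (X\<^sup>\<bottom>))"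
      by (rule nn_integral_lborel_on_rotate[OF subspace_orthogonal_comp o, where g="\<lambda>w. ennreal (exp (- (norm w)\<^sup>2)) * h (norm (proj V0 w))"]) measurable
    then show "(\<integral>\<^sup>+w. h (norm (proj V0 (transpose C *v w))) \<partial>gauss (X\<^sup>\<bottom>)) = (\<integral>\<^sup>+w. h (norm (proj V0 w)) \<partial>gauss (X\<^sup>\<bottom>))"
      by (simp add: nn_integral_gauss rot_image[OF subspace_orthogonal_comp C] orthogonal_matrix_norm[OF o])
  qed
  also have "\<dots> = (\<integral>\<^sup>+w. h (norm (proj V0 w)) \<partial>gauss (X\<^sup>\<bottom>))" by (simp add: HX.emeasure_space_1)
  also have "\<dots> = (\<integral>\<^sup>+w. ennreal (exp (- (norm w)\<^sup>2)) * h (norm (proj V0 w)) \<partial>lborel_on (W0 + V0))"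
    by (subst nn_integral_gauss) (simp_all add: X_comp)
  also have "\<dots> = (\<integral>\<^sup>+u. \<integral>\<^sup>+v. ennreal (exp (- (norm (u + v))\<^sup>2)) * h (norm (proj V0 (u + v))) \<partial>lborel_on V0 \<partial>lborel_on W0)"
    by (rule nn_integral_lborel_on_sum[OF subs(3,4) orth(6)]) measurable
  also have "\<dots> = (\<integral>\<^sup>+u. ennreal (exp (- (norm u)\<^sup>2)) * (\<integral>\<^sup>+v. ennreal (exp (- (norm v)\<^sup>2)) * h (norm v) \<partial>lborel_on V0) \<partial>lborel_on W0)"
  proof (rule nn_integral_cong_AE, use AE_lborel_on_in[OF subs(3)] in eventually_elim)
    fix u assume u: "u \<in> W0"
    have "(\<integral>\<^sup>+v. ennreal (exp (- (norm (u + v))\<^sup>2)) * h (norm (proj V0 (u + v))) \<partial>lborel_on V0)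
      = (\<integral>\<^sup>+v. ennreal (exp (- (norm u)\<^sup>2)) * (ennreal (exp (- (norm v)\<^sup>2)) * h (norm v)) \<partial>lborel_on V0)"
    proof (rule nn_integral_cong_AE, use AE_lborel_on_in[OF subs(4)] in eventually_elim)
      fix v assume v: "v \<in> V0"
      have pu: "proj V0 u = 0" by (rule proj_zero[OF subs(4)]) (use orth(6) u in blast)
      have "u \<bullet> v = 0" using orthogonal_comp_inner(2)[of u V0 v] orth(6) u v by blast
      then have "(norm (u + v))\<^sup>2 = (norm u)\<^sup>2 + (norm v)\<^sup>2"
        by (intro norm_add_Pythagorean) (simp add: orthogonal_def)
      then show "ennreal (exp (- (norm (u + v))\<^sup>2)) * h (norm (proj V0 (u + v)))
        = ennreal (exp (- (norm u)\<^sup>2)) * (ennreal (exp (- (norm v)\<^sup>2)) * h (norm v))"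
        using v subs by (simp add: proj_add pu mult.assoc[symmetric] ennreal_mult[symmetric] exp_add[symmetric] add.commute)
    qed
    also have "\<dots> = ennreal (exp (- (norm u)\<^sup>2)) * (\<integral>\<^sup>+v. ennreal (exp (- (norm v)\<^sup>2)) * h (norm v) \<partial>lborel_on V0)"
      by (rule nn_integral_cmult) measurable
    finally show "(\<integral>\<^sup>+v. ennreal (exp (- (norm (u + v))\<^sup>2)) * h (norm (proj V0 (u + v))) \<partial>lborel_on V0)
      = ennreal (exp (- (norm u)\<^sup>2)) * (\<integral>\<^sup>+v. ennreal (exp (- (norm v)\<^sup>2)) * h (norm v) \<partial>lborel_on V0)" .
  qed
  also have "\<dots> = (\<integral>\<^sup>+u. ennreal (exp (- 1 * (norm u)\<^sup>2)) \<partial>lborel_on W0) * (\<integral>\<^sup>+v. ennreal (exp (- (norm v)\<^sup>2)) * h (norm v) \<partial>lborel_on V0)"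
    by (subst nn_integral_multc) auto
  also have "(\<integral>\<^sup>+u. ennreal (exp (- 1 * (norm u)\<^sup>2)) \<partial>lborel_on W0) = ennreal (pi powr (l / 2))"
    by (subst nn_integral_lborel_on_exp[OF subs(3)]) (simp_all add: dims)
  finally show ?thesis by (simp add: nn_integral_gauss)
qed

lemma dim_X_comp: "dim (X\<^sup>\<bottom>) = l + dim V0"
  unfolding X_comp by (simp add: dim_orth_sum[OF subs(3,4) orth(6)] dims)

text \<open>
  Apply the comparison with the Gaussian to the indicator of \<open>0\<close>; the Gaussian in \<open>V0\<close> has no mass there.
\<close>

lemma AE_haar_proj_nonzero:
  assumes e: "e \<in> X\<^sup>\<bottom>" "norm e = 1" and V: "dim V0 > 0"
  shows "AE C in haar (X\<^sup>\<bottom>). proj V0 (transpose C *v e) \<noteq> 0"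
proof -
  note sets_haar[OF subspace_orthogonal_comp[of X], measurable_cong] borel_measurable_proj[OF subs(4), measurable]
  have ne: "Y \<noteq> {0}" if "dim Y > 0" for Y :: "(real^'n) set" using that by (metis dim_eq_0 less_irrefl order_refl)
  have V0: "V0 \<noteq> {0}" "X\<^sup>\<bottom> \<noteq> {0}" by (rule ne[OF V], rule ne) (simp only: dim_X_comp, use V in linarith)
  have "ennreal (pi powr ((l + dim V0) / 2)) * (\<integral>\<^sup>+C. indicator {0} (norm (proj V0 (transpose C *v e))) \<partial>haar (X\<^sup>\<bottom>))
    = (\<integral>\<^sup>+w. \<integral>\<^sup>+C. indicator {0} (norm (proj V0 (transpose C *v e))) \<partial>haar (X\<^sup>\<bottom>) \<partial>gauss (X\<^sup>\<bottom>))"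
    using gauss_total[OF subspace_orthogonal_comp, of X] by (simp add: dim_X_comp gauss_def mult.commute)
  also have "\<dots> = (\<integral>\<^sup>+w. \<integral>\<^sup>+C. indicator {0} (norm w * norm (proj V0 (transpose C *v e))) \<partial>haar (X\<^sup>\<bottom>) \<partial>gauss (X\<^sup>\<bottom>))"
    by (rule nn_integral_cong_AE, use AE_gauss[OF AE_lborel_on_neq[OF subspace_orthogonal_comp V0(2) subspace_0[OF subspace_orthogonal_comp]]] in eventually_elim)
       (simp add: indicator_def)
  also have "\<dots> = ennreal (pi powr (l / 2)) * (\<integral>\<^sup>+v. indicator {0} (norm v) \<partial>gauss V0)"
    by (rule nn_integral_gauss_rotations[OF e]) measurable
  also have "(\<integral>\<^sup>+v. indicator {0} (norm v) \<partial>gauss V0) = (\<integral>\<^sup>+v. 0 \<partial>gauss V0)"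
    by (rule nn_integral_cong_AE, use AE_gauss[OF AE_lborel_on_neq[OF subs(4) V0(1) subspace_0[OF subs(4)]]] in eventually_elim) simp
  finally have "(\<integral>\<^sup>+C. indicator {0} (norm (proj V0 (transpose C *v e))) \<partial>haar (X\<^sup>\<bottom>)) = 0" by simp
  then have "AE C in haar (X\<^sup>\<bottom>). (indicator {0} (norm (proj V0 (transpose C *v e))) :: ennreal) = 0"
    by (subst (asm) nn_integral_0_iff_AE) auto
  then show ?thesis by eventually_elim (auto simp: indicator_def split: if_splits)
qed

text \<open>
  The quotient of the normalized moments of order \<open>-2b\<close> of the length under the Gaussians of \<open>V0\<close> and of \<open>X\<^sup>\<bottom>\<close>.
\<close>
definition rot_const :: "real \<Rightarrow> real" where
  "rot_const b = Gamma (dim V0 / 2 - b) * Gamma ((l + dim V0) / 2) / (Gamma (dim V0 / 2) * Gamma ((l + dim V0) / 2 - b))"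

definition rot_const_complex :: "complex \<Rightarrow> complex" where
  "rot_const_complex \<beta> = Gamma (complex_of_real (dim V0 / 2) - \<beta>) * complex_of_real (Gamma ((l + dim V0) / 2))
     / (complex_of_real (Gamma (dim V0 / 2)) * Gamma (complex_of_real ((l + dim V0) / 2) - \<beta>))"

text \<open>
  The kernel is multiplicative, so that the moment of the \<open>V0\<close>-component of a Gaussian in \<open>X\<^sup>\<bottom>\<close> is the product of the
  moment of the length and the wanted average.
\<close>

lemma nn_integral_rot_powr:
  assumes e: "e \<in> X\<^sup>\<bottom>" "norm e = 1" and b: "0 < b" "b < dim V0 / 2"
  shows "(\<integral>\<^sup>+C. ennreal (((norm (proj V0 (transpose C *v e)))\<^sup>2) powr (- b)) \<partial>haar (X\<^sup>\<bottom>)) = ennreal (rot_const b)"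
    and "rot_const b > 0"
proof -
  note sets_haar[OF subspace_orthogonal_comp[of X], measurable_cong] borel_measurable_proj[OF subs(4), measurable]
  let ?I = "\<integral>\<^sup>+C. ennreal (((norm (proj V0 (transpose C *v e)))\<^sup>2) powr (- b)) \<partial>haar (X\<^sup>\<bottom>)"
  have V: "dim V0 > 0" using b by (cases "dim V0 = 0") auto
  let ?d = "real (dim V0) / 2" and ?D = "real (l + dim V0) / 2"
  have bD: "b < ?D" using b by (simp add: field_simps)
  have dX: "dim (X\<^sup>\<bottom>) > 0" using V dim_X_comp by simp
  have pos: "Gamma ?d > 0" "Gamma ?D > 0" "Gamma (?d - b) > 0" "Gamma (?D - b) > 0"
    using b V bD by (auto intro!: Gamma_real_pos)
  show "rot_const b > 0" unfolding rot_const_def using pos by simp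
  have "ennreal (pi powr ?D / Gamma ?D * Gamma (?D - b)) * ?I
     = (\<integral>\<^sup>+w. ennreal (((norm w)\<^sup>2) powr (- b)) \<partial>gauss (X\<^sup>\<bottom>)) * ?I"
    using nn_integral_gauss_powr[OF subspace_orthogonal_comp dX b(1)] bD by (simp add: dim_X_comp)
  also have "\<dots> = (\<integral>\<^sup>+w. \<integral>\<^sup>+C. ennreal (((norm w)\<^sup>2) powr (- b)) * ennreal (((norm (proj V0 (transpose C *v e)))\<^sup>2) powr (- b)) \<partial>haar (X\<^sup>\<bottom>) \<partial>gauss (X\<^sup>\<bottom>))"
    by (subst nn_integral_cmult) (simp_all add: nn_integral_multc)
  also have "\<dots> = (\<integral>\<^sup>+w. \<integral>\<^sup>+C. ennreal (((norm w * norm (proj V0 (transpose C *v e)))\<^sup>2) powr (- b)) \<partial>haar (X\<^sup>\<bottom>) \<partial>gauss (X\<^sup>\<bottom>))"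
    by (simp add: ennreal_mult[symmetric] powr_mult power_mult_distrib)
  also have "\<dots> = ennreal (pi powr (l / 2)) * (\<integral>\<^sup>+v. ennreal (((norm v)\<^sup>2) powr (- b)) \<partial>gauss V0)"
    by (rule nn_integral_gauss_rotations[OF e, where h="\<lambda>s. ennreal ((s\<^sup>2) powr (- b))"]) measurable
  also have "\<dots> = ennreal (pi powr (l / 2) * (pi powr ?d / Gamma ?d * Gamma (?d - b)))"
    using pos by (simp add: nn_integral_gauss_powr[OF subs(4) V b] ennreal_mult[symmetric])
  also have "pi powr (l / 2) * (pi powr ?d / Gamma ?d * Gamma (?d - b)) = (pi powr ?D / Gamma ?D * Gamma (?D - b)) * rot_const b"
  proof -
    have "pi powr ?D = pi powr (l / 2) * pi powr ?d" by (simp add: powr_add[symmetric] add_divide_distrib)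
    then show ?thesis unfolding rot_const_def using pos by (simp add: field_simps)
  qed
  also have "ennreal \<dots> = ennreal (pi powr ?D / Gamma ?D * Gamma (?D - b)) * ennreal (rot_const b)"
    using pos \<open>rot_const b > 0\<close> by (intro ennreal_mult) simp_all
  finally show "?I = ennreal (rot_const b)"
    using pos by (simp add: ennreal_mult_cancel_left)
qed

text \<open>
  The same product formula for complex exponents. The comparison of Gaussian and rotations is transferred as an
  equality of distributions, which then applies to complex integrands.
\<close>

lemma integral_rot_powr:
  fixes \<beta> :: complex
  assumes e: "e \<in> X\<^sup>\<bottom>" "norm e = 1" and b: "0 < Re \<beta>" "Re \<beta> < dim V0 / 2"
  shows "(LINT C|haar (X\<^sup>\<bottom>). complex_of_real ((norm (proj V0 (transpose C *v e)))\<^sup>2) powr (- \<beta>)) = rot_const_complex \<beta>"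
proof -
  note sets_haar[OF subspace_orthogonal_comp[of X], measurable_cong] borel_measurable_proj[OF subs(4), measurable]
  interpret HX: prob_space "haar (X\<^sup>\<bottom>)" by (rule prob_haar[OF subspace_orthogonal_comp])
  interpret GX: sigma_finite_measure "gauss (X\<^sup>\<bottom>)" by (rule sigma_finite_gauss[OF subspace_orthogonal_comp])
  interpret XG: pair_sigma_finite "gauss (X\<^sup>\<bottom>)" "haar (X\<^sup>\<bottom>)" ..
  let ?I = "LINT C|haar (X\<^sup>\<bottom>). complex_of_real ((norm (proj V0 (transpose C *v e)))\<^sup>2) powr (- \<beta>)"
  have V: "dim V0 > 0" using b by (cases "dim V0 = 0") auto
  let ?d = "real (dim V0) / 2" and ?D = "real (l + dim V0) / 2"
  have bD: "Re \<beta> < ?D" using b by (simp add: field_simps)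
  have dX: "dim (X\<^sup>\<bottom>) > 0" using V dim_X_comp by simp
  let ?g = "\<lambda>z. norm (fst z) * norm (proj V0 (transpose (snd z) *v e))"
  let ?h = "\<lambda>s::real. complex_of_real (s\<^sup>2) powr (- \<beta>)"
  have [measurable]: "?g \<in> borel_measurable (gauss (X\<^sup>\<bottom>) \<Otimes>\<^sub>M haar (X\<^sup>\<bottom>))" by measurable
  have law: "distr (gauss (X\<^sup>\<bottom>) \<Otimes>\<^sub>M haar (X\<^sup>\<bottom>)) borel ?g = distr (density (gauss V0) (\<lambda>_. ennreal (pi powr (l / 2)))) borel norm"
  proof (rule measure_eqI)
    fix D assume "D \<in> sets (distr (gauss (X\<^sup>\<bottom>) \<Otimes>\<^sub>M haar (X\<^sup>\<bottom>)) borel ?g)"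
    then have [measurable]: "D \<in> sets borel" by simp
    have "emeasure (distr (gauss (X\<^sup>\<bottom>) \<Otimes>\<^sub>M haar (X\<^sup>\<bottom>)) borel ?g) D = (\<integral>\<^sup>+s. indicator D s \<partial>distr (gauss (X\<^sup>\<bottom>) \<Otimes>\<^sub>M haar (X\<^sup>\<bottom>)) borel ?g)"
      by simp
    also have "\<dots> = (\<integral>\<^sup>+w. \<integral>\<^sup>+C. indicator D (norm w * norm (proj V0 (transpose C *v e))) \<partial>haar (X\<^sup>\<bottom>) \<partial>gauss (X\<^sup>\<bottom>))"
      by (subst nn_integral_distr) (auto simp: HX.nn_integral_fst[symmetric])
    also have "\<dots> = ennreal (pi powr (l / 2)) * (\<integral>\<^sup>+v. indicator D (norm v) \<partial>gauss V0)"
      by (rule nn_integral_gauss_rotations[OF e]) measurable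
    also have "\<dots> = (\<integral>\<^sup>+s. indicator D s \<partial>distr (density (gauss V0) (\<lambda>_. ennreal (pi powr (l / 2)))) borel norm)"
      by (subst nn_integral_distr, simp, simp, subst nn_integral_density) (auto simp: nn_integral_cmult)
    finally show "emeasure (distr (gauss (X\<^sup>\<bottom>) \<Otimes>\<^sub>M haar (X\<^sup>\<bottom>)) borel ?g) D = emeasure (distr (density (gauss V0) (\<lambda>_. ennreal (pi powr (l / 2)))) borel norm) D"
      by simp
  qed simp
  have split: "?h (a * c) = ?h a * ?h c" for a c
    unfolding power_mult_distrib of_real_mult by (intro powr_times_real_left) auto
  have int: "integrable (gauss (X\<^sup>\<bottom>) \<Otimes>\<^sub>M haar (X\<^sup>\<bottom>)) (\<lambda>z. ?h (norm (fst z)) * ?h (norm (proj V0 (transpose (snd z) *v e))))"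
  proof (rule integrableI_bounded)
    have "(\<integral>\<^sup>+z. ennreal (norm (?h (norm (fst z)) * ?h (norm (proj V0 (transpose (snd z) *v e))))) \<partial>(gauss (X\<^sup>\<bottom>) \<Otimes>\<^sub>M haar (X\<^sup>\<bottom>)))
      = (\<integral>\<^sup>+w. \<integral>\<^sup>+C. ennreal (((norm w * norm (proj V0 (transpose C *v e)))\<^sup>2) powr (- Re \<beta>)) \<partial>haar (X\<^sup>\<bottom>) \<partial>gauss (X\<^sup>\<bottom>))"
      by (subst HX.nn_integral_fst[symmetric])
         (simp_all add: norm_mult norm_of_real_powr power_mult_distrib powr_mult del: of_real_power)
    also have "\<dots> = ennreal (pi powr (l / 2)) * (\<integral>\<^sup>+v. ennreal (((norm v)\<^sup>2) powr (- Re \<beta>)) \<partial>gauss V0)"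
      by (rule nn_integral_gauss_rotations[OF e, where h="\<lambda>s. ennreal ((s\<^sup>2) powr (- Re \<beta>))"]) measurable
    also have "\<dots> < \<infinity>" by (simp add: nn_integral_gauss_powr[OF subs(4) V b] ennreal_mult_less_top)
    finally show "(\<integral>\<^sup>+z. ennreal (norm (?h (norm (fst z)) * ?h (norm (proj V0 (transpose (snd z) *v e))))) \<partial>(gauss (X\<^sup>\<bottom>) \<Otimes>\<^sub>M haar (X\<^sup>\<bottom>))) < \<infinity>" .
  qed measurable
  have "(LINT w|gauss (X\<^sup>\<bottom>). ?h (norm w)) * ?I = (LINT w|gauss (X\<^sup>\<bottom>). LINT C|haar (X\<^sup>\<bottom>). ?h (norm w) * ?h (norm (proj V0 (transpose C *v e))))"
    by simp
  also have "\<dots> = (LINT z|(gauss (X\<^sup>\<bottom>) \<Otimes>\<^sub>M haar (X\<^sup>\<bottom>)). ?h (norm (fst z)) * ?h (norm (proj V0 (transpose (snd z) *v e))))"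
    using XG.integral_fst'[OF int] by simp
  also have "\<dots> = (LINT z|(gauss (X\<^sup>\<bottom>) \<Otimes>\<^sub>M haar (X\<^sup>\<bottom>)). ?h (?g z))"
    by (simp only: split)
  also have "\<dots> = (LINT s|distr (gauss (X\<^sup>\<bottom>) \<Otimes>\<^sub>M haar (X\<^sup>\<bottom>)) borel ?g. ?h s)"
    by (rule integral_distr[symmetric]) measurable
  also have "\<dots> = (LINT v|density (gauss V0) (\<lambda>_. ennreal (pi powr (l / 2))). ?h (norm v))"
    unfolding law by (rule integral_distr) measurable
  also have "\<dots> = (LINT v|gauss V0. (pi powr (l / 2)) *\<^sub>R ?h (norm v))"
  proof (rule integral_density)
    show "(\<lambda>v. ?h (norm v)) \<in> borel_measurable (gauss V0)" by measurable
  qed simp_all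
  also have "\<dots> = of_real (pi powr (l / 2)) * (LINT v|gauss V0. ?h (norm v))"
    by (subst integral_scaleR_right) (rule scaleR_conv_of_real)
  finally have eq: "(LINT w|gauss (X\<^sup>\<bottom>). ?h (norm w)) * ?I = of_real (pi powr (l / 2)) * (LINT v|gauss V0. ?h (norm v))" .
  have M1: "(LINT w|gauss (X\<^sup>\<bottom>). ?h (norm w)) = of_real (pi powr ?D / Gamma ?D) * Gamma (of_real ?D - \<beta>)"
    using integral_gauss_powr[OF subspace_orthogonal_comp dX b(1)] bD by (simp only: dim_X_comp)
  have M2: "(LINT v|gauss V0. ?h (norm v)) = of_real (pi powr ?d / Gamma ?d) * Gamma (of_real ?d - \<beta>)"
    by (rule integral_gauss_powr[OF subs(4) V b])
  have "?d > 0" "?D > 0" using V by simp_all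
  from this[THEN Gamma_real_pos] have nz0: "Gamma ?d \<noteq> 0" "Gamma ?D \<noteq> 0" by simp_all
  have "Re (complex_of_real ?D - \<beta>) > 0" using bD by simp
  then have "Gamma (complex_of_real ?D - \<beta>) \<noteq> 0" by (rule Gamma_nonzero_Re)
  note nz = this nz0
  have "pi powr ?D = pi powr (l / 2) * pi powr ?d" by (simp add: powr_add[symmetric] add_divide_distrib)
  then have pD: "complex_of_real (pi powr ?D) = complex_of_real (pi powr (l / 2)) * complex_of_real (pi powr ?d)" by simp
  have "of_real (pi powr ?D / Gamma ?D) * Gamma (of_real ?D - \<beta>) * ?I
      = of_real (pi powr (l / 2)) * (of_real (pi powr ?d / Gamma ?d) * Gamma (of_real ?d - \<beta>))"
    using eq unfolding M1 M2 .
  moreover have "rot_const_complex \<beta> = Gamma (of_real ?d - \<beta>) * of_real (Gamma ?D) / (of_real (Gamma ?d) * Gamma (of_real ?D - \<beta>))"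
    by (simp add: rot_const_complex_def)
  \<comment> \<open>The equation is solved for the unknown with all Gamma values abstracted to variables.\<close>
  moreover have "I = Gd * gD / (gd * GD)"
    if "(a * b) / gD * GD * I = a * (b / gd * Gd)" "a \<noteq> 0" "b \<noteq> 0" "gd \<noteq> 0" "gD \<noteq> 0" "GD \<noteq> 0"
    for a b gd gD GD Gd I :: complex
    using that by (simp add: field_simps)
  ultimately show ?thesis
    using nz by (simp only: of_real_divide pD) (simp only: of_real_eq_0_iff powr_eq_0_iff pi_neq_zero not_False_eq_True)
qed

end

lemma powr_square_half:
  fixes \<beta> :: complex
  assumes "s \<ge> 0"
  shows "complex_of_real s powr (- 2 * \<beta>) = complex_of_real (s\<^sup>2) powr (- \<beta>)"
proof -
  have "complex_of_real (s\<^sup>2) powr (- \<beta>) = (complex_of_real s * complex_of_real s) powr (- \<beta>)"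
    by (simp add: power2_eq_square)
  also have "\<dots> = complex_of_real s powr (- \<beta>) * complex_of_real s powr (- \<beta>)"
    using assms by (intro powr_times_real_left) auto
  also have "\<dots> = complex_of_real s powr (- 2 * \<beta>)" by (simp add: powr_add[symmetric])
  finally show ?thesis by simp
qed

context orthogonal_frame
begin

text \<open>
  The factor produced by integrating over \<open>Q0\<close>.
\<close>
definition cyl_const :: "real \<Rightarrow> real" where
  "cyl_const b = pi powr (q / 2) * Gamma (b - q / 2) / Gamma b"

definition cyl_const_complex :: "complex \<Rightarrow> complex" where
  "cyl_const_complex \<beta> = of_real (pi powr (q / 2)) * Gamma (\<beta> - of_real (q / 2)) / Gamma \<beta>"

lemma proj_V0_reduce:
  assumes "C \<in> rot (X\<^sup>\<bottom>)"
  shows "proj V0 (transpose C *v z) = proj V0 (transpose C *v (z - proj X z))"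
proof -
  have sc: "subspace (X\<^sup>\<bottom>)" by (rule subspace_orthogonal_comp)
  have "proj V0 (transpose C *v z) = proj V0 (proj (X\<^sup>\<bottom>) (transpose C *v z))"
    by (rule proj_subset[OF subs(4) sc sub0(8), symmetric])
  also have "proj (X\<^sup>\<bottom>) (transpose C *v z) = transpose C *v (z - proj X z)"
    using proj_rot[OF sc rot_transpose[OF assms], of z] by (simp only: proj_orthogonal_comp[OF subX])
  finally show ?thesis .
qed

lemma unit_direction:
  assumes "norm (z - proj X z) > 0"
  obtains e where "e \<in> X\<^sup>\<bottom>" "norm e = 1"
proof (rule that[of "(z - proj X z) /\<^sub>R norm (z - proj X z)"])
  show "(z - proj X z) /\<^sub>R norm (z - proj X z) \<in> X\<^sup>\<bottom>"
    by (rule subspace_scale[OF subspace_orthogonal_comp proj_comp[OF subX]])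
  show "norm ((z - proj X z) /\<^sub>R norm (z - proj X z)) = 1" using assms by simp
qed

lemma nn_integral_rot_isotropic:
  fixes h :: "real \<Rightarrow> ennreal"
  assumes e: "e \<in> X\<^sup>\<bottom>" "norm e = 1" and h: "h \<in> borel_measurable borel"
  shows "(\<integral>\<^sup>+C. h (norm (proj V0 (transpose C *v z))) \<partial>haar (X\<^sup>\<bottom>))
    = (\<integral>\<^sup>+C. h (norm (z - proj X z) * norm (proj V0 (transpose C *v e))) \<partial>haar (X\<^sup>\<bottom>))"
proof -
  have "(\<integral>\<^sup>+C. h (norm (proj V0 (transpose C *v z))) \<partial>haar (X\<^sup>\<bottom>))
    = (\<integral>\<^sup>+C. h (norm (proj V0 (transpose C *v (z - proj X z)))) \<partial>haar (X\<^sup>\<bottom>))"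
    by (rule nn_integral_cong) (simp only: space_haar[OF subspace_orthogonal_comp] proj_V0_reduce[of _ z])
  also have "\<dots> = (\<integral>\<^sup>+C. h (norm (z - proj X z) * norm (proj V0 (transpose C *v e))) \<partial>haar (X\<^sup>\<bottom>))"
    by (rule haar_isotropic[OF e proj_comp[OF subX] h])
  finally show ?thesis .
qed

lemma cylinder_measurable: "(\<lambda>s. \<integral>\<^sup>+y. ennreal (((norm y)\<^sup>2 + s\<^sup>2) powr (- b)) \<partial>lborel_on Q0) \<in> borel_measurable borel"
proof -
  interpret KQ: sigma_finite_measure "lborel_on Q0" by (rule sigma_finite_lborel_on[OF subs(2)])
  show ?thesis by measurable
qed

text \<open>
  The inner integral over \<open>Q0\<close> gives a power of the \<open>V0\<close>-component, whose average over rotations is a power of the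
  length of the component of \<open>z\<close> orthogonal to \<open>X\<close>. In the application \<open>z = T\<^sup>-\<^sup>1x - w\<close> and this length is the distance from \<open>x\<close> to
  the small plane.
\<close>

lemma nn_integral_kernel_average:
  assumes z: "norm (z - proj X z) > 0" and b: "q / 2 < b" "b - q / 2 < dim V0 / 2"
  shows "(\<integral>\<^sup>+C. \<integral>\<^sup>+y. ennreal (((norm y)\<^sup>2 + (norm (proj V0 (transpose C *v z)))\<^sup>2) powr (- b)) \<partial>lborel_on Q0 \<partial>haar (X\<^sup>\<bottom>))
    = ennreal (cyl_const b * rot_const (b - q / 2)) * ennreal (((norm (z - proj X z))\<^sup>2) powr (- (b - q / 2)))"
    and "cyl_const b > 0" "rot_const (b - q / 2) > 0"
proof -
  note sets_haar[OF subspace_orthogonal_comp[of X], measurable_cong] borel_measurable_proj[OF subs(4), measurable]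
  from unit_direction[OF z] obtain e where e: "e \<in> X\<^sup>\<bottom>" "norm e = 1" .
  let ?b = "b - q / 2" and ?\<rho> = "norm (z - proj X z)"
  have V: "dim V0 > 0" using b by (cases "dim V0 = 0") auto
  have b0: "b > 0" using b by (meson divide_nonneg_nonneg le_less_trans of_nat_0_le_iff zero_le_numeral)
  show cp: "cyl_const b > 0" unfolding cyl_const_def using b b0 by (simp add: Gamma_real_pos)
  show rp: "rot_const ?b > 0" by (rule nn_integral_rot_powr(2)[OF e]) (use b in auto)
  have "(\<integral>\<^sup>+C. \<integral>\<^sup>+y. ennreal (((norm y)\<^sup>2 + (norm (proj V0 (transpose C *v z)))\<^sup>2) powr (- b)) \<partial>lborel_on Q0 \<partial>haar (X\<^sup>\<bottom>))
    = (\<integral>\<^sup>+C. \<integral>\<^sup>+y. ennreal (((norm y)\<^sup>2 + (?\<rho> * norm (proj V0 (transpose C *v e)))\<^sup>2) powr (- b)) \<partial>lborel_on Q0 \<partial>haar (X\<^sup>\<bottom>))"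
    by (rule nn_integral_rot_isotropic[OF e cylinder_measurable])
  also have "\<dots> = (\<integral>\<^sup>+C. ennreal (cyl_const b * (?\<rho>\<^sup>2) powr (- ?b)) * ennreal (((norm (proj V0 (transpose C *v e)))\<^sup>2) powr (- ?b)) \<partial>haar (X\<^sup>\<bottom>))"
  proof (rule nn_integral_cong_AE, use AE_haar_proj_nonzero[OF e V] in eventually_elim)
    fix C assume "proj V0 (transpose C *v e) \<noteq> 0"
    then have s: "?\<rho> * norm (proj V0 (transpose C *v e)) > 0" using z by simp
    show "(\<integral>\<^sup>+y. ennreal (((norm y)\<^sup>2 + (?\<rho> * norm (proj V0 (transpose C *v e)))\<^sup>2) powr (- b)) \<partial>lborel_on Q0)
      = ennreal (cyl_const b * (?\<rho>\<^sup>2) powr (- ?b)) * ennreal (((norm (proj V0 (transpose C *v e)))\<^sup>2) powr (- ?b))"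
    proof -
      have "((?\<rho> * norm (proj V0 (transpose C *v e)))\<^sup>2) powr (- ?b) = (?\<rho>\<^sup>2) powr (- ?b) * ((norm (proj V0 (transpose C *v e)))\<^sup>2) powr (- ?b)"
        by (simp only: power_mult_distrib powr_mult zero_le_power2)
      then show ?thesis
        using nn_integral_powr_cylinder_finite[OF subs(2) s, of b] b cp
        by (simp add: dims cyl_const_def[symmetric] ennreal_mult[symmetric] mult.assoc)
    qed
  qed
  also have "\<dots> = ennreal (cyl_const b * (?\<rho>\<^sup>2) powr (- ?b)) * ennreal (rot_const ?b)"
    using nn_integral_rot_powr(1)[OF e, of ?b] b by (subst nn_integral_cmult) auto
  also have "\<dots> = ennreal (cyl_const b * rot_const ?b) * ennreal ((?\<rho>\<^sup>2) powr (- ?b))"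
    using cp rp by (simp add: ennreal_mult[symmetric] mult_ac)
  finally show "(\<integral>\<^sup>+C. \<integral>\<^sup>+y. ennreal (((norm y)\<^sup>2 + (norm (proj V0 (transpose C *v z)))\<^sup>2) powr (- b)) \<partial>lborel_on Q0 \<partial>haar (X\<^sup>\<bottom>))
    = ennreal (cyl_const b * rot_const ?b) * ennreal ((?\<rho>\<^sup>2) powr (- ?b))" .
qed

lemma nn_integral_kernel_average_infinite:
  assumes z: "norm (z - proj X z) > 0" and b: "b \<le> q / 2" and q: "q > 0" and V: "dim V0 > 0"
  shows "(\<integral>\<^sup>+C. \<integral>\<^sup>+y. ennreal (((norm y)\<^sup>2 + (norm (proj V0 (transpose C *v z)))\<^sup>2) powr (- b)) \<partial>lborel_on Q0 \<partial>haar (X\<^sup>\<bottom>)) = \<infinity>"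
proof -
  from unit_direction[OF z] obtain e where e: "e \<in> X\<^sup>\<bottom>" "norm e = 1" .
  let ?\<rho> = "norm (z - proj X z)"
  interpret HX: prob_space "haar (X\<^sup>\<bottom>)" by (rule prob_haar[OF subspace_orthogonal_comp])
  have "(\<integral>\<^sup>+C. \<integral>\<^sup>+y. ennreal (((norm y)\<^sup>2 + (norm (proj V0 (transpose C *v z)))\<^sup>2) powr (- b)) \<partial>lborel_on Q0 \<partial>haar (X\<^sup>\<bottom>))
    = (\<integral>\<^sup>+C. \<integral>\<^sup>+y. ennreal (((norm y)\<^sup>2 + (?\<rho> * norm (proj V0 (transpose C *v e)))\<^sup>2) powr (- b)) \<partial>lborel_on Q0 \<partial>haar (X\<^sup>\<bottom>))"
    by (rule nn_integral_rot_isotropic[OF e cylinder_measurable])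
  also have "\<dots> = (\<integral>\<^sup>+C. \<infinity> \<partial>haar (X\<^sup>\<bottom>))"
  proof (rule nn_integral_cong_AE, use AE_haar_proj_nonzero[OF e V] in eventually_elim)
    fix C assume "proj V0 (transpose C *v e) \<noteq> 0"
    then have s: "?\<rho> * norm (proj V0 (transpose C *v e)) > 0" using z by simp
    show "(\<integral>\<^sup>+y. ennreal (((norm y)\<^sup>2 + (?\<rho> * norm (proj V0 (transpose C *v e)))\<^sup>2) powr (- b)) \<partial>lborel_on Q0) = \<infinity>"
      by (rule nn_integral_powr_cylinder_infinite[OF subs(2) _ s]) (use b q in \<open>simp_all add: dims\<close>)
  qed
  also have "\<dots> = \<infinity>" by (simp add: HX.emeasure_space_1)
  finally show ?thesis .
qed

lemma integral_kernel_average: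
  fixes \<beta> :: complex
  assumes z: "norm (z - proj X z) > 0" and b: "q / 2 < Re \<beta>" "Re \<beta> - q / 2 < dim V0 / 2"
  shows "(LINT c|(haar (X\<^sup>\<bottom>) \<Otimes>\<^sub>M lborel_on Q0). complex_of_real ((norm (snd c))\<^sup>2 + (norm (proj V0 (transpose (fst c) *v z)))\<^sup>2) powr (- \<beta>))
    = cyl_const_complex \<beta> * rot_const_complex (\<beta> - of_real (q / 2)) * complex_of_real ((norm (z - proj X z))\<^sup>2) powr (- (\<beta> - of_real (q / 2)))"
proof -
  note sets_haar[OF subspace_orthogonal_comp[of X], measurable_cong] borel_measurable_proj[OF subs(4), measurable]
  interpret HX: prob_space "haar (X\<^sup>\<bottom>)" by (rule prob_haar[OF subspace_orthogonal_comp])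
  interpret KQ: sigma_finite_measure "lborel_on Q0" by (rule sigma_finite_lborel_on[OF subs(2)])
  interpret XQ: pair_sigma_finite "haar (X\<^sup>\<bottom>)" "lborel_on Q0" ..
  from unit_direction[OF z] obtain e where e: "e \<in> X\<^sup>\<bottom>" "norm e = 1" .
  let ?b = "\<beta> - of_real (q / 2)" and ?\<rho> = "norm (z - proj X z)"
  have V: "dim V0 > 0" using b by (cases "dim V0 = 0") auto
  let ?F = "\<lambda>c. complex_of_real ((norm (snd c))\<^sup>2 + (norm (proj V0 (transpose (fst c) *v z)))\<^sup>2) powr (- \<beta>)"
  let ?h = "\<lambda>s::real. complex_of_real (s\<^sup>2) powr (- ?b)"
  have law: "distr (haar (X\<^sup>\<bottom>)) borel (\<lambda>C. norm (proj V0 (transpose C *v z))) = distr (haar (X\<^sup>\<bottom>)) borel (\<lambda>C. ?\<rho> * norm (proj V0 (transpose C *v e)))"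
  proof (rule measure_eqI)
    fix D assume "D \<in> sets (distr (haar (X\<^sup>\<bottom>)) borel (\<lambda>C. norm (proj V0 (transpose C *v z))))"
    then have [measurable]: "D \<in> sets borel" by simp
    have "emeasure (distr (haar (X\<^sup>\<bottom>)) borel (\<lambda>C. norm (proj V0 (transpose C *v z)))) D
      = (\<integral>\<^sup>+s. indicator D s \<partial>distr (haar (X\<^sup>\<bottom>)) borel (\<lambda>C. norm (proj V0 (transpose C *v z))))" by simp
    also have "\<dots> = (\<integral>\<^sup>+C. indicator D (norm (proj V0 (transpose C *v z))) \<partial>haar (X\<^sup>\<bottom>))"
      by (rule nn_integral_distr) measurable
    also have "\<dots> = (\<integral>\<^sup>+C. indicator D (?\<rho> * norm (proj V0 (transpose C *v e))) \<partial>haar (X\<^sup>\<bottom>))"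
      by (rule nn_integral_rot_isotropic[OF e]) measurable
    also have "\<dots> = (\<integral>\<^sup>+s. indicator D s \<partial>distr (haar (X\<^sup>\<bottom>)) borel (\<lambda>C. ?\<rho> * norm (proj V0 (transpose C *v e))))"
      by (rule nn_integral_distr[symmetric]) measurable
    also have "\<dots> = emeasure (distr (haar (X\<^sup>\<bottom>)) borel (\<lambda>C. ?\<rho> * norm (proj V0 (transpose C *v e)))) D" by simp
    finally show "emeasure (distr (haar (X\<^sup>\<bottom>)) borel (\<lambda>C. norm (proj V0 (transpose C *v z)))) D
      = emeasure (distr (haar (X\<^sup>\<bottom>)) borel (\<lambda>C. ?\<rho> * norm (proj V0 (transpose C *v e)))) D" .
  qed simp
  have split: "?h (a * c) = ?h a * ?h c" for a c
    unfolding power_mult_distrib of_real_mult by (intro powr_times_real_left) auto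
  \<comment> \<open>The integral over \<open>Q0\<close> is evaluated only where the \<open>V0\<close>-component does not vanish.\<close>
  have pz: "AE C in haar (X\<^sup>\<bottom>). norm (proj V0 (transpose C *v z)) > 0"
  proof -
    have m: "(\<lambda>C. ?\<rho> * norm (proj V0 (transpose C *v e))) \<in> haar (X\<^sup>\<bottom>) \<rightarrow>\<^sub>M borel"
      "(\<lambda>C. norm (proj V0 (transpose C *v z))) \<in> haar (X\<^sup>\<bottom>) \<rightarrow>\<^sub>M borel" by measurable
    have p: "{s \<in> space borel. s > (0::real)} \<in> sets borel" by measurable
    have "AE C in haar (X\<^sup>\<bottom>). ?\<rho> * norm (proj V0 (transpose C *v e)) > 0"
      using AE_haar_proj_nonzero[OF e V] by eventually_elim (use z in simp)
    then have "AE s in distr (haar (X\<^sup>\<bottom>)) borel (\<lambda>C. ?\<rho> * norm (proj V0 (transpose C *v e))). s > 0"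
      by (simp only: AE_distr_iff[OF m(1) p])
    then show ?thesis unfolding law[symmetric] by (simp only: AE_distr_iff[OF m(2) p])
  qed
  have int: "integrable (haar (X\<^sup>\<bottom>) \<Otimes>\<^sub>M lborel_on Q0) ?F"
  proof (rule integrableI_bounded)
    have "(\<integral>\<^sup>+c. ennreal (norm (?F c)) \<partial>(haar (X\<^sup>\<bottom>) \<Otimes>\<^sub>M lborel_on Q0))
      = (\<integral>\<^sup>+C. \<integral>\<^sup>+y. ennreal (((norm y)\<^sup>2 + (norm (proj V0 (transpose C *v z)))\<^sup>2) powr (- Re \<beta>)) \<partial>lborel_on Q0 \<partial>haar (X\<^sup>\<bottom>))"
      by (subst KQ.nn_integral_fst[symmetric]) (simp_all add: norm_of_real_powr del: of_real_add of_real_power)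
    also have "\<dots> < \<infinity>" by (subst nn_integral_kernel_average(1)[OF z b]) (simp add: ennreal_mult_less_top)
    finally show "(\<integral>\<^sup>+c. ennreal (norm (?F c)) \<partial>(haar (X\<^sup>\<bottom>) \<Otimes>\<^sub>M lborel_on Q0)) < \<infinity>" .
  qed measurable
  have "(LINT c|(haar (X\<^sup>\<bottom>) \<Otimes>\<^sub>M lborel_on Q0). ?F c) = (LINT C|haar (X\<^sup>\<bottom>). LINT y|lborel_on Q0. ?F (C, y))"
    by (rule XQ.integral_fst'[OF int, symmetric])
  also have "\<dots> = (LINT C|haar (X\<^sup>\<bottom>). cyl_const_complex \<beta> * ?h (norm (proj V0 (transpose C *v z))))"
  proof (rule integral_cong_AE)
    show "(\<lambda>C. LINT y|lborel_on Q0. ?F (C, y)) \<in> borel_measurable (haar (X\<^sup>\<bottom>))"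
      by (rule KQ.borel_measurable_lebesgue_integral) measurable
    show "AE C in haar (X\<^sup>\<bottom>). (LINT y|lborel_on Q0. ?F (C, y)) = cyl_const_complex \<beta> * ?h (norm (proj V0 (transpose C *v z)))"
      using pz
    proof eventually_elim
      fix C assume "norm (proj V0 (transpose C *v z)) > 0"
      from integral_powr_cylinder[OF subs(2) this, of \<beta>] b
      show "(LINT y|lborel_on Q0. ?F (C, y)) = cyl_const_complex \<beta> * ?h (norm (proj V0 (transpose C *v z)))"
        by (simp only: dims fst_conv snd_conv cyl_const_complex_def)
    qed
  qed measurable
  also have "\<dots> = cyl_const_complex \<beta> * (LINT C|haar (X\<^sup>\<bottom>). ?h (norm (proj V0 (transpose C *v z))))"
    by (rule Bochner_Integration.integral_mult_right_zero)
  also have "(LINT C|haar (X\<^sup>\<bottom>). ?h (norm (proj V0 (transpose C *v z)))) = (LINT s|distr (haar (X\<^sup>\<bottom>)) borel (\<lambda>C. norm (proj V0 (transpose C *v z))). ?h s)"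
    by (rule integral_distr[symmetric]) measurable
  also have "\<dots> = (LINT C|haar (X\<^sup>\<bottom>). ?h (?\<rho> * norm (proj V0 (transpose C *v e))))"
    unfolding law by (rule integral_distr) measurable
  also have "\<dots> = (LINT C|haar (X\<^sup>\<bottom>). ?h ?\<rho> * ?h (norm (proj V0 (transpose C *v e))))"
    by (simp only: split)
  also have "\<dots> = ?h ?\<rho> * (LINT C|haar (X\<^sup>\<bottom>). ?h (norm (proj V0 (transpose C *v e))))"
    by (rule Bochner_Integration.integral_mult_right_zero)
  also have "(LINT C|haar (X\<^sup>\<bottom>). ?h (norm (proj V0 (transpose C *v e)))) = rot_const_complex ?b"
    by (rule integral_rot_powr[OF e]) (use b in auto)
  finally show ?thesis by (simp only: mult_ac)
qed

lemma AE_infdist_pos: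
  assumes V: "dim V0 > 0" and T: "T \<in> rot UNIV"
  shows "AE w in lborel_on (X\<^sup>\<bottom>). norm (transpose T *v x - w - proj X (transpose T *v x - w)) > 0"
proof -
  have "dim (X\<^sup>\<bottom>) > 0" by (simp only: dim_X_comp, use V in linarith)
  then have ne: "X\<^sup>\<bottom> \<noteq> {0}" by (metis dim_eq_0 less_irrefl order_refl)
  have c: "proj (X\<^sup>\<bottom>) (transpose T *v x) \<in> X\<^sup>\<bottom>" by (rule proj_in[OF subspace_orthogonal_comp])
  show ?thesis
    using AE_lborel_on_neq[OF subspace_orthogonal_comp ne c] AE_lborel_on_in[OF subspace_orthogonal_comp[of X]]
  proof eventually_elim
    fix w assume w: "w \<noteq> proj (X\<^sup>\<bottom>) (transpose T *v x)" "w \<in> X\<^sup>\<bottom>"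
    have eq: "transpose T *v x - w - proj X (transpose T *v x - w) = proj (X\<^sup>\<bottom>) (transpose T *v x) - w"
      by (simp add: proj_diff subX proj_zero[OF subX w(2)] proj_orthogonal_comp)
    show "norm (transpose T *v x - w - proj X (transpose T *v x - w)) > 0" unfolding eq using w(1) by simp
  qed
qed

end

section \<open>The identity for Borel functions\<close>

lemma nn_integral_pair4:
  assumes "sigma_finite_measure N1" "sigma_finite_measure N2" "sigma_finite_measure N3"
    and h: "h \<in> borel_measurable (((M \<Otimes>\<^sub>M N1) \<Otimes>\<^sub>M N2) \<Otimes>\<^sub>M N3)"
  shows "(\<integral>\<^sup>+z. h z \<partial>(((M \<Otimes>\<^sub>M N1) \<Otimes>\<^sub>M N2) \<Otimes>\<^sub>M N3))
    = (\<integral>\<^sup>+a. \<integral>\<^sup>+x. \<integral>\<^sup>+y. \<integral>\<^sup>+u. h (((a, x), y), u) \<partial>N3 \<partial>N2 \<partial>N1 \<partial>M)"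
proof -
  have 3: "(\<lambda>z. \<integral>\<^sup>+u. h (z, u) \<partial>N3) \<in> borel_measurable ((M \<Otimes>\<^sub>M N1) \<Otimes>\<^sub>M N2)"
    by (rule sigma_finite_measure.borel_measurable_nn_integral_fst[OF assms(3) h])
  have 2: "(\<lambda>z. \<integral>\<^sup>+y. \<integral>\<^sup>+u. h ((z, y), u) \<partial>N3 \<partial>N2) \<in> borel_measurable (M \<Otimes>\<^sub>M N1)"
    by (rule sigma_finite_measure.borel_measurable_nn_integral_fst[OF assms(2) 3])
  show ?thesis
    by (simp only: sigma_finite_measure.nn_integral_fst[OF assms(3) h, symmetric]
        sigma_finite_measure.nn_integral_fst[OF assms(2) 3, symmetric]
        sigma_finite_measure.nn_integral_fst[OF assms(1) 2, symmetric])
qed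

lemma integral_pair:
  fixes g :: "_ \<Rightarrow> 'b::{banach, second_countable_topology}"
  assumes M: "sigma_finite_measure M" and N: "sigma_finite_measure N" and g: "integrable (M \<Otimes>\<^sub>M N) g"
  shows "integrable M (\<lambda>a. LINT x|N. g (a, x))" "(LINT a|M. LINT x|N. g (a, x)) = (LINT z|(M \<Otimes>\<^sub>M N). g z)"
proof -
  interpret M: sigma_finite_measure M by fact
  interpret N: sigma_finite_measure N by fact
  interpret pair_sigma_finite M N ..
  show "integrable M (\<lambda>a. LINT x|N. g (a, x))" by (rule integrable_fst'[OF g])
  show "(LINT a|M. LINT x|N. g (a, x)) = (LINT z|(M \<Otimes>\<^sub>M N). g z)" by (rule integral_fst'[OF g])
qed

lemma sigma_finite_pair:
  assumes "sigma_finite_measure A" "sigma_finite_measure B"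
  shows "sigma_finite_measure (A \<Otimes>\<^sub>M B)"
proof -
  interpret A: sigma_finite_measure A by fact
  interpret B: sigma_finite_measure B by fact
  interpret pair_sigma_finite A B ..
  show ?thesis by (rule sigma_finite_measure_axioms)
qed

lemma integral_pair4:
  fixes h :: "_ \<Rightarrow> 'b::{banach, second_countable_topology}"
  assumes M: "sigma_finite_measure M" and N: "sigma_finite_measure N1" "sigma_finite_measure N2" "sigma_finite_measure N3"
    and h: "integrable (((M \<Otimes>\<^sub>M N1) \<Otimes>\<^sub>M N2) \<Otimes>\<^sub>M N3) h"
  shows "integrable M (\<lambda>a. LINT x|N1. LINT y|N2. LINT u|N3. h (((a, x), y), u))"
    "(LINT a|M. LINT x|N1. LINT y|N2. LINT u|N3. h (((a, x), y), u)) = (LINT z|(((M \<Otimes>\<^sub>M N1) \<Otimes>\<^sub>M N2) \<Otimes>\<^sub>M N3). h z)"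
proof -
  have s1: "sigma_finite_measure (M \<Otimes>\<^sub>M N1)" using M N(1)
    by (rule sigma_finite_pair)
  have s2: "sigma_finite_measure ((M \<Otimes>\<^sub>M N1) \<Otimes>\<^sub>M N2)" using s1 N(2)
    by (rule sigma_finite_pair)
  note 3 = integral_pair[OF s2 N(3) h]
  note 2 = integral_pair[OF s1 N(2) 3(1)]
  note 1 = integral_pair[OF M N(1) 2(1)]
  show "integrable M (\<lambda>a. LINT x|N1. LINT y|N2. LINT u|N3. h (((a, x), y), u))" by (rule 1(1))
  show "(LINT a|M. LINT x|N1. LINT y|N2. LINT u|N3. h (((a, x), y), u)) = (LINT z|(((M \<Otimes>\<^sub>M N1) \<Otimes>\<^sub>M N2) \<Otimes>\<^sub>M N3). h z)" by (simp only: 1(2) 2(2) 3(2))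
qed

text \<open>
  Powers of the squared distance fit the quadratic decomposition of the distance and the Gaussian
  integrals.
\<close>

lemma semyanistyi_kernel_powr:
  fixes \<zeta> :: "'a::euclidean_space set"
  shows "semyanistyi_kernel m \<alpha> x \<zeta> = complex_of_real ((infdist x \<zeta>)\<^sup>2) powr (- ((of_nat DIM('a) - of_nat m - \<alpha>) / 2))"
proof -
  have e: "\<alpha> + of_nat m - of_nat DIM('a) = - 2 * ((of_nat DIM('a) - of_nat m - \<alpha>) / 2)" by (simp add: field_simps)
  show ?thesis unfolding semyanistyi_kernel_def e by (rule powr_square_half[OF infdist_nonneg])
qed

lemma norm_semyanistyi_kernel:
  fixes \<zeta> :: "'a::euclidean_space set"
  shows "norm (semyanistyi_kernel m \<alpha> x \<zeta>) = ((infdist x \<zeta>)\<^sup>2) powr (- ((real DIM('a) - real m - Re \<alpha>) / 2))"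
  by (simp add: semyanistyi_kernel_powr norm_of_real_powr del: of_real_power)

context orthogonal_frame
begin

lemma frame_dims: "p + q + (l + dim V0) = CARD('n)"
  using dim_orthogonal_comp[OF subX] dim_X_comp X_gr by (simp add: grassmannian_def)

text \<open>
  The distribution of (distance from \<open>x\<close> to the \<open>k\<close>-plane, \<open>j\<close>-plane) when the \<open>k\<close>-plane is chosen first. An
  equality of distributions carries the reduction from nonnegative to complex integrands.
\<close>
definition large_law :: "real^'n \<Rightarrow> (real \<times> (real^'n) set) measure" where
  "large_law x = distr ((((haar UNIV \<Otimes>\<^sub>M lborel_on (E\<^sup>\<bottom>)) \<Otimes>\<^sub>M haar (E\<^sup>\<bottom>)) \<Otimes>\<^sub>M haar E) \<Otimes>\<^sub>M lborel_on W0)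
     (borel \<Otimes>\<^sub>M plane_algebra (affine_grassmannian (p + q)))
     (\<lambda>y. (infdist x (placed E (fst (fst (fst (fst y)))) (snd (fst (fst (fst y))))),
        placed X (fst (fst (fst (fst y))) ** snd (fst y) ** snd (fst (fst y))) (snd y + transpose (snd (fst (fst y))) *v snd (fst (fst (fst y))))))"

text \<open>
  The same pair when the \<open>j\<close>-plane is chosen first.
\<close>
definition small_law :: "real^'n \<Rightarrow> (real \<times> (real^'n) set) measure" where
  "small_law x = distr ((haar UNIV \<Otimes>\<^sub>M lborel_on (X\<^sup>\<bottom>)) \<Otimes>\<^sub>M (haar (X\<^sup>\<bottom>) \<Otimes>\<^sub>M lborel_on Q0))
     (borel \<Otimes>\<^sub>M plane_algebra (affine_grassmannian (p + q)))
     (\<lambda>y. (sqrt ((norm (snd (snd y)))\<^sup>2 + (norm (proj V0 (transpose (fst (snd y)) *v (transpose (fst (fst y)) *v x - snd (fst y)))))\<^sup>2),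
        placed X (fst (fst y)) (snd (fst y))))"

lemma frame_sigma_finite:
  "sigma_finite_measure (haar (UNIV :: (real^'n) set))" "sigma_finite_measure (haar E)" "sigma_finite_measure (haar (E\<^sup>\<bottom>))"
  "sigma_finite_measure (haar (X\<^sup>\<bottom>))" "sigma_finite_measure (lborel_on (E\<^sup>\<bottom>))" "sigma_finite_measure (lborel_on (X\<^sup>\<bottom>))"
  "sigma_finite_measure (lborel_on W0)" "sigma_finite_measure (lborel_on Q0)"
  using prob_space_imp_sigma_finite[OF prob_haar[OF subspace_UNIV]] prob_space_imp_sigma_finite[OF prob_haar[OF subE]]
    prob_space_imp_sigma_finite[OF prob_haar[OF subspace_orthogonal_comp]] sigma_finite_lborel_on[OF subspace_orthogonal_comp]
    sigma_finite_lborel_on[OF subs(3)] sigma_finite_lborel_on[OF subs(2)]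
  by auto

lemma large_map_measurable:
  "(\<lambda>y. (infdist x (placed E (fst (fst (fst (fst y)))) (snd (fst (fst (fst y))))),
        placed X (fst (fst (fst (fst y))) ** snd (fst y) ** snd (fst (fst y))) (snd y + transpose (snd (fst (fst y))) *v snd (fst (fst (fst y))))))
   \<in> (((haar UNIV \<Otimes>\<^sub>M lborel_on (E\<^sup>\<bottom>)) \<Otimes>\<^sub>M haar (E\<^sup>\<bottom>)) \<Otimes>\<^sub>M haar E) \<Otimes>\<^sub>M lborel_on W0
     \<rightarrow>\<^sub>M borel \<Otimes>\<^sub>M plane_algebra (affine_grassmannian (p + q))"
proof -
  note sets_haar[OF subE, measurable_cong] sets_haar[OF subspace_orthogonal_comp[of E], measurable_cong]
    sets_haar[OF subspace_UNIV, measurable_cong]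
  show ?thesis
    using measurable_Pair[OF dist_params[unfolded split_beta', of x] placed_params[unfolded split_beta']]
    by (simp cong: measurable_cong_sets sets_pair_measure_cong)
qed

lemma small_map_measurable:
  "(\<lambda>y. (sqrt ((norm (snd (snd y)))\<^sup>2 + (norm (proj V0 (transpose (fst (snd y)) *v (transpose (fst (fst y)) *v x - snd (fst y)))))\<^sup>2),
        placed X (fst (fst y)) (snd (fst y))))
    \<in> (haar UNIV \<Otimes>\<^sub>M lborel_on (X\<^sup>\<bottom>)) \<Otimes>\<^sub>M (haar (X\<^sup>\<bottom>) \<Otimes>\<^sub>M lborel_on Q0)
     \<rightarrow>\<^sub>M borel \<Otimes>\<^sub>M plane_algebra (affine_grassmannian (p + q))"
proof -
  note sets_haar[OF subspace_orthogonal_comp[of X], measurable_cong]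
    sets_haar[OF subspace_UNIV, measurable_cong] borel_measurable_proj[OF subs(4), measurable]
  show ?thesis by (rule measurable_Pair[OF _ placed_X_measurable]) measurable
qed

lemma nn_integral_large_law:
  assumes G: "G \<in> borel_measurable (borel \<Otimes>\<^sub>M plane_algebra (affine_grassmannian (p + q)))"
  shows "(\<integral>\<^sup>+y. G y \<partial>large_law x) = (\<integral>\<^sup>+T. \<integral>\<^sup>+z. \<integral>\<^sup>+B. \<integral>\<^sup>+A. \<integral>\<^sup>+u. G (infdist x (placed E T z), placed X (T ** A ** B) (u + transpose B *v z))
       \<partial>lborel_on W0 \<partial>haar E \<partial>haar (E\<^sup>\<bottom>) \<partial>lborel_on (E\<^sup>\<bottom>) \<partial>haar UNIV)"
proof -
  have m: "(\<lambda>y. G (infdist x (placed E (fst (fst (fst (fst y)))) (snd (fst (fst (fst y))))),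
        placed X (fst (fst (fst (fst y))) ** snd (fst y) ** snd (fst (fst y))) (snd y + transpose (snd (fst (fst y))) *v snd (fst (fst (fst y))))))
    \<in> borel_measurable ((((haar UNIV \<Otimes>\<^sub>M lborel_on (E\<^sup>\<bottom>)) \<Otimes>\<^sub>M haar (E\<^sup>\<bottom>)) \<Otimes>\<^sub>M haar E) \<Otimes>\<^sub>M lborel_on W0)"
    by (rule measurable_compose[OF large_map_measurable G])
  have m2: "(\<lambda>a. \<integral>\<^sup>+B. \<integral>\<^sup>+A. \<integral>\<^sup>+u. G (infdist x (placed E (fst a) (snd a)), placed X (fst a ** A ** B) (u + transpose B *v snd a))
     \<partial>lborel_on W0 \<partial>haar E \<partial>haar (E\<^sup>\<bottom>)) \<in> borel_measurable (haar UNIV \<Otimes>\<^sub>M lborel_on (E\<^sup>\<bottom>))"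
    using measurable_nn_integral3[OF frame_sigma_finite(3,2,7) m] by simp
  show ?thesis
    unfolding large_law_def 
    by (subst nn_integral_distr[OF large_map_measurable], use G in simp)
       (simp add: nn_integral_pair4[OF frame_sigma_finite(3,2,7) m]
        sigma_finite_measure.nn_integral_fst[OF frame_sigma_finite(5) m2, symmetric])
qed

lemma nn_integral_small_law:
  assumes G: "G \<in> borel_measurable (borel \<Otimes>\<^sub>M plane_algebra (affine_grassmannian (p + q)))"
  shows "(\<integral>\<^sup>+y. G y \<partial>small_law x) = (\<integral>\<^sup>+T. \<integral>\<^sup>+w. \<integral>\<^sup>+C. \<integral>\<^sup>+y. G (sqrt ((norm y)\<^sup>2 + (norm (proj V0 (transpose C *v (transpose T *v x - w))))\<^sup>2), placed X T w)
        \<partial>lborel_on Q0 \<partial>haar (X\<^sup>\<bottom>) \<partial>lborel_on (X\<^sup>\<bottom>) \<partial>haar UNIV)"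
proof -
  interpret KQ: sigma_finite_measure "lborel_on Q0" by (rule frame_sigma_finite)
  interpret HX: sigma_finite_measure "haar (X\<^sup>\<bottom>)" by (rule frame_sigma_finite)
  interpret XQ: pair_sigma_finite "haar (X\<^sup>\<bottom>)" "lborel_on Q0" ..
  interpret KX: sigma_finite_measure "lborel_on (X\<^sup>\<bottom>)" by (rule frame_sigma_finite)
  let ?g = "\<lambda>y. G (sqrt ((norm (snd (snd y)))\<^sup>2 + (norm (proj V0 (transpose (fst (snd y)) *v (transpose (fst (fst y)) *v x - snd (fst y)))))\<^sup>2),
        placed X (fst (fst y)) (snd (fst y)))"
  let ?M = "haar UNIV \<Otimes>\<^sub>M lborel_on (X\<^sup>\<bottom>)" and ?N = "haar (X\<^sup>\<bottom>) \<Otimes>\<^sub>M lborel_on Q0"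
  have m: "?g \<in> borel_measurable (?M \<Otimes>\<^sub>M ?N)"
    by (rule measurable_compose[OF small_map_measurable G])
  have m2: "(\<lambda>a. \<integral>\<^sup>+c. ?g (a, c) \<partial>?N) \<in> borel_measurable ?M"
    by (rule sigma_finite_measure.borel_measurable_nn_integral_fst[OF XQ.sigma_finite_measure_axioms m])
  have "(\<integral>\<^sup>+y. G y \<partial>small_law x) = (\<integral>\<^sup>+y. ?g y \<partial>(?M \<Otimes>\<^sub>M ?N))"
    unfolding small_law_def by (rule nn_integral_distr[OF small_map_measurable]) (use G in simp)
  also have "\<dots> = (\<integral>\<^sup>+a. \<integral>\<^sup>+c. ?g (a, c) \<partial>?N \<partial>?M)"
    by (rule sigma_finite_measure.nn_integral_fst[OF XQ.sigma_finite_measure_axioms m, symmetric])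
  also have "\<dots> = (\<integral>\<^sup>+T. \<integral>\<^sup>+w. \<integral>\<^sup>+c. ?g ((T, w), c) \<partial>?N \<partial>lborel_on (X\<^sup>\<bottom>) \<partial>haar UNIV)"
    by (rule KX.nn_integral_fst[OF m2, symmetric])
  also have "\<dots> = (\<integral>\<^sup>+T. \<integral>\<^sup>+w. \<integral>\<^sup>+C. \<integral>\<^sup>+y. ?g ((T, w), (C, y)) \<partial>lborel_on Q0 \<partial>haar (X\<^sup>\<bottom>) \<partial>lborel_on (X\<^sup>\<bottom>) \<partial>haar UNIV)"
  proof (rule nn_integral_cong, rule nn_integral_cong)
    fix T :: "real^'n^'n" and w :: "real^'n" assume T: "T \<in> space (haar UNIV)"
    have "(T, w) \<in> space ?M" using T by (simp add: space_pair_measure)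
    from measurable_compose[OF measurable_Pair1'[OF this] m]
    show "(\<integral>\<^sup>+c. ?g ((T, w), c) \<partial>?N) = (\<integral>\<^sup>+C. \<integral>\<^sup>+y. ?g ((T, w), (C, y)) \<partial>lborel_on Q0 \<partial>haar (X\<^sup>\<bottom>))"
      by (rule KQ.nn_integral_fst[symmetric])
  qed
  finally show ?thesis by simp
qed

lemma large_law_eq_small_law: "large_law x = small_law x"
proof (rule measure_eqI)
  show "sets (large_law x) = sets (small_law x)" by (simp add: large_law_def small_law_def)
  fix D assume "D \<in> sets (large_law x)"
  then have D: "D \<in> sets (borel \<Otimes>\<^sub>M plane_algebra (affine_grassmannian (p + q)))" by (simp add: large_law_def)
  then have G: "indicator D \<in> borel_measurable (borel \<Otimes>\<^sub>M plane_algebra (affine_grassmannian (p + q)))" by simp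
  have "emeasure (large_law x) D = (\<integral>\<^sup>+y. indicator D y \<partial>large_law x)" using D by (simp add: large_law_def)
  also have "\<dots> = (\<integral>\<^sup>+y. indicator D y \<partial>small_law x)"
    by (simp only: nn_integral_large_law[OF G] nn_integral_small_law[OF G] nn_integral_reduction[OF G])
  also have "\<dots> = emeasure (small_law x) D" using D by (simp add: small_law_def)
  finally show "emeasure (large_law x) D = emeasure (small_law x) D" .
qed

text \<open>
  The kernel depends only on the outer plane and can be moved under the transform.
\<close>

lemma strichartz_nn_cmult:
  fixes g :: "(real^'n) set \<Rightarrow> ennreal"
  assumes g: "g \<in> borel_measurable (plane_algebra (affine_grassmannian (p + q)))" and \<zeta>: "\<zeta> \<in> affine_grassmannian (p + l)"
  shows "strichartz_nn p q (\<lambda>\<tau>. g \<tau> * c) \<zeta> = strichartz_nn p q g \<zeta> * c"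
proof -
  from frame_section obtain \<sigma> where "\<forall>\<zeta>\<in>affine_grassmannian (p + l). fst (\<sigma> \<zeta>) \<in> rot UNIV \<and> snd (\<sigma> \<zeta>) \<in> E\<^sup>\<bottom> \<and> placed E (fst (\<sigma> \<zeta>)) (snd (\<sigma> \<zeta>)) = \<zeta>"
    by (rule bexE)
  with \<zeta> obtain T z where T: "T \<in> rot UNIV" and z: "z \<in> E\<^sup>\<bottom>" and eq: "placed E T z = \<zeta>" by blast
  note o = rot_orthogonal[OF T]
  interpret HE: sigma_finite_measure "haar E" by (rule frame_sigma_finite)
  interpret HF: sigma_finite_measure "haar (E\<^sup>\<bottom>)" by (rule frame_sigma_finite)
  interpret KW: sigma_finite_measure "lborel_on W0" by (rule frame_sigma_finite)
  note sets_haar[OF subE, measurable_cong] sets_haar[OF subspace_orthogonal_comp[of E], measurable_cong]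
  let ?h = "\<lambda>y. g (placed X (T ** snd (fst y) ** fst (fst y)) (snd y + transpose (fst (fst y)) *v z))"
  have m: "?h \<in> borel_measurable ((haar (E\<^sup>\<bottom>) \<Otimes>\<^sub>M haar E) \<Otimes>\<^sub>M lborel_on W0)"
    by (rule measurable_compose[OF placed_X_measurable[OF rot_borel_E_mult[OF const_rot[OF T]]] g]) measurable
  have m1: "(\<lambda>u. g (placed X (T ** A ** B) (u + transpose B *v z))) \<in> borel_measurable (lborel_on W0)"
    if "B \<in> space (haar (E\<^sup>\<bottom>))" "A \<in> space (haar E)" for A B
    using measurable_compose[OF measurable_Pair1'[of "(B, A)"] m] that by (simp add: space_pair_measure)
  have m2: "(\<lambda>A. \<integral>\<^sup>+u. g (placed X (T ** A ** B) (u + transpose B *v z)) \<partial>lborel_on W0) \<in> borel_measurable (haar E)"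
    if "B \<in> space (haar (E\<^sup>\<bottom>))" for B
    using measurable_compose[OF measurable_Pair1'[OF that] KW.borel_measurable_nn_integral_fst[OF m]] by simp
  have m3: "(\<lambda>B. \<integral>\<^sup>+A. \<integral>\<^sup>+u. g (placed X (T ** A ** B) (u + transpose B *v z)) \<partial>lborel_on W0 \<partial>haar E) \<in> borel_measurable (haar (E\<^sup>\<bottom>))"
    using HE.borel_measurable_nn_integral_fst[OF KW.borel_measurable_nn_integral_fst[OF m]] by simp
  have gc: "(\<lambda>\<tau>. g \<tau> * c) \<in> borel_measurable (plane_algebra (affine_grassmannian (p + q)))" using g by measurable
  show ?thesis
    unfolding eq[symmetric] strichartz_nn_placed[OF gc o z] strichartz_nn_placed[OF g o z]
    by (simp add: nn_integral_multc m1 m2 m3 cong: nn_integral_cong)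
qed

lemma dual_nn_small_law:
  fixes g :: "(real^'n) set \<Rightarrow> ennreal" and \<alpha> :: complex
  assumes g: "g \<in> borel_measurable (plane_algebra (affine_grassmannian (p + q)))"
  shows "dual_semyanistyi_nn (p + l) \<alpha> (strichartz_nn p q g) x
    = (\<integral>\<^sup>+y. g (snd y) * ennreal (((fst y)\<^sup>2) powr (- ((real CARD('n) - real (p + l) - Re \<alpha>) / 2))) \<partial>small_law x)"
proof -
  let ?b = "(real CARD('n) - real (p + l) - Re \<alpha>) / 2"
  define G where "G y = g (snd y) * ennreal (((fst y)\<^sup>2) powr (- ?b))" for y
  have G: "G \<in> borel_measurable (borel \<Otimes>\<^sub>M plane_algebra (affine_grassmannian (p + q)))"
    unfolding G_def[abs_def] using g by measurable
  have sp: "space (affine_law E) = affine_grassmannian (p + l)"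
    using sets_eq_imp_space_eq[OF sets_affine_law[OF E_gr]] by simp
  have "dual_semyanistyi_nn (p + l) \<alpha> (strichartz_nn p q g) x
    = (\<integral>\<^sup>+\<zeta>. strichartz_nn p q g \<zeta> * ennreal (((infdist x \<zeta>)\<^sup>2) powr (- ?b)) \<partial>affine_law E)"
    unfolding dual_semyanistyi_nn_def affine_grassmannian_measure_eq[OF E_gr] nn_integral_completion norm_semyanistyi_kernel by simp
  also have "\<dots> = (\<integral>\<^sup>+\<zeta>. strichartz_nn p q (\<lambda>\<tau>. G (infdist x \<zeta>, \<tau>)) \<zeta> \<partial>affine_law E)"
    by (rule nn_integral_cong) (simp add: G_def sp strichartz_nn_cmult[OF g])
  also have "\<dots> = (\<integral>\<^sup>+y. G y \<partial>small_law x)"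
    by (simp only: strichartz_nn_reduction[OF G] nn_integral_small_law[OF G])
  finally show ?thesis by (simp only: G_def)
qed

lemma dual_nn_reduction:
  fixes g :: "(real^'n) set \<Rightarrow> ennreal" and \<alpha> :: complex
  assumes g: "g \<in> borel_measurable (plane_algebra (affine_grassmannian (p + q)))"
  shows "dual_semyanistyi_nn (p + l) \<alpha> (strichartz_nn p q g) x
    = (\<integral>\<^sup>+T. \<integral>\<^sup>+w. g (placed X T w) * (\<integral>\<^sup>+C. \<integral>\<^sup>+y. ennreal (((norm y)\<^sup>2 + (norm (proj V0 (transpose C *v (transpose T *v x - w))))\<^sup>2)
          powr (- ((real CARD('n) - real (p + l) - Re \<alpha>) / 2))) \<partial>lborel_on Q0 \<partial>haar (X\<^sup>\<bottom>)) \<partial>lborel_on (X\<^sup>\<bottom>) \<partial>haar UNIV)"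
proof -
  let ?b = "(real CARD('n) - real (p + l) - Re \<alpha>) / 2"
  define G where "G y = g (snd y) * ennreal (((fst y)\<^sup>2) powr (- ?b))" for y
  have G: "G \<in> borel_measurable (borel \<Otimes>\<^sub>M plane_algebra (affine_grassmannian (p + q)))"
    unfolding G_def[abs_def] using g by measurable
  have "dual_semyanistyi_nn (p + l) \<alpha> (strichartz_nn p q g) x = (\<integral>\<^sup>+y. G y \<partial>small_law x)"
    by (simp only: G_def dual_nn_small_law[OF g])
  also note nn_integral_small_law[OF G]
  also have "(\<integral>\<^sup>+T. \<integral>\<^sup>+w. \<integral>\<^sup>+C. \<integral>\<^sup>+y. G (sqrt ((norm y)\<^sup>2 + (norm (proj V0 (transpose C *v (transpose T *v x - w))))\<^sup>2), placed X T w)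
        \<partial>lborel_on Q0 \<partial>haar (X\<^sup>\<bottom>) \<partial>lborel_on (X\<^sup>\<bottom>) \<partial>haar UNIV)
     = (\<integral>\<^sup>+T. \<integral>\<^sup>+w. g (placed X T w) * (\<integral>\<^sup>+C. \<integral>\<^sup>+y. ennreal (((norm y)\<^sup>2 + (norm (proj V0 (transpose C *v (transpose T *v x - w))))\<^sup>2)
          powr (- ?b)) \<partial>lborel_on Q0 \<partial>haar (X\<^sup>\<bottom>)) \<partial>lborel_on (X\<^sup>\<bottom>) \<partial>haar UNIV)"
  proof (rule nn_integral_cong, rule nn_integral_cong)
    fix T :: "real^'n^'n" and w :: "real^'n"
    note sets_haar[OF subspace_orthogonal_comp[of X], measurable_cong] borel_measurable_proj[OF subs(4), measurable]
    interpret KQ: sigma_finite_measure "lborel_on Q0" by (rule frame_sigma_finite)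
    have "(\<integral>\<^sup>+C. \<integral>\<^sup>+y. G (sqrt ((norm y)\<^sup>2 + (norm (proj V0 (transpose C *v (transpose T *v x - w))))\<^sup>2), placed X T w) \<partial>lborel_on Q0 \<partial>haar (X\<^sup>\<bottom>))
      = (\<integral>\<^sup>+C. \<integral>\<^sup>+y. g (placed X T w) * ennreal (((norm y)\<^sup>2 + (norm (proj V0 (transpose C *v (transpose T *v x - w))))\<^sup>2) powr (- ?b)) \<partial>lborel_on Q0 \<partial>haar (X\<^sup>\<bottom>))"
      by (simp only: G_def fst_conv snd_conv real_sqrt_pow2[OF add_nonneg_nonneg[OF zero_le_power2 zero_le_power2]])
    also have "\<dots> = (\<integral>\<^sup>+C. g (placed X T w) * (\<integral>\<^sup>+y. ennreal (((norm y)\<^sup>2 + (norm (proj V0 (transpose C *v (transpose T *v x - w))))\<^sup>2) powr (- ?b)) \<partial>lborel_on Q0) \<partial>haar (X\<^sup>\<bottom>))"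
      by (rule nn_integral_cong, rule nn_integral_cmult) measurable
    also have "\<dots> = g (placed X T w) * (\<integral>\<^sup>+C. \<integral>\<^sup>+y. ennreal (((norm y)\<^sup>2 + (norm (proj V0 (transpose C *v (transpose T *v x - w))))\<^sup>2) powr (- ?b)) \<partial>lborel_on Q0 \<partial>haar (X\<^sup>\<bottom>))"
      by (rule nn_integral_cmult) measurable
    finally show "(\<integral>\<^sup>+C. \<integral>\<^sup>+y. G (sqrt ((norm y)\<^sup>2 + (norm (proj V0 (transpose C *v (transpose T *v x - w))))\<^sup>2), placed X T w) \<partial>lborel_on Q0 \<partial>haar (X\<^sup>\<bottom>))
      = g (placed X T w) * (\<integral>\<^sup>+C. \<integral>\<^sup>+y. ennreal (((norm y)\<^sup>2 + (norm (proj V0 (transpose C *v (transpose T *v x - w))))\<^sup>2) powr (- ?b)) \<partial>lborel_on Q0 \<partial>haar (X\<^sup>\<bottom>))" .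
  qed
  finally show ?thesis .
qed

lemma infdist_placed_X: "T \<in> rot UNIV \<Longrightarrow> infdist x (placed X T w) = norm (transpose T *v x - w - proj X (transpose T *v x - w))"
  by (rule infdist_placed[OF subX rot_orthogonal])

lemma dual_nn_finite:
  fixes g :: "(real^'n) set \<Rightarrow> ennreal" and \<alpha> :: complex
  assumes g: "g \<in> borel_measurable (plane_algebra (affine_grassmannian (p + q)))"
    and a: "Re \<alpha> > 0" "Re \<alpha> + real (p + q + l) < real CARD('n)"
  obtains K where "K > 0" "dual_semyanistyi_nn (p + l) \<alpha> (strichartz_nn p q g) x = ennreal K * dual_semyanistyi_nn (p + q) (\<alpha> + of_nat l) g x"
proof -
  let ?b = "(real CARD('n) - real (p + l) - Re \<alpha>) / 2"
  have n: "real CARD('n) = real p + real q + real l + real (dim V0)" using frame_dims by linarith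
  have b: "q / 2 < ?b" "?b - q / 2 < dim V0 / 2" using a by (auto simp: n field_simps)
  have V: "dim V0 > 0" using b by (cases "dim V0 = 0") auto
  have b': "?b - q / 2 = (real CARD('n) - real (p + q) - Re (\<alpha> + of_nat l)) / 2" by (simp add: field_simps)
  let ?K = "cyl_const ?b * rot_const (?b - q / 2)"
  note sets_affine_law[OF X_gr, measurable_cong]
  note g[measurable] borel_measurable_infdist_plane[measurable]
  have K: "?K > 0"
  proof -
    have "\<exists>z. norm (z - proj X z) > 0"
    proof -
      have "dim (X\<^sup>\<bottom>) > 0" by (simp only: dim_X_comp, use V in linarith)
      then have "X\<^sup>\<bottom> \<noteq> {0}" by (metis dim_eq_0 less_irrefl order_refl)
      then obtain z where "z \<in> X\<^sup>\<bottom>" "z \<noteq> 0" using subspace_0[OF subspace_orthogonal_comp, of X] by blast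
      then show ?thesis by (intro exI[of _ z]) (simp add: proj_zero subX)
    qed
    then obtain z where z: "norm (z - proj X z) > 0" ..
    from nn_integral_kernel_average(2,3)[OF z b] show ?thesis by simp
  qed
  have "dual_semyanistyi_nn (p + l) \<alpha> (strichartz_nn p q g) x
    = (\<integral>\<^sup>+T. \<integral>\<^sup>+w. ennreal ?K * (g (placed X T w) * ennreal (((infdist x (placed X T w))\<^sup>2) powr (- (?b - q / 2)))) \<partial>lborel_on (X\<^sup>\<bottom>) \<partial>haar UNIV)"
    unfolding dual_nn_reduction[OF g]
  proof (rule nn_integral_cong)
    fix T :: "real^'n^'n" assume "T \<in> space (haar UNIV)"
    then have T: "T \<in> rot UNIV" by (simp add: space_haar)
    show "(\<integral>\<^sup>+w. g (placed X T w) * (\<integral>\<^sup>+C. \<integral>\<^sup>+y. ennreal (((norm y)\<^sup>2 + (norm (proj V0 (transpose C *v (transpose T *v x - w))))\<^sup>2)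
          powr (- ?b)) \<partial>lborel_on Q0 \<partial>haar (X\<^sup>\<bottom>)) \<partial>lborel_on (X\<^sup>\<bottom>))
      = (\<integral>\<^sup>+w. ennreal ?K * (g (placed X T w) * ennreal (((infdist x (placed X T w))\<^sup>2) powr (- (?b - q / 2)))) \<partial>lborel_on (X\<^sup>\<bottom>))"
      by (rule nn_integral_cong_AE, use AE_infdist_pos[OF V T, of x] in eventually_elim)
         (simp only: nn_integral_kernel_average(1)[OF _ b] infdist_placed_X[OF T] mult_ac)
  qed
  also have "\<dots> = (\<integral>\<^sup>+\<tau>. ennreal ?K * (g \<tau> * ennreal (((infdist x \<tau>)\<^sup>2) powr (- (?b - q / 2)))) \<partial>affine_law X)"
    by (rule nn_integral_affine_law[OF X_gr, symmetric]) measurable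
  also have "\<dots> = ennreal ?K * (\<integral>\<^sup>+\<tau>. g \<tau> * ennreal (((infdist x \<tau>)\<^sup>2) powr (- (?b - q / 2))) \<partial>affine_law X)"
    by (rule nn_integral_cmult) measurable
  also have "(\<integral>\<^sup>+\<tau>. g \<tau> * ennreal (((infdist x \<tau>)\<^sup>2) powr (- (?b - q / 2))) \<partial>affine_law X) = dual_semyanistyi_nn (p + q) (\<alpha> + of_nat l) g x"
    unfolding dual_semyanistyi_nn_def affine_grassmannian_measure_eq[OF X_gr] nn_integral_completion norm_semyanistyi_kernel b' by simp
  finally show thesis using that[OF K] by blast
qed

text \<open>
  The kernel average is infinite at almost every \<open>j\<close>-plane, so that a finite integral forces \<open>g\<close> to vanish.
\<close>

lemma dual_nn_infinite:
  fixes g :: "(real^'n) set \<Rightarrow> ennreal" and \<alpha> :: complex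
  assumes g: "g \<in> borel_measurable (plane_algebra (affine_grassmannian (p + q)))"
    and a: "real CARD('n) \<le> Re \<alpha> + real (p + q + l)" and q: "q > 0" and V: "dim V0 > 0"
    and fin: "dual_semyanistyi_nn (p + l) \<alpha> (strichartz_nn p q g) x < \<infinity>"
  shows "AE \<tau> in affine_law X. g \<tau> = 0"
proof -
  let ?b = "(real CARD('n) - real (p + l) - Re \<alpha>) / 2"
  have b: "?b \<le> q / 2" using a by simp
  note sets_affine_law[OF X_gr, measurable_cong] g[measurable]
  have "dual_semyanistyi_nn (p + l) \<alpha> (strichartz_nn p q g) x
    = (\<integral>\<^sup>+T. \<integral>\<^sup>+w. \<infinity> * g (placed X T w) \<partial>lborel_on (X\<^sup>\<bottom>) \<partial>haar UNIV)"
    unfolding dual_nn_reduction[OF g]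
  proof (rule nn_integral_cong)
    fix T :: "real^'n^'n" assume "T \<in> space (haar UNIV)"
    then have T: "T \<in> rot UNIV" by (simp add: space_haar)
    show "(\<integral>\<^sup>+w. g (placed X T w) * (\<integral>\<^sup>+C. \<integral>\<^sup>+y. ennreal (((norm y)\<^sup>2 + (norm (proj V0 (transpose C *v (transpose T *v x - w))))\<^sup>2)
          powr (- ?b)) \<partial>lborel_on Q0 \<partial>haar (X\<^sup>\<bottom>)) \<partial>lborel_on (X\<^sup>\<bottom>))
      = (\<integral>\<^sup>+w. \<infinity> * g (placed X T w) \<partial>lborel_on (X\<^sup>\<bottom>))"
      by (rule nn_integral_cong_AE, use AE_infdist_pos[OF V T, of x] in eventually_elim)
         (simp only: nn_integral_kernel_average_infinite[OF _ b q V] mult.commute)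
  qed
  also have "\<dots> = (\<integral>\<^sup>+\<tau>. \<infinity> * g \<tau> \<partial>affine_law X)"
    by (rule nn_integral_affine_law[OF X_gr, symmetric]) measurable
  finally have "(\<integral>\<^sup>+\<tau>. \<infinity> * g \<tau> \<partial>affine_law X) \<noteq> \<infinity>" using fin by auto
  then have "AE \<tau> in affine_law X. \<infinity> * g \<tau> \<noteq> \<infinity>" by (intro nn_integral_PInf_AE) measurable
  then show ?thesis by eventually_elim (auto simp: ennreal_mult_eq_top_iff)
qed

end

context orthogonal_frame
begin

lemma placed_law_measurable:
  assumes E': "E' \<in> grassmannian UNIV m"
  shows "(\<lambda>z. placed E' (fst z) (snd z)) \<in> haar UNIV \<Otimes>\<^sub>M lborel_on (E'\<^sup>\<bottom>) \<rightarrow>\<^sub>M plane_algebra (affine_grassmannian m)"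
proof -
  note sets_haar[OF subspace_UNIV, measurable_cong]
  have "(\<lambda>z. placed E' (fst z) (snd z)) \<in> rot_borel UNIV \<Otimes>\<^sub>M borel \<rightarrow>\<^sub>M plane_algebra (affine_grassmannian m)"
    by (rule placed_measurable[OF E']) measurable
  then show ?thesis by (simp cong: measurable_cong_sets sets_pair_measure_cong)
qed

lemma integral_affine_law:
  fixes F :: "(real^'n) set \<Rightarrow> complex"
  assumes E': "E' \<in> grassmannian UNIV m" and F: "F \<in> borel_measurable (plane_algebra (affine_grassmannian m))"
  shows "(LINT \<zeta>|affine_law E'. F \<zeta>) = (LINT y|(haar UNIV \<Otimes>\<^sub>M lborel_on (E'\<^sup>\<bottom>)). F (placed E' (fst y) (snd y)))"
proof -
  have d: "dim E' = m" using E' by (simp add: grassmannian_def)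
  show ?thesis unfolding affine_law_def d by (rule integral_distr[OF placed_law_measurable[OF E'] F])
qed

lemma semyanistyi_kernel_measurable:
  fixes x :: "real^'n"
  shows "semyanistyi_kernel m \<alpha> x \<in> borel_measurable (plane_algebra (affine_grassmannian m'))"
proof -
  note borel_measurable_infdist_plane[measurable]
  have "(\<lambda>\<zeta>. complex_of_real ((infdist x \<zeta>)\<^sup>2) powr (- ((of_nat DIM(real^'n) - of_nat m - \<alpha>) / 2))) \<in> borel_measurable (plane_algebra (affine_grassmannian m'))"
    by (rule measurable_compose[OF _ powr_of_real_measurable]) measurable
  then show ?thesis by (simp only: semyanistyi_kernel_powr[abs_def])
qed

lemma AE_pair_lborel_on:
  assumes W: "subspace W" and M: "sigma_finite_measure M"
  shows "AE y in M \<Otimes>\<^sub>M lborel_on W. snd y \<in> W"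
proof -
  interpret M: sigma_finite_measure M by fact
  interpret K: sigma_finite_measure "lborel_on W" by (rule sigma_finite_lborel_on[OF W])
  interpret pair_sigma_finite M "lborel_on W" ..
  have "W \<in> sets borel" using closed_subspace[OF W] by simp
  then have s: "{y \<in> space (M \<Otimes>\<^sub>M lborel_on W). snd y \<in> W} \<in> sets (M \<Otimes>\<^sub>M lborel_on W)" by measurable
  show ?thesis by (rule AE_pair_measure[OF s]) (simp add: AE_lborel_on_in[OF W])
qed

text \<open>
  Iterated complex integrals are combined by Fubini, using integrability over all five variables.
\<close>

lemma integral_large_law:
  fixes f :: "(real^'n) set \<Rightarrow> complex" and \<beta> :: complex
  assumes f: "f \<in> borel_measurable (plane_algebra (affine_grassmannian (p + q)))"
    and int: "integrable (large_law x) (\<lambda>y. f (snd y) * complex_of_real ((fst y)\<^sup>2) powr (- \<beta>))"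
  shows "(LINT \<zeta>|affine_law E. strichartz p q f \<zeta> * complex_of_real ((infdist x \<zeta>)\<^sup>2) powr (- \<beta>))
     = (LINT y|large_law x. f (snd y) * complex_of_real ((fst y)\<^sup>2) powr (- \<beta>))"
proof -
  let ?H = "\<lambda>y. f (snd y) * complex_of_real ((fst y)\<^sup>2) powr (- \<beta>)"
  let ?M = "haar (UNIV :: (real^'n) set) \<Otimes>\<^sub>M lborel_on (E\<^sup>\<bottom>)"
  let ?g = "\<lambda>y. (infdist x (placed E (fst (fst (fst (fst y)))) (snd (fst (fst (fst y))))),
        placed X (fst (fst (fst (fst y))) ** snd (fst y) ** snd (fst (fst y))) (snd y + transpose (snd (fst (fst y))) *v snd (fst (fst (fst y)))))"
  note borel_measurable_infdist_plane[measurable]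
  have Hm: "?H \<in> borel_measurable (borel \<Otimes>\<^sub>M plane_algebra (affine_grassmannian (p + q)))"
  proof -
    have [measurable]: "(\<lambda>y. complex_of_real ((fst y)\<^sup>2) powr (- \<beta>)) \<in> borel_measurable (borel \<Otimes>\<^sub>M plane_algebra (affine_grassmannian (p + q)))"
      by (rule measurable_compose[OF _ powr_of_real_measurable]) measurable
    show ?thesis using f by measurable
  qed
  have k: "(\<lambda>\<zeta>. complex_of_real ((infdist x \<zeta>)\<^sup>2) powr (- \<beta>)) \<in> borel_measurable (plane_algebra (affine_grassmannian (p + l)))"
    by (rule measurable_compose[OF _ powr_of_real_measurable]) measurable
  have m: "(\<lambda>\<zeta>. strichartz p q f \<zeta> * complex_of_real ((infdist x \<zeta>)\<^sup>2) powr (- \<beta>)) \<in> borel_measurable (plane_algebra (affine_grassmannian (p + l)))"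
    by (rule borel_measurable_times[OF strichartz_measurable[OF f] k])
  have sM: "sigma_finite_measure ?M" by (rule sigma_finite_pair[OF frame_sigma_finite(1,5)])
  have int': "integrable (((?M \<Otimes>\<^sub>M haar (E\<^sup>\<bottom>)) \<Otimes>\<^sub>M haar E) \<Otimes>\<^sub>M lborel_on W0) (\<lambda>y. ?H (?g y))"
    using int unfolding large_law_def by (subst (asm) integrable_distr_eq[OF large_map_measurable Hm])
  have "(LINT \<zeta>|affine_law E. strichartz p q f \<zeta> * complex_of_real ((infdist x \<zeta>)\<^sup>2) powr (- \<beta>))
    = (LINT a|?M. strichartz p q f (placed E (fst a) (snd a)) * complex_of_real ((infdist x (placed E (fst a) (snd a)))\<^sup>2) powr (- \<beta>))"
    by (rule integral_affine_law[OF E_gr m])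
  also have "\<dots> = (LINT a|?M. LINT B|haar (E\<^sup>\<bottom>). LINT A|haar E. LINT u|lborel_on W0. ?H (?g (((a, B), A), u)))"
  proof (rule integral_cong_AE)
    show "(\<lambda>a. strichartz p q f (placed E (fst a) (snd a)) * complex_of_real ((infdist x (placed E (fst a) (snd a)))\<^sup>2) powr (- \<beta>)) \<in> borel_measurable ?M"
      by (rule measurable_compose[OF placed_law_measurable[OF E_gr] m])
    show "(\<lambda>a. LINT B|haar (E\<^sup>\<bottom>). LINT A|haar E. LINT u|lborel_on W0. ?H (?g (((a, B), A), u))) \<in> borel_measurable ?M"
      by (rule borel_measurable_integrable[OF integral_pair4(1)[OF sM frame_sigma_finite(3,2,7) int']])
    show "AE a in ?M. strichartz p q f (placed E (fst a) (snd a)) * complex_of_real ((infdist x (placed E (fst a) (snd a)))\<^sup>2) powr (- \<beta>)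
       = (LINT B|haar (E\<^sup>\<bottom>). LINT A|haar E. LINT u|lborel_on W0. ?H (?g (((a, B), A), u)))"
      using AE_pair_lborel_on[OF subspace_orthogonal_comp frame_sigma_finite(1), of E] AE_space
    proof eventually_elim
      case (elim a)
      then have "orthogonal_matrix (fst a)" by (auto simp: space_pair_measure space_haar rot_orthogonal)
      from strichartz_placed[OF f this elim(1)] show ?case by (simp add: del: of_real_power)
    qed
  qed
  also have "\<dots> = (LINT y|(((?M \<Otimes>\<^sub>M haar (E\<^sup>\<bottom>)) \<Otimes>\<^sub>M haar E) \<Otimes>\<^sub>M lborel_on W0). ?H (?g y))"
    by (rule integral_pair4(2)[OF sM frame_sigma_finite(3,2,7) int'])
  also have "\<dots> = (LINT y|large_law x. ?H y)"
    unfolding large_law_def by (rule integral_distr[OF large_map_measurable Hm, symmetric])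
  finally show ?thesis .
qed

lemma integral_small_law:
  fixes f :: "(real^'n) set \<Rightarrow> complex" and \<beta> :: complex
  assumes f: "f \<in> borel_measurable (plane_algebra (affine_grassmannian (p + q)))"
    and b: "q / 2 < Re \<beta>" "Re \<beta> - q / 2 < dim V0 / 2"
    and int: "integrable (small_law x) (\<lambda>y. f (snd y) * complex_of_real ((fst y)\<^sup>2) powr (- \<beta>))"
  shows "(LINT y|small_law x. f (snd y) * complex_of_real ((fst y)\<^sup>2) powr (- \<beta>))
    = cyl_const_complex \<beta> * rot_const_complex (\<beta> - of_real (q / 2)) *
      (LINT \<tau>|affine_law X. f \<tau> * complex_of_real ((infdist x \<tau>)\<^sup>2) powr (- (\<beta> - of_real (q / 2))))"
proof -
  let ?H = "\<lambda>y. f (snd y) * complex_of_real ((fst y)\<^sup>2) powr (- \<beta>)"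
  let ?M = "haar (UNIV :: (real^'n) set) \<Otimes>\<^sub>M lborel_on (X\<^sup>\<bottom>)" and ?N = "haar (X\<^sup>\<bottom>) \<Otimes>\<^sub>M lborel_on Q0"
  let ?g = "\<lambda>y. (sqrt ((norm (snd (snd y)))\<^sup>2 + (norm (proj V0 (transpose (fst (snd y)) *v (transpose (fst (fst y)) *v x - snd (fst y)))))\<^sup>2),
        placed X (fst (fst y)) (snd (fst y)))"
  let ?K = "cyl_const_complex \<beta> * rot_const_complex (\<beta> - of_real (q / 2))" and ?b = "\<beta> - of_real (q / 2)"
  have V: "dim V0 > 0" using b by (cases "dim V0 = 0") auto
  note borel_measurable_infdist_plane[measurable]
  have Hm: "?H \<in> borel_measurable (borel \<Otimes>\<^sub>M plane_algebra (affine_grassmannian (p + q)))"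
  proof -
    have [measurable]: "(\<lambda>y. complex_of_real ((fst y)\<^sup>2) powr (- \<beta>)) \<in> borel_measurable (borel \<Otimes>\<^sub>M plane_algebra (affine_grassmannian (p + q)))"
      by (rule measurable_compose[OF _ powr_of_real_measurable]) measurable
    show ?thesis using f by measurable
  qed
  have k: "(\<lambda>\<tau>. complex_of_real ((infdist x \<tau>)\<^sup>2) powr (- ?b)) \<in> borel_measurable (plane_algebra (affine_grassmannian (p + q)))"
    by (rule measurable_compose[OF _ powr_of_real_measurable]) measurable
  have m: "(\<lambda>\<tau>. f \<tau> * complex_of_real ((infdist x \<tau>)\<^sup>2) powr (- ?b)) \<in> borel_measurable (plane_algebra (affine_grassmannian (p + q)))"
    by (rule borel_measurable_times[OF f k])
  have sM: "sigma_finite_measure ?M" by (rule sigma_finite_pair[OF frame_sigma_finite(1,6)])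
  have sN: "sigma_finite_measure ?N" by (rule sigma_finite_pair[OF frame_sigma_finite(4,8)])
  have int': "integrable (?M \<Otimes>\<^sub>M ?N) (\<lambda>y. ?H (?g y))"
    using int unfolding small_law_def by (subst (asm) integrable_distr_eq[OF small_map_measurable Hm])
  have pos: "AE a in ?M. norm (transpose (fst a) *v x - snd a - proj X (transpose (fst a) *v x - snd a)) > 0"
  proof -
    interpret HU: sigma_finite_measure "haar (UNIV :: (real^'n) set)" by (rule frame_sigma_finite)
    interpret KX: sigma_finite_measure "lborel_on (X\<^sup>\<bottom>)" by (rule frame_sigma_finite)
    interpret pair_sigma_finite "haar (UNIV :: (real^'n) set)" "lborel_on (X\<^sup>\<bottom>)" ..
    note sets_haar[OF subspace_UNIV, measurable_cong] borel_measurable_proj[OF subX, measurable]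
    have s: "{a \<in> space ?M. norm (transpose (fst a) *v x - snd a - proj X (transpose (fst a) *v x - snd a)) > 0} \<in> sets ?M"
      by measurable
    show ?thesis
      by (rule AE_pair_measure[OF s], rule AE_I2) (simp add: space_haar AE_infdist_pos[OF V, of _ x, simplified])
  qed
  have "(LINT y|small_law x. ?H y) = (LINT y|(?M \<Otimes>\<^sub>M ?N). ?H (?g y))"
    unfolding small_law_def by (rule integral_distr[OF small_map_measurable Hm])
  also have "\<dots> = (LINT a|?M. LINT c|?N. ?H (?g (a, c)))"
    by (rule integral_pair(2)[OF sM sN int', symmetric])
  also have "\<dots> = (LINT a|?M. ?K * (f (placed X (fst a) (snd a)) * complex_of_real ((infdist x (placed X (fst a) (snd a)))\<^sup>2) powr (- ?b)))"
  proof (rule integral_cong_AE)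
    show "(\<lambda>a. LINT c|?N. ?H (?g (a, c))) \<in> borel_measurable ?M"
      by (rule borel_measurable_integrable[OF integral_pair(1)[OF sM sN int']])
    show "(\<lambda>a. ?K * (f (placed X (fst a) (snd a)) * complex_of_real ((infdist x (placed X (fst a) (snd a)))\<^sup>2) powr (- ?b))) \<in> borel_measurable ?M"
      by (rule borel_measurable_times[OF borel_measurable_const measurable_compose[OF placed_law_measurable[OF X_gr] m]])
    show "AE a in ?M. (LINT c|?N. ?H (?g (a, c))) = ?K * (f (placed X (fst a) (snd a)) * complex_of_real ((infdist x (placed X (fst a) (snd a)))\<^sup>2) powr (- ?b))"
      using pos AE_space
    proof eventually_elim
      case (elim a)
      then have T: "fst a \<in> rot UNIV" by (auto simp: space_pair_measure space_haar)
      have "(LINT c|?N. ?H (?g (a, c))) = f (placed X (fst a) (snd a)) *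
        (LINT c|?N. complex_of_real ((norm (snd c))\<^sup>2 + (norm (proj V0 (transpose (fst c) *v (transpose (fst a) *v x - snd a))))\<^sup>2) powr (- \<beta>))"
        by (simp only: fst_conv snd_conv real_sqrt_pow2[OF add_nonneg_nonneg[OF zero_le_power2 zero_le_power2]] Bochner_Integration.integral_mult_right_zero)
      also note integral_kernel_average[OF elim(1) b]
      finally show ?case by (simp only: infdist_placed_X[OF T] mult_ac)
    qed
  qed
  also have "\<dots> = ?K * (LINT a|?M. f (placed X (fst a) (snd a)) * complex_of_real ((infdist x (placed X (fst a) (snd a)))\<^sup>2) powr (- ?b))"
    by (rule Bochner_Integration.integral_mult_right_zero)
  also note integral_affine_law[OF X_gr m, symmetric]
  finally show ?thesis .
qed

lemma dual_integral_eq: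
  fixes f :: "(real^'n) set \<Rightarrow> complex" and \<alpha> :: complex
  assumes f: "f \<in> borel_measurable (plane_algebra (affine_grassmannian (p + q)))"
    and a: "Re \<alpha> > 0" "Re \<alpha> + real (p + q + l) < real CARD('n)"
    and fin: "dual_semyanistyi_nn (p + l) \<alpha> (strichartz_nn p q (\<lambda>\<tau>. ennreal (norm (f \<tau>)))) x < \<infinity>"
    and \<beta>: "\<beta> = (of_nat CARD('n) - of_nat (p + l) - \<alpha>) / 2"
  shows "(LINT \<zeta>|affine_grassmannian_measure (p + l). strichartz p q f \<zeta> * semyanistyi_kernel (p + l) \<alpha> x \<zeta>)
    = cyl_const_complex \<beta> * rot_const_complex (\<beta> - of_real (q / 2)) *
      (LINT \<tau>|affine_grassmannian_measure (p + q). f \<tau> * semyanistyi_kernel (p + q) (\<alpha> + of_nat l) x \<tau>)"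
proof -
  let ?b = "(real CARD('n) - real (p + l) - Re \<alpha>) / 2"
  let ?H = "\<lambda>y. f (snd y) * complex_of_real ((fst y)\<^sup>2) powr (- \<beta>)"
  have n: "real CARD('n) = real p + real q + real l + real (dim V0)" using frame_dims by linarith
  have R: "Re \<beta> = ?b" unfolding \<beta> by simp
  have b: "q / 2 < Re \<beta>" "Re \<beta> - q / 2 < dim V0 / 2" using a unfolding R by (auto simp: n field_simps)
  have b': "\<beta> - of_real (q / 2) = (of_nat CARD('n) - of_nat (p + q) - (\<alpha> + of_nat l)) / 2" unfolding \<beta> by (simp add: field_simps)
  have H: "?H \<in> borel_measurable (borel \<Otimes>\<^sub>M plane_algebra (affine_grassmannian (p + q)))"
  proof -
    have [measurable]: "(\<lambda>y. complex_of_real ((fst y)\<^sup>2) powr (- \<beta>)) \<in> borel_measurable (borel \<Otimes>\<^sub>M plane_algebra (affine_grassmannian (p + q)))"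
      by (rule measurable_compose[OF _ powr_of_real_measurable]) measurable
    show ?thesis using f by measurable
  qed
  have "(\<integral>\<^sup>+y. ennreal (norm (?H y)) \<partial>small_law x) < \<infinity>"
    using fin f by (simp add: dual_nn_small_law norm_mult norm_of_real_powr R ennreal_mult del: of_real_power)
  then have int: "integrable (small_law x) ?H"
    using H by (intro integrableI_bounded) (simp_all add: small_law_def)
  have m1: "(\<lambda>\<zeta>. strichartz p q f \<zeta> * semyanistyi_kernel (p + l) \<alpha> x \<zeta>) \<in> borel_measurable (affine_law E)"
    unfolding measurable_cong_sets[OF sets_affine_law[OF E_gr] refl]
    by (rule borel_measurable_times[OF strichartz_measurable[OF f] semyanistyi_kernel_measurable])
  have m2: "(\<lambda>\<tau>. f \<tau> * semyanistyi_kernel (p + q) (\<alpha> + of_nat l) x \<tau>) \<in> borel_measurable (affine_law X)"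
    unfolding measurable_cong_sets[OF sets_affine_law[OF X_gr] refl]
    by (rule borel_measurable_times[OF f semyanistyi_kernel_measurable])
  have "(LINT \<zeta>|affine_grassmannian_measure (p + l). strichartz p q f \<zeta> * semyanistyi_kernel (p + l) \<alpha> x \<zeta>)
    = (LINT \<zeta>|affine_law E. strichartz p q f \<zeta> * complex_of_real ((infdist x \<zeta>)\<^sup>2) powr (- \<beta>))"
    unfolding affine_grassmannian_measure_eq[OF E_gr] integral_completion[OF m1] by (simp add: semyanistyi_kernel_powr \<beta> del: of_real_power)
  also have "\<dots> = (LINT y|small_law x. ?H y)"
    using integral_large_law[OF f, of x \<beta>] int by (simp only: large_law_eq_small_law)
  also note integral_small_law[OF f b int]
  also have "(LINT \<tau>|affine_law X. f \<tau> * complex_of_real ((infdist x \<tau>)\<^sup>2) powr (- (\<beta> - of_real (q / 2))))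
    = (LINT \<tau>|affine_grassmannian_measure (p + q). f \<tau> * semyanistyi_kernel (p + q) (\<alpha> + of_nat l) x \<tau>)"
    unfolding affine_grassmannian_measure_eq[OF X_gr] integral_completion[OF m2] by (simp only: semyanistyi_kernel_powr b' DIM_cart DIM_real mult_1_right)
  finally show ?thesis .
qed

text \<open>
  With \<open>r = n - j - l\<close> one has \<open>\<beta> = (q + r - \<alpha>)/2\<close> and \<open>\<beta> - q/2 = (r - \<alpha>)/2\<close>. The factor \<open>\<Gamma>(\<beta>)\<close> of the
  normalization on the left and \<open>\<Gamma>(\<beta> - q/2)\<close> of the one on the right cancel against \<open>cyl_const_complex\<close>, and \<open>\<Gamma>(\<alpha>/2)\<close>,
  \<open>\<Gamma>((\<alpha> + l)/2)\<close> against \<open>rot_const_complex\<close>.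
\<close>

lemma normalized_const_eq:
  fixes \<alpha> :: complex
  assumes a: "Re \<alpha> > 0" "Re \<alpha> + real (p + q + l) < real CARD('n)"
    and \<beta>: "\<beta> = (of_nat CARD('n) - of_nat (p + l) - \<alpha>) / 2"
  shows "1 / semyanistyi_gamma (CARD('n) - (p + l)) \<alpha> * (cyl_const_complex \<beta> * rot_const_complex (\<beta> - of_real (q / 2)))
    = complex_of_real (2 ^ l * pi powr (real l / 2) * Gamma ((real CARD('n) - real (p + q)) / 2)
         / Gamma ((real CARD('n) - real (p + q) - real l) / 2)) * (1 / semyanistyi_gamma (CARD('n) - (p + q)) (\<alpha> + of_nat l))"
proof -
  define r where "r = dim V0"
  have n: "CARD('n) = p + q + l + r" using frame_dims by (simp add: r_def)
  have k: "CARD('n) - (p + l) = q + r" "CARD('n) - (p + q) = l + r" using n by auto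
  have n': "complex_of_nat CARD('n) = of_nat p + of_nat q + of_nat l + of_nat r" unfolding n by simp
  have b1: "\<beta> = (of_nat q + of_nat r - \<alpha>) / 2" unfolding \<beta> n' by (simp add: field_simps)
  have b2: "\<beta> - of_real (q / 2) = (of_nat r - \<alpha>) / 2" unfolding b1 by (simp add: field_simps)
  have rr: "real r > Re \<alpha>" using a n by simp
  have c1: "complex_of_real (real r / 2) - (of_nat r - \<alpha>) / 2 = \<alpha> / 2" by (simp add: field_simps)
  have c2: "complex_of_real (real (l + r) / 2) - (of_nat r - \<alpha>) / 2 = (\<alpha> + of_nat l) / 2" by (simp add: field_simps)
  have c3: "((of_nat (l + r) :: complex) - (\<alpha> + of_nat l)) / 2 = (of_nat r - \<alpha>) / 2" by (simp add: field_simps)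
  have c4: "((of_nat (q + r) :: complex) - \<alpha>) / 2 = (of_nat q + of_nat r - \<alpha>) / 2" by simp
  have d1: "(real CARD('n) - real (p + q)) / 2 = real (l + r) / 2" "(real CARD('n) - real (p + q) - real l) / 2 = real r / 2"
    using n by simp_all
  have p0: "complex_of_real pi \<noteq> 0" by simp
  have pq: "complex_of_real (pi powr (real q / 2)) = complex_of_real pi powr (of_nat q / 2)"
    by (subst powr_of_real[symmetric]) simp_all
  have pl: "complex_of_real (pi powr (real l / 2)) = complex_of_real pi powr (of_nat l / 2)"
    by (subst powr_of_real[symmetric]) simp_all
  have s1: "complex_of_real pi powr (of_nat (q + r) / 2) = complex_of_real pi powr (of_nat q / 2) * complex_of_real pi powr (of_nat r / 2)"
    by (simp add: powr_add[symmetric] add_divide_distrib)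
  have s2: "complex_of_real pi powr (of_nat (l + r) / 2) = complex_of_real pi powr (of_nat l / 2) * complex_of_real pi powr (of_nat r / 2)"
    by (simp add: powr_add[symmetric] add_divide_distrib)
  have s3: "(2::complex) powr (\<alpha> + of_nat l) = 2 powr \<alpha> * 2 ^ l" by (simp add: powr_add powr_nat')
  have g: "Gamma (\<alpha> / 2) \<noteq> 0" "Gamma ((\<alpha> + of_nat l) / 2) \<noteq> 0" "Gamma ((of_nat r - \<alpha>) / 2) \<noteq> 0"
    "Gamma ((of_nat q + of_nat r - \<alpha>) / 2) \<noteq> 0"
    using a rr by (auto intro!: Gamma_nonzero_Re simp: add_pos_nonneg)
  have g': "Gamma (real r / 2) \<noteq> 0" "Gamma (real (l + r) / 2) \<noteq> 0"
    using a rr by (auto intro!: Gamma_real_pos less_imp_neq[THEN not_sym])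
  show ?thesis
    unfolding semyanistyi_gamma_def cyl_const_complex_def rot_const_complex_def r_def[symmetric] k b2 c1 c2 c3 c4 d1
      s1 s2 s3 pq
    unfolding b1 of_real_divide of_real_mult of_real_power of_real_numeral pl
    using g g' p0 by (simp add: field_simps del: of_nat_add)
qed

end

section \<open>Lebesgue measurable functions\<close>

lemma measurable_completion_AE_eq:
  fixes f g :: "'a \<Rightarrow> 'b::topological_space"
  assumes g: "g \<in> borel_measurable M" and ae: "AE x in M. f x = g x"
  shows "f \<in> borel_measurable (completion M)"
proof (rule borel_measurableI)
  fix S :: "'b set" assume "open S"
  then have "g -` S \<inter> space (completion M) \<in> sets (completion M)"
    using measurable_sets[OF measurable_completion[OF g], of S] by simp
  then show "f -` S \<inter> space (completion M) \<in> sets (completion M)"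
    by (rule completion.in_sets_AE[rotated])
       (use AE_completion[OF ae] in \<open>auto elim!: eventually_mono\<close>)
qed

lemma integral_completion_AE_eq:
  fixes f g :: "'a \<Rightarrow> 'b::{banach, second_countable_topology}"
  assumes g: "g \<in> borel_measurable M" and ae: "AE x in M. f x = g x"
  shows "(LINT x|completion M. f x) = (LINT x|M. g x)"
proof -
  have "(LINT x|completion M. f x) = (LINT x|completion M. g x)"
    by (rule integral_cong_AE[OF measurable_completion_AE_eq[OF g ae] measurable_completion[OF g] AE_completion[OF ae]])
  then show ?thesis by (simp only: integral_completion[OF g])
qed

lemma completion_ex_borel_measurable_complex:
  fixes f :: "'a \<Rightarrow> complex"
  assumes f: "f \<in> borel_measurable (completion M)"
  shows "\<exists>f'\<in>borel_measurable M. AE x in M. f x = f' x"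
proof -
  have "(\<lambda>x. Re (f x)) \<in> borel_measurable (completion M)" "(\<lambda>x. Im (f x)) \<in> borel_measurable (completion M)"
    using f by measurable
  from this[THEN completion_ex_borel_measurable_real] obtain u v
    where uv[measurable]: "u \<in> borel_measurable M" "v \<in> borel_measurable M"
      and "AE x in M. Re (f x) = u x" "AE x in M. Im (f x) = v x" by auto
  then have ae: "AE x in M. f x = Complex (u x) (v x)" by (auto elim!: eventually_elim2 simp: complex_eq_iff)
  have m: "(\<lambda>x. Complex (u x) (v x)) \<in> borel_measurable M"
    unfolding Complex_eq by measurable
  show ?thesis by (rule bexI[where P = "\<lambda>f'. AE x in M. f x = f' x", OF ae m])
qed

context orthogonal_frame
begin

text \<open>
  If the transform of the indicator of \<open>N\<close> vanishes at a plane, then at each of the three integrations the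
  planes or points that meet \<open>N\<close> form a null set. Only \<open>f'\<close> is Borel; the integrands built from \<open>f\<close> are measurable with
  respect to the completed measures, since they agree almost everywhere with those of \<open>f'\<close>.
\<close>

lemma strichartz_eq_off_null:
  fixes f f' :: "(real^'n) set \<Rightarrow> complex"
  assumes T: "orthogonal_matrix T" and z: "z \<in> E\<^sup>\<bottom>"
    and N: "N \<in> sets (plane_algebra (affine_grassmannian (p + q)))"
    and null: "strichartz_nn p q (indicator N) (placed E T z) = 0"
    and f': "f' \<in> borel_measurable (plane_algebra (affine_grassmannian (p + q)))"
    and eq: "\<And>\<tau>. \<tau> \<in> affine_grassmannian (p + q) \<Longrightarrow> \<tau> \<notin> N \<Longrightarrow> f \<tau> = f' \<tau>"
  shows "strichartz_nn p q (\<lambda>\<tau>. ennreal (norm (f \<tau>))) (placed E T z) = strichartz_nn p q (\<lambda>\<tau>. ennreal (norm (f' \<tau>))) (placed E T z)"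
    and "strichartz p q f (placed E T z) = strichartz p q f' (placed E T z)"
proof -
  define \<eta> where "\<eta> = (*v) T ` E"
  define v where "v = T *v z"
  have \<eta>: "subspace \<eta>" unfolding \<eta>_def by (rule subspace_matrix_image[OF subE])
  have \<eta>c: "\<eta>\<^sup>\<bottom> = (*v) T ` (E\<^sup>\<bottom>)" unfolding \<eta>_def by (rule orthogonal_matrix_image_comp[OF T])
  let ?Gp = "plane_algebra (grassmannian \<eta> p)" and ?Gq = "plane_algebra (grassmannian (\<eta>\<^sup>\<bottom>) q)"
  let ?A = "plane_algebra (affine_grassmannian (p + q) :: (real^'n) set set)"
  let ?RP = "random_plane E P0 T" and ?RQ = "random_plane (E\<^sup>\<bottom>) Q0 T"
  let ?K = "\<lambda>P. lborel_on (P\<^sup>\<bottom> \<inter> \<eta>)"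
  define F where "F P Q = (LINT u|?K P. f' (join_plane P Q (u + v)))" for P Q
  define I :: "(real^'n) set \<Rightarrow> (real^'n) set \<Rightarrow> ennreal" where "I P Q = (\<integral>\<^sup>+u. indicator N (join_plane P Q (u + v)) \<partial>?K P)" for P Q
  have gp: "grassmannian_measure \<eta> p = completion ?RP"
    unfolding \<eta>_def by (rule grassmannian_measure_eq[OF subE P0_gr T])
  have gq: "grassmannian_measure (\<eta>\<^sup>\<bottom>) q = completion ?RQ"
    unfolding \<eta>c by (rule grassmannian_measure_eq[OF subspace_orthogonal_comp Q0_gr T])
  have sRP[measurable_cong]: "sets ?RP = sets ?Gp" by (simp add: random_plane_def dims \<eta>_def)
  have sRQ[measurable_cong]: "sets ?RQ = sets ?Gq" by (simp add: random_plane_def dims \<eta>c)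
  have spP: "space ?RP = space ?Gp" and spQ: "space ?RQ = space ?Gq"
    using sets_eq_imp_space_eq[OF sRP] sets_eq_imp_space_eq[OF sRQ] by auto
  interpret RP: prob_space ?RP
    using random_plane_invariant[OF subE P0_gr T] by (simp add: invariant_grassmannian_measure_def)
  have ind: "(indicator N :: _ \<Rightarrow> ennreal) \<in> borel_measurable ?A" using N by simp
  have mF: "(\<lambda>x. F (fst x) (snd x)) \<in> borel_measurable (?Gp \<Otimes>\<^sub>M ?Gq)"
    unfolding F_def
    by (rule integral_lborel_on_measurable[OF measurable_rotated_W[OF \<eta>] measurable_inner_integrand[OF f' \<eta>]])
  have mI: "(\<lambda>x. I (fst x) (snd x)) \<in> borel_measurable (?Gp \<Otimes>\<^sub>M ?Gq)"
    unfolding I_def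
    by (rule nn_integral_lborel_on_measurable[OF measurable_rotated_W[OF \<eta>] measurable_inner_integrand[OF ind \<eta>]])
  have mF': "(\<lambda>P. F P Q) \<in> borel_measurable ?Gp" and mI': "(\<lambda>P. I P Q) \<in> borel_measurable ?Gp" if "Q \<in> space ?Gq" for Q
    using measurable_compose[OF measurable_Pair2'[OF that] mF] measurable_compose[OF measurable_Pair2'[OF that] mI] by simp_all
  have [measurable]: "(\<lambda>(Q, P). F P Q) \<in> borel_measurable (?Gq \<Otimes>\<^sub>M ?RP)"
    using measurable_compose[OF measurable_pair_swap' mF] by (simp add: split_beta')
  have [measurable]: "(\<lambda>(Q, P). I P Q) \<in> borel_measurable (?Gq \<Otimes>\<^sub>M ?RP)"
    using measurable_compose[OF measurable_pair_swap' mI] by (simp add: split_beta')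
  have mFQ: "(\<lambda>Q. LINT P|?RP. F P Q) \<in> borel_measurable ?RQ"
    unfolding measurable_cong_sets[OF sRQ refl] by (rule RP.borel_measurable_lebesgue_integral) measurable
  have mIQ: "(\<lambda>Q. \<integral>\<^sup>+P. I P Q \<partial>?RP) \<in> borel_measurable ?RQ"
    unfolding measurable_cong_sets[OF sRQ refl] by (rule RP.borel_measurable_nn_integral) measurable
  have join: "(\<lambda>u. join_plane P Q (u + v)) \<in> ?K P \<rightarrow>\<^sub>M ?A" if "P \<in> space ?Gp" "Q \<in> space ?Gq" for P Q
    using measurable_compose[OF measurable_Pair1'[of "(P, Q)" "?Gp \<Otimes>\<^sub>M ?Gq" borel] join_plane_measurable[OF \<eta>, of v]] that
    by (simp add: space_pair_measure cong: measurable_cong_sets)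
  have "(\<integral>\<^sup>+Q. \<integral>\<^sup>+P. I P Q \<partial>?RP \<partial>?RQ) = 0"
    using null
    unfolding strichartz_nn_def placed_foot_direction[OF T z] Let_def \<eta>_def[symmetric] v_def[symmetric] gp gq I_def
    by (simp add: nn_integral_completion lebesgue_subspace_eq subspace_inter subspace_orthogonal_comp \<eta>)
  then have aeQ: "AE Q in ?RQ. (\<integral>\<^sup>+P. I P Q \<partial>?RP) = 0"
    by (simp only: nn_integral_0_iff_AE[OF mIQ])
  have aeP: "AE P in ?RP. I P Q = 0" if "Q \<in> space ?Gq" "(\<integral>\<^sup>+P. I P Q \<partial>?RP) = 0" for Q
    using that(2) mI'[OF that(1)] by (simp only: nn_integral_0_iff_AE measurable_cong_sets[OF sRP refl])
  have aeu: "AE u in ?K P. f (join_plane P Q (u + v)) = f' (join_plane P Q (u + v))"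
    if P: "P \<in> space ?Gp" and Q: "Q \<in> space ?Gq" and 0: "I P Q = 0" for P Q
  proof -
    have "AE u in ?K P. (indicator N (join_plane P Q (u + v)) :: ennreal) = 0"
      using 0 unfolding I_def by (simp only: nn_integral_0_iff_AE[OF measurable_compose[OF join[OF P Q] ind]])
    then show ?thesis using AE_space
    proof eventually_elim
      case (elim u)
      then show ?case using measurable_space[OF join[OF P Q] elim(2)] by (intro eq) (auto simp: indicator_eq_0_iff)
    qed
  qed
  show "strichartz_nn p q (\<lambda>\<tau>. ennreal (norm (f \<tau>))) (placed E T z) = strichartz_nn p q (\<lambda>\<tau>. ennreal (norm (f' \<tau>))) (placed E T z)"
  proof -
    have unf: "strichartz_nn p q g (placed E T z) = (\<integral>\<^sup>+Q. \<integral>\<^sup>+P. \<integral>\<^sup>+u. g (join_plane P Q (u + v)) \<partial>?K P \<partial>?RP \<partial>?RQ)" for g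
      unfolding strichartz_nn_def placed_foot_direction[OF T z] Let_def \<eta>_def[symmetric] v_def[symmetric] gp gq
      by (simp add: nn_integral_completion lebesgue_subspace_eq subspace_inter subspace_orthogonal_comp \<eta>)
    show ?thesis unfolding unf
    proof (rule nn_integral_cong_AE, use aeQ AE_space in eventually_elim)
      fix Q assume Q: "(\<integral>\<^sup>+P. I P Q \<partial>?RP) = 0" "Q \<in> space ?RQ"
      then have Q': "Q \<in> space ?Gq" by (simp only: spQ)
      show "(\<integral>\<^sup>+P. \<integral>\<^sup>+u. ennreal (norm (f (join_plane P Q (u + v)))) \<partial>?K P \<partial>?RP) = (\<integral>\<^sup>+P. \<integral>\<^sup>+u. ennreal (norm (f' (join_plane P Q (u + v)))) \<partial>?K P \<partial>?RP)"
      proof (rule nn_integral_cong_AE, use aeP[OF Q' Q(1)] AE_space in eventually_elim)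
        fix P assume P: "I P Q = 0" "P \<in> space ?RP"
        then have P': "P \<in> space ?Gp" by (simp only: spP)
        show "(\<integral>\<^sup>+u. ennreal (norm (f (join_plane P Q (u + v)))) \<partial>?K P) = (\<integral>\<^sup>+u. ennreal (norm (f' (join_plane P Q (u + v)))) \<partial>?K P)"
          by (rule nn_integral_cong_AE, use aeu[OF P' Q' P(1)] in eventually_elim) simp
      qed
    qed
  qed
  have val: "strichartz p q g (placed E T z) = (LINT Q|?RQ. LINT P|?RP. F P Q)"
    if g: "\<And>P Q. P \<in> space ?Gp \<Longrightarrow> Q \<in> space ?Gq \<Longrightarrow> I P Q = 0 \<Longrightarrow>
       AE u in ?K P. g (join_plane P Q (u + v)) = f' (join_plane P Q (u + v))" for g
  proof -
    have "strichartz p q g (placed E T z) = (LINT Q|completion ?RQ. LINT P|completion ?RP. LINT u|completion (?K P). g (join_plane P Q (u + v)))"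
      unfolding strichartz_def placed_foot_direction[OF T z] Let_def \<eta>_def[symmetric] v_def[symmetric] gp gq
      by (simp add: lebesgue_subspace_eq subspace_inter subspace_orthogonal_comp \<eta>)
    also have "\<dots> = (LINT Q|?RQ. LINT P|?RP. F P Q)"
    proof (rule integral_completion_AE_eq[OF mFQ], use aeQ AE_space in eventually_elim)
      fix Q assume Q: "(\<integral>\<^sup>+P. I P Q \<partial>?RP) = 0" "Q \<in> space ?RQ"
      then have Q': "Q \<in> space ?Gq" by (simp only: spQ)
      have m: "(\<lambda>P. F P Q) \<in> borel_measurable ?RP" using mF'[OF Q'] by (simp only: measurable_cong_sets[OF sRP refl])
      show "(LINT P|completion ?RP. LINT u|completion (?K P). g (join_plane P Q (u + v))) = (LINT P|?RP. F P Q)"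
      proof (rule integral_completion_AE_eq[OF m], use aeP[OF Q' Q(1)] AE_space in eventually_elim)
        fix P assume P: "I P Q = 0" "P \<in> space ?RP"
        then have P': "P \<in> space ?Gp" by (simp only: spP)
        show "(LINT u|completion (?K P). g (join_plane P Q (u + v))) = F P Q"
          unfolding F_def by (rule integral_completion_AE_eq[OF measurable_compose[OF join[OF P' Q'] f'] g[OF P' Q' P(1)]])
      qed
    qed
    finally show ?thesis .
  qed
  show "strichartz p q f (placed E T z) = strichartz p q f' (placed E T z)"
  proof -
    have "strichartz p q f (placed E T z) = (LINT Q|?RQ. LINT P|?RP. F P Q)" by (rule val, rule aeu)
    moreover have "strichartz p q f' (placed E T z) = (LINT Q|?RQ. LINT P|?RP. F P Q)" by (rule val, rule AE_I2, rule refl)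
    ultimately show ?thesis by (rule trans[OF _ sym])
  qed
qed

text \<open>
  Apply the reduction to the indicator of \<open>N\<close>. The right-hand side involves the indicator only at the small plane, whose
  distribution is the invariant measure.
\<close>

lemma AE_strichartz_null:
  assumes N: "N \<in> null_sets (affine_law X)"
  shows "AE \<zeta> in affine_law E. strichartz_nn p q (indicator N) \<zeta> = 0"
proof -
  let ?A = "plane_algebra (affine_grassmannian (p + q) :: (real^'n) set set)"
  let ?c = "emeasure (lborel_on Q0) UNIV * emeasure (haar (X\<^sup>\<bottom>)) (space (haar (X\<^sup>\<bottom>)))"
  have Ns: "N \<in> sets ?A" using N by (simp add: null_sets_def sets_affine_law[OF X_gr])
  then have ind: "(indicator N :: _ \<Rightarrow> ennreal) \<in> borel_measurable ?A" by simp
  have G: "(\<lambda>y. indicator N (snd y) :: ennreal) \<in> borel_measurable (borel \<Otimes>\<^sub>M ?A)"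
    by (rule measurable_compose[OF measurable_snd ind])
  have m: "strichartz_nn p q (indicator N) \<in> borel_measurable (affine_law E)"
    using strichartz_nn_measurable[OF G] by (simp add: measurable_cong_sets[OF sets_affine_law[OF E_gr] refl])
  have "(\<integral>\<^sup>+\<zeta>. strichartz_nn p q (indicator N) \<zeta> \<partial>affine_law E)
    = (\<integral>\<^sup>+T. \<integral>\<^sup>+w. \<integral>\<^sup>+C. \<integral>\<^sup>+y. indicator N (placed X T w) \<partial>lborel_on Q0 \<partial>haar (X\<^sup>\<bottom>) \<partial>lborel_on (X\<^sup>\<bottom>) \<partial>haar UNIV)"
    using strichartz_nn_reduction[OF G] by simp
  also have "\<dots> = (\<integral>\<^sup>+T. \<integral>\<^sup>+w. indicator N (placed X T w) * ?c \<partial>lborel_on (X\<^sup>\<bottom>) \<partial>haar UNIV)"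
    by (simp add: mult.assoc)
  also have "\<dots> = (\<integral>\<^sup>+\<tau>. indicator N \<tau> * ?c \<partial>affine_law X)"
    by (rule nn_integral_affine_law[OF X_gr, symmetric]) (use ind in measurable)
  also have "\<dots> = (\<integral>\<^sup>+\<tau>. indicator N \<tau> \<partial>affine_law X) * ?c"
    by (rule nn_integral_multc) (use N in auto)
  also have "\<dots> = 0" using N by (simp add: null_sets_def)
  finally show ?thesis by (simp only: nn_integral_0_iff_AE[OF m])
qed

lemma dual_integrals_cong_AE:
  fixes f f' :: "(real^'n) set \<Rightarrow> complex"
  assumes f': "f' \<in> borel_measurable (plane_algebra (affine_grassmannian (p + q)))"
    and ae: "AE \<tau> in affine_law X. f \<tau> = f' \<tau>"
  shows "dual_semyanistyi_nn (p + l) \<alpha> (strichartz_nn p q (\<lambda>\<tau>. ennreal (norm (f \<tau>)))) x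
       = dual_semyanistyi_nn (p + l) \<alpha> (strichartz_nn p q (\<lambda>\<tau>. ennreal (norm (f' \<tau>)))) x"
    and "dual_semyanistyi (p + l) \<alpha> (strichartz p q f) x = dual_semyanistyi (p + l) \<alpha> (strichartz p q f') x"
    and "dual_semyanistyi_nn (p + q) \<gamma> (\<lambda>\<tau>. ennreal (norm (f \<tau>))) x = dual_semyanistyi_nn (p + q) \<gamma> (\<lambda>\<tau>. ennreal (norm (f' \<tau>))) x"
    and "dual_semyanistyi (p + q) \<gamma> f x = dual_semyanistyi (p + q) \<gamma> f' x"
proof -
  have spE: "space (affine_law E) = affine_grassmannian (p + l)"
    using sets_eq_imp_space_eq[OF sets_affine_law[OF E_gr]] by simp
  have spX: "space (affine_law X) = affine_grassmannian (p + q)"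
    using sets_eq_imp_space_eq[OF sets_affine_law[OF X_gr]] by simp
  from AE_E[OF ae] obtain N where N: "{\<tau> \<in> space (affine_law X). f \<tau> \<noteq> f' \<tau>} \<subseteq> N" "emeasure (affine_law X) N = 0" "N \<in> sets (affine_law X)"
    by auto
  then have N0: "N \<in> null_sets (affine_law X)" by (simp add: null_sets_def)
  have Ns: "N \<in> sets (plane_algebra (affine_grassmannian (p + q)))" using N(3) by (simp only: sets_affine_law[OF X_gr])
  have eq: "f \<tau> = f' \<tau>" if "\<tau> \<in> affine_grassmannian (p + q)" "\<tau> \<notin> N" for \<tau> using that N(1) by (auto simp: spX)
  from frame_section obtain \<sigma> where \<sigma>: "\<forall>\<zeta>\<in>affine_grassmannian (p + l). fst (\<sigma> \<zeta>) \<in> rot UNIV \<and> snd (\<sigma> \<zeta>) \<in> E\<^sup>\<bottom> \<and> placed E (fst (\<sigma> \<zeta>)) (snd (\<sigma> \<zeta>)) = \<zeta>"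
    by (rule bexE)
  have aeE: "AE \<zeta> in affine_law E. strichartz_nn p q (\<lambda>\<tau>. ennreal (norm (f \<tau>))) \<zeta> = strichartz_nn p q (\<lambda>\<tau>. ennreal (norm (f' \<tau>))) \<zeta>
      \<and> strichartz p q f \<zeta> = strichartz p q f' \<zeta>"
    using AE_strichartz_null[OF N0] AE_space
  proof eventually_elim
    case (elim \<zeta>)
    with \<sigma> spE have *: "fst (\<sigma> \<zeta>) \<in> rot UNIV" "snd (\<sigma> \<zeta>) \<in> E\<^sup>\<bottom>" "placed E (fst (\<sigma> \<zeta>)) (snd (\<sigma> \<zeta>)) = \<zeta>" by auto
    from strichartz_eq_off_null[OF rot_orthogonal[OF *(1)] *(2) Ns, of f' f] elim(1) f' eq
    show ?case by (simp only: *(3)) blast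
  qed
  show "dual_semyanistyi_nn (p + l) \<alpha> (strichartz_nn p q (\<lambda>\<tau>. ennreal (norm (f \<tau>)))) x
       = dual_semyanistyi_nn (p + l) \<alpha> (strichartz_nn p q (\<lambda>\<tau>. ennreal (norm (f' \<tau>)))) x"
    unfolding dual_semyanistyi_nn_def affine_grassmannian_measure_eq[OF E_gr] nn_integral_completion
    by (rule nn_integral_cong_AE, use aeE in eventually_elim) simp
  show "dual_semyanistyi_nn (p + q) \<gamma> (\<lambda>\<tau>. ennreal (norm (f \<tau>))) x = dual_semyanistyi_nn (p + q) \<gamma> (\<lambda>\<tau>. ennreal (norm (f' \<tau>))) x"
    unfolding dual_semyanistyi_nn_def affine_grassmannian_measure_eq[OF X_gr] nn_integral_completion
    by (rule nn_integral_cong_AE, use ae in eventually_elim) simp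
  have mE: "(\<lambda>\<zeta>. strichartz p q f' \<zeta> * semyanistyi_kernel (p + l) \<alpha> x \<zeta>) \<in> borel_measurable (affine_law E)"
    unfolding measurable_cong_sets[OF sets_affine_law[OF E_gr] refl]
    by (rule borel_measurable_times[OF strichartz_measurable[OF f'] semyanistyi_kernel_measurable])
  have mX: "(\<lambda>\<tau>. f' \<tau> * semyanistyi_kernel (p + q) \<gamma> x \<tau>) \<in> borel_measurable (affine_law X)"
    unfolding measurable_cong_sets[OF sets_affine_law[OF X_gr] refl]
    by (rule borel_measurable_times[OF f' semyanistyi_kernel_measurable])
  have "(LINT \<zeta>|completion (affine_law E). strichartz p q f \<zeta> * semyanistyi_kernel (p + l) \<alpha> x \<zeta>)
     = (LINT \<zeta>|affine_law E. strichartz p q f' \<zeta> * semyanistyi_kernel (p + l) \<alpha> x \<zeta>)"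
    by (rule integral_completion_AE_eq[OF mE], use aeE in eventually_elim) simp
  then show "dual_semyanistyi (p + l) \<alpha> (strichartz p q f) x = dual_semyanistyi (p + l) \<alpha> (strichartz p q f') x"
    by (simp only: dual_semyanistyi_def affine_grassmannian_measure_eq[OF E_gr] integral_completion[OF mE])
  have "(LINT \<tau>|completion (affine_law X). f \<tau> * semyanistyi_kernel (p + q) \<gamma> x \<tau>)
     = (LINT \<tau>|affine_law X. f' \<tau> * semyanistyi_kernel (p + q) \<gamma> x \<tau>)"
    by (rule integral_completion_AE_eq[OF mX], use ae in eventually_elim) simp
  then show "dual_semyanistyi (p + q) \<gamma> f x = dual_semyanistyi (p + q) \<gamma> f' x"
    by (simp only: dual_semyanistyi_def affine_grassmannian_measure_eq[OF X_gr] integral_completion[OF mX])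
qed

end

section \<open>The composition formula\<close>

text \<open>
  Choose the subspaces successively in the orthogonal complement of the previous ones.
\<close>

lemma ex_orthogonal_frame:
  assumes "p + q + l < CARD('n)"
  shows "\<exists>P0 Q0 W0 V0 :: (real^'n) set. orthogonal_frame P0 Q0 W0 V0 p q l"
proof -
  have ex: "\<exists>T. subspace T \<and> T \<subseteq> S \<and> dim T = m" if "subspace S" "m \<le> dim S" for S :: "(real^'n) set" and m
    using choose_subspace_of_subspace[OF that(2)] that(1) by (metis span_eq_iff)
  have sym: "B \<subseteq> A\<^sup>\<bottom>" if "A \<subseteq> B\<^sup>\<bottom>" for A B :: "(real^'n) set"
  proof (rule subsetI, rule orthogonal_compI)
    fix x y assume "y \<in> B" "x \<in> A"
    then show "x \<bullet> y = 0" by (intro orthogonal_comp_inner(2)[OF subsetD[OF that]])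
  qed
  obtain P :: "(real^'n) set" where P: "subspace P" "dim P = p"
    using ex[OF subspace_UNIV, of p] assms by auto
  have "dim (P\<^sup>\<bottom>) = CARD('n) - p" using dim_orthogonal_comp[OF P(1)] P(2) by simp
  then have "q \<le> dim (P\<^sup>\<bottom>)" using assms by linarith
  from ex[OF subspace_orthogonal_comp this] obtain Q where Q: "subspace Q" "Q \<subseteq> P\<^sup>\<bottom>" "dim Q = q" by blast
  have PQ: "P \<subseteq> Q\<^sup>\<bottom>" by (rule sym[OF Q(2)])
  have sPQ: "subspace (P + Q)" by (rule subspace_orth_sum[OF P(1) Q(1)])
  have "dim ((P + Q)\<^sup>\<bottom>) = CARD('n) - (p + q)"
    using dim_orthogonal_comp[OF sPQ] dim_orth_sum[OF P(1) Q(1) PQ] P(2) Q(3) by simp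
  then have "l \<le> dim ((P + Q)\<^sup>\<bottom>)" using assms by linarith
  from ex[OF subspace_orthogonal_comp this] obtain W where W: "subspace W" "W \<subseteq> (P + Q)\<^sup>\<bottom>" "dim W = l" by blast
  define V where "V = (P + Q + W)\<^sup>\<bottom>"
  have sPQW: "subspace (P + Q + W)" by (rule subspace_orth_sum[OF sPQ W(1)])
  have 0: "0 \<in> P" "0 \<in> Q" "0 \<in> W" by (simp_all add: subspace_0 P(1) Q(1) W(1))
  have plus: "A \<subseteq> A + B" "B \<subseteq> A + B" if "0 \<in> A" "0 \<in> B" for A B :: "(real^'n) set"
    using set_plus_intro[OF _ that(2), of _ A] set_plus_intro[OF that(1), of _ B] by auto
  have incl: "P \<subseteq> P + Q" "Q \<subseteq> P + Q" "P + Q \<subseteq> P + Q + W" "W \<subseteq> P + Q + W"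
    using plus[OF 0(1,2)] plus[OF subspace_0[OF sPQ] 0(3)] by simp_all
  show ?thesis
  proof (intro exI, unfold_locales)
    show "P \<subseteq> Q\<^sup>\<bottom>" by (rule PQ)
    show "P \<subseteq> W\<^sup>\<bottom>" "Q \<subseteq> W\<^sup>\<bottom>" using sym[OF W(2)] incl(1,2) by (simp_all only: subset_trans)
    have "P + Q + W \<subseteq> V\<^sup>\<bottom>" unfolding V_def by (rule sym) simp
    then show "P \<subseteq> V\<^sup>\<bottom>" "Q \<subseteq> V\<^sup>\<bottom>" "W \<subseteq> V\<^sup>\<bottom>" using incl by (meson subset_trans)+
    show "P + Q + (W + V) = UNIV"
    proof -
      have "x \<in> P + Q + W + V" for x
        using set_plus_intro[OF proj_in[OF sPQW] proj_comp[OF sPQW], of x x] by (simp add: V_def)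
      then show ?thesis by (auto simp: add.assoc)
    qed
    show "subspace V" unfolding V_def by (rule subspace_orthogonal_comp)
  qed (use P Q W in simp_all)
qed

theorem theorem5p4:
  fixes f :: "(real ^ 'n) set \<Rightarrow> complex" and \<alpha> :: complex
    and p q l j k :: nat and x :: "real ^ 'n"
  assumes "p > 0" "q > 0" "l > 0" "p + q + l < CARD('n)"
    and "j = p + q" "k = p + l"
    and "semyanistyi_admissible CARD('n) k \<alpha>"
    and "semyanistyi_admissible CARD('n) j (\<alpha> + of_nat l)"
    and "f \<in> borel_measurable (affine_grassmannian_measure j)"
    and "dual_semyanistyi_strichartz_exists k \<alpha> p q f x \<or>
         dual_semyanistyi_exists j (\<alpha> + of_nat l) f x \<and> Re \<alpha> + real (j + l) < real CARD('n)"
  shows "dual_semyanistyi_strichartz_exists k \<alpha> p q f x \<and>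
         dual_semyanistyi_exists j (\<alpha> + of_nat l) f x \<and>
         dual_semyanistyi k \<alpha> (strichartz p q f) x =
           complex_of_real (2 ^ l * pi powr (real l / 2) * Gamma ((real CARD('n) - real j) / 2)
                             / Gamma ((real CARD('n) - real j - real l) / 2)) *
           dual_semyanistyi j (\<alpha> + of_nat l) f x"
proof -
  note jk = assms(5,6)
  from ex_orthogonal_frame[OF assms(4)] obtain P0 Q0 W0 V0 :: "(real^'n) set"
    where "orthogonal_frame P0 Q0 W0 V0 p q l" by (elim exE)
  then interpret orthogonal_frame P0 Q0 W0 V0 p q l .
  have a: "Re \<alpha> > 0" using assms(7) by (simp add: semyanistyi_admissible_def)
  have V: "dim V0 > 0" using frame_dims assms(4) by linarith
  have f: "f \<in> borel_measurable (completion (affine_law X))"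
    using assms(9) by (simp only: jk affine_grassmannian_measure_eq[OF X_gr])
  from completion_ex_borel_measurable_complex[OF f]
  obtain f' where "f' \<in> borel_measurable (affine_law X)" and ae: "AE \<tau> in affine_law X. f \<tau> = f' \<tau>" by (rule bexE)
  then have f': "f' \<in> borel_measurable (plane_algebra (affine_grassmannian (p + q)))"
    by (simp only: measurable_cong_sets[OF sets_affine_law[OF X_gr] refl])
  then have nf': "(\<lambda>\<tau>. ennreal (norm (f' \<tau>))) \<in> borel_measurable (plane_algebra (affine_grassmannian (p + q)))" by measurable
  note cong = dual_integrals_cong_AE[OF f' ae]
  show ?thesis
  proof (cases "Re \<alpha> + real (p + q + l) < real CARD('n)")
    case True
    from dual_nn_finite[OF nf' a True, of x] obtain K where K: "K > 0"
      "dual_semyanistyi_nn (p + l) \<alpha> (strichartz_nn p q (\<lambda>\<tau>. ennreal (norm (f' \<tau>)))) x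
         = ennreal K * dual_semyanistyi_nn (p + q) (\<alpha> + of_nat l) (\<lambda>\<tau>. ennreal (norm (f' \<tau>))) x" by blast
    have iff: "dual_semyanistyi_strichartz_exists (p + l) \<alpha> p q f x \<longleftrightarrow> dual_semyanistyi_exists (p + q) (\<alpha> + of_nat l) f x"
      using K(1) by (auto simp: dual_semyanistyi_strichartz_exists_def dual_semyanistyi_exists_def cong K(2) ennreal_mult_less_top)
    then have 1: "dual_semyanistyi_strichartz_exists (p + l) \<alpha> p q f x" "dual_semyanistyi_exists (p + q) (\<alpha> + of_nat l) f x"
      using assms(10) by (auto simp: jk)
    then have fin: "dual_semyanistyi_nn (p + l) \<alpha> (strichartz_nn p q (\<lambda>\<tau>. ennreal (norm (f' \<tau>)))) x < \<infinity>"
      by (simp only: dual_semyanistyi_strichartz_exists_def cong)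
    let ?\<beta> = "(of_nat CARD('n) - of_nat (p + l) - \<alpha>) / 2"
    note 2 = dual_integral_eq[OF f' a True fin refl]
    note 3 = normalized_const_eq[OF a True refl]
    have "dual_semyanistyi (p + l) \<alpha> (strichartz p q f') x
      = 1 / semyanistyi_gamma (CARD('n) - (p + l)) \<alpha> * (cyl_const_complex ?\<beta> * rot_const_complex (?\<beta> - of_real (q / 2))) *
        (LINT \<tau>|affine_grassmannian_measure (p + q). f' \<tau> * semyanistyi_kernel (p + q) (\<alpha> + of_nat l) x \<tau>)"
      unfolding dual_semyanistyi_def 2 by (simp only: DIM_cart DIM_real mult_1_right mult.assoc)
    also have "\<dots> = complex_of_real (2 ^ l * pi powr (real l / 2) * Gamma ((real CARD('n) - real (p + q)) / 2)
         / Gamma ((real CARD('n) - real (p + q) - real l) / 2)) * dual_semyanistyi (p + q) (\<alpha> + of_nat l) f' x"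
      unfolding dual_semyanistyi_def 3 by (simp only: DIM_cart DIM_real mult_1_right mult.assoc)
    finally show ?thesis using 1 unfolding jk cong by blast
  next
    case False
    with assms(10) have e: "dual_semyanistyi_strichartz_exists (p + l) \<alpha> p q f x" by (auto simp: jk)
    then have "dual_semyanistyi_nn (p + l) \<alpha> (strichartz_nn p q (\<lambda>\<tau>. ennreal (norm (f' \<tau>)))) x < \<infinity>"
      by (simp only: dual_semyanistyi_strichartz_exists_def cong)
    from dual_nn_infinite[OF nf' _ assms(2) V this] False
    have "AE \<tau> in affine_law X. ennreal (norm (f' \<tau>)) = 0" by simp
    with ae have "AE \<tau> in affine_law X. f \<tau> = 0" by eventually_elim simp
    \<comment> \<open>The zero function takes over the part of the Borel function \<open>f'\<close>.\<close>
    note cong0 = dual_integrals_cong_AE[OF borel_measurable_const this]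
    have "strichartz p q (\<lambda>_ :: (real^'n) set. 0) = (\<lambda>_. 0)" by (simp add: strichartz_def fun_eq_iff)
    then have z: "dual_semyanistyi (p + l) \<alpha> (strichartz p q f) x = 0" "dual_semyanistyi (p + q) (\<alpha> + of_nat l) f x = 0"
      unfolding cong0(2,4) by (simp_all add: dual_semyanistyi_def)
    have "dual_semyanistyi_exists (p + q) (\<alpha> + of_nat l) f x"
      unfolding dual_semyanistyi_exists_def cong0(3) by (simp add: dual_semyanistyi_nn_def)
    then show ?thesis using e unfolding jk z by simp
  qed
qed

end
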